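(* Let $p$ be a prime, let $n\geq 2$, and let $\mathcal{C}=\{C_i\}_{i=1}^n$ be an $n$-coloring of $\mathbb{F}_p$ with $|C_i|\geq 3$ for all $i\in\{1,\ldots,n\}$. Let $a_1,\ldots,a_n\in\mathbb{F}_p^*$ be not all equal and let $b\in\mathbb{F}_p$. Then $\mathcal{C}$ is rainbow free with respect to the equation $\sum_{i=1}^n a_ix_i=b$ if and only if the following conditions are both satisfied: (i) $n=2$. (ii) There are $z_1,\ldots,z_m,y_1,\ldots,y_q\in\mathbb{F}_p$ (for some $m,q$) such that $$C_1=\bigcup_{i=1}^m S_{(-a_2a_1^{-1},\,ba_1^{-1})}(z_i)\qquad\text{and}\qquad C_2=\bigcup_{i=1}^q S_{(-a_2a_1^{-1},\,ba_1^{-1})}(y_i).$$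
   Context: $p$ is a prime, $\mathbb{F}_p$ is the field with $p$ elements, and $\mathbb{F}_p^*=\mathbb{F}_p\setminus\{0\}$. $\mathbb{S}_n$ is the set of permutations of $\{1,\ldots,n\}$. An $n$-coloring of $\mathbb{F}_p$ is a family $\mathcal{C}=\{C_i\}_{i=1}^n$ of pairwise disjoint subsets of $\mathbb{F}_p$ with $\bigcup_{i=1}^nC_i=\mathbb{F}_p$. Given an equation $\sum_{i=1}^na_ix_i=b$ with $a_1,\ldots,a_n\in\mathbb{F}_p^*$ and $b\in\mathbb{F}_p$, the coloring $\mathcal{C}$ is rainbow free with respect to this equation if $\sum_{i=1}^na_{\sigma(i)}v_i\neq b$ for all $\sigma\in\mathbb{S}_n$ and all $v_i\in C_i$ ($1\le i\le n$). For $\lambda,\mu,x\in\mathbb{F}_p$, $$S_{(\lambda,\mu)}(x):=\left\{\lambda^kx+\left(\sum_{i=0}^{k-1}\lambda^i\right)\mu:\;k\in\mathbb{N}\right\}.$$ *)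

theory Defs
  imports
    "HOL-Combinatorics.Permutations"
    "HOL-Library.Disjoint_Sets"
    "Berlekamp_Zassenhaus.Finite_Field"
begin

text \<open>
  The field with \<open>p\<close> elements is \<open>'p mod_ring\<close> for a type \<open>'p\<close> of class \<open>prime_card\<close>, that is, the
  integers modulo the prime \<open>p = CARD('p)\<close>. Families indexed by \<open>{1..n}\<close> are functions on \<open>nat\<close>
  whose values outside \<open>{1..n}\<close> are irrelevant.
\<close>

definition coloring :: "nat \<Rightarrow> (nat \<Rightarrow> 'a set) \<Rightarrow> bool" where
  "coloring n C \<longleftrightarrow> disjoint_family_on C {1..n} \<and> (\<Union>i\<in>{1..n}. C i) = UNIV"

definition rainbow_free :: "nat \<Rightarrow> (nat \<Rightarrow> 'a::field) \<Rightarrow> 'a \<Rightarrow> (nat \<Rightarrow> 'a set) \<Rightarrow> bool" where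
  "rainbow_free n a b C \<longleftrightarrow>
    (\<forall>\<sigma> v. \<sigma> permutes {1..n} \<longrightarrow> (\<forall>i\<in>{1..n}. v i \<in> C i) \<longrightarrow> (\<Sum>i=1..n. a (\<sigma> i) * v i) \<noteq> b)"

text \<open>
  The forward orbit of \<open>x\<close> under \<open>t \<mapsto> \<lambda> t + \<mu>\<close>. The exponent \<open>k\<close> starts at 0; over a finite field with
  \<open>\<lambda> \<noteq> 0\<close> this map is a permutation, so starting at 1 gives the same set.
\<close>

definition affine_orbit :: "'a::field \<Rightarrow> 'a \<Rightarrow> 'a \<Rightarrow> 'a set" where
  "affine_orbit l m x = {l ^ k * x + (\<Sum>i<k. l ^ i) * m | k :: nat. True}"

end

theory Submission
  imports Defs "HOL-Library.Set_Algebras"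
begin

text \<open>
  For \<open>n = 2\<close> the coloring is rainbow free iff both classes are closed under the map
  \<open>t \<mapsto> (b - a\<^sub>2 t) / a\<^sub>1\<close>, that is, iff they are unions of orbits of it.

  For \<open>n \<ge> 3\<close> put aside a class \<open>C\<^sub>l\<close> with at least four elements and a coefficient \<open>c\<close>, and let \<open>U\<close> be the set
  of values that the other coefficients, in all orders, take on the other classes. If \<open>U\<close> has at
  least \<open>p - card C\<^sub>l + 1\<close> elements, then \<open>U + c C\<^sub>l\<close> is the whole field and contains \<open>b\<close>. This
  exceeds the Cauchy-Davenport bound, and is proved by induction on the number of classes,
  Vosper's theorem forcing all sets to be progressions with a common difference in a minimal
  counterexample. For two classes \<open>A\<close>, \<open>B\<close> and coefficients \<open>a \<noteq> \<plusminus>b\<close>, a counterexample makes both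
  \<open>(aA, bB)\<close> and \<open>(bA, aB)\<close> critical pairs with the same complement; Hamidoune's atoms then provide a
  difference \<open>d\<close> for which one set has boundary at most two, the other pair transports this to \<open>(a/b) d\<close>,
  and a set cannot have small boundary along a whole geometric progression of differences.

  The coefficients \<open>c, c, -c\<close> need separate treatment: for three classes because \<open>c, -c\<close> is no
  admissible pair of coefficients for the induction, and for \<open>n = 3\<close> because the equation is a
  translate of \<open>x + y = z\<close>.
\<close>

section \<open>Sumsets and boundaries\<close>

text \<open>A counterexample satisfies only \<open>|A + B| <= |A| + |B|\<close>, one unit beyond
  Vosper's range. Hence atoms are used at two levels: with excess \<open>|B| - 1\<close> they prove
  Vosper's theorem, with excess \<open>|B|\<close> they give, unless the complement is short, a
  direction in which a set splits into at most two progressions. The pairs of coefficients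
  \<open>c, c\<close> and \<open>c, -c\<close> are true exceptions. For \<open>c, c\<close>, two
  disjoint intervals have a sumset of \<open>|A| + |B| - 1\<close> elements; for
  \<open>c, -c\<close>, so does an interval centred at 0 with an interval opposite to it that is
  symmetric under negation, as then \<open>A - B = B - A\<close>. The summand 4 in the size
  hypotheses is the size of the class put aside: some class has four elements, since otherwise
  \<open>p = 3 n\<close>. Structure is expressed by the single number \<open>bd d X\<close> because
  it is invariant under translation, reflection, complement and change of sign of \<open>d\<close>,
  subadditive in \<open>d\<close>, and submultiplicative under sumsets. Classes of 3, 4 or 5
  elements and \<open>p = 11\<close> are treated apart, since the general counts are too weak for
  them.\<close>

lemma translation_closed:
  fixes A :: "'p::prime_card mod_ring set"
  assumes "A \<noteq> {}" "d \<noteq> 0" "\<And>x. x \<in> A \<Longrightarrow> x + d \<in> A"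
  shows "A = UNIV"
proof -
  obtain a where a: "a \<in> A" using assms(1) by blast
  have step: "a + of_nat n * d \<in> A" for n
  proof (induction n)
    case (Suc n)
    then have "(a + of_nat n * d) + d \<in> A" by (rule assms(3))
    then show ?case by (simp add: algebra_simps)
  qed (use a in simp)
  have "x \<in> A" for x
  proof -
    obtain i where "(x - a) / d = of_nat i" using surj_of_nat_mod_ring by blast
    then have "x = a + of_nat i * d" using assms(2) by (simp add: field_simps)
    then show ?thesis using step by simp
  qed
  then show ?thesis by blast
qed

lemma card_translate [simp]:
  "card ((+) c ` X) = card X" "card ((\<lambda>x. x + c) ` X) = card X"
  for c :: "'a::ab_group_add"
  by (auto intro!: card_image simp: inj_on_def)

lemma card_uminus [simp]: "card (uminus ` X) = card X" for X :: "'a::ab_group_add set"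
  by (auto intro!: card_image simp: inj_on_def)

lemma card_scale [simp]: "c \<noteq> 0 \<Longrightarrow> card ((*) c ` X) = card X" for c :: "'a::field"
  by (auto intro!: card_image simp: inj_on_def)

lemma scale_plus: "(*) c ` (A + B) = (*) c ` A + (*) c ` B" for c :: "'a::field"
proof (intro equalityI subsetI)
  fix x assume "x \<in> (*) c ` A + (*) c ` B"
  then obtain a b where ab: "a \<in> A" "b \<in> B" "x = c * a + c * b" by (auto simp: set_plus_def)
  then have "x = c * (a + b)" by (simp add: distrib_left)
  then show "x \<in> (*) c ` (A + B)" using ab by blast
next
  fix x assume "x \<in> (*) c ` (A + B)"
  then obtain a b where ab: "a \<in> A" "b \<in> B" "x = c * (a + b)" by (auto simp: set_plus_def)
  then have "x = c * a + c * b" by (simp add: distrib_left)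
  then show "x \<in> (*) c ` A + (*) c ` B" using ab by blast
qed

text \<open>Pigeonhole: \<open>A\<close> and the reflected set \<open>x - B\<close> are too large to
  be disjoint.\<close>

lemma plus_eq_UNIV:
  fixes A B :: "'a::{ab_group_add,finite} set"
  assumes "card A + card B > CARD('a)"
  shows "A + B = UNIV"
proof -
  have "x \<in> A + B" for x
  proof -
    let ?C = "(\<lambda>b. x - b) ` B"
    have "card ?C = card B" by (auto intro!: card_image simp: inj_on_def)
    moreover have "card (A \<union> ?C) \<le> CARD('a)" by (rule card_mono) auto
    ultimately have "A \<inter> ?C \<noteq> {}"
      using assms card_Un_disjoint[of A ?C] by (metis finite not_le)
    then obtain b where "b \<in> B" "x - b \<in> A" by blast
    then have "(x - b) + b \<in> A + B" by blast
    then show ?thesis by simp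
  qed
  then show ?thesis by blast
qed

text \<open>Dyson's transform: replace \<open>A\<close> by its union with \<open>B + e\<close> and
  \<open>B\<close> by the part that \<open>e\<close> carries into \<open>A\<close>. The total size
  is kept, the sumset does not grow, and the second set shrinks.\<close>

theorem cauchy_davenport:
  fixes A B :: "'p::prime_card mod_ring set"
  assumes "A \<noteq> {}" "B \<noteq> {}"
  shows "A + B = UNIV \<or> card A + card B \<le> card (A + B) + 1"
  using assms
proof (induction "card B" arbitrary: A B rule: less_induct)
  case less
  show ?case
  proof (cases "card B = 1")
    case True
    then obtain b where "B = {b}" by (auto simp: card_1_singleton_iff)
    then show ?thesis by (simp add: card_plus_sing)
  next
    case False
    obtain b0 where b0: "b0 \<in> B" using less.prems by blast
    have "B \<noteq> {b0}" using False by auto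
    then obtain b1 where b1: "b1 \<in> B" "b1 \<noteq> b0" using b0 by blast
    show ?thesis
    proof (cases "\<forall>a\<in>A. a + (b1 - b0) \<in> A")
      case True
      then have "A = UNIV" using translation_closed[of A "b1 - b0"] less.prems b1 by auto
      then have "card A + card B > CARD('p mod_ring)"
        using less.prems(2) by (simp add: card_gt_0_iff)
      then show ?thesis using plus_eq_UNIV by blast
    next
      case False
      then obtain a where a: "a \<in> A" "a + (b1 - b0) \<notin> A" by blast
      \<comment> \<open>\<open>e\<close> carries \<open>b0\<close> to \<open>a\<close> in
        \<open>A\<close> and \<open>b1\<close> to a point outside \<open>A\<close>, so
        \<open>B'\<close> is nonempty and strictly smaller than \<open>B\<close>.\<close>
      define e where "e = a - b0"
      define B' where "B' = {b \<in> B. b + e \<in> A}"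
      define A' where "A' = A \<union> (\<lambda>b. b + e) ` (B - B')"
      have b01: "b0 \<in> B'" "b1 \<notin> B'" using b0 a by (auto simp: B'_def e_def algebra_simps)
      have sub: "B' \<subseteq> B" by (auto simp: B'_def)
      then have lt: "card B' < card B" using b01 b1 by (intro psubset_card_mono) auto
      have inc: "A' + B' \<subseteq> A + B"
      proof
        fix x assume "x \<in> A' + B'"
        then obtain u w where uw: "x = u + w" "u \<in> A'" "w \<in> B'" by (auto simp: set_plus_def)
        show "x \<in> A + B"
        proof (cases "u \<in> A")
          case True then show ?thesis using uw sub by blast
        next
          case False
          then obtain b where "b \<in> B" "u = b + e" using uw by (auto simp: A'_def)
          moreover have "w + e \<in> A" using uw by (auto simp: B'_def)
          ultimately have "(w + e) + b \<in> A + B" by blast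
          then show ?thesis using uw \<open>u = b + e\<close> by (simp add: algebra_simps)
        qed
      qed
      have "card A' = card A + card ((\<lambda>b. b + e) ` (B - B'))"
        unfolding A'_def by (rule card_Un_disjoint) (auto simp: B'_def)
      also have "\<dots> = card A + (card B - card B')"
        using sub by (simp add: card_Diff_subset)
      finally have cA: "card A' + card B' = card A + card B" using lt by simp
      have "A' + B' = UNIV \<or> card A' + card B' \<le> card (A' + B') + 1"
        using less.hyps[OF lt, of A'] less.prems b01 by (auto simp: A'_def)
      then show ?thesis
      proof
        assume "A' + B' = UNIV" then show ?thesis using inc by auto
      next
        assume "card A' + card B' \<le> card (A' + B') + 1"
        moreover have "card (A' + B') \<le> card (A + B)" using inc by (intro card_mono) auto
        ultimately show ?thesis using cA by linarith
      qed
    qed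
  qed
qed

corollary cauchy_davenport_less:
  fixes A B :: "'p::prime_card mod_ring set"
  assumes "A \<noteq> {}" "B \<noteq> {}" "card (A + B) < CARD('p)"
  shows "card A + card B \<le> card (A + B) + 1"
  using cauchy_davenport[OF assms(1,2)] assms(3) by auto

text \<open>
  For \<open>d \<noteq> 0\<close> and a nonempty proper subset \<open>X\<close> of a field of prime order, \<open>bd d X\<close> is the number of
  progressions with difference \<open>d\<close> into which \<open>X\<close> decomposes; in particular \<open>bd d X \<le> 1\<close> says that \<open>X\<close> is
  one such progression.
\<close>

definition bd :: "'a::ab_group_add \<Rightarrow> 'a set \<Rightarrow> nat" where
  "bd d X = card {x \<in> X. x + d \<notin> X}"

text \<open>The largest \<open>E\<close> with \<open>E + {0, d}\<close> inside \<open>X\<close>.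
  Eroding one summand while adding \<open>{0, d}\<close> to the other moves a step \<open>d\<close>
  between two summands without leaving the sumset.\<close>

definition erode :: "'a::ab_group_add \<Rightarrow> 'a set \<Rightarrow> 'a set" where
  "erode d X = {x \<in> X. x + d \<in> X}"

context
  fixes X :: "'a::{ab_group_add,finite} set"
begin

lemma card_plus_pair: "card (X + {0, d}) = card X + bd d X"
proof -
  have "X + {0, d} = X \<union> (\<lambda>x. x + d) ` {x \<in> X. x + d \<notin> X}"
    by (auto simp: set_plus_def)
  also have "card \<dots> = card X + card ((\<lambda>x. x + d) ` {x \<in> X. x + d \<notin> X})"
    by (rule card_Un_disjoint) auto
  finally show ?thesis by (simp add: bd_def)
qed

lemma card_erode: "card (erode d X) + bd d X = card X"
proof -
  have "card (erode d X \<union> {x \<in> X. x + d \<notin> X}) = card (erode d X) + bd d X"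
    unfolding bd_def by (rule card_Un_disjoint) (auto simp: erode_def)
  moreover have "erode d X \<union> {x \<in> X. x + d \<notin> X} = X" by (auto simp: erode_def)
  ultimately show ?thesis by simp
qed

lemma erode_plus: "erode d X + {0, d} \<subseteq> X"
  by (auto simp: erode_def set_plus_def)

lemma erode_uminus: "erode (- d) X = (\<lambda>x. x + d) ` erode d X"
proof (intro equalityI subsetI)
  fix x assume "x \<in> erode (- d) X"
  then have "x - d \<in> erode d X" "x = (x - d) + d" by (auto simp: erode_def)
  then show "x \<in> (\<lambda>x. x + d) ` erode d X" by blast
qed (auto simp: erode_def)

lemma bd_uminus [simp]: "bd (- d) X = bd d X"
  using card_erode[of d] card_erode[of "- d"] by (simp add: erode_uminus)

lemma bd_0 [simp]: "bd 0 X = 0"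
  by (simp add: bd_def)

lemma bd_le_card: "bd d X \<le> card X"
  using card_erode[of d] by simp

text \<open>A point that leaves \<open>X\<close> under \<open>d + e\<close> leaves it under
  \<open>d\<close>, or its image under \<open>d\<close> leaves it under \<open>e\<close>.\<close>

lemma bd_triangle: "bd (d + e) X \<le> bd d X + bd e X"
proof -
  let ?S = "{x \<in> X. x + d \<notin> X}" and ?T = "{x \<in> X. x + e \<notin> X}"
  have "{x \<in> X. x + (d + e) \<notin> X} \<subseteq> ?S \<union> (\<lambda>x. x - d) ` ?T"
  proof
    fix x assume x: "x \<in> {x \<in> X. x + (d + e) \<notin> X}"
    show "x \<in> ?S \<union> (\<lambda>x. x - d) ` ?T"
    proof (cases "x + d \<in> X")
      case True
      then have "x + d \<in> ?T" "x = (x + d) - d" using x by (auto simp: add.assoc)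
      then show ?thesis by blast
    qed (use x in auto)
  qed
  then have "bd (d + e) X \<le> card (?S \<union> (\<lambda>x. x - d) ` ?T)"
    unfolding bd_def by (intro card_mono) auto
  also have "\<dots> \<le> card ?S + card ((\<lambda>x. x - d) ` ?T)" by (rule card_Un_le)
  also have "card ((\<lambda>x. x - d) ` ?T) \<le> card ?T" by (rule card_image_le) simp
  finally show ?thesis by (simp add: bd_def)
qed

text \<open>An exit from the complement along \<open>d\<close> is an entry into \<open>X\<close>,
  that is, up to the shift an exit of \<open>X\<close> along \<open>- d\<close>.\<close>

lemma bd_Compl [simp]: "bd d (- X) = bd d X"
proof -
  have "{x \<in> X. x + (- d) \<notin> X} = (\<lambda>x. x + d) ` {x \<in> - X. x + d \<notin> - X}"
  proof (intro equalityI subsetI)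
    fix x assume x: "x \<in> {x \<in> X. x + (- d) \<notin> X}"
    then have "x - d \<in> {x \<in> - X. x + d \<notin> - X}" "x = (x - d) + d" by auto
    then show "x \<in> (\<lambda>x. x + d) ` {x \<in> - X. x + d \<notin> - X}" by blast
  qed auto
  then have "bd (- d) X = bd d (- X)" by (simp add: bd_def)
  then show ?thesis by simp
qed

lemma bd_translate [simp]: "bd d ((+) c ` X) = bd d X"
proof -
  have "{x \<in> (+) c ` X. x + d \<notin> (+) c ` X} = (+) c ` {x \<in> X. x + d \<notin> X}"
  proof -
    have "c + x + d \<in> (+) c ` X \<longleftrightarrow> x + d \<in> X" for x
      unfolding image_iff by (metis add.assoc add_left_cancel)
    then show ?thesis by auto
  qed
  then show ?thesis by (simp add: bd_def)
qed

lemma bd_reflect [simp]: "bd d (uminus ` X) = bd d X"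
proof -
  have "{x \<in> uminus ` X. x + d \<notin> uminus ` X} = uminus ` {x \<in> X. x + (- d) \<notin> X}"
  proof -
    have "- x + d \<in> uminus ` X \<longleftrightarrow> x + (- d) \<in> X" for x
    proof
      assume "- x + d \<in> uminus ` X"
      then obtain y where "y \<in> X" "- x + d = - y" by blast
      then have "x + (- d) = y" by (metis minus_add_distrib minus_minus)
      then show "x + (- d) \<in> X" using \<open>y \<in> X\<close> by simp
    next
      assume "x + (- d) \<in> X"
      then show "- x + d \<in> uminus ` X" by (metis imageI minus_add_distrib minus_minus)
    qed
    then have "{x \<in> X. x + (- d) \<notin> X} = {x \<in> X. - x + d \<notin> uminus ` X}" by blast
    then show ?thesis by auto
  qed
  then have "bd d (uminus ` X) = bd (- d) X" by (simp add: bd_def)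
  then show ?thesis by simp
qed

text \<open>If \<open>x + y + d\<close> is missing from the sumset, neither \<open>x + d\<close> nor
  \<open>y + d\<close> can stay in its own set. With both factors at most 1 this says that two
  progressions with difference \<open>d\<close> add up to a progression or to the whole
  field.\<close>

lemma bd_plus_le: "bd d (X + Y) \<le> bd d X * bd d Y"
proof -
  let ?S = "{x \<in> X. x + d \<notin> X}" and ?T = "{x \<in> Y. x + d \<notin> Y}"
  have "{z \<in> X + Y. z + d \<notin> X + Y} \<subseteq> (\<lambda>(x, y). x + y) ` (?S \<times> ?T)"
  proof
    fix z assume z: "z \<in> {z \<in> X + Y. z + d \<notin> X + Y}"
    then obtain x y where xy: "z = x + y" "x \<in> X" "y \<in> Y" by (auto simp: set_plus_def)
    have "x + d \<notin> X"
    proof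
      assume "x + d \<in> X"
      then have "(x + d) + y \<in> X + Y" using xy by blast
      then show False using z xy by (simp add: algebra_simps)
    qed
    moreover have "y + d \<notin> Y"
    proof
      assume "y + d \<in> Y"
      then have "x + (y + d) \<in> X + Y" using xy by blast
      then show False using z xy by (simp add: algebra_simps)
    qed
    ultimately show "z \<in> (\<lambda>(x, y). x + y) ` (?S \<times> ?T)" using xy by force
  qed
  then have "bd d (X + Y) \<le> card ((\<lambda>(x, y). x + y) ` (?S \<times> ?T))"
    unfolding bd_def by (intro card_mono) auto
  also have "\<dots> \<le> card (?S \<times> ?T)" by (rule card_image_le) simp
  finally show ?thesis by (simp add: bd_def card_cartesian_product)
qed

end

lemma bd_scale: 
  fixes c :: "'a::{field,finite}"
  assumes "c \<noteq> 0" shows "bd (c * d) ((*) c ` X) = bd d X"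
proof -
  have "{x \<in> (*) c ` X. x + c * d \<notin> (*) c ` X} = (*) c ` {x \<in> X. x + d \<notin> X}"
  proof -
    have "c * x + c * d \<in> (*) c ` X \<longleftrightarrow> x + d \<in> X" for x
      unfolding image_iff using assms by (metis distrib_left mult_left_cancel)
    then show ?thesis by auto
  qed
  then show ?thesis using assms by (simp add: bd_def)
qed

lemma bd_scale': 
  fixes c :: "'a::{field,finite}"
  assumes "c \<noteq> 0" shows "bd d ((*) c ` X) = bd (d / c) X"
  using bd_scale[OF assms, of "d / c" X] assms by simp

lemma bd_pair_le: "bd d {0, d} \<le> 1"
  for d :: "'a::ab_group_add"
proof -
  have "{x \<in> {0, d}. x + d \<notin> {0, d}} \<subseteq> {d}" by auto
  then show ?thesis unfolding bd_def using card_mono[of "{d}"] by fastforce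
qed

lemma bd_plus_pair_le:
  fixes X :: "'a::{ab_group_add,finite} set"
  shows "bd d (X + {0, d}) \<le> bd d X"
proof -
  have "bd d (X + {0, d}) \<le> bd d X * bd d {0, d}" by (rule bd_plus_le)
  also have "\<dots> \<le> bd d X * 1" by (rule mult_le_mono2) (rule bd_pair_le)
  finally show ?thesis by simp
qed

lemma bd_pos:
  fixes X :: "'p::prime_card mod_ring set"
  assumes "d \<noteq> 0" "X \<noteq> {}" "X \<noteq> UNIV"
  shows "bd d X \<ge> 1"
proof -
  have "{x \<in> X. x + d \<notin> X} \<noteq> {}" using translation_closed[of X d] assms by blast
  then show ?thesis unfolding bd_def by (metis One_nat_def Suc_leI card_gt_0_iff finite)
qed

lemma plus_eq_empty_iff [simp]: fixes A B :: "'a::plus set" shows "A + B = {} \<longleftrightarrow> A = {} \<or> B = {}"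
proof
  assume e: "A + B = {}"
  show "A = {} \<or> B = {}"
  proof (rule ccontr)
    assume "\<not> (A = {} \<or> B = {})"
    then obtain a b where "a \<in> A" "b \<in> B" by blast
    then have "a + b \<in> A + B" by (rule set_plus_intro)
    then show False using e by simp
  qed
next
  assume "A = {} \<or> B = {}"
  then show "A + B = {}" by (elim disjE) simp_all
qed

lemma translate_plus: "(+) c ` X + Y = (+) c ` (X + Y)" for c :: "'a::ab_group_add"
proof (intro equalityI subsetI)
  fix z assume "z \<in> (+) c ` X + Y"
  then obtain x y where "x \<in> X" "y \<in> Y" "z = (c + x) + y" by (auto simp: set_plus_def)
  then have "z = c + (x + y)" "x + y \<in> X + Y" by (auto simp: add.assoc)
  then show "z \<in> (+) c ` (X + Y)" by blast
next
  fix z assume "z \<in> (+) c ` (X + Y)"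
  then obtain x y where "x \<in> X" "y \<in> Y" "z = c + (x + y)" by (auto simp: set_plus_def)
  then have "z = (c + x) + y" "c + x \<in> (+) c ` X" "y \<in> Y" by (auto simp: add.assoc)
  then show "z \<in> (+) c ` X + Y" by blast
qed

lemma card_Compl_finite: "card (- A) = CARD('a) - card A" for A :: "'a::finite set"
  by (simp add: card_Diff_subset Compl_eq_Diff_UNIV)

lemma card_le_CARD: "card A \<le> CARD('a)" for A :: "'a::finite set"
  by (rule card_mono) auto

section \<open>Atoms and Vosper's theorem\<close>

text \<open>Every nonzero difference has at most one representation; the property is stated through
  translates because this is how atoms produce it and how it is counted.\<close>

definition sidon :: "'a::ab_group_add set \<Rightarrow> bool" where
  "sidon M \<longleftrightarrow> (\<forall>d. d \<noteq> 0 \<longrightarrow> card (M \<inter> (+) d ` M) \<le> 1)"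

text \<open>
  An extremal set of least cardinality meets each of its translates in at most one point: by
  submodularity of \<open>X \<mapsto> card (X + B)\<close> a larger intersection would be extremal again.
\<close>

lemma isoperimetric_atom:
  fixes B :: "'p::prime_card mod_ring set"
  assumes low: "\<And>X. 2 \<le> card X \<Longrightarrow> card (X + B) + 2 \<le> CARD('p) \<Longrightarrow> card X + t \<le> card (X + B)"
    and X0: "2 \<le> card X0" "card (X0 + B) + 2 \<le> CARD('p)" "card (X0 + B) \<le> card X0 + t"
  shows "\<exists>M. 2 \<le> card M \<and> card (M + B) + 2 \<le> CARD('p) \<and> card (M + B) \<le> card M + t \<and> sidon M"
proof -
  define frag where "frag X \<longleftrightarrow> 2 \<le> card X \<and> card (X + B) + 2 \<le> CARD('p) \<and> card (X + B) \<le> card X + t" for X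
  have "frag X0" using X0 by (simp add: frag_def)
  from ex_has_least_nat[of frag, OF this, of card]
  obtain M where M: "frag M" and min: "\<And>X. frag X \<Longrightarrow> card M \<le> card X" by blast
  have M': "2 \<le> card M" "card (M + B) + 2 \<le> CARD('p)" "card (M + B) \<le> card M + t"
    using M by (auto simp: frag_def)
  have MB: "card (M + B) = card M + t" using low[OF M'(1,2)] M'(3) by simp
  \<comment> \<open>The dual extremal set: \<open>N + B\<close> avoids \<open>- M\<close>, so
    \<open>N\<close> competes with \<open>M\<close>, and minimality yields the bound
    \<open>half\<close>.\<close>
  define N where "N = uminus ` (- (M + B))"
  have cN: "card N = CARD('p) - (card M + t)"
    by (simp add: N_def card_Compl_finite MB)
  have "N + B \<subseteq> - (uminus ` M)"
  proof
    fix z assume "z \<in> N + B"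
    then obtain y b where yb: "y \<notin> M + B" "b \<in> B" "z = - y + b"
      unfolding N_def set_plus_def[of "uminus ` _"] by blast
    have "z \<notin> uminus ` M"
    proof
      assume "z \<in> uminus ` M"
      then obtain m where "m \<in> M" "z = - m" by blast
      then have "y = m + b" using yb by (simp add: algebra_simps)
      then show False using yb \<open>m \<in> M\<close> by blast
    qed
    then show "z \<in> - (uminus ` M)" by simp
  qed
  then have "card (N + B) \<le> card (- (uminus ` M))" by (intro card_mono) auto
  then have "card (N + B) \<le> CARD('p) - card M" by (simp add: card_Compl_finite)
  then have "frag N" using M' MB cN by (auto simp: frag_def)
  then have half: "2 * card M + t \<le> CARD('p)" using min[of N] cN M' MB by simp
  have "card (M \<inter> (+) d ` M) \<le> 1" if d: "d \<noteq> 0" for d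
  proof (rule ccontr)
    assume "\<not> card (M \<inter> (+) d ` M) \<le> 1"
    then have "2 \<le> card (M \<inter> (+) d ` M)" by linarith
    define J where "J = M \<inter> (+) d ` M"
    define K where "K = M \<union> (+) d ` M"
    have J2: "2 \<le> card J" using \<open>2 \<le> card (M \<inter> (+) d ` M)\<close> by (simp add: J_def)
    have JM: "J \<noteq> M"
    proof
      assume "J = M"
      then have "M = (+) d ` M" unfolding J_def
        by (intro card_subset_eq) auto
      then have "M = UNIV" using d M' translation_closed[of M d]
        by (metis add.commute card.empty imageI not_numeral_le_zero)
      then have "card M = CARD('p)" by simp
      then show False using MB M'(2) by linarith
    qed
    have lt: "card J < card M" using JM by (intro psubset_card_mono) (auto simp: J_def)
    have JK: "card K + card J = 2 * card M"
      using card_Un_Int[of M "(+) d ` M"] by (simp add: J_def K_def)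
    have "J + B \<subseteq> (M + B) \<inter> (+) d ` (M + B)"
      unfolding translate_plus[symmetric] by (auto simp: J_def set_plus_def)
    moreover have "K + B = (M + B) \<union> (+) d ` (M + B)"
      unfolding translate_plus[symmetric] by (simp add: K_def Un_set_plus)
    ultimately have sub: "card (J + B) + card (K + B) \<le> 2 * card (M + B)"
      using card_Un_Int[of "M + B" "(+) d ` (M + B)"]
        card_mono[of "(M + B) \<inter> (+) d ` (M + B)" "J + B"] by simp
    have "J + B \<subseteq> M + B" by (auto simp: J_def set_plus_def)
    then have JB: "card (J + B) + 2 \<le> CARD('p)"
      using card_mono[of "M + B" "J + B"] M'(2) by simp
    show False
    proof (cases "card (K + B) + 2 \<le> CARD('p)")
      case True
      \<comment> \<open>The lower bound for the union and submodularity make the intersection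
        \<open>J\<close> extremal, although it is smaller than \<open>M\<close>.\<close>
      have "card K + t \<le> card (K + B)" using low[OF _ True] JK lt J2 by simp
      then have "card (J + B) \<le> card J + t" using sub MB JK by linarith
      then have "frag J" using J2 JB by (simp add: frag_def)
      then show False using min lt by (meson not_le)
    next
      case False
      \<comment> \<open>Here \<open>K + B\<close> misses at most one point; submodularity and
        \<open>half\<close> leave \<open>J + B\<close> fewer points than its lower bound
        \<open>card J + t\<close>.\<close>
      then have "card (J + B) \<le> t + 1" using sub MB half by linarith
      then show False using low[OF J2 JB] J2 by linarith
    qed
  qed
  then show ?thesis using M' by (auto simp: sidon_def)
qed

lemma sidon_Int_le:
  fixes M :: "'a::{ab_group_add,finite} set"
  assumes "sidon M" "x \<noteq> y"
  shows "card ((+) x ` M \<inter> (+) y ` M) \<le> 1"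
proof -
  have "(+) x ` M \<inter> (+) y ` M = (+) x ` (M \<inter> (+) (y - x) ` M)"
    by (auto simp: image_iff algebra_simps)
  then show ?thesis using assms by (simp add: sidon_def)
qed

lemma sidon_sum_ge2:
  fixes M N :: "'a::{ab_group_add,finite} set"
  assumes "sidon M" "2 \<le> card N"
  shows "2 * card M \<le> card (M + N) + 1"
proof -
  obtain x y where xy: "x \<in> N" "y \<in> N" "x \<noteq> y"
  proof -
    have "\<not> card N \<le> Suc 0" using assms(2) by simp
    then show ?thesis using that card_le_Suc0_iff_eq[of N] by auto
  qed
  have "(+) x ` M \<union> (+) y ` M \<subseteq> M + N" using xy by (auto simp: add.commute)
  then have "card ((+) x ` M \<union> (+) y ` M) \<le> card (M + N)" by (intro card_mono) auto
  then show ?thesis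
    using card_Un_Int[of "(+) x ` M" "(+) y ` M"] sidon_Int_le[OF assms(1) xy(3)] by simp
qed

text \<open>Three translates of \<open>M\<close>, any two of which share at most one point.\<close>

lemma sidon_sum_ge3:
  fixes M N :: "'a::{ab_group_add,finite} set"
  assumes "sidon M" "3 \<le> card N"
  shows "3 * card M \<le> card (M + N) + 3"
proof -
  obtain T where "T \<subseteq> N" "card T = 3" using assms(2) by (meson obtain_subset_with_card_n)
  then obtain x y z where xyz: "x \<in> N" "y \<in> N" "z \<in> N" "x \<noteq> y" "x \<noteq> z" "y \<noteq> z"
    by (auto simp: card_3_iff)
  let ?X = "(+) x ` M" and ?Y = "(+) y ` M" and ?Z = "(+) z ` M"
  have "?X \<union> ?Y \<union> ?Z \<subseteq> M + N" using xyz by (auto simp: add.commute)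
  then have "card (?X \<union> ?Y \<union> ?Z) \<le> card (M + N)" by (intro card_mono) auto
  moreover have "card ((?X \<union> ?Y) \<inter> ?Z) \<le> card (?X \<inter> ?Z) + card (?Y \<inter> ?Z)"
    unfolding Int_Un_distrib2 by (rule card_Un_le)
  ultimately show ?thesis
    using card_Un_Int[of ?X ?Y] card_Un_Int[of "?X \<union> ?Y" ?Z]
      sidon_Int_le[OF assms(1) xyz(4)] sidon_Int_le[OF assms(1) xyz(5)]
      sidon_Int_le[OF assms(1) xyz(6)] by simp
qed

lemma card2_plus:
  fixes B :: "'a::{ab_group_add,finite} set"
  assumes "card M = 2"
  obtains d where "d \<noteq> 0" "card (M + B) = card B + bd d B"
proof -
  obtain x y where xy: "M = {x, y}" "x \<noteq> y" using assms by (auto simp: card_2_iff)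
  have "M = (+) x ` {0, y - x}" using xy by auto
  then have "card (M + B) = card ({0, y - x} + B)" by (simp only: translate_plus card_translate)
  also have "\<dots> = card B + bd (y - x) B" by (simp add: card_plus_pair add.commute[of _ B])
  finally show thesis using that[of "y - x"] xy by simp
qed

text \<open>Take an atom \<open>M\<close> of \<open>B\<close> and then an atom \<open>N\<close> of
  \<open>M\<close>. Both are Sidon sets, whose translates overlap too little for a sumset of
  \<open>card M + card N - 1\<close> elements unless \<open>M\<close> is a pair; and adding a pair
  with difference \<open>d\<close> to \<open>B\<close> costs exactly \<open>bd d B\<close>.\<close>

lemma vosper_one:
  fixes A B :: "'p::prime_card mod_ring set"
  assumes "2 \<le> card A" "2 \<le> card B" "card (A + B) + 2 \<le> CARD('p)"
    "card (A + B) < card A + card B"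
  shows "\<exists>d. d \<noteq> 0 \<and> bd d B \<le> 1"
proof -
  have low: "card X + (card Y - 1) \<le> card (X + Y)"
    if "2 \<le> card X" "2 \<le> card Y" "card (X + Y) + 2 \<le> CARD('p)" for X Y :: "'p mod_ring set"
  proof -
    have "X \<noteq> {}" "Y \<noteq> {}" using that by auto
    then show ?thesis using cauchy_davenport_less[of X Y] that by linarith
  qed
  obtain M where M: "2 \<le> card M" "card (M + B) + 2 \<le> CARD('p)" "card (M + B) \<le> card M + (card B - 1)"
    "sidon M"
  proof -
    have "card (A + B) \<le> card A + (card B - 1)" using assms by linarith
    then show ?thesis
      using that isoperimetric_atom[of B "card B - 1" A, OF low] assms by blast
  qed
  have BM: "card (B + M) + 2 \<le> CARD('p)" "card (B + M) \<le> card B + (card M - 1)"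
    using M assms by (simp_all add: add.commute[of B M])
  obtain N where N: "2 \<le> card N" "card (N + M) + 2 \<le> CARD('p)" "card (N + M) \<le> card N + (card M - 1)"
    "sidon N"
    using isoperimetric_atom[of M "card M - 1" B, OF low] M assms BM by blast
  have "card M = 2"
  \<comment> \<open>If both sets have three elements, the two Sidon estimates add up to
    \<open>card M + card N <= 4\<close>.\<close>
  proof (cases "card N \<ge> 3 \<and> card M \<ge> 3")
    case True
    then have "3 * card M \<le> card (N + M) + 3" "3 * card N \<le> card (N + M) + 3"
      using sidon_sum_ge3[OF M(4), of N] sidon_sum_ge3[OF N(4), of M]
      by (simp_all add: add.commute[of M N])
    then show ?thesis using N True by linarith
  next
    case False
    moreover have "2 * card M \<le> card (N + M) + 1"
      using sidon_sum_ge2[OF M(4) N(1)] by (simp add: add.commute[of M N])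
    ultimately show ?thesis using N M by linarith
  qed
  then obtain d where "d \<noteq> 0" "card (M + B) = card B + bd d B" using card2_plus by blast
  then show ?thesis using M \<open>card M = 2\<close> assms by (intro exI[of _ d]) auto
qed

text \<open>The direction found for \<open>B\<close> also serves \<open>A\<close>: eroding
  \<open>B\<close> by \<open>d\<close> costs at most one point, and Cauchy-Davenport for
  \<open>A + {0, d}\<close> with the eroded set allows the former at most one new point.\<close>

theorem vosper:
  fixes A B :: "'p::prime_card mod_ring set"
  assumes "2 \<le> card A" "2 \<le> card B" "card (A + B) + 2 \<le> CARD('p)"
    "card (A + B) < card A + card B"
  obtains d where "d \<noteq> 0" "bd d A \<le> 1" "bd d B \<le> 1"
proof -
  obtain d where d: "d \<noteq> 0" "bd d B \<le> 1" using vosper_one[OF assms] by blast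
  let ?E = "erode d B"
  have sub: "(A + {0, d}) + ?E \<subseteq> A + B"
  proof -
    have "(A + {0, d}) + ?E = A + (?E + {0, d})" by (simp only: ac_simps)
    then show ?thesis using set_plus_mono2[OF order_refl erode_plus[of d B]] by metis
  qed
  then have "card ((A + {0, d}) + ?E) \<le> card (A + B)" by (intro card_mono) auto
  moreover have "card ?E + bd d B = card B" by (rule card_erode)
  moreover have "?E \<noteq> {}" using \<open>card ?E + _ = _\<close> d assms(2) by fastforce
  moreover have "A + {0, d} \<noteq> {}" using card_plus_pair[of A d] assms(1) by fastforce
  ultimately have "card (A + {0, d}) + card ?E \<le> card (A + B) + 1"
    using cauchy_davenport_less[of "A + {0, d}" ?E] assms(3) by linarith
  then have "bd d A \<le> 1"
    using card_plus_pair[of A d] \<open>card ?E + _ = _\<close> d assms(4) by linarith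
  then show thesis using that d by blast
qed

section \<open>Critical triples\<close>

text \<open>Non-progressions. For them Vosper's theorem raises the Cauchy-Davenport bound by one,
  which makes the atom argument available one level higher.\<close>

definition nap :: "'a::ab_group_add set \<Rightarrow> bool" where
  "nap X \<longleftrightarrow> (\<forall>d. d \<noteq> 0 \<longrightarrow> 2 \<le> bd d X)"

lemma nap_card: "nap X \<Longrightarrow> 2 \<le> card X" for X :: "'p::prime_card mod_ring set"
  unfolding nap_def using bd_le_card[of 1 X] by (metis le_trans zero_neq_one)

lemma nap_sum_ge:
  fixes X Y :: "'p::prime_card mod_ring set"
  assumes "nap Y" "2 \<le> card X" "card (X + Y) + 2 \<le> CARD('p)"
  shows "card X + card Y \<le> card (X + Y)"
proof (rule ccontr)
  assume "\<not> ?thesis"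
  then have "card (X + Y) < card X + card Y" by simp
  then obtain d where d: "d \<noteq> 0" "bd d Y \<le> 1"
    using vosper[OF assms(2) nap_card[OF assms(1)] assms(3)] by blast
  then have "2 \<le> bd d Y" using assms(1) unfolding nap_def by blast
  then show False using d by simp
qed

lemma sidon_nap:
  fixes M :: "'a::{ab_group_add,finite} set"
  assumes "sidon M" "3 \<le> card M"
  shows "nap M"
  unfolding nap_def
proof (intro allI impI)
  fix d :: 'a assume d: "d \<noteq> 0"
  have "(\<lambda>x. x + d) ` erode d M \<subseteq> M \<inter> (+) d ` M" by (auto simp: erode_def add.commute)
  then have "card (erode d M) \<le> card (M \<inter> (+) d ` M)"
    using card_mono[of "M \<inter> (+) d ` M" "(\<lambda>x. x + d) ` erode d M"] by simp
  then have "card (erode d M) \<le> 1" using assms(1) d unfolding sidon_def by fastforce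
  then show "2 \<le> bd d M" using card_erode[of d M] assms(2) by linarith
qed

text \<open>The argument of \<open>vosper_one\<close> with excess \<open>card B\<close>: the Sidon
  counts now admit atoms of two or three elements. A Sidon set of at least three elements is a
  non-progression, so the raised lower bound applies to the atom \<open>M\<close> as well.\<close>

lemma two_atom:
  fixes B :: "'p::prime_card mod_ring set"
  assumes B: "nap B" and X0: "2 \<le> card X0" "card (X0 + B) + 2 \<le> CARD('p)" "card (X0 + B) \<le> card X0 + card B"
  shows "(\<exists>d. d \<noteq> 0 \<and> bd d B \<le> 2) \<or> (\<exists>M. card M = 3 \<and> card (M + B) \<le> card B + 3)"
proof -
  obtain M where M: "2 \<le> card M" "card (M + B) + 2 \<le> CARD('p)" "card (M + B) \<le> card M + card B"
    "sidon M"
    using isoperimetric_atom[of B "card B" X0, OF nap_sum_ge[OF B]] X0 by blast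
  have B2: "2 \<le> card B" by (rule nap_card[OF B])
  show ?thesis
  proof (cases "card M = 2")
    case True
    then obtain d where "d \<noteq> 0" "card (M + B) = card B + bd d B" using card2_plus by blast
    then show ?thesis using M True by auto
  next
    case False
    then have M3: "3 \<le> card M" using M by simp
    have nM: "nap M" using sidon_nap M M3 by blast
    obtain N where N: "2 \<le> card N" "card (N + M) + 2 \<le> CARD('p)" "card (N + M) \<le> card N + card M"
      "sidon N"
    proof -
      have "card (B + M) + 2 \<le> CARD('p)" "card (B + M) \<le> card B + card M"
        using M by (simp_all add: add.commute)
      then show ?thesis
        using that isoperimetric_atom[of M "card M" B, OF nap_sum_ge[OF nM]] B2 by blast
    qed
    have "card M \<le> 3"
    proof (cases "card N \<ge> 3")
      case True
      then have "3 * card M \<le> card (N + M) + 3" "3 * card N \<le> card (N + M) + 3"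
        using sidon_sum_ge3[OF M(4), of N] sidon_sum_ge3[OF N(4), of M] M3
        by (simp_all add: add.commute[of M N])
      then show ?thesis using N True by linarith
    next
      case False
      moreover have "2 * card M \<le> card (N + M) + 1"
        using sidon_sum_ge2[OF M(4) N(1)] by (simp add: add.commute[of M N])
      ultimately show ?thesis using N M by linarith
    qed
    then show ?thesis using M M3 by (intro disjI2 exI[of _ M]) auto
  qed
qed

text \<open>If every difference costs at least three, any two of the three translates of
  \<open>B\<close> already cover \<open>M + B\<close>. For the complement \<open>K\<close> this
  means that two of \<open>t\<close>, \<open>t - x\<close>, \<open>t - y\<close> in \<open>K\<close>
  force the third. Cut \<open>K\<close> into runs with difference \<open>x\<close>: there are at
  most three, and the shift by \<open>y\<close> makes the number of runs of a given minimal length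
  drop strictly as that length grows, so \<open>card K <= 3 + 2 + 1\<close>.\<close>

lemma three_atom_bound:
  fixes B :: "'p::prime_card mod_ring set"
  assumes M: "card M = 3" "card (M + B) \<le> card B + 3"
    and bd3: "\<And>d. d \<noteq> 0 \<Longrightarrow> 3 \<le> bd d B" and "B \<noteq> {}"
  shows "CARD('p) \<le> card B + 6"
proof -
  obtain m0 m1 m2 where m: "M = {m0, m1, m2}" "m0 \<noteq> m1" "m0 \<noteq> m2" "m1 \<noteq> m2"
    using M(1) card_3_iff[of M] by blast
  define x where "x = m1 - m0"
  define y where "y = m2 - m0"
  have xy: "x \<noteq> 0" "y \<noteq> 0" using m by (auto simp: x_def y_def)
  have union_card: "card ((+) u ` B \<union> (+) v ` B) = card B + bd (v - u) B" for u v
  proof -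
    have "(+) u ` B \<union> (+) v ` B = {u, v} + B" by (auto simp: set_plus_def)
    also have "{u, v} = (+) u ` {0, v - u}" by auto
    finally have "card ((+) u ` B \<union> (+) v ` B) = card ({0, v - u} + B)"
      by (simp only: translate_plus card_translate)
    then show ?thesis by (simp add: card_plus_pair add.commute[of _ B])
  qed
  have sub: "(+) u ` B \<union> (+) v ` B \<subseteq> M + B" if "u \<in> M" "v \<in> M" for u v
    using that by auto
  have union: "(+) u ` B \<union> (+) v ` B = M + B" if "u \<in> M" "v \<in> M" "u \<noteq> v" for u v
  proof (rule card_subset_eq)
    show "card ((+) u ` B \<union> (+) v ` B) = card (M + B)"
      using union_card[of u v] bd3[of "v - u"] M(2) that
        card_mono[OF _ sub[OF that(1,2)]] by simp
  qed (use sub that in auto)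
  define K where "K = - B"
  have rule: "t - w \<in> K" if "t - u \<in> K" "t - v \<in> K" "u \<in> M" "v \<in> M" "u \<noteq> v" "w \<in> M" for t u v w
  proof (rule ccontr)
    assume "t - w \<notin> K"
    then have "t - w \<in> B" by (simp add: K_def)
    then have "w + (t - w) \<in> M + B" using \<open>w \<in> M\<close> by blast
    then have "t \<in> (+) u ` B \<union> (+) v ` B" unfolding union[OF \<open>u \<in> M\<close> \<open>v \<in> M\<close> \<open>u \<noteq> v\<close>] by simp
    then show False using \<open>t - u \<in> K\<close> \<open>t - v \<in> K\<close> by (auto simp: K_def)
  qed
  have r1: "t - y \<in> K" if "t \<in> K" "t - x \<in> K" for t
  proof -
    have e: "t + m0 - m0 = t" "t + m0 - m1 = t - x" "t + m0 - m2 = t - y"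
      by (simp_all add: x_def y_def)
    show ?thesis
      by (rule rule[of "t + m0" m0 m1 m2, unfolded e]) (use that m in \<open>simp_all only: insert_iff simp_thms\<close>)
  qed
  have r3: "t \<in> K" if "t - x \<in> K" "t - y \<in> K" for t
  proof -
    have e: "t + m0 - m0 = t" "t + m0 - m1 = t - x" "t + m0 - m2 = t - y"
      by (simp_all add: x_def y_def)
    show ?thesis
      by (rule rule[of "t + m0" m1 m2 m0, unfolded e]) (use that m in \<open>simp_all only: insert_iff simp_thms\<close>)
  qed
  \<comment> \<open>\<open>F i\<close> holds the points preceded by at least \<open>i\<close>
    further points of their run; \<open>R i\<close> holds the run ends among them, one for each run
    of more than \<open>i\<close> points.\<close>
  define F where "F i = {t. \<forall>j\<le>i. t - of_nat j * x \<in> K}" for i :: nat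
  define R where "R i = {t \<in> F i. t + x \<notin> K}" for i
  have FK: "F i \<subseteq> K" for i by (auto simp: F_def dest: spec[of _ 0])
  have RS: "R (Suc i) \<subseteq> R i" for i by (auto simp: R_def F_def)
  \<comment> \<open>Shifting by \<open>- y\<close> turns the end of a run of more than
    \<open>i + 1\<close> points into the end of a run of more than \<open>i\<close> points:
    \<open>r1\<close> loses one point, \<open>r3\<close> keeps the next point outside
    \<open>K\<close>.\<close>
  have shift: "t - y \<in> R i" if "t \<in> R (Suc i)" for t i
  proof -
    have "t - y - of_nat j * x \<in> K" if "j \<le> i" for j
    proof -
      have "t - of_nat j * x \<in> K" "t - of_nat (Suc j) * x \<in> K"
        using \<open>t \<in> R (Suc i)\<close> that by (auto simp: R_def F_def simp del: of_nat_Suc)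
      then have "t - of_nat j * x - y \<in> K" using r1[of "t - of_nat j * x"]
        by (simp add: algebra_simps)
      then show ?thesis by (simp add: algebra_simps)
    qed
    moreover have "t - y + x \<notin> K"
    proof
      assume "t - y + x \<in> K"
      moreover have "t \<in> K" using \<open>t \<in> R (Suc i)\<close> FK by (auto simp: R_def)
      ultimately have "t + x \<in> K" using r3[of "t + x"] by (simp add: algebra_simps)
      then show False using \<open>t \<in> R (Suc i)\<close> by (simp add: R_def)
    qed
    ultimately show ?thesis by (simp add: R_def F_def)
  qed
  have dec: "card (R (Suc i)) < card (R i)" if "R (Suc i) \<noteq> {}" for i
  proof (rule psubset_card_mono)
    \<comment> \<open>Otherwise the run ends would be closed under the shift by \<open>- y\<close>
      and fill the field.\<close>
    have "R (Suc i) \<noteq> R i"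
    proof
      assume "R (Suc i) = R i"
      have "t + (- y) \<in> R i" if "t \<in> R i" for t
        using shift[of t i] that unfolding \<open>R (Suc i) = R i\<close> by simp
      moreover have "R i \<noteq> {}" "- y \<noteq> 0" using that xy RS[of i] by auto
      ultimately have "R i = UNIV" using translation_closed[of "R i" "- y"] by blast
      then have "0 \<in> R i" "x \<in> F i" by (auto simp: R_def)
      then show False using FK[of i] unfolding R_def by auto
    qed
    then show "R (Suc i) \<subset> R i" using RS by blast
  qed simp
  have F0: "F 0 = K" by (auto simp: F_def)
  have "card (R 0) = bd x K" by (simp add: R_def F0 bd_def)
  also have "\<dots> = bd x B" by (simp add: K_def)
  also have "\<dots> \<le> 3"
    using union_card[of m0 m1] union[of m0 m1] m M(2) by (simp add: x_def)
  finally have R0: "card (R 0) \<le> 3" .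
  have step: "card (R (Suc i)) \<le> card (R i) - 1" for i
    by (cases "R (Suc i) = {}") (use dec[of i] in auto)
  have Suc123: "Suc 0 = 1" "Suc 1 = 2" "Suc 2 = 3" by simp_all
  have R123: "card (R 1) \<le> 2" "card (R 2) \<le> 1" "card (R 3) \<le> 0"
  proof -
    note step[of 0, unfolded Suc123] step[of 1, unfolded Suc123] step[of 2, unfolded Suc123]
    then show "card (R 1) \<le> 2" "card (R 2) \<le> 1" "card (R 3) \<le> 0" using R0 by linarith+
  qed
  have rec: "card (F i) = card (R i) + card (F (Suc i))" for i
  proof -
    have un: "F i = R i \<union> {t \<in> F i. t + x \<in> K}" by (auto simp: R_def)
    have "R i \<inter> {t \<in> F i. t + x \<in> K} = {}" by (auto simp: R_def)
    then have "card (F i) = card (R i) + card {t \<in> F i. t + x \<in> K}"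
      using card_Un_disjoint[of "R i" "{t \<in> F i. t + x \<in> K}"] un by (metis finite)
    moreover have "(\<lambda>t. t + x) ` {t \<in> F i. t + x \<in> K} = F (Suc i)"
    proof (intro equalityI subsetI)
      fix s assume "s \<in> (\<lambda>t. t + x) ` {t \<in> F i. t + x \<in> K}"
      then obtain t where t: "t \<in> F i" "t + x \<in> K" "s = t + x" by blast
      have "s - of_nat j * x \<in> K" if "j \<le> Suc i" for j
      proof (cases j)
        case (Suc k)
        then have "t - of_nat k * x \<in> K" using t that by (simp add: F_def)
        moreover have "s - of_nat j * x = t - of_nat k * x" using t Suc by (simp add: algebra_simps)
        ultimately show ?thesis by simp
      qed (use t in simp)
      then show "s \<in> F (Suc i)" by (simp add: F_def)
    next
      fix s assume s: "s \<in> F (Suc i)"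
      have "s - x - of_nat j * x \<in> K" if "j \<le> i" for j
      proof -
        have "s - of_nat (Suc j) * x \<in> K" using s that unfolding F_def by blast
        then show ?thesis by (simp add: algebra_simps)
      qed
      then have "s - x \<in> F i" by (simp add: F_def)
      moreover have "s - x + x \<in> K" using s FK by auto
      ultimately have "s - x \<in> {t \<in> F i. t + x \<in> K}" by blast
      then have "(s - x) + x \<in> (\<lambda>t. t + x) ` {t \<in> F i. t + x \<in> K}" by (rule imageI)
      then show "s \<in> (\<lambda>t. t + x) ` {t \<in> F i. t + x \<in> K}" by simp
    qed
    then have "card (F (Suc i)) = card {t \<in> F i. t + x \<in> K}"
      using card_translate(2)[of x "{t \<in> F i. t + x \<in> K}"] by simp
    ultimately show ?thesis by simp
  qed
  have "F 3 = {}"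
  proof (rule ccontr)
    assume "F 3 \<noteq> {}"
    have "card (R 3) = 0" "Suc 3 = 4" using R123 by simp_all
    then have "card (F 4) = card (F 3)" using rec[of 3] by simp
    moreover have "F 4 \<subseteq> F 3" by (auto simp: F_def)
    ultimately have F43: "F 4 = F 3" by (intro card_subset_eq) auto
    have "t + (- x) \<in> F 3" if "t \<in> F 3" for t
    proof -
      have "t - x - of_nat j * x \<in> K" if "j \<le> 3" for j
      proof -
        have "t \<in> F 4" "Suc j \<le> 4" using \<open>t \<in> F 3\<close> F43 that by auto
        then have "t - of_nat (Suc j) * x \<in> K" unfolding F_def by blast
        then show ?thesis by (simp add: algebra_simps)
      qed
      then show ?thesis by (simp add: F_def)
    qed
    then have "F 3 = UNIV" using translation_closed[of "F 3" "- x"] \<open>F 3 \<noteq> {}\<close> xy by simp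
    then have "K = UNIV" using FK[of 3] by blast
    then show False using \<open>B \<noteq> {}\<close> unfolding K_def by blast
  qed
  then have "card (F 3) = 0" by (simp only: card.empty)
  have "card (F 0) \<le> 6"
  proof -
    show ?thesis
      using rec[of 0, unfolded Suc123] rec[of 1, unfolded Suc123] rec[of 2, unfolded Suc123]
        R0 R123 \<open>card (F 3) = 0\<close> by linarith
  qed
  then have "card K \<le> 6" by (simp only: F0)
  then show ?thesis by (simp add: K_def card_Compl_finite)
qed

text \<open>Symmetric form of the inequality \<open>card (X + Y) <= card X + card Y\<close>: the
  complement of \<open>- Z\<close> has exactly the size on the right and contains the sumset. Each
  of the three sets can take the part of the complement.\<close>

definition crit :: "'a::ab_group_add set \<Rightarrow> 'a set \<Rightarrow> 'a set \<Rightarrow> bool" where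
  "crit X Y Z \<longleftrightarrow> (\<forall>x\<in>X. \<forall>y\<in>Y. \<forall>z\<in>Z. x + y + z \<noteq> 0) \<and> card X + card Y + card Z = CARD('a)"

lemma crit_perm:
  assumes "crit X Y Z"
  shows "crit Y X Z" "crit X Z Y" "crit Z Y X"
proof -
  have xyz: "x + y + z \<noteq> 0" if "x \<in> X" "y \<in> Y" "z \<in> Z" for x y z
    using assms that unfolding crit_def by blast
  have yxz: "y + x + z \<noteq> 0" and xzy: "x + z + y \<noteq> 0" and zyx: "z + y + x \<noteq> 0"
    if "x \<in> X" "y \<in> Y" "z \<in> Z" for x y z
  proof -
    have "y + x + z = x + y + z" "x + z + y = x + y + z" "z + y + x = x + y + z"
      by (simp_all add: ac_simps)
    then show "y + x + z \<noteq> 0" "x + z + y \<noteq> 0" "z + y + x \<noteq> 0" using xyz[OF that] by metis+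
  qed
  have c: "card X + card Y + card Z = CARD('a)" using assms unfolding crit_def by blast
  have "card Y + card X + card Z = CARD('a)" "card X + card Z + card Y = CARD('a)"
    "card Z + card Y + card X = CARD('a)" using c by linarith+
  then show "crit Y X Z" "crit X Z Y" "crit Z Y X"
    unfolding crit_def using yxz xzy zyx by blast+
qed

lemma crit_sum_subset: "crit X Y Z \<Longrightarrow> X + Y \<subseteq> - (uminus ` Z)"
proof
  fix w assume c: "crit X Y Z" and "w \<in> X + Y"
  then obtain x y where xy: "x \<in> X" "y \<in> Y" "w = x + y" by (auto simp: set_plus_def)
  show "w \<in> - (uminus ` Z)"
  proof
    assume "w \<in> uminus ` Z"
    then obtain z where "z \<in> Z" "w = - z" by blast
    then have "x + y + z = 0" using xy by simp
    then show False using c xy \<open>z \<in> Z\<close> unfolding crit_def by blast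
  qed
qed

lemma crit_sum_card:
  fixes X :: "'a::{ab_group_add,finite} set"
  assumes "crit X Y Z"
  shows "card (X + Y) \<le> card X + card Y"
proof -
  have "card (X + Y) \<le> card (- (uminus ` Z))"
    by (intro card_mono crit_sum_subset assms) auto
  then have "card (X + Y) \<le> CARD('a) - card Z" by (simp add: card_Compl_finite)
  moreover have "card X + card Y + card Z = CARD('a)" using assms by (simp add: crit_def)
  ultimately show ?thesis by linarith
qed

text \<open>The bound 7 is what excludes a three-point atom, since that would leave at most six
  points outside \<open>Z\<close>.\<close>

lemma crit_two_atom:
  fixes X :: "'p::prime_card mod_ring set"
  assumes crit: "crit X Y Z" and "nap Z" "2 \<le> card X" "2 \<le> card Y" "7 \<le> card X + card Y"
  shows "\<exists>d. d \<noteq> 0 \<and> bd d Z \<le> 2"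
proof -
  have XZ: "card (X + Z) \<le> card X + card Z" by (rule crit_sum_card[OF crit_perm(2)[OF crit]])
  have p: "card X + card Y + card Z = CARD('p)" using crit by (simp add: crit_def)
  have *: "(\<exists>d. d \<noteq> 0 \<and> bd d Z \<le> 2) \<or> (\<exists>M. card M = 3 \<and> card (M + Z) \<le> card Z + 3)"
    using two_atom[of Z X] XZ p assms by simp
  show ?thesis
  proof (rule ccontr)
    assume no: "\<not> ?thesis"
    have b3: "3 \<le> bd d Z" if "d \<noteq> 0" for d
    proof -
      have "\<not> bd d Z \<le> 2" using no that by blast
      then show ?thesis by simp
    qed
    obtain M where "card M = 3" "card (M + Z) \<le> card Z + 3"
      using * no by blast
    moreover have "Z \<noteq> {}" using nap_card[OF assms(2)] by auto
    ultimately have "CARD('p) \<le> card Z + 6" using three_atom_bound b3 by blast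
    then show False using p assms by simp
  qed
qed

text \<open>Adding \<open>{0, d}\<close> to \<open>X\<close> enlarges the sumset within the
  complement of \<open>- Z\<close> enlarged by \<open>bd d Z\<close> points, and \<open>Y\<close>, a
  non-progression, makes the raised lower bound apply. Four points in \<open>Z\<close> keep the
  enlarged sumset two short of the field.\<close>

lemma crit_transfer:
  fixes X :: "'p::prime_card mod_ring set"
  assumes crit: "crit X Y Z" and "nap Y" "2 \<le> card X" "4 \<le> card Z" "bd d Z \<le> 2"
  shows "bd d X \<le> 2"
proof -
  let ?S = "- (uminus ` Z)"
  have p: "card X + card Y + card Z = CARD('p)" using crit by (simp add: crit_def)
  have "(X + {0, d}) + Y = (X + Y) + {0, d}" by (simp only: ac_simps)
  also have "\<dots> \<subseteq> ?S + {0, d}" by (intro set_plus_mono2 crit_sum_subset crit) auto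
  finally have "card ((X + {0, d}) + Y) \<le> card (?S + {0, d})" by (intro card_mono) auto
  also have "\<dots> = card ?S + bd d Z" by (simp add: card_plus_pair)
  also have "card ?S = CARD('p) - card Z" by (simp add: card_Compl_finite)
  finally have le: "card ((X + {0, d}) + Y) \<le> card X + card Y + bd d Z" using p by simp
  have "card (X + {0, d}) + card Y \<le> card ((X + {0, d}) + Y)"
    using le p assms by (intro nap_sum_ge) (auto simp: card_plus_pair)
  then show ?thesis using le assms by (simp add: card_plus_pair)
qed

text \<open>\<open>near d X\<close>: the set is a progression with difference \<open>d\<close>, possibly with one point deleted.\<close>

definition near :: "'a::ab_group_add \<Rightarrow> 'a set \<Rightarrow> bool" where
  "near d X \<longleftrightarrow> (\<exists>t. bd d (insert t X) \<le> 1)"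

lemma bd_erode_le:
  fixes X :: "'a::{ab_group_add,finite} set"
  shows "bd d (erode d X) \<le> bd d X"
proof -
  have "(\<lambda>x. x + d) ` {x \<in> erode d X. x + d \<notin> erode d X} \<subseteq> {x \<in> X. x + d \<notin> X}"
    by (auto simp: erode_def)
  then have "card ((\<lambda>x. x + d) ` {x \<in> erode d X. x + d \<notin> erode d X}) \<le> card {x \<in> X. x + d \<notin> X}"
    by (intro card_mono) auto
  then show ?thesis by (simp add: bd_def)
qed

lemma near_ap: "bd d X \<le> 1 \<Longrightarrow> X \<noteq> {} \<Longrightarrow> near d X"
  unfolding near_def by (metis ex_in_conv insert_absorb)

lemma near_iff_scale:
  fixes c :: "'a::{field,finite}"
  assumes "c \<noteq> 0"
  shows "near d ((*) c ` X) \<longleftrightarrow> near (d / c) X"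
proof
  assume "near d ((*) c ` X)"
  then obtain t where t: "bd d (insert t ((*) c ` X)) \<le> 1" by (auto simp: near_def)
  have "insert t ((*) c ` X) = (*) c ` (insert (t / c) X)" using assms by simp
  then show "near (d / c) X" using t assms unfolding near_def by (metis bd_scale')
next
  assume "near (d / c) X"
  then obtain t where t: "bd (d / c) (insert t X) \<le> 1" by (auto simp: near_def)
  have "insert (c * t) ((*) c ` X) = (*) c ` (insert t X)" by simp
  then show "near d ((*) c ` X)" using t assms unfolding near_def by (metis bd_scale')
qed

text \<open>Two pieces that merge when each is lengthened by one step have a gap of a single point
  between them, and this point is the one to insert.\<close>

lemma near_of_card:
  fixes X :: "'p::prime_card mod_ring set"
  assumes "d \<noteq> 0" "X \<noteq> {}" "card (X + {0, d} + {0, d}) \<le> card X + 3" "card X + 4 \<le> CARD('p)"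
  shows "near d X"
proof (cases "bd d X \<le> 1")
  case True then show ?thesis using near_ap assms by blast
next
  case False
  let ?Y = "X + {0, d}"
  have sum: "card (?Y + {0, d}) = card X + bd d X + bd d ?Y" by (simp add: card_plus_pair)
  have "?Y \<noteq> UNIV"
  proof
    assume "?Y = UNIV"
    then have "card ?Y = CARD('p)" by simp
    then have "card X + bd d X = CARD('p)" by (simp only: card_plus_pair)
    then show False using assms(3,4) sum by linarith
  qed
  moreover have "?Y \<noteq> {}" using assms(2) by simp
  ultimately have "1 \<le> bd d ?Y" using bd_pos assms(1) by blast
  then have b: "bd d X = 2" "bd d ?Y = 1" using sum assms(3) False by auto
  \<comment> \<open>Without a gap of one point every end of \<open>X\<close> would move to an end of
    \<open>X + {0, d}\<close>, and the boundary could not fall from 2 to 1.\<close>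
  have "\<exists>x\<in>X. x + d \<notin> X \<and> x + d + d \<in> X"
  proof (rule ccontr)
    assume "\<not> ?thesis"
    then have *: "x + d + d \<notin> X" if "x \<in> X" "x + d \<notin> X" for x using that by blast
    have "(\<lambda>x. x + d) ` {x \<in> X. x + d \<notin> X} \<subseteq> {y \<in> ?Y. y + d \<notin> ?Y}"
    proof
      fix z assume "z \<in> (\<lambda>x. x + d) ` {x \<in> X. x + d \<notin> X}"
      then obtain x where x: "x \<in> X" "x + d \<notin> X" "z = x + d" by blast
      then have "z \<in> ?Y" by auto
      moreover have "z + d \<notin> ?Y"
      proof
        assume "z + d \<in> ?Y"
        then obtain w where "w \<in> X" "x + d + d = w \<or> x + d + d = w + d"
          using x by (auto simp: set_plus_def)
        then show False using *[OF x(1,2)] x(2) by (metis add_right_cancel)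
      qed
      ultimately show "z \<in> {y \<in> ?Y. y + d \<notin> ?Y}" by blast
    qed
    then have "card ((\<lambda>x. x + d) ` {x \<in> X. x + d \<notin> X}) \<le> bd d ?Y"
      unfolding bd_def by (intro card_mono) auto
    then show False using b by (simp add: bd_def)
  qed
  then obtain x where x: "x \<in> X" "x + d \<notin> X" "x + d + d \<in> X" by blast
  have "{y \<in> insert (x + d) X. y + d \<notin> insert (x + d) X} \<subseteq> {y \<in> X. y + d \<notin> X} - {x}"
  proof
    fix y assume y: "y \<in> {y \<in> insert (x + d) X. y + d \<notin> insert (x + d) X}"
    then have "y \<noteq> x + d" "y \<noteq> x" using x(3) by blast+
    then show "y \<in> {y \<in> X. y + d \<notin> X} - {x}" using y by blast
  qed
  then have "bd d (insert (x + d) X) \<le> card ({y \<in> X. y + d \<notin> X} - {x})"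
    unfolding bd_def by (intro card_mono) auto
  also have "\<dots> = card {y \<in> X. y + d \<notin> X} - 1" using x by (intro card_Diff_singleton) blast
  also have "card {y \<in> X. y + d \<notin> X} = 2" using b(1) by (simp only: bd_def)
  finally have "bd d (insert (x + d) X) \<le> 1" by simp
  then show ?thesis unfolding near_def by blast
qed

text \<open>Erode the progression \<open>Y\<close> twice, at a cost of at most two points, and
  lengthen \<open>X\<close> twice instead; Cauchy-Davenport then limits the growth of
  \<open>X\<close> to three.\<close>

lemma near_of_ap_sum:
  fixes X :: "'p::prime_card mod_ring set"
  assumes "d \<noteq> 0" "bd d Y \<le> 1" "3 \<le> card Y" "X \<noteq> {}" "card (X + Y) \<le> card X + card Y"
    "card X + card Y < CARD('p)" "card X + 4 \<le> CARD('p)"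
  shows "near d X"
proof (rule near_of_card)
  let ?E = "erode d (erode d Y)"
  have cE: "card Y \<le> card ?E + 2"
    using card_erode[of d Y] card_erode[of d "erode d Y"] bd_erode_le[of d Y] assms(2) by linarith
  have "?E + {0, d} + {0, d} \<subseteq> erode d Y + {0, d}"
    by (rule set_plus_mono2[OF erode_plus order_refl])
  then have "?E + {0, d} + {0, d} \<subseteq> Y" using erode_plus[of d Y] by (rule subset_trans)
  then have "X + (?E + {0, d} + {0, d}) \<subseteq> X + Y" by (rule set_plus_mono2[OF order_refl])
  moreover have "X + (?E + {0, d} + {0, d}) = (X + {0, d} + {0, d}) + ?E"
    by (simp only: add.assoc add.commute add.left_commute)
  ultimately have "(X + {0, d} + {0, d}) + ?E \<subseteq> X + Y" by (simp only:)
  then have "card ((X + {0, d} + {0, d}) + ?E) \<le> card (X + Y)"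
    by (rule card_mono[OF finite])
  then have le: "card ((X + {0, d} + {0, d}) + ?E) \<le> card X + card Y"
    using assms(5) by (rule le_trans)
  have "X + {0, d} + {0, d} \<noteq> {}" using assms(4) unfolding plus_eq_empty_iff by blast
  moreover have "?E \<noteq> {}"
  proof
    assume "?E = {}"
    then have "card ?E = 0" by (simp only: card.empty)
    then show False using cE assms(3) by linarith
  qed
  moreover have "card ((X + {0, d} + {0, d}) + ?E) < CARD('p)"
    using le assms(6) by (rule le_less_trans)
  ultimately have "card (X + {0, d} + {0, d}) + card ?E \<le> card ((X + {0, d} + {0, d}) + ?E) + 1"
    using cauchy_davenport_less[of "X + {0, d} + {0, d}" ?E] by blast
  then show "card (X + {0, d} + {0, d}) \<le> card X + 3" using le cE by linarith
qed (rule assms)+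

text \<open>Both sides count the ordered pairs of elements of \<open>X\<close>, the left side sorted
  by difference.\<close>

lemma sum_card_erode:
  fixes X :: "'a::{ab_group_add,finite} set"
  shows "(\<Sum>d\<in>UNIV. card (erode d X)) = card X * card X"
proof -
  have "(\<Sum>d\<in>UNIV. card (erode d X)) = card (SIGMA d:UNIV. erode d X)"
    by (rule card_SigmaI[symmetric]) auto
  also have "\<dots> = card (X \<times> X)"
  proof (rule bij_betw_same_card)
    show "bij_betw (\<lambda>(d, x). (x, x + d)) (SIGMA d:UNIV. erode d X) (X \<times> X)"
      by (rule bij_betw_byWitness[where f' = "\<lambda>(x, y). (y - x, x)"]) (auto simp: erode_def)
  qed
  finally show ?thesis by (simp add: card_cartesian_product)
qed

section \<open>Directions of small boundary\<close>

text \<open>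
  The triangle inequality \<open>bd (d + e) X \<le> bd d X + bd e X\<close> makes the level sets grow at the
  Cauchy-Davenport rate, while their sizes sum to \<open>(card X)\<^sup>2\<close>. Hence a set cannot have small
  boundary in too many directions.
\<close>

definition level :: "'a::ab_group_add set \<Rightarrow> nat \<Rightarrow> 'a set" where
  "level X i = {d. bd d X \<le> i}"

text \<open>Each \<open>d\<close> is counted for every \<open>i\<close> from \<open>bd d X\<close>
  up to \<open>card X - 1\<close>, which is \<open>card (erode d X)\<close> times.\<close>

lemma sum_card_level:
  fixes X :: "'a::{ab_group_add,finite} set"
  shows "(\<Sum>i<card X. card (level X i)) = card X * card X"
proof -
  have "card (level X i) = (\<Sum>d\<in>UNIV. if bd d X \<le> i then 1 else 0)" for i
    by (simp add: level_def sum.If_cases)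
  then have "(\<Sum>i<card X. card (level X i)) = (\<Sum>i<card X. \<Sum>d\<in>UNIV. if bd d X \<le> i then 1 else 0)"
    by simp
  also have "\<dots> = (\<Sum>d\<in>UNIV. \<Sum>i<card X. if bd d X \<le> i then 1 else 0)"
    by (rule sum.swap)
  also have "\<dots> = (\<Sum>d\<in>UNIV. card (erode d X))"
  proof (rule sum.cong[OF refl])
    fix d :: 'a
    have "(\<Sum>i<card X. if bd d X \<le> i then 1 else 0) = card {i \<in> {..<card X}. bd d X \<le> i}"
      by (simp add: sum.If_cases Int_def)
    also have "{i \<in> {..<card X}. bd d X \<le> i} = {bd d X..<card X}" by auto
    finally show "(\<Sum>i<card X. if bd d X \<le> i then 1 else 0) = card (erode d X)"
      using card_erode[of d X] by simp
  qed
  finally show ?thesis by (simp add: sum_card_erode)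
qed

lemma level_mono: "i \<le> j \<Longrightarrow> card (level X i) \<le> card (level X j)"
  for X :: "'a::{ab_group_add,finite} set"
  by (rule card_mono) (auto simp: level_def)

lemma level_pos: "1 \<le> card (level X i)" for X :: "'a::{ab_group_add,finite} set"
proof -
  have "0 \<in> level X i" by (simp add: level_def)
  then show ?thesis by (metis One_nat_def Suc_leI card_gt_0_iff empty_iff finite)
qed

lemma level_add:
  fixes X :: "'p::prime_card mod_ring set"
  shows "card (level X i) + card (level X j) \<le> card (level X (i + j)) + 1 \<or> card (level X (i + j)) = CARD('p)"
proof -
  have sub: "level X i + level X j \<subseteq> level X (i + j)"
  proof
    fix z assume "z \<in> level X i + level X j"
    then obtain d e where "z = d + e" "bd d X \<le> i" "bd e X \<le> j"
      by (auto simp: level_def set_plus_def)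
    then show "z \<in> level X (i + j)" using bd_triangle[of d e X] by (simp add: level_def)
  qed
  have "level X i \<noteq> {}" "level X j \<noteq> {}" using level_pos[of X i] level_pos[of X j] by force+
  from cauchy_davenport[OF this] show ?thesis
  proof
    assume "level X i + level X j = UNIV"
    then have "level X (i + j) = UNIV" using sub by auto
    then show ?thesis by simp
  next
    assume "card (level X i) + card (level X j) \<le> card (level X i + level X j) + 1"
    moreover have "card (level X i + level X j) \<le> card (level X (i + j))" using sub by (intro card_mono) auto
    ultimately show ?thesis by linarith
  qed
qed

text \<open>Starting from 13 directions at level 4, every two further levels bring at least four
  more directions, and the total exceeds \<open>card X * card X\<close> by two. The bound
  \<open>2 * card X < p\<close> covers the levels that already exhaust the field.\<close>

lemma level_sum_contra:
  fixes X :: "'p::prime_card mod_ring set"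
  assumes m: "6 \<le> card X" "2 * card X < CARD('p)"
    and l2: "5 \<le> card (level X 2)" and l4: "13 \<le> card (level X 4)"
  shows False
proof -
  define N where "N i = card (level X i)" for i
  have Nmono: "N i \<le> N j" if "i \<le> j" for i j using level_mono that by (simp add: N_def)
  have even: "13 + 4 * k \<le> N (4 + 2 * k) \<or> N (4 + 2 * k) = CARD('p)" for k
  proof (induction k)
    case (Suc k)
    have e: "4 + 2 * k + 2 = 4 + 2 * Suc k" by simp
    have "N (4 + 2 * k) + N 2 \<le> N (4 + 2 * Suc k) + 1 \<or> N (4 + 2 * Suc k) = CARD('p)"
      using level_add[of X "4 + 2 * k" 2] unfolding N_def e .
    moreover have "N (4 + 2 * Suc k) \<le> CARD('p)"
      using card_le_CARD[of "level X (4 + 2 * Suc k)"] by (simp add: N_def)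
    moreover have "N (4 + 2 * k) \<le> N (4 + 2 * Suc k)" by (rule Nmono) simp
    moreover have "5 \<le> N 2" using l2 by (simp add: N_def)
    ultimately show ?case using Suc by arith
  qed (use l4 in \<open>simp add: N_def\<close>)
  have big: "2 * i + 3 \<le> N i" if "4 \<le> i" "i < card X" for i
  proof -
    define k where "k = (i - 4) div 2"
    have "4 + 2 * k \<le> i" "i \<le> 5 + 2 * k" using that by (auto simp: k_def)
    then show ?thesis using even[of k] Nmono[of "4 + 2 * k" i] that m by linarith
  qed
  have "n * n + 2 \<le> (\<Sum>i<n. N i)" if "6 \<le> n" "n \<le> card X" for n
    using that
  proof (induction n rule: dec_induct)
    case base
    \<comment> \<open>Levels 0 to 5 contribute at least 1 + 1 + 5 + 5 + 13 + 13 = 38 = 6 * 6 +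
      2.\<close>
    have s: "{..<6} = {0, 1, 2, 3, 4, 5::nat}" by auto
    have "N 0 \<ge> 1" "N 1 \<ge> 1" using level_pos by (simp_all add: N_def)
    moreover have "N 2 \<ge> 5" "N 4 \<ge> 13" using l2 l4 by (simp_all add: N_def)
    moreover have "N 3 \<ge> N 2" "N 5 \<ge> N 4" by (auto intro: Nmono)
    ultimately show ?case by (simp add: s)
  next
    case (step n)
    then show ?case using big[of n] by simp
  qed
  from this[of "card X"] show False using m sum_card_level[of X] by (simp add: N_def)
qed

text \<open>Levels 0 and 1 contain the direction 0 and contribute the summand 2; the total for five
  points must be 25.\<close>

lemma level_sum_contra5:
  fixes X :: "'p::prime_card mod_ring set"
  assumes "card X = 5" "27 \<le> card (level X 2) + card (level X 3) + card (level X 4) + 2"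
  shows False
proof -
  have "{..<5} = {0, 1, 2, 3, 4::nat}" by auto
  then show False
    using sum_card_level[of X] assms level_pos[of X 0] level_pos[of X 1] by simp
qed

lemma level_sum_contra4:
  fixes X :: "'p::prime_card mod_ring set"
  assumes "card X = 4" "9 \<le> card (level X 2)"
  shows False
proof -
  have "{..<4} = {0, 1, 2, 3::nat}" by auto
  then show False
    using sum_card_level[of X] assms level_pos[of X 0] level_pos[of X 1] level_mono[of 2 3 X] by simp
qed

section \<open>Directions obtained from the powers of a ratio\<close>

lemma of_nat_mod_ring_eq_0_iff: "(of_nat n :: 'p::prime_card mod_ring) = 0 \<longleftrightarrow> CARD('p) dvd n"
  by (metis of_nat_0_mod_ring_dvd dvdE mult_zero_left of_nat_card_eq_0 of_nat_mult)

lemma of_int_mod_ring_eq_0_iff: "(of_int n :: 'p::prime_card mod_ring) = 0 \<longleftrightarrow> int CARD('p) dvd n"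
proof -
  have "(of_int n :: 'p mod_ring) = 0 \<longleftrightarrow> (of_int \<bar>n\<bar> :: 'p mod_ring) = 0"
    by (cases "n \<ge> 0") simp_all
  also have "(of_int \<bar>n\<bar> :: 'p mod_ring) = of_nat (nat \<bar>n\<bar>)" by (simp add: of_nat_nat)
  also have "of_nat (nat \<bar>n\<bar>) = (0 :: 'p mod_ring) \<longleftrightarrow> CARD('p) dvd nat \<bar>n\<bar>"
    by (rule of_nat_mod_ring_eq_0_iff)
  also have "\<dots> \<longleftrightarrow> int CARD('p) dvd int (nat \<bar>n\<bar>)" by (rule int_dvd_int_iff[symmetric])
  also have "\<dots> \<longleftrightarrow> int CARD('p) dvd n" by simp
  finally show ?thesis .
qed

lemma of_nat_mod_ring_neq_0: 
  assumes "0 < n" "n < CARD('p)" shows "(of_nat n :: 'p::prime_card mod_ring) \<noteq> 0"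
  using assms by (auto simp: of_nat_mod_ring_eq_0_iff dest: dvd_imp_le)

text \<open>A coincidence between two of these elements makes a power of \<open>u\<close> with
  positive exponent below \<open>k\<close> equal to \<open>1\<close> or \<open>- 1\<close>, or
  compares equal exponents with different signs.\<close>

lemma card_signed_powers:
  fixes u d :: "'p::prime_card mod_ring"
  assumes "d \<noteq> 0" "u \<noteq> 0" "2 < CARD('p)" "\<And>j. 0 < j \<Longrightarrow> j < k \<Longrightarrow> u ^ j \<noteq> 1 \<and> u ^ j \<noteq> - 1"
  shows "card (insert 0 ((\<lambda>(i, s). s * (u ^ i * d)) ` ({..<k} \<times> {1, - 1}))) = 2 * k + 1"
proof -
  have one: "(1 :: 'p mod_ring) \<noteq> - 1"
  proof
    assume "(1 :: 'p mod_ring) = - 1"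
    then have "(1 :: 'p mod_ring) + 1 = - 1 + 1" by (simp only:)
    then have "(of_nat 2 :: 'p mod_ring) = 0" by simp
    then show False using of_nat_mod_ring_neq_0[of 2, where 'p = 'p] assms(3) by simp
  qed
  have key: "i = j \<and> s = t" if "i \<le> j" "j < k" "s \<in> {1, - 1}" "t \<in> {1, - 1}"
    "s * (u ^ i * d) = t * (u ^ j * d)" for i j and s t :: "'p mod_ring"
  proof -
    obtain r where r: "j = i + r" using le_Suc_ex \<open>i \<le> j\<close> by blast
    have "s * (u ^ i * d) = u ^ i * (s * d)" by (simp only: ac_simps)
    moreover have "t * (u ^ j * d) = u ^ i * (t * u ^ r * d)" by (simp only: r power_add ac_simps)
    ultimately have "u ^ i * (s * d) = u ^ i * (t * u ^ r * d)" using that(5) by (simp only:)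
    then have "s * d = t * u ^ r * d" using assms(2) by simp
    then have e: "s = t * u ^ r" using assms(1) by simp
    have "t * t = 1" using that(4) by auto
    then have "u ^ r = t * s" unfolding e by (simp flip: mult.assoc)
    then have "u ^ r = 1 \<or> u ^ r = - 1" using that(3,4) by auto
    then have "r = 0" using assms(4)[of r] that(2) r by (cases "r = 0") auto
    then show ?thesis using e r by simp
  qed
  have "inj_on (\<lambda>(i, s). s * (u ^ i * d)) ({..<k} \<times> {1, - 1})"
  proof (rule inj_onI)
    fix x y assume xy: "x \<in> {..<k} \<times> {1, - 1}" "y \<in> {..<k} \<times> {1, - 1}"
      and e: "(case x of (i, s) \<Rightarrow> s * (u ^ i * d)) = (case y of (i, s) \<Rightarrow> s * (u ^ i * d))"
    obtain i s j t where ij: "x = (i, s)" "y = (j, t)" by (metis surj_pair)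
    have a: "i < k" "j < k" "s \<in> {1, - 1}" "t \<in> {1, - 1}" "s * (u ^ i * d) = t * (u ^ j * d)"
      using xy e by (simp_all add: ij)
    show "x = y"
    proof (cases "i \<le> j")
      case True then show ?thesis using key[OF True a(2,3,4,5)] ij by simp
    next
      case False
      then have "j \<le> i" by simp
      then show ?thesis using key[OF _ a(1) a(4) a(3) a(5)[symmetric]] ij by simp
    qed
  qed
  then have "card ((\<lambda>(i, s). s * (u ^ i * d)) ` ({..<k} \<times> {1, - 1})) = card ({..<k} \<times> {1, - 1 :: 'p mod_ring})"
    by (rule card_image)
  also have "\<dots> = 2 * k" using one by (simp add: card_cartesian_product)
  finally have "card ((\<lambda>(i, s). s * (u ^ i * d)) ` ({..<k} \<times> {1, - 1})) = 2 * k" .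
  moreover have "0 \<notin> (\<lambda>(i, s). s * (u ^ i * d)) ` ({..<k} \<times> {1, - 1})"
    using assms(1,2) by auto
  ultimately show ?thesis by simp
qed

lemma fermat_mod_ring:
  assumes "(u :: 'p::prime_card mod_ring) \<noteq> 0"
  shows "u ^ (CARD('p) - 1) = 1"
proof -
  have "u ^ CARD('p) = u" using finite_field_power_card_eq_same[of u] by simp
  moreover have "CARD('p) = Suc (CARD('p) - 1)" by simp
  ultimately have "u * u ^ (CARD('p) - 1) = u * 1" by (metis mult.right_neutral power_Suc)
  then show ?thesis by (simp only: mult_left_cancel[OF assms])
qed

text \<open>With \<open>u\<close> as imaginary unit, \<open>S + S\<close> is the image of the 13
  Gaussian integers \<open>a + b i\<close> with \<open>|a| + |b| <= 2\<close>. If two of them agreed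
  modulo \<open>p\<close>, then \<open>p\<close> would divide a nonzero norm
  \<open>a * a + b * b\<close> with \<open>|a| + |b| <= 4\<close>.\<close>

lemma card_gaussian_ball:
  fixes u d :: "'p::prime_card mod_ring"
  assumes u: "u * u = - 1" and d: "d \<noteq> 0" and p: "13 \<le> CARD('p)"
  defines "S \<equiv> {0, d, - d, u * d, - (u * d)}"
  shows "13 \<le> card (S + S)"
proof -
  define g :: "int \<times> int \<Rightarrow> 'p mod_ring" where "g = (\<lambda>(a, b). (of_int a + of_int b * u) * d)"
  define L :: "(int \<times> int) list" where
    "L = [(0,0), (1,0), (-1,0), (0,1), (0,-1), (2,0), (-2,0), (0,2), (0,-2), (1,1), (1,-1), (-1,1), (-1,-1)]"
  have key: "a = 0 \<and> b = 0" if "of_int a + of_int b * u = 0" "\<bar>a\<bar> + \<bar>b\<bar> \<le> 4" for a b :: int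
  proof -
    have "(of_int a + of_int b * u) * (of_int a - of_int b * u) = of_int (a * a) - of_int (b * b) * (u * u)"
      by (simp add: algebra_simps)
    then have "(of_int (a * a + b * b) :: 'p mod_ring) = 0" using that(1) u by simp
    then have dv: "int CARD('p) dvd a * a + b * b" by (simp only: of_int_mod_ring_eq_0_iff)
    have ab: "a \<in> {-4, -3, -2, -1, 0, 1, 2, 3, 4}" "b \<in> {-4, -3, -2, -1, 0, 1, 2, 3, 4}"
      using that(2) by auto
    \<comment> \<open>Such norms are at most 16, and 13 = 9 + 4 would need
      \<open>|a| + |b| = 5\<close>; there is no prime from 14 to 16.\<close>
    have le: "a * a + b * b \<le> 16 \<and> a * a + b * b \<noteq> 13" using ab that(2) by auto
    have "a * a + b * b = 0"
    proof (rule ccontr)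
      assume nz: "a * a + b * b \<noteq> 0"
      have pos: "0 < a * a + b * b" using nz by (metis add_nonneg_nonneg less_le zero_le_square)
      obtain k where k: "a * a + b * b = int CARD('p) * k" using dv by blast
      have "k \<ge> 1"
      proof (rule ccontr)
        assume "\<not> k \<ge> 1"
        then have "int CARD('p) * k \<le> 0" by (intro mult_nonneg_nonpos) auto
        then show False using pos k by linarith
      qed
      moreover have "k < 2"
      proof (rule ccontr)
        assume "\<not> k < 2"
        then have "13 * 2 \<le> int CARD('p) * k" using p by (intro mult_mono) auto
        then show False using le k by linarith
      qed
      ultimately have "k = 1" by simp
      then have c: "int CARD('p) \<le> 16" "int CARD('p) \<noteq> 13" using le k by auto
      have "prime CARD('p)" by (rule prime_card)
      moreover have "CARD('p) = 14 \<or> CARD('p) = 15 \<or> CARD('p) = 16" using c p by linarith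
      moreover have "\<not> prime (14::nat)" "\<not> prime (15::nat)" "\<not> prime (16::nat)" by simp_all
      ultimately show False by metis
    qed
    then show ?thesis by (simp add: sum_squares_eq_zero_iff)
  qed
  have "inj_on g (set L)"
  proof (rule inj_onI)
    fix x y assume x: "x \<in> set L" and y: "y \<in> set L" and e: "g x = g y"
    obtain a b a' b' where ab: "x = (a, b)" "y = (a', b')" by (metis surj_pair)
    have "(of_int a + of_int b * u) * d = (of_int a' + of_int b' * u) * d" using e by (simp add: g_def ab)
    then have "of_int a + of_int b * u = of_int a' + of_int b' * u" using d by (simp only: mult_right_cancel[OF d])
    then have "of_int (a - a') + of_int (b - b') * u = 0" by (simp add: algebra_simps)
    moreover have "\<bar>a\<bar> + \<bar>b\<bar> \<le> 2" "\<bar>a'\<bar> + \<bar>b'\<bar> \<le> 2" using x y ab by (auto simp: L_def)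
    then have "\<bar>a - a'\<bar> + \<bar>b - b'\<bar> \<le> 4" by linarith
    ultimately have "a - a' = 0 \<and> b - b' = 0" by (rule key)
    then show "x = y" using ab by simp
  qed
  then have "card (g ` set L) = card (set L)" by (rule card_image)
  also have "\<dots> = 13" by (simp add: L_def)
  finally have "card (g ` set L) = 13" .
  moreover have "g ` set L \<subseteq> S + S"
  proof -
    have S: "0 \<in> S" "d \<in> S" "- d \<in> S" "u * d \<in> S" "- (u * d) \<in> S" by (simp_all add: S_def)
    have "g (0, 0) = 0 + 0" unfolding g_def by (simp; algebra)
    then have g0: "g (0, 0) \<in> S + S" using set_plus_intro[OF S(1) S(1)] by metis
    have "g (1, 0) = d + 0" unfolding g_def by (simp; algebra)
    then have g1: "g (1, 0) \<in> S + S" using set_plus_intro[OF S(2) S(1)] by metis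
    have "g (-1, 0) = - d + 0" unfolding g_def by (simp; algebra)
    then have g2: "g (-1, 0) \<in> S + S" using set_plus_intro[OF S(3) S(1)] by metis
    have "g (0, 1) = u * d + 0" unfolding g_def by (simp; algebra)
    then have g3: "g (0, 1) \<in> S + S" using set_plus_intro[OF S(4) S(1)] by metis
    have "g (0, -1) = - (u * d) + 0" unfolding g_def by (simp; algebra)
    then have g4: "g (0, -1) \<in> S + S" using set_plus_intro[OF S(5) S(1)] by metis
    have "g (2, 0) = d + d" unfolding g_def by (simp; algebra)
    then have g5: "g (2, 0) \<in> S + S" using set_plus_intro[OF S(2) S(2)] by metis
    have "g (-2, 0) = - d + - d" unfolding g_def by (simp; algebra)
    then have g6: "g (-2, 0) \<in> S + S" using set_plus_intro[OF S(3) S(3)] by metis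
    have "g (0, 2) = u * d + u * d" unfolding g_def by (simp; algebra)
    then have g7: "g (0, 2) \<in> S + S" using set_plus_intro[OF S(4) S(4)] by metis
    have "g (0, -2) = - (u * d) + - (u * d)" unfolding g_def by (simp; algebra)
    then have g8: "g (0, -2) \<in> S + S" using set_plus_intro[OF S(5) S(5)] by metis
    have "g (1, 1) = d + u * d" unfolding g_def by (simp add: algebra_simps)
    then have g9: "g (1, 1) \<in> S + S" using set_plus_intro[OF S(2) S(4)] by metis
    have "g (1, -1) = d + - (u * d)" unfolding g_def by (simp add: algebra_simps)
    then have g10: "g (1, -1) \<in> S + S" using set_plus_intro[OF S(2) S(5)] by metis
    have "g (-1, 1) = - d + u * d" unfolding g_def by (simp add: algebra_simps)
    then have g11: "g (-1, 1) \<in> S + S" using set_plus_intro[OF S(3) S(4)] by metis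
    have "g (-1, -1) = - d + - (u * d)" unfolding g_def by (simp add: algebra_simps)
    then have g12: "g (-1, -1) \<in> S + S" using set_plus_intro[OF S(3) S(5)] by metis
    show ?thesis unfolding L_def using g0 g1 g2 g3 g4 g5 g6 g7 g8 g9 g10 g11 g12 by simp
  qed
  ultimately show ?thesis using card_mono[of "S + S" "g ` set L"] by simp
qed

text \<open>The level count fails here by one pair of directions: a further pair at level 3 would
  complete it. Hence \<open>2 d\<close> is not at level 3, so \<open>X\<close> consists of a
  three-term progression with difference \<open>d\<close> and a pair with the same difference;
  likewise every point has a neighbour in direction \<open>u d\<close>. The pair cannot supply the
  neighbours of the triple.\<close>

lemma gaussian_five_contra:
  fixes X :: "'p::prime_card mod_ring set"
  assumes X: "card X = 5" and u: "u * u = - 1" and d: "d \<noteq> 0" and p: "13 \<le> CARD('p)"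
    and bd2: "bd d X \<le> 2" "bd (u * d) X \<le> 2"
  shows False
proof -
  have small: "(of_int n :: 'p mod_ring) \<noteq> 0" if "0 < \<bar>n\<bar>" "\<bar>n\<bar> < 13" for n
    using that p zdvd_not_zless[of "\<bar>n\<bar>" "int CARD('p)"] by (auto simp: of_int_mod_ring_eq_0_iff)
  have n2: "(2 :: 'p mod_ring) \<noteq> 0" and n5: "(5 :: 'p mod_ring) \<noteq> 0"
    using small[of 2] small[of 5] by simp_all
  have u1: "u \<noteq> 1" "u \<noteq> - 1" "u \<noteq> 0"
  proof -
    have "(1 :: 'p mod_ring) \<noteq> - 1"
    proof
      assume "(1 :: 'p mod_ring) = - 1"
      then have "(1 :: 'p mod_ring) + 1 = - 1 + 1" by (simp only:)
      then show False using n2 by simp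
    qed
    then show "u \<noteq> 1" "u \<noteq> - 1" "u \<noteq> 0" using u by auto
  qed
  have l2: "{0, d, - d, u * d, - (u * d)} \<subseteq> level X 2"
    using bd2 by (simp add: level_def)
  have c5: "card {0, d, - d, u * d, - (u * d)} = 5"
  proof -
    have "(2::nat) < CARD('p)" using p by simp
    moreover have "u ^ j \<noteq> 1 \<and> u ^ j \<noteq> - 1" if "0 < j" "j < 2" for j
    proof -
      have "j = 1" using that by simp
      then show ?thesis using u1 by simp
    qed
    ultimately have "card (insert 0 ((\<lambda>(i, s). s * (u ^ i * d)) ` ({..<2} \<times> {1, - 1}))) = 2 * 2 + 1"
      using d u1 by (intro card_signed_powers) auto
    moreover have "insert 0 ((\<lambda>(i, s). s * (u ^ i * d)) ` ({..<2} \<times> {1, - 1})) = {0, d, - d, u * d, - (u * d)}"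
    proof -
      have "{..<2} \<times> {1, - 1} = {(0::nat, 1), (0, - 1), (1, 1), (1, - 1 :: 'p mod_ring)}" by auto
      then show ?thesis by simp
    qed
    ultimately show ?thesis by simp
  qed
  have N2: "5 \<le> card (level X 2)" using card_mono[OF _ l2] c5 by simp
  have "{0, d, - d, u * d, - (u * d)} + {0, d, - d, u * d, - (u * d)} \<subseteq> level X 4"
  proof
    fix z assume "z \<in> {0, d, - d, u * d, - (u * d)} + {0, d, - d, u * d, - (u * d)}"
    then obtain v w where "z = v + w" "v \<in> level X 2" "w \<in> level X 2"
      using l2 by (auto elim!: set_plus_elim)
    then show "z \<in> level X 4" using bd_triangle[of v w X] by (simp add: level_def)
  qed
  then have N4: "13 \<le> card (level X 4)"
    using card_gaussian_ball[OF u d p] card_mono[of "level X 4"] by (meson finite le_trans)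
  have shape: "\<exists>t. {t - e, t, t + e} \<subseteq> X \<and> (\<exists>v. X = {t - e, t, t + e, v, v + e})
      \<and> (\<forall>x\<in>X. x + e \<in> X \<or> x - e \<in> X)"
    if e: "e \<noteq> 0" "bd e X \<le> 2" "2 * e \<notin> {0, d, - d, u * d, - (u * d)}" for e
  proof -
    let ?P = "erode e X"
    have P: "3 \<le> card ?P" using card_erode[of e X] e(2) X by simp
    have PX: "?P \<union> (+) e ` ?P \<subseteq> X" by (auto simp: erode_def add.commute)
    then have "card (?P \<union> (+) e ` ?P) \<le> 5" using X card_mono[of X] by (metis finite)
    then have I: "2 * card ?P \<le> 5 + card (?P \<inter> (+) e ` ?P)"
      using card_Un_Int[of ?P "(+) e ` ?P"] by simp
    have I1: "card (?P \<inter> (+) e ` ?P) \<le> 1"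
    proof (rule ccontr)
      assume "\<not> ?thesis"
      moreover have "(\<lambda>x. x - e) ` (?P \<inter> (+) e ` ?P) \<subseteq> erode (2 * e) X"
        by (auto simp: erode_def algebra_simps)
      then have "card ((\<lambda>x. x - e) ` (?P \<inter> (+) e ` ?P)) \<le> card (erode (2 * e) X)"
        by (intro card_mono) auto
      \<comment> \<open>Two overlaps put \<open>2 * e\<close> and its negative on level 3; then 1 +
        1 + 5 + 7 + 13 = 27 exceeds 25.\<close>
      ultimately have "2 \<le> card (erode (2 * e) X)"
        by (simp add: card_image inj_on_def)
      then have "2 * e \<in> level X 3" using card_erode[of "2 * e" X] X by (simp add: level_def)
      then have sub: "{2 * e, - (2 * e)} \<union> {0, d, - d, u * d, - (u * d)} \<subseteq> level X 3"
        using l2 level_mono[of 2 3] by (auto simp: level_def)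
      have "2 * e \<noteq> - (2 * e)"
      proof
        assume "2 * e = - (2 * e)"
        then have "2 * e + 2 * e = - (2 * e) + 2 * e" by (simp only:)
        then have "2 * e + 2 * e = 0" by (simp only: left_minus)
        then have "2 * (2 * e) = 0" by (simp only: mult_2)
        then show False using n2 e(1) by (simp only: mult_eq_0_iff simp_thms)
      qed
      moreover have "- (2 * e) \<notin> {0, d, - d, u * d, - (u * d)}"
      proof
        assume "- (2 * e) \<in> {0, d, - d, u * d, - (u * d)}"
        then have "- (- (2 * e)) \<in> uminus ` {0, d, - d, u * d, - (u * d)}" by (rule imageI)
        then show False using e(3) by auto
      qed
      ultimately have "{2 * e, - (2 * e)} \<inter> {0, d, - d, u * d, - (u * d)} = {}"
        "card {2 * e, - (2 * e)} = 2" using e(3) by auto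
      then have "card ({2 * e, - (2 * e)} \<union> {0, d, - d, u * d, - (u * d)}) = 7"
        using card_Un_disjoint[of "{2 * e, - (2 * e)}" "{0, d, - d, u * d, - (u * d)}"] c5
        by (simp only: finite)
      then have "7 \<le> card (level X 3)" using card_mono[OF _ sub] by simp
      then show False using level_sum_contra5[OF X] N2 N4 by linarith
    qed
    then have P3: "card ?P = 3" "card (?P \<inter> (+) e ` ?P) = 1" using I P by linarith+
    have "card (?P \<union> (+) e ` ?P) = 5" using card_Un_Int[of ?P "(+) e ` ?P"] P3 by simp
    then have XP: "X = ?P \<union> (+) e ` ?P" using PX X by (metis card_subset_eq finite)
    obtain t where t: "t \<in> ?P" "t \<in> (+) e ` ?P" using P3(2) by (metis Int_iff card.empty ex_in_conv zero_neq_one)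
    then have t': "t - e \<in> ?P" by auto
    have "t - e \<noteq> t" using e(1) by simp
    then have "card (?P - {t - e, t}) = 1" using P3(1) t t' by (simp add: card_Diff_subset)
    then obtain v where v: "?P - {t - e, t} = {v}" by (auto simp: card_1_singleton_iff)
    then have Pv: "?P = {t - e, t, v}" using t t' by blast
    have "{t - e, t, v} \<union> (+) e ` {t - e, t, v} = {t - e, t, t + e, v, v + e}"
      by (simp add: add.commute insert_commute)
    then have XE: "X = {t - e, t, t + e, v, v + e}" using XP Pv by simp
    have XS: "x + e \<in> X \<or> x - e \<in> X" if "x \<in> X" for x
    proof -
      have "x \<in> ?P \<or> x \<in> (+) e ` ?P" using that XP by blast
      then show ?thesis by (auto simp: erode_def)
    qed
    have "{t - e, t, t + e} \<subseteq> {t - e, t, t + e, v, v + e}" by blast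
    then have "{t - e, t, t + e} \<subseteq> X" by (simp only: XE)
    then show ?thesis using XE XS by blast
  qed
  have q1: "2 * d \<notin> {0, d, - d, u * d, - (u * d)}"
  proof
    assume "2 * d \<in> {0, d, - d, u * d, - (u * d)}"
    then have "2 * d = 0 * d \<or> 2 * d = 1 * d \<or> 2 * d = (- 1) * d \<or> 2 * d = u * d \<or> 2 * d = (- u) * d" by auto
    then have "(2 :: 'p mod_ring) = 0 \<or> (2 :: 'p mod_ring) = 1 \<or> (2 :: 'p mod_ring) = - 1 \<or> 2 = u \<or> 2 = - u"
      using d by (simp only: mult_right_cancel[OF d])
    then consider "(of_int 2 :: 'p mod_ring) = 0" | "(of_int 1 :: 'p mod_ring) = 0"
      | "(of_int 3 :: 'p mod_ring) = 0" | "(4 :: 'p mod_ring) = u * u"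
    proof (elim disjE)
      assume "(2 :: 'p mod_ring) = 1"
      then have "(2 :: 'p mod_ring) - 1 = 0" by simp
      then show ?thesis using that(2) by simp
    next
      assume "(2 :: 'p mod_ring) = - 1"
      then have "(2 :: 'p mod_ring) + 1 = 0" by simp
      then show ?thesis using that(3) by simp
    next
      assume "2 = u" then show ?thesis using that(4) by (metis mult_2 numeral_Bit0 one_add_one mult.right_neutral distrib_left)
    next
      assume "2 = - u"
      then have "u * u = 2 * 2" by (metis minus_mult_minus)
      then show ?thesis using that(4) by simp
    qed (use that in simp)
    then show False
    proof cases
      case 4
      then have "(4 :: 'p mod_ring) + 1 = 0" using u by simp
      then show False using n5 by simp
    qed (use small[of 2] small[of 1] small[of 3] in auto)
  qed
  have q2: "2 * (u * d) \<notin> {0, d, - d, u * d, - (u * d)}"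
  proof
    assume "2 * (u * d) \<in> {0, d, - d, u * d, - (u * d)}"
    then have "u * (2 * (u * d)) \<in> (*) u ` {0, d, - d, u * d, - (u * d)}" by (rule imageI)
    also have "(*) u ` {0, d, - d, u * d, - (u * d)} = {0, u * d, - (u * d), - d, d}"
      using u by (simp flip: mult.assoc)
    also have "u * (2 * (u * d)) = (u * u) * (2 * d)" by (simp only: ac_simps)
    finally have "- (2 * d) \<in> {0, u * d, - (u * d), - d, d}" using u by simp
    then have "- (- (2 * d)) \<in> uminus ` {0, u * d, - (u * d), - d, d}" by (rule imageI)
    then have "2 * d \<in> {0, d, - d, u * d, - (u * d)}" by auto
    then show False using q1 by blast
  qed
  obtain t v where tv: "X = {t - d, t, t + d, v, v + d}" "{t - d, t, t + d} \<subseteq> X"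
    using shape[OF d bd2(1) q1] by blast
  have nb: "\<forall>x\<in>X. x + u * d \<in> X \<or> x - u * d \<in> X"
    using shape[OF _ bd2(2) q2] d u1 by auto
  have "2 * d \<noteq> u * d" "2 * d \<noteq> - u * d" using q1 by simp_all
  then have nu: "u \<noteq> 2" "u \<noteq> - 2" by auto
  \<comment> \<open>A neighbour inside the triple would make \<open>u\<close> one of
    \<open>0, 1, - 1, 2, - 2\<close>, so the neighbour lies in the pair.\<close>
  have ex: "\<exists>s\<in>{1, - 1}. t + a * d + s * (u * d) \<in> {v, v + d}" if a: "a \<in> {- 1, 0, 1}" for a
  proof -
    have "t + a * d \<in> X" using a tv(2) by auto
    then obtain s where s: "s \<in> {1, - 1}" "t + a * d + s * (u * d) \<in> X" 
    proof -
      have "t + a * d + u * d \<in> X \<or> t + a * d - u * d \<in> X" using nb \<open>t + a * d \<in> X\<close> by blast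
      then show thesis using that[of 1] that[of "- 1"] by auto
    qed
    have "t + a * d + s * (u * d) \<noteq> t + b * d" if b: "b \<in> {- 1, 0, 1}" for b
    proof
      assume "t + a * d + s * (u * d) = t + b * d"
      then have "s * (u * d) = (b - a) * d" by (simp add: algebra_simps)
      then have "s * u * d = (b - a) * d" by (simp only: mult.assoc)
      then have su: "s * u = b - a" using d by (simp only: mult_right_cancel[OF d])
      have "b - a \<in> {- 2, - 1, 0, 1, 2}" using a b by auto
      moreover have "u = s * (b - a)"
      proof -
        have "s * s = 1" using s(1) by auto
        then have "u = (s * s) * u" by simp
        also have "\<dots> = s * (b - a)" by (simp only: mult.assoc su)
        finally show ?thesis .
      qed
      ultimately have "u \<in> {- 2, - 1, 0, 1, 2}" using s(1) by auto
      then show False using u1 nu by blast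
    qed
    from this[of "- 1"] this[of 0] this[of 1] have "t + a * d + s * (u * d) \<in> {v, v + d}"
      using s(2) tv(1) by auto
    then show ?thesis using s(1) by blast
  qed
  obtain s0 s1 s2 where s: "s0 \<in> {1, - 1}" "s1 \<in> {1, - 1}" "s2 \<in> {1, - 1}"
    "t + (- 1) * d + s0 * (u * d) \<in> {v, v + d}" "t + 0 * d + s1 * (u * d) \<in> {v, v + d}"
    "t + 1 * d + s2 * (u * d) \<in> {v, v + d}"
    using ex[of "- 1"] ex[of 0] ex[of 1] by blast
  have diff: "(a - b) + (x - y) * u \<in> {0, 1, - 1}"
    if "t + a * d + x * (u * d) \<in> {v, v + d}" "t + b * d + y * (u * d) \<in> {v, v + d}" for a b x y
  proof -
    have "z - z' \<in> {0, d, - d}" if "z \<in> {v, v + d}" "z' \<in> {v, v + d}" for z z' using that by auto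
    then have "(t + a * d + x * (u * d)) - (t + b * d + y * (u * d)) \<in> {0, d, - d}" using that by blast
    moreover have "(t + a * d + x * (u * d)) - (t + b * d + y * (u * d)) = ((a - b) + (x - y) * u) * d"
      by (simp add: algebra_simps)
    ultimately have "((a - b) + (x - y) * u) * d \<in> {0 * d, 1 * d, (- 1) * d}" by simp
    then show ?thesis using d by (simp only: insert_iff empty_iff mult_right_cancel[OF d] simp_thms)
  qed
  have d20: "2 + (s2 - s0) * u \<in> {0, 1, - 1}" using diff[OF s(6,4)] by simp
  have d21: "1 + (s2 - s1) * u \<in> {0, 1, - 1}" using diff[OF s(6,5)] by simp
  have d10: "1 + (s1 - s0) * u \<in> {0, 1, - 1}" using diff[OF s(5,4)] by simp
  have ne: "s2 \<noteq> s0"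
  proof
    assume "s2 = s0"
    then have "(2 :: 'p mod_ring) \<in> {0, 1, - 1}" using d20 by simp
    then have "(2 :: 'p mod_ring) * d \<in> {0, d, - d}" by auto
    then show False using q1 by blast
  qed
  \<comment> \<open>\<open>w\<close> is \<open>2 u\<close> or \<open>- 2 u\<close>, so its square is
    \<open>- 4\<close>. The positions of the neighbours in the pair restrict \<open>w\<close> to
    \<open>0, - 1, - 2\<close>, and \<open>p\<close> would divide 4, 5 or 8.\<close>
  define w where "w = (s2 - s0) * u"
  have "s1 = s0 \<or> s1 = s2" using s(1-3) ne by auto
  then have w1: "1 + w \<in> {0, 1, - 1}" using d21 d10 by (auto simp: w_def)
  have ww: "w * w = - 4"
  proof -
    have "s2 - s0 = 2 \<or> s2 - s0 = - 2" using s(1,3) ne by auto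
    then have "(s2 - s0) * (s2 - s0) = 4" by auto
    moreover have "w * w = ((s2 - s0) * (s2 - s0)) * (u * u)" by (simp only: w_def ac_simps)
    ultimately show ?thesis using u by simp
  qed
  have "w = 0 \<or> w = - 1 \<or> w = - 2"
  proof -
    have "(1 + w) - 1 \<in> (\<lambda>x. x - 1) ` {0, 1, - 1}" using w1 by (rule imageI)
    moreover have "(1 + w) - 1 = w" by simp
    ultimately show ?thesis by auto
  qed
  then have "w * w \<in> {0, 1, 4}" by auto
  then have "(- 4 :: 'p mod_ring) \<in> {0, 1, 4}" using ww by simp
  then have "(- 4 :: 'p mod_ring) + 4 \<in> (\<lambda>x. x + 4) ` {0, 1, 4}" by (rule imageI)
  then have z: "(0 :: 'p mod_ring) \<in> {4, 5, 8}" by simp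
  have "(4 :: 'p mod_ring) \<noteq> 0" "(5 :: 'p mod_ring) \<noteq> 0" "(8 :: 'p mod_ring) \<noteq> 0"
    using small[of 4] small[of 5] small[of 8] by simp_all
  then show False using z by fastforce
qed

lemma level_plus_subset: "level X i + level X j \<subseteq> level X (i + j)"
  for X :: "'a::{ab_group_add,finite} set"
proof
  fix z assume "z \<in> level X i + level X j"
  then obtain v w where vw: "z = v + w" "v \<in> level X i" "w \<in> level X j" by (auto elim!: set_plus_elim)
  have "bd (v + w) X \<le> bd v X + bd w X" by (rule bd_triangle)
  then show "z \<in> level X (i + j)" using vw by (simp add: level_def)
qed

text \<open>The powers of \<open>u\<close> fill level 2: besides 0, four directions if
  \<open>u * u = - 1\<close>, where the Gaussian ball supplies level 4; six otherwise; and eight if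
  \<open>p = 11\<close>, because there neither the square nor the cube of \<open>u\<close> is
  \<open>1\<close> or \<open>- 1\<close>.\<close>

lemma rotation_contra_small:
  fixes X :: "'p::prime_card mod_ring set"
  assumes u: "u \<noteq> 0" "u \<noteq> 1" "u \<noteq> - 1" and d: "d \<noteq> 0" and b: "\<And>k. bd (u ^ k * d) X \<le> 2"
    and X: "2 * card X < CARD('p)"
    and sz: "13 \<le> CARD('p) \<and> 5 \<le> card X \<or> CARD('p) = 11 \<and> 4 \<le> card X"
  shows False
proof -
  have p2: "2 < CARD('p)" using sz by linarith
  have one: "(1 :: 'p mod_ring) \<noteq> - 1"
  proof
    assume "(1 :: 'p mod_ring) = - 1"
    then have "(1 :: 'p mod_ring) + 1 = - 1 + 1" by (simp only:)
    then have "(of_nat 2 :: 'p mod_ring) = 0" by simp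
    then show False using of_nat_mod_ring_neq_0[where n = 2 and 'p = 'p] p2 by simp
  qed
  have u2: "u * u \<noteq> 1" using u(2,3) by (simp add: square_eq_1_iff)
  have L: "insert 0 ((\<lambda>(i, s). s * (u ^ i * d)) ` ({..<k} \<times> {1, - 1})) \<subseteq> level X 2" for k
    using b by (auto simp: level_def)
  have fin: "finite (level X i)" for i by simp
  have L4: "card (level X 2 + level X 2) \<le> card (level X 4)"
    using card_mono[OF fin level_plus_subset[of X 2 2]] by simp
  show False
  proof (cases "u * u = - 1")
    case True
    \<comment> \<open>\<open>- 1\<close> is not a square modulo 11.\<close>
    have "CARD('p) \<noteq> 11"
    proof
      assume "CARD('p) = 11"
      then have "u ^ 10 = 1" using fermat_mod_ring[OF u(1)] by simp
      moreover have "u ^ 10 = (u * u) ^ 5" by (simp only: power2_eq_square[symmetric] power_mult[symmetric]) simp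
      ultimately show False using True one by simp
    qed
    then have p: "13 \<le> CARD('p)" and X5: "5 \<le> card X" using sz by auto
    have b0: "bd d X \<le> 2" "bd (u * d) X \<le> 2" using b[of 0] b[of 1] by simp_all
    have S: "{0, d, - d, u * d, - (u * d)} \<subseteq> level X 2" using b0 by (simp add: level_def)
    have n4: "13 \<le> card (level X 4)"
      using card_gaussian_ball[OF True d p] card_mono[OF finite set_plus_mono2[OF S S]] L4 by linarith
    show False
    proof (cases "card X = 5")
      case True5: True
      show False by (rule gaussian_five_contra[OF True5 True d p b0])
    next
      case False
      have "card (insert 0 ((\<lambda>(i, s). s * (u ^ i * d)) ` ({..<2} \<times> {1, - 1}))) = 2 * 2 + 1"
      proof (rule card_signed_powers[OF d u(1) p2])
        fix j :: nat assume "0 < j" "j < 2"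
        then have "j = 1" by simp
        then show "u ^ j \<noteq> 1 \<and> u ^ j \<noteq> - 1" using u by simp
      qed
      then have n2: "5 \<le> card (level X 2)" using card_mono[OF fin L[of 2]] by simp
      have "6 \<le> card X" using False X5 by simp
      then show False using level_sum_contra[OF _ X n2 n4] by blast
    qed
  next
    case False
    have "card (insert 0 ((\<lambda>(i, s). s * (u ^ i * d)) ` ({..<3} \<times> {1, - 1}))) = 2 * 3 + 1"
    proof (rule card_signed_powers[OF d u(1) p2])
      fix j :: nat assume "0 < j" "j < 3"
      then have "j = 1 \<or> j = 2" by linarith
      then show "u ^ j \<noteq> 1 \<and> u ^ j \<noteq> - 1" using u u2 False by (auto simp: power2_eq_square)
    qed
    then have n2: "7 \<le> card (level X 2)" using card_mono[OF fin L[of 3]] by simp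
    have n3: "card (level X 2) \<le> card (level X 3)" by (rule level_mono) simp
    have a4: "card (level X 2) + card (level X 2) \<le> card (level X 4) + 1 \<or> card (level X 4) = CARD('p)"
      using level_add[of X 2 2] by simp
    show False using sz
    proof
      assume s: "13 \<le> CARD('p) \<and> 5 \<le> card X"
      have n4: "13 \<le> card (level X 4)" using a4 n2 s by linarith
      show False
      proof (cases "card X = 5")
        case True
        show False using level_sum_contra5[OF True] n2 n3 n4 by linarith
      next
        case F: False
        have "6 \<le> card X" "5 \<le> card (level X 2)" using F s n2 by linarith+
        then show False using level_sum_contra[OF _ X _ n4] by blast
      qed
    next
      assume s: "CARD('p) = 11 \<and> 4 \<le> card X"
      have u10: "u ^ 10 = 1" using fermat_mod_ring[OF u(1)] s by simp
      have u3: "u ^ 3 \<noteq> 1 \<and> u ^ 3 \<noteq> - 1"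
      proof (rule ccontr)
        assume "\<not> ?thesis"
        then have c: "u ^ 3 = 1 \<or> u ^ 3 = - 1" by blast
        have "u ^ 10 = u * (u ^ 3 * u ^ 3 * u ^ 3)" by (simp only: power_add[symmetric] power_Suc[symmetric]) simp
        then have e: "u * (u ^ 3 * u ^ 3 * u ^ 3) = 1" using u10 by simp
        have "u = 1 \<or> u = - 1" using c
        proof
          assume "u ^ 3 = 1" then show ?thesis using e by simp
        next
          assume "u ^ 3 = - 1"
          then have "- u = 1" using e by simp
          then have "- (- u) = - 1" by (simp only:)
          then show ?thesis by simp
        qed
        then show False using u by blast
      qed
      have "card (insert 0 ((\<lambda>(i, s). s * (u ^ i * d)) ` ({..<4} \<times> {1, - 1}))) = 2 * 4 + 1"
      proof (rule card_signed_powers[OF d u(1) p2])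
        fix j :: nat assume "0 < j" "j < 4"
        then have "j = 1 \<or> j = 2 \<or> j = 3" by linarith
        then show "u ^ j \<noteq> 1 \<and> u ^ j \<noteq> - 1" using u u2 u3 False by (auto simp: power2_eq_square)
      qed
      then have m2: "9 \<le> card (level X 2)" using card_mono[OF fin L[of 4]] by simp
      have m4: "11 \<le> card (level X 4)" using a4 m2 s by linarith
      have "card X = 4 \<or> card X = 5" using X s by linarith
      then show False
      proof
        assume "card X = 4" then show False using level_sum_contra4 m2 by blast
      next
        assume "card X = 5" then show False using level_sum_contra5 m2 n3 m4 by fastforce
      qed
    qed
  qed
qed

text \<open>The complement has the same boundaries, so the set may be taken below half the
  field.\<close>

lemma rotation_contra:
  fixes X :: "'p::prime_card mod_ring set"
  assumes u: "u \<noteq> 0" "u \<noteq> 1" "u \<noteq> - 1" and d: "d \<noteq> 0" and b: "\<And>k. bd (u ^ k * d) X \<le> 2"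
    and sz: "13 \<le> CARD('p) \<and> 5 \<le> card X \<and> card X + 5 \<le> CARD('p) \<or>
      CARD('p) = 11 \<and> 4 \<le> card X \<and> card X + 4 \<le> CARD('p)"
  shows False
proof (cases "2 * card X < CARD('p)")
  case True
  then show False using rotation_contra_small[OF u d b] sz by blast
next
  case False
  have c: "card (- X) + card X = CARD('p)" using card_Compl_finite[of X] card_le_CARD[of X] by simp
  have "odd CARD('p)" using prime_odd_nat[OF prime_card[where 'a = 'p]] sz by linarith
  then have "2 * card X \<noteq> CARD('p)" by (metis dvd_triv_left)
  then have "2 * card (- X) < CARD('p)" using c False by linarith
  moreover have "13 \<le> CARD('p) \<and> 5 \<le> card (- X) \<or> CARD('p) = 11 \<and> 4 \<le> card (- X)"
    using sz c by linarith
  ultimately show False using rotation_contra_small[OF u d, of "- X"] b by (simp add: bd_Compl)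
qed

section \<open>Sets close to arithmetic progressions\<close>

lemma of_nat_mod_ring_inj:
  assumes "(of_nat i :: 'p::prime_card mod_ring) = of_nat j" "i < CARD('p)" "j < CARD('p)"
  shows "i = j"
proof -
  have "j \<le> i" if e: "(of_nat i :: 'p mod_ring) = of_nat j" and j: "j < CARD('p)" for i j
  proof (rule ccontr)
    assume "\<not> j \<le> i"
    then have "(of_nat (j - i) :: 'p mod_ring) = of_nat j - of_nat i" by (simp add: of_nat_diff)
    then have "(of_nat (j - i) :: 'p mod_ring) = 0" using e by simp
    moreover have "0 < j - i" "j - i < CARD('p)" using j \<open>\<not> j \<le> i\<close> by auto
    ultimately show False using of_nat_mod_ring_neq_0 by blast
  qed
  from this[of i j] this[of j i] show ?thesis using assms by simp
qed

lemma inj_on_of_nat_translate: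
  "inj_on (\<lambda>i. x + of_nat i :: 'p::prime_card mod_ring) {..<CARD('p)}"
  by (rule inj_onI) (auto dest: of_nat_mod_ring_inj)

lemma mem_of_nat_image_iff:
  assumes "i < CARD('p)" "S \<subseteq> {..<CARD('p)}"
  shows "x + of_nat i \<in> (\<lambda>i. x + of_nat i :: 'p::prime_card mod_ring) ` S \<longleftrightarrow> i \<in> S"
  using inj_on_image_mem_iff[OF inj_on_of_nat_translate _ assms(2)] assms(1) by blast

lemma ex_of_nat_translate: "\<exists>i<CARD('p). y = x + (of_nat i :: 'p::prime_card mod_ring)"
proof -
  have "card ((\<lambda>i. x + of_nat i :: 'p mod_ring) ` {..<CARD('p)}) = CARD('p mod_ring)"
    by (subst card_image[OF inj_on_of_nat_translate]) simp
  then have "(\<lambda>i. x + of_nat i :: 'p mod_ring) ` {..<CARD('p)} = UNIV"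
    by (intro card_subset_eq) auto
  then have "y \<in> (\<lambda>i. x + of_nat i) ` {..<CARD('p)}" by simp
  then show ?thesis by auto
qed

text \<open>Start at a point of \<open>Y\<close> without predecessor and run to the first exit. That
  is the only exit, so any remaining points of \<open>Y\<close> would be closed under adding
  1.\<close>

lemma interval_of_bd:
  fixes Y :: "'p::prime_card mod_ring set"
  assumes b: "bd 1 Y \<le> 1" and Y: "Y \<noteq> {}" "Y \<noteq> UNIV"
  obtains x where "Y = (\<lambda>i. x + of_nat i) ` {..<card Y}"
proof -
  have "\<exists>x\<in>Y. x - 1 \<notin> Y"
  proof (rule ccontr)
    assume "\<not> ?thesis"
    then have "Y = UNIV" using translation_closed[of Y "- 1"] Y(1) by simp
    then show False using Y by simp
  qed
  then obtain x where x: "x \<in> Y" "x - 1 \<notin> Y" by blast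
  define f where "f i = x + of_nat i" for i :: nat
  have ex: "\<exists>n. f n \<notin> Y"
  proof -
    obtain y where "y \<notin> Y" using Y(2) by blast
    then show ?thesis using ex_of_nat_translate[of y x] by (auto simp: f_def)
  qed
  define n where "n = (LEAST n. f n \<notin> Y)"
  have n: "f n \<notin> Y" using LeastI_ex[OF ex] by (simp add: n_def)
  have less: "f i \<in> Y" if "i < n" for i using not_less_Least[of i "\<lambda>n. f n \<notin> Y"] that by (auto simp: n_def)
  have "n \<noteq> 0"
  proof
    assume "n = 0"
    then show False using n x by (simp add: f_def)
  qed
  then obtain k where k: "n = Suc k" by (cases n) auto
  have fS: "f (Suc i) = f i + 1" for i by (simp add: f_def add.commute add.left_commute)
  have ek: "f k \<in> {y \<in> Y. y + 1 \<notin> Y}" using n less[of k] k fS[of k] by simp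
  have only: "y = f k" if "y \<in> Y" "y + 1 \<notin> Y" for y
  proof -
    have "card {y \<in> Y. y + 1 \<notin> Y} \<le> 1" using b by (simp add: bd_def)
    moreover have "finite {y \<in> Y. y + 1 \<notin> Y}" by simp
    ultimately show ?thesis using ek that card_le_Suc0_iff_eq[of "{y \<in> Y. y + 1 \<notin> Y}"] by auto
  qed
  have "Y - f ` {..<n} = {}"
  proof (rule ccontr)
    assume ne: "Y - f ` {..<n} \<noteq> {}"
    have "y + 1 \<in> Y - f ` {..<n}" if y: "y \<in> Y - f ` {..<n}" for y
    proof
      show "y + 1 \<in> Y" using only[of y] y k by blast
      show "y + 1 \<notin> f ` {..<n}"
      proof
        assume "y + 1 \<in> f ` {..<n}"
        then obtain i where i: "i < n" "y + 1 = f i" by blast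
        show False
        proof (cases i)
          case 0
          have "y = x - 1" using i(2) 0 by (simp add: f_def eq_diff_eq)
          then show False using y x(2) by blast
        next
          case (Suc j)
          have "y = f j" using i(2) Suc fS[of j] by simp
          then show False using y i(1) Suc by auto
        qed
      qed
    qed
    then have "Y - f ` {..<n} = UNIV" using ne by (intro translation_closed[of _ 1]) auto
    then show False using Y(2) by blast
  qed
  then have Yf: "Y = f ` {..<n}" using less by blast
  have "n \<le> CARD('p)"
  proof (rule ccontr)
    assume "\<not> ?thesis"
    then have "f ` {..<CARD('p)} \<subseteq> Y" using Yf by auto
    moreover have "f ` {..<CARD('p)} = UNIV" using ex_of_nat_translate[of _ x] by (auto simp: f_def)
    ultimately show False using Y(2) by blast
  qed
  then have "inj_on f {..<n}" unfolding f_def by (intro inj_on_subset[OF inj_on_of_nat_translate]) auto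
  then have "card Y = n" using Yf card_image by fastforce
  then show ?thesis using that[of x] Yf by (simp add: f_def)
qed

text \<open>The hole \<open>h = card X\<close> encodes that no inner point is missing and
  \<open>X\<close> itself is an interval.\<close>

lemma near_interval:
  fixes X :: "'p::prime_card mod_ring set"
  assumes n: "near 1 X" and X: "X \<noteq> {}" "card X + 2 \<le> CARD('p)"
  obtains x h where "h \<le> card X" "X = (\<lambda>i. x + of_nat i) ` ({..card X} - {h})"
proof -
  obtain t where t: "bd 1 (insert t X) \<le> 1" using n by (auto simp: near_def)
  show ?thesis
  proof (cases "t \<in> X")
    case True
    have "X \<noteq> UNIV" using X(2) by auto
    then obtain x where "X = (\<lambda>i. x + of_nat i) ` {..<card X}"
      using interval_of_bd[of X] t True X(1) by (metis insert_absorb)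
    moreover have "{..card X} - {card X} = {..<card X}" by auto
    ultimately show ?thesis using that[of "card X" x] by simp
  next
    case False
    have c: "card (insert t X) = card X + 1" using False by simp
    then have "insert t X \<noteq> UNIV" using X(2) by auto
    then obtain x where x: "insert t X = (\<lambda>i. x + of_nat i) ` {..<card (insert t X)}"
      using interval_of_bd[of "insert t X"] t by blast
    then have x': "insert t X = (\<lambda>i. x + of_nat i) ` {..card X}" using c by (simp add: lessThan_Suc_atMost)
    then obtain h where h: "h \<le> card X" "t = x + of_nat h" by auto
    have inj: "inj_on (\<lambda>i. x + of_nat i :: 'p mod_ring) {..card X}"
      using X(2) by (intro inj_on_subset[OF inj_on_of_nat_translate]) auto
    have "X = insert t X - {t}" using False by blast
    also have "\<dots> = (\<lambda>i. x + of_nat i) ` ({..card X} - {h})"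
      using inj_on_image_set_diff[OF inj, of "{..card X}" "{h}"] h x' by simp
    finally show ?thesis using that[of h x] h by blast
  qed
qed

lemma near_plus_le:
  fixes X :: "'p::prime_card mod_ring set"
  assumes "near d X"
  shows "card (X + {0, d}) \<le> card X + 2" "card (X + {0, d, d + d}) \<le> card X + 3"
proof -
  obtain t where t: "bd d (insert t X) \<le> 1" using assms by (auto simp: near_def)
  have c: "card (insert t X) \<le> card X + 1" by (simp add: card_insert_if)
  have fin: "finite (A :: 'p mod_ring set)" for A by simp
  have "card (X + {0, d}) \<le> card (insert t X + {0, d})" by (intro card_mono fin set_plus_mono2) auto
  then show "card (X + {0, d}) \<le> card X + 2" using card_plus_pair[of "insert t X" d] c t by linarith
  have e: "{0, d, d + d} = {0, d} + {0, d}" by (auto simp: set_plus_def)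
  have "card (X + {0, d, d + d}) \<le> card (insert t X + ({0, d} + {0, d}))"
    unfolding e by (intro card_mono fin set_plus_mono2) auto
  also have "\<dots> = card (insert t X + {0, d} + {0, d})" by (simp only: add.assoc)
  also have "\<dots> = card (insert t X) + bd d (insert t X) + bd d (insert t X + {0, d})"
    by (simp only: card_plus_pair)
  finally show "card (X + {0, d, d + d}) \<le> card X + 3"
    using c t bd_plus_pair_le[of d "insert t X"] by linarith
qed

lemma near_uminus: "near (- d) X \<longleftrightarrow> near d X" for X :: "'a::{ab_group_add,finite} set"
  by (simp add: near_def)

text \<open>Being near a progression with difference \<open>e\<close> allows a gain of at most 2
  points from adding \<open>{0, e}\<close> and of 3 from \<open>{0, e, 2 e}\<close>. An interval
  with one hole gains too much: three points in one step for \<open>k >= 4\<close>, four in two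
  steps for \<open>k = 2\<close>, and for \<open>k = 3\<close> three in one step or, in three small
  shapes, four in two steps.\<close>

lemma near_direction_aux:
  fixes X :: "'p::prime_card mod_ring set"
  assumes n: "near 1 X" and nk: "near (of_nat k) X"
    and X: "3 \<le> card X" "card X + 6 \<le> CARD('p)" and p: "11 \<le> CARD('p)"
    and k: "2 \<le> k" "k + 4 \<le> CARD('p)"
  shows False
proof -
  let ?p = "CARD('p)"
  define m where "m = card X"
  have "X \<noteq> {}" using X by auto
  have X2: "card X + 2 \<le> ?p" using X by simp
  obtain x h where h: "h \<le> m" and Xf: "X = (\<lambda>i. x + of_nat i) ` ({..m} - {h})"
    using near_interval[OF n \<open>X \<noteq> {}\<close>] X2 unfolding m_def by metis
  have m: "3 \<le> m" "m + 6 \<le> ?p" using X by (simp_all add: m_def)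
  have mem: "x + of_nat i \<in> X \<longleftrightarrow> i \<le> m \<and> i \<noteq> h" if "i < ?p" for i
    unfolding Xf using that m by (subst mem_of_nat_image_iff) auto
  have count: "card S \<le> card (X + T)"
    if H: "\<And>z. z \<in> S \<Longrightarrow> z < ?p \<and> (\<exists>t i. of_nat t \<in> T \<and> i \<le> m \<and> i \<noteq> h \<and> z = i + t)" for S :: "nat set" and T
  proof -
    have S: "S \<subseteq> {..<?p}" using H by auto
    have "(\<lambda>i. x + of_nat i) ` S \<subseteq> X + T"
    proof
      fix y assume "y \<in> (\<lambda>i. x + of_nat i) ` S"
      then obtain z where z: "z \<in> S" "y = x + of_nat z" by blast
      obtain t i where ti: "of_nat t \<in> T" "i \<le> m" "i \<noteq> h" "z = i + t" using H[OF z(1)] by blast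
      have "x + of_nat i \<in> X" using mem[of i] ti m by simp
      moreover have "y = (x + of_nat i) + of_nat t" using z ti by (simp add: add.assoc)
      ultimately show "y \<in> X + T" using ti(1) by (metis set_plus_intro)
    qed
    then have "card ((\<lambda>i. x + of_nat i :: 'p mod_ring) ` S) \<le> card (X + T)" by (intro card_mono) auto
    then show ?thesis using card_image[OF inj_on_subset[OF inj_on_of_nat_translate S]] by metis
  qed
  have p1: "card (X + {0, of_nat k}) \<le> m + 2" and p2: "card (X + {0, of_nat k, of_nat k + of_nat k}) \<le> m + 3"
    using near_plus_le[OF nk] by (simp_all add: m_def)
  consider "k = 2" | "k = 3" | "4 \<le> k" using k by linarith
  then show False
  proof cases
    case 1
    have T: "of_nat 0 \<in> {0, of_nat k, of_nat k + of_nat k :: 'p mod_ring}"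
      "of_nat 2 \<in> {0, of_nat k, of_nat k + of_nat k :: 'p mod_ring}"
      "of_nat 4 \<in> {0, of_nat k, of_nat k + of_nat k :: 'p mod_ring}" using 1 by simp_all
    have "\<exists>e. \<forall>z\<le>m + 4. z \<noteq> e \<longrightarrow> (\<exists>t\<in>{0, 2, 4}. \<exists>i\<le>m. i \<noteq> h \<and> z = i + t)"
    proof (intro exI allI impI)
      \<comment> \<open>The conditional names the one number up to \<open>m + 4\<close> that may be
        missed; \<open>m + 9\<close>, out of range, stands for none.\<close>
      fix z assume z: "z \<le> m + 4" "z \<noteq> (if h = m then m + 4 else if Suc h = m then m + 3 else if h \<le> 1 then h else m + 9)"
      have "z \<le> m \<and> z \<noteq> h \<or> 2 \<le> z \<and> z - 2 \<le> m \<and> z - 2 \<noteq> h \<or> 4 \<le> z \<and> z - 4 \<le> m \<and> z - 4 \<noteq> h"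
      proof (cases "h \<le> 1 \<or> h = m \<or> Suc h = m")
        case True
        consider "h = m" | "Suc h = m" | "h \<le> 1" "h \<noteq> m" "Suc h \<noteq> m" using True by blast
        then show ?thesis
        proof cases
          case 1
          then have "z < m \<or> z = m \<or> z = m + 1 \<or> z = m + 2 \<or> z = m + 3" using z by auto
          then show ?thesis using 1 m by auto
        next
          case 2
          then have "z \<le> m \<and> z \<noteq> h \<or> z = h \<or> z = h + 2 \<or> z = h + 3 \<or> z = h + 5" using z by auto
          then show ?thesis using 2 m by auto
        next
          case 3
          then have "z \<noteq> h" using z by simp
          then have "z \<le> m \<and> z \<noteq> h \<or> z = m + 1 \<or> z = m + 2 \<or> z = m + 3 \<or> z = m + 4" using z(1) by linarith
          then show ?thesis using 3 m by auto
        qed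
      next
        case False
        then have f: "2 \<le> h" "Suc h < m" using h by linarith+
        have "z \<le> m \<and> z \<noteq> h \<or> z = h \<or> z = m + 1 \<or> z = m + 2 \<or> z = m + 3 \<or> z = m + 4" using z(1) by linarith
        then show ?thesis using f by (elim disjE) auto
      qed
      then show "\<exists>t\<in>{0, 2, 4}. \<exists>i\<le>m. i \<noteq> h \<and> z = i + t"
      proof (elim disjE conjE)
        assume "z \<le> m" "z \<noteq> h" then show ?thesis by (intro bexI[of _ 0] exI[of _ z]) auto
      next
        assume "2 \<le> z" "z - 2 \<le> m" "z - 2 \<noteq> h"
        then show ?thesis by (intro bexI[of _ 2] exI[of _ "z - 2"]) auto
      next
        assume "4 \<le> z" "z - 4 \<le> m" "z - 4 \<noteq> h"
        then show ?thesis by (intro bexI[of _ 4] exI[of _ "z - 4"]) auto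
      qed
    qed
    then obtain e where e: "\<And>z. z \<le> m + 4 \<Longrightarrow> z \<noteq> e \<Longrightarrow> \<exists>t\<in>{0, 2, 4}. \<exists>i\<le>m. i \<noteq> h \<and> z = i + t" by blast
    have "card ({..m + 4} - {e}) \<le> card (X + {0, of_nat k, of_nat k + of_nat k})"
    proof (rule count)
      fix z assume z: "z \<in> {..m + 4} - {e}"
      then obtain t i where ti: "t \<in> {0, 2, 4}" "i \<le> m" "i \<noteq> h" "z = i + t" using e[of z] by (metis DiffD1 DiffD2 atMost_iff singletonI)
      have tin: "of_nat t \<in> {0, of_nat k, of_nat k + of_nat k :: 'p mod_ring}" using ti(1) T by blast
      have "z < ?p" using z m by simp
      with tin ti show "z < ?p \<and> (\<exists>t i. of_nat t \<in> {0, of_nat k, of_nat k + of_nat k :: 'p mod_ring} \<and> i \<le> m \<and> i \<noteq> h \<and> z = i + t)"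
        by blast
    qed
    moreover have "m + 4 \<le> card ({..m + 4} - {e})" by (simp add: card_Diff_singleton_if)
    ultimately show False using p2 by linarith
  next
    case 2
    have T1: "of_nat 0 \<in> {0, of_nat k :: 'p mod_ring}" "of_nat 3 \<in> {0, of_nat k :: 'p mod_ring}" using 2 by simp_all
    have T: "of_nat 0 \<in> {0, of_nat k, of_nat k + of_nat k :: 'p mod_ring}"
      "of_nat 3 \<in> {0, of_nat k, of_nat k + of_nat k :: 'p mod_ring}"
      "of_nat 6 \<in> {0, of_nat k, of_nat k + of_nat k :: 'p mod_ring}" using 2 by simp_all
    let ?U = "\<lambda>z. z \<le> m \<and> z \<noteq> h \<or> 3 \<le> z \<and> z - 3 \<le> m \<and> z - 3 \<noteq> h"
    have "card {z. z \<le> m + 3 \<and> ?U z} \<le> card (X + {0, of_nat k})"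
    proof (rule count)
      fix z assume z: "z \<in> {z. z \<le> m + 3 \<and> ?U z}"
      then have "(\<exists>t\<in>{0, 3}. \<exists>i\<le>m. i \<noteq> h \<and> z = i + t)"
      proof -
        have "?U z" using z by blast
        then show ?thesis
        proof (elim disjE conjE)
          assume "z \<le> m" "z \<noteq> h" then show ?thesis by (intro bexI[of _ 0] exI[of _ z]) auto
        next
          assume "3 \<le> z" "z - 3 \<le> m" "z - 3 \<noteq> h"
          then show ?thesis by (intro bexI[of _ 3] exI[of _ "z - 3"]) auto
        qed
      qed
      then obtain t i where "t \<in> {0, 3}" "i \<le> m" "i \<noteq> h" "z = i + t" by blast
      then show "z < ?p \<and> (\<exists>t i. of_nat t \<in> {0, of_nat k :: 'p mod_ring} \<and> i \<le> m \<and> i \<noteq> h \<and> z = i + t)"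
        using T1 z m by (intro conjI exI[of _ t] exI[of _ i]) auto
    qed
    then have U: "card {z. z \<le> m + 3 \<and> ?U z} \<le> m + 2" using p1 by linarith
    \<comment> \<open>In all other cases only one number up to \<open>m + 3\<close> can be missed:
      the hole if it is among the first three places, and its shift by 3 otherwise.\<close>
    have hm: "h \<in> {1, 2} \<and> (h + 1 = m \<or> h + 2 = m)"
    proof (rule ccontr)
      assume nh: "\<not> ?thesis"
      define e where "e = (if h \<le> 2 then h else h + 3)"
      have "{..m + 3} - {e} \<subseteq> {z. z \<le> m + 3 \<and> ?U z}"
      proof (cases "h \<le> 2")
        case True
        then have "e = h" by (simp add: e_def)
        moreover have "?U z" if "z \<le> m + 3" "z \<noteq> h" for z using nh h m that True by simp presburger
        ultimately show ?thesis by blast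
      next
        case False
        then have "e = h + 3" by (simp add: e_def)
        moreover have "?U z" if "z \<le> m + 3" "z \<noteq> h + 3" for z using h m that False by presburger
        ultimately show ?thesis by blast
      qed
      then have "card ({..m + 3} - {e}) \<le> card {z. z \<le> m + 3 \<and> ?U z}" by (intro card_mono) auto
      moreover have "m + 3 \<le> card ({..m + 3} - {e})" by (simp add: card_Diff_singleton_if)
      ultimately show False using U by linarith
    qed
    \<comment> \<open>The three remaining shapes, written out. Their sums reach up to 10, which is
      below \<open>p\<close>.\<close>
    have "\<exists>S. card S = m + 4 \<and> (\<forall>z\<in>S. z \<le> 10 \<and>
      (z \<le> m \<and> z \<noteq> h \<or> 3 \<le> z \<and> z - 3 \<le> m \<and> z - 3 \<noteq> h \<or> 6 \<le> z \<and> z - 6 \<le> m \<and> z - 6 \<noteq> h))"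
    proof -
      consider "h = 1" "m = 3" | "h = 2" "m = 3" | "h = 2" "m = 4" using hm m by auto
      then show ?thesis
      proof cases
        case 1 show ?thesis by (rule exI[of _ "{0, 2, 3, 5, 6, 8, 9}"]) (use 1 in simp)
      next
        case 2 show ?thesis by (rule exI[of _ "{0, 1, 3, 4, 6, 7, 9}"]) (use 2 in simp)
      next
        case 3 show ?thesis by (rule exI[of _ "{0, 1, 3, 4, 6, 7, 9, 10}"]) (use 3 in simp)
      qed
    qed
    then obtain S where S1: "card S = m + 4" and S0: "\<And>z. z \<in> S \<Longrightarrow> z \<le> 10 \<and>
      (z \<le> m \<and> z \<noteq> h \<or> 3 \<le> z \<and> z - 3 \<le> m \<and> z - 3 \<noteq> h \<or> 6 \<le> z \<and> z - 6 \<le> m \<and> z - 6 \<noteq> h)" by blast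
    have S2: "z \<le> 10 \<and> (\<exists>t\<in>{0, 3, 6}. \<exists>i\<le>m. i \<noteq> h \<and> z = i + t)" if "z \<in> S" for z
    proof
      show "z \<le> 10" using S0[OF that] by blast
      from S0[OF that] have "z \<le> m \<and> z \<noteq> h \<or> 3 \<le> z \<and> z - 3 \<le> m \<and> z - 3 \<noteq> h \<or> 6 \<le> z \<and> z - 6 \<le> m \<and> z - 6 \<noteq> h"
        by blast
      then show "\<exists>t\<in>{0, 3, 6}. \<exists>i\<le>m. i \<noteq> h \<and> z = i + t"
      proof (elim disjE conjE)
        assume "z \<le> m" "z \<noteq> h" then show ?thesis by (intro bexI[of _ 0] exI[of _ z]) simp_all
      next
        assume "3 \<le> z" "z - 3 \<le> m" "z - 3 \<noteq> h"
        then show ?thesis by (intro bexI[of _ 3] exI[of _ "z - 3"]) simp_all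
      next
        assume "6 \<le> z" "z - 6 \<le> m" "z - 6 \<noteq> h"
        then show ?thesis by (intro bexI[of _ 6] exI[of _ "z - 6"]) simp_all
      qed
    qed
    note S = S1 S2
    have "card S \<le> card (X + {0, of_nat k, of_nat k + of_nat k})"
    proof (rule count)
      fix z assume z: "z \<in> S"
      then obtain t i where ti: "t \<in> {0, 3, 6}" "i \<le> m" "i \<noteq> h" "z = i + t" using S(2)[of z] by blast
      have tin: "of_nat t \<in> {0, of_nat k, of_nat k + of_nat k :: 'p mod_ring}" using ti(1) T by blast
      have "z < ?p" using S(2)[OF z] p by simp
      with tin ti show "z < ?p \<and> (\<exists>t i. of_nat t \<in> {0, of_nat k, of_nat k + of_nat k :: 'p mod_ring} \<and> i \<le> m \<and> i \<noteq> h \<and> z = i + t)"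
        by blast
    qed
    then show False using S(1) p2 by linarith
  next
    case 3
    \<comment> \<open>Four places of the interval whose shifts by \<open>k\<close> land beyond
      \<open>m\<close> without wrapping round; the hole removes at most one of them.\<close>
    define S where "S = (if k + m < ?p then {m - 3..m} else {?p - k - 4..?p - k - 1})"
    have S: "i \<le> m \<and> m < i + k \<and> i + k < ?p" if "i \<in> S" for i
    proof (cases "k + m < ?p")
      case True
      then have "m - 3 \<le> i \<and> i \<le> m" using that by (simp add: S_def)
      then show ?thesis using True 3 m by linarith
    next
      case False
      then have "?p - k - 4 \<le> i \<and> i \<le> ?p - k - 1" using that by (simp add: S_def)
      then show ?thesis using False 3 m k by linarith
    qed
    have "m + 1 - (m - 3) = 4" "?p - k - 1 + 1 - (?p - k - 4) = 4" using m k by linarith+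
    then have "card S = 4" by (simp add: S_def)
    then have c: "3 \<le> card (S - {h})" by (simp add: card_Diff_singleton_if)
    have "card (S - {h}) = card ((\<lambda>i. x + of_nat (i + k) :: 'p mod_ring) ` (S - {h}))"
    proof (rule card_image[symmetric], rule inj_onI)
      fix i j assume ij: "i \<in> S - {h}" "j \<in> S - {h}" "x + of_nat (i + k) = x + (of_nat (j + k) :: 'p mod_ring)"
      then have "(of_nat (i + k) :: 'p mod_ring) = of_nat (j + k)" by (simp only: add_left_cancel)
      moreover have "i + k < ?p" "j + k < ?p" using S ij by auto
      ultimately have "i + k = j + k" by (rule of_nat_mod_ring_inj)
      then show "i = j" by simp
    qed
    also have "\<dots> \<le> card ((X + {0, of_nat k}) - X)"
    proof (intro card_mono)
      show "(\<lambda>i. x + of_nat (i + k)) ` (S - {h}) \<subseteq> X + {0, of_nat k} - X"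
      proof
        fix y assume "y \<in> (\<lambda>i. x + of_nat (i + k)) ` (S - {h})"
        then obtain i where i: "i \<in> S" "i \<noteq> h" "y = x + of_nat (i + k)" by blast
        have "x + of_nat i \<in> X" using mem[of i] S[OF i(1)] i(2) by simp
        then have "(x + of_nat i) + of_nat k \<in> X + {0, of_nat k}" by (intro set_plus_intro) auto
        moreover have "y \<notin> X" using mem[of "i + k"] S[OF i(1)] i(3) by simp
        ultimately show "y \<in> X + {0, of_nat k} - X" using i(3) by (simp add: add.assoc)
      qed
    qed simp
    also have "\<dots> = card (X + {0, of_nat k}) - card X"
    proof (rule card_Diff_subset)
      show "X \<subseteq> X + {0, of_nat k}"
      proof
        fix y assume "y \<in> X"
        then have "y + 0 \<in> X + {0, of_nat k}" by (intro set_plus_intro) auto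
        then show "y \<in> X + {0, of_nat k}" by simp
      qed
    qed simp
    finally show False using c p1 by (simp add: m_def)
  qed
qed

text \<open>Scaling makes one difference 1 and the other a number \<open>k\<close>, which may be
  exchanged for \<open>p - k\<close> because signs do not matter. One of the two equals 1 or falls
  into the range of \<open>near_direction_aux\<close>.\<close>

lemma near_direction:
  fixes X :: "'p::prime_card mod_ring set"
  assumes n: "near d X" and nk: "near e X" and d: "d \<noteq> 0" and e: "e \<noteq> 0"
    and X: "3 \<le> card X" "card X + 6 \<le> CARD('p)" and p: "11 \<le> CARD('p)"
  shows "e = d \<or> e = - d"
proof -
  let ?Y = "(*) (1 / d) ` X"
  have n1: "near 1 ?Y" "near (e / d) ?Y" using n nk d near_iff_scale[of "1 / d" 1 X] near_iff_scale[of "1 / d" "e / d" X] by simp_all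
  have cY: "card ?Y = card X" using d by (intro card_scale) simp
  obtain k where k: "k < CARD('p)" "e / d = of_nat k" using ex_of_nat_translate[of "e / d" 0] by auto
  have k0: "k \<noteq> 0"
  proof
    assume "k = 0" then have "e / d = 0" using k by simp
    then show False using d e by simp
  qed
  have neg: "(of_nat (CARD('p) - k) :: 'p mod_ring) = - of_nat k"
    using k(1) by (simp add: of_nat_diff of_nat_card_eq_0)
  have nn: "near (of_nat k) ?Y" "near (of_nat (CARD('p) - k)) ?Y" using n1 k(2) neg by (simp_all add: near_uminus)
  consider "k = 1" | "CARD('p) - k = 1" | "2 \<le> k" "k + 4 \<le> CARD('p)" | "2 \<le> CARD('p) - k" "(CARD('p) - k) + 4 \<le> CARD('p)"
    using k k0 p by linarith
  then show ?thesis
  proof cases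
    case 1
    then have "e / d = 1" using k by simp
    then show ?thesis using d by simp
  next
    case 2
    then have "- (e / d) = 1" using k neg by simp
    then have "e / d = - 1" by (metis add.inverse_inverse)
    then show ?thesis using d by (simp add: field_simps)
  next
    case 3
    then show ?thesis using near_direction_aux[OF n1(1) nn(1)] X p cY by simp
  next
    case 4
    then show ?thesis using near_direction_aux[OF n1(1) nn(2)] X p cY by simp
  qed
qed

section \<open>Two colors\<close>

lemma nap_scale:
  fixes c :: "'a::{field,finite}"
  assumes "c \<noteq> 0" "nap X" shows "nap ((*) c ` X)"
  using assms by (simp add: nap_def bd_scale')

lemma nap_translate: "nap ((+) c ` X) \<longleftrightarrow> nap X" for c :: "'a::{ab_group_add,finite}"
  by (simp add: nap_def)

section \<open>Non-progressions with three elements\<close>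

lemma nap_not_ap3:
  fixes e :: "'a::{ab_group_add,finite}"
  assumes "nap X" "e \<noteq> 0" shows "X \<noteq> {y, y + e, y + e + e}"
proof
  assume X: "X = {y, y + e, y + e + e}"
  have "{x \<in> X. x + e \<notin> X} \<subseteq> {y + e + e}" unfolding X by blast
  then have "card {x \<in> X. x + e \<notin> X} \<le> card {y + e + e}" by (intro card_mono) auto
  then have "bd e X \<le> 1" by (simp add: bd_def)
  then show False using assms unfolding nap_def by fastforce
qed

lemma nap3_erode:
  fixes A :: "'a::{ab_group_add,finite} set"
  assumes "nap A" "card A = 3" "d \<noteq> 0"
  shows "card (erode d A) \<le> 1"
proof -
  have "2 \<le> bd d A" using assms by (simp add: nap_def)
  then show ?thesis using card_erode[of d A] assms(2) by linarith
qed

text \<open>Of the nine ordered pairs three have difference 0; a nonzero difference occurring twice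
  would make the triple a progression.\<close>

lemma nap3_diff_card:
  fixes A :: "'a::{ab_group_add,finite} set"
  assumes "nap A" "card A = 3"
  shows "7 \<le> card (A + uminus ` A)"
proof -
  let ?D = "A + uminus ` A"
  have 0: "0 \<in> ?D"
  proof -
    obtain x where "x \<in> A" using assms(2) by fastforce
    then have "x + - x \<in> ?D" by (intro set_plus_intro) auto
    then show ?thesis by simp
  qed
  have sup: "erode d A = {}" if "d \<notin> ?D" for d
  proof (rule ccontr)
    assume "erode d A \<noteq> {}"
    then obtain x where x: "x \<in> A" "x + d \<in> A" by (auto simp: erode_def)
    then have "(x + d) + - x \<in> ?D" by (intro set_plus_intro) auto
    then show False using that by simp
  qed
  have "9 = (\<Sum>d\<in>UNIV. card (erode d A))" using sum_card_erode[of A] assms(2) by simp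
  also have "\<dots> = (\<Sum>d\<in>?D. card (erode d A))"
    by (rule sum.mono_neutral_right) (auto simp: sup)
  also have "\<dots> = card (erode 0 A) + (\<Sum>d\<in>?D - {0}. card (erode d A))"
    by (rule sum.remove[OF finite 0])
  also have "card (erode 0 A) = 3" using assms(2) by (simp add: erode_def)
  also have "(\<Sum>d\<in>?D - {0}. card (erode d A)) \<le> (\<Sum>d\<in>?D - {0}. 1)"
    by (rule sum_mono) (use nap3_erode[OF assms] in auto)
  also have "(\<Sum>d\<in>?D - {0}. 1) = card ?D - 1" using 0 by simp
  finally show ?thesis by simp
qed

lemma card_Int_translates:
  fixes A :: "'a::{ab_group_add,finite} set"
  assumes "nap A" "card A = 3" "y \<noteq> y'"
  shows "card ((+) y ` A \<inter> (+) y' ` A) \<le> 1"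
proof -
  have "(\<lambda>x. x - y) ` ((+) y ` A \<inter> (+) y' ` A) \<subseteq> erode (y - y') A"
  proof
    fix z assume "z \<in> (\<lambda>x. x - y) ` ((+) y ` A \<inter> (+) y' ` A)"
    then obtain u v where uv: "u \<in> A" "v \<in> A" "y + u = y' + v" "z = y + u - y" by blast
    have "z = u" using uv(4) by simp
    moreover have "u + (y - y') = v"
    proof -
      have "u + (y - y') = (y + u) - y'" by simp
      also have "\<dots> = v" by (simp add: uv(3))
      finally show ?thesis .
    qed
    ultimately show "z \<in> erode (y - y') A" using uv by (simp add: erode_def)
  qed
  then have "card ((\<lambda>x. x - y) ` ((+) y ` A \<inter> (+) y' ` A)) \<le> card (erode (y - y') A)"
    by (intro card_mono) auto
  also have "\<dots> \<le> 1" using assms by (intro nap3_erode) auto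
  finally show ?thesis by (simp add: card_image inj_on_def)
qed

lemma card_Un3_ge:
  assumes "finite P" "finite Q" "finite R"
  shows "card P + card Q + card R \<le> card (P \<union> Q \<union> R) + card (P \<inter> Q) + card (P \<inter> R) + card (Q \<inter> R)"
proof -
  have "card (P \<union> Q) + card (P \<inter> Q) = card P + card Q" using card_Un_Int assms by metis
  moreover have "card (P \<union> Q \<union> R) + card ((P \<union> Q) \<inter> R) = card (P \<union> Q) + card R"
    using card_Un_Int[of "P \<union> Q" R] assms by simp
  moreover have "card ((P \<union> Q) \<inter> R) \<le> card (P \<inter> R) + card (Q \<inter> R)"
    by (simp add: Int_Un_distrib2 card_Un_le)
  ultimately show ?thesis by linarith
qed

text \<open>Three translates of \<open>A\<close> have nine points in all and at most six in their
  union, while any two share at most one point; so any two of them meet.\<close>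

lemma nap3_sum_diff:
  fixes A B :: "'a::{ab_group_add,finite} set"
  assumes "nap A" "card A = 3" "B = {y1, y2, y3}" "card B = 3" "card (A + B) \<le> 6"
  shows "\<exists>u\<in>A. \<exists>v\<in>A. y1 - y2 = u - v \<and> u \<noteq> v"
proof -
  have ne: "y1 \<noteq> y2" "y1 \<noteq> y3" "y2 \<noteq> y3" using assms(3,4) by (auto simp: card_insert_if split: if_splits)
  let ?T = "\<lambda>y. (+) y ` A"
  have "?T y1 \<union> ?T y2 \<union> ?T y3 = A + B"
    unfolding assms(3) by (auto simp: set_plus_def add.commute; metis add.commute)
  then have "3 + 3 + 3 \<le> 6 + card (?T y1 \<inter> ?T y2) + card (?T y1 \<inter> ?T y3) + card (?T y2 \<inter> ?T y3)"
    using card_Un3_ge[of "?T y1" "?T y2" "?T y3"] assms(2,5) by simp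
  then have "card (?T y1 \<inter> ?T y2) \<noteq> 0"
    using card_Int_translates[OF assms(1,2) ne(2)] card_Int_translates[OF assms(1,2) ne(3)] by linarith
  then have "?T y1 \<inter> ?T y2 \<noteq> {}" by auto
  then obtain x where "x \<in> ?T y1" "x \<in> ?T y2" by blast
  then obtain u v where uv: "u \<in> A" "v \<in> A" "y1 + u = y2 + v" by auto
  have "y1 - y2 = v - u"
  proof -
    have "y1 - y2 = (y1 + u) - u - y2" by simp
    also have "\<dots> = v - u" by (simp add: uv(3))
    finally show ?thesis .
  qed
  moreover have "v \<noteq> u" using ne(1) \<open>y1 - y2 = v - u\<close> by auto
  ultimately show ?thesis using uv by blast
qed

lemma mod_ring_mult_numeral_neq_0:
  assumes "(x :: 'p::prime_card mod_ring) \<noteq> 0" "0 < n" "n < CARD('p)"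
  shows "of_nat n * x \<noteq> 0"
  using assms of_nat_mod_ring_neq_0[where n = n and 'p = 'p] by simp

text \<open>All differences within \<open>B\<close> are differences within \<open>A\<close>. The
  consistent ways to match them make \<open>B\<close> a translate of \<open>A\<close>, a translate
  of \<open>- A\<close>, or a progression; the second is impossible because \<open>A - A\<close> has
  seven elements.\<close>

lemma nap3_translate:
  fixes A B :: "'p::prime_card mod_ring set"
  assumes A: "nap A" "card A = 3" and B: "nap B" "card B = 3" and AB: "card (A + B) \<le> 6" and p: "2 < CARD('p)"
  obtains t where "B = (+) t ` A"
proof -
  obtain y1 y2 y3 where By: "B = {y1, y2, y3}" "y1 \<noteq> y2" "y1 \<noteq> y3" "y2 \<noteq> y3"
    using B(2) by (auto simp: card_3_iff)
  have B': "B = {y2, y3, y1}" "B = {y1, y3, y2}" using By(1) by auto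
  obtain u v where uv: "u \<in> A" "v \<in> A" "y1 - y2 = u - v" "u \<noteq> v"
    using nap3_sum_diff[OF A By(1) B(2) AB] by blast
  have "card (A - {u, v}) = 1" using A(2) uv by (simp add: card_Diff_subset)
  then obtain w where w: "A - {u, v} = {w}" by (auto simp: card_1_singleton_iff)
  then have Au: "A = {u, v, w}" "w \<noteq> u" "w \<noteq> v" using uv by blast+
  obtain s r where sr: "s \<in> A" "r \<in> A" "y2 - y3 = s - r" "s \<noteq> r"
    using nap3_sum_diff[OF A B'(1) B(2) AB] by blast
  obtain s' r' where sr': "s' \<in> A" "r' \<in> A" "y1 - y3 = s' - r'" "s' \<noteq> r'"
    using nap3_sum_diff[OF A B'(2) B(2) AB] by blast
  have two: "x = y" if "x + x = y + (y :: 'p mod_ring)" for x y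
  proof (rule ccontr)
    assume "x \<noteq> y"
    then have "of_nat 2 * (x - y) \<noteq> 0" using p by (intro mod_ring_mult_numeral_neq_0) auto
    moreover have "of_nat 2 * (x - y) = (x + x) - (y + y)" by (simp add: algebra_simps)
    ultimately show False using that by simp
  qed
  have ap: False if "e \<noteq> 0" "B = {y, y + e, y + e + e}" for y e using nap_not_ap3[OF B(1)] that by blast
  have y12: "y1 = y2 + (u - v)" using uv(3) by (simp add: algebra_simps)
  have y13: "y1 - y3 = (u - v) + (s - r)" using uv(3) sr(3) by (simp add: algebra_simps)
  have y23: "y3 = y2 - (s - r)" using sr(3) by (simp add: algebra_simps)
  have apB: False if e: "u - v = e" "s - r = - (e + e)" for e
  proof -
    have "B = {y2, y2 + e, y2 + e + e}" using By(1) y12 y23 e by (auto simp: algebra_simps)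
    moreover have "e \<noteq> 0" using uv(4) e(1) by auto
    ultimately show False using ap by blast
  qed
  have apC: False if e: "u - v = - (e + e)" "s - r = e" "e \<noteq> 0" for e
  proof -
    have "y1 = y2 + - e + - e" "y3 = y2 + - e" using y12 y23 e by (simp_all add: algebra_simps)
    then have "B = {y2, y2 + - e, y2 + - e + - e}" using By(1) by auto
    then show False using ap[of "- e" y2] e(3) by simp
  qed
  have S: "s' - r' = u - v + (s - r)" using y13 sr'(3) by simp
  consider "s = u" "r = v" | "s = v" "r = u" | "s = v" "r = w" | "s = w" "r = u" | "s = u" "r = w" | "s = w" "r = v"
    using sr(1,2,4) Au(1) by blast
  then show thesis
  proof cases
    case 1
    have "B = {y3, y3 + (u - v), y3 + (u - v) + (u - v)}" using By(1) y12 y23 1 by (auto simp: algebra_simps)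
    moreover have "u - v \<noteq> 0" using uv(4) by simp
    ultimately show thesis using ap by blast
  next
    case 2
    then have "y1 - y3 = 0" using y13 by simp
    then show thesis using By by simp
  next
    case 3
    have y23': "y3 = y2 - (v - w)" using y23 3 by simp
    have e: "(y1 - u) + u = y1" "(y1 - u) + v = y2" "(y1 - u) + w = y3"
      by (simp_all add: y12 y23' algebra_simps)
    have "B = (+) (y1 - u) ` A" by (simp only: Au(1) image_insert image_empty e By(1))
    then show thesis by (rule that)
  next
    \<comment> \<open>The reversed orientation: \<open>B\<close> is a translate of
      \<open>- A\<close>.\<close>
    case 4
    have y23': "y3 = y2 - (w - u)" using y23 4 by simp
    have e: "(y3 + w) + - v = y1" "(y3 + w) + - u = y2" "(y3 + w) + - w = y3"
      by (simp_all add: y12 y23' algebra_simps)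
    have "B = (+) (y3 + w) ` uminus ` A"
      by (simp only: Au(1) image_insert image_empty e By(1) insert_commute)
    then have "A + B = (+) (y3 + w) ` (A + uminus ` A)" by (metis translate_plus add.commute)
    then have "7 \<le> card (A + B)" using nap3_diff_card[OF A] by simp
    then show thesis using AB by simp
  next
    case 5
    consider "s' = u" "r' = v" | "s' = v" "r' = u" | "s' = v" "r' = w" | "s' = w" "r' = u" | "s' = u" "r' = w" | "s' = w" "r' = v"
      using sr'(1,2,4) Au(1) by blast
    then show thesis
    proof cases
      case 1
      then show thesis using S 5 Au by (simp add: algebra_simps)
    next
      case 2
      have "u - v + (u - w) = v - u" using S 2 5 by simp
      then have "s - r = - ((u - v) + (u - v))" using 5 by (simp add: algebra_simps)
      then show thesis using apB by blast
    next
      case 3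
      have X: "u - v + (u - w) = v - w" using S[symmetric] by (simp only: 3 5)
      have "u + u = (u - v + (u - w)) + v + w" by (simp add: algebra_simps)
      also have "\<dots> = v + v" unfolding X by (simp add: algebra_simps)
      finally have "u + u = v + v" .
      then show thesis using two uv(4) by blast
    next
      case 4
      have "u - v + (u - w) = w - u" using S 4 5 by simp
      then have "u - v = - ((u - w) + (u - w))" by (simp add: algebra_simps)
      then show thesis using apC[of "u - w"] 5 Au by simp
    next
      case c5: 5
      then show thesis using S 5 uv by (simp add: algebra_simps)
    next
      case 6
      have X: "u - v + (u - w) = w - v" using S[symmetric] by (simp only: 6 5)
      have "u + u = (u - v + (u - w)) + v + w" by (simp add: algebra_simps)
      also have "\<dots> = w + w" unfolding X by (simp add: algebra_simps)
      finally have "u + u = w + w" .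
      then show thesis using two Au by blast
    qed
  next
    case 6
    consider "s' = u" "r' = v" | "s' = v" "r' = u" | "s' = v" "r' = w" | "s' = w" "r' = u" | "s' = u" "r' = w" | "s' = w" "r' = v"
      using sr'(1,2,4) Au(1) by blast
    then show thesis
    proof cases
      case 1
      then show thesis using S 6 Au by (simp add: algebra_simps)
    next
      case 2
      have "u - v + (w - v) = v - u" using S 2 6 by simp
      then have "s - r = - ((u - v) + (u - v))" using 6 by (simp add: algebra_simps)
      then show thesis using apB by blast
    next
      case 3
      have "u - v + (w - v) = v - w" using S 3 6 by simp
      then have "u - v = - ((w - v) + (w - v))" by (simp add: algebra_simps)
      then show thesis using apC[of "w - v"] 6 Au by simp
    next
      case 4
      have X: "u - v + (w - v) = w - u" using S 4 6 by simp
      have "u + u = (u - v + (w - v)) + (v + v) - w + u" by (simp add: algebra_simps)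
      also have "\<dots> = v + v" unfolding X by (simp add: algebra_simps)
      finally have "u + u = v + v" .
      then show thesis using two uv(4) by blast
    next
      case 5
      have X: "u - v + (w - v) = u - w" using S 5 6 by simp
      have "w + w = (u - v + (w - v)) + (v + v) - u + w" by (simp add: algebra_simps)
      also have "\<dots> = v + v" unfolding X by (simp add: algebra_simps)
      finally have "w + w = v + v" .
      then show thesis using two Au by blast
    next
      case c6: 6
      then show thesis using S 6 uv by (simp add: algebra_simps)
    qed
  qed
qed

text \<open>Since \<open>y + z = - x\<close>, symmetry places \<open>x\<close> in the sumset, and it
  can only be \<open>2 y\<close> or \<open>2 z\<close>. The same holds for \<open>y\<close> and
  \<open>z\<close>, so doubling has a cycle of length two or three, and 3 or 7 annihilates a nonzero
  element.\<close>

lemma symmetric_triple_contra: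
  fixes x y z :: "'p::prime_card mod_ring"
  assumes S: "nap {x, y, z}" "card {x, y, z} = 3" "x + y + z = 0"
    and sym: "\<And>w. w \<in> {x, y, z} + {x, y, z} \<Longrightarrow> - w \<in> {x, y, z} + {x, y, z}" and p: "11 \<le> CARD('p)"
  shows False
proof -
  have ne: "x \<noteq> y" "x \<noteq> z" "y \<noteq> z" using S(2) by (auto simp: card_insert_if split: if_splits)
  have pn: "of_nat n * t \<noteq> 0" if "t \<noteq> 0" "0 < n" "n < 11" for n and t :: "'p mod_ring"
    using mod_ring_mult_numeral_neq_0[of t n] that p by simp
  have aux: "(a = b + b \<or> a = c + c) \<and> a \<noteq> 0"
    if abc: "{x, y, z} = {a, b, c}" "a \<noteq> b" "a \<noteq> c" "b \<noteq> c" "a + b + c = 0" for a b c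
  proof
    have nz: "t \<noteq> 0" if t: "{x, y, z} = {t, r, s}" "t + r + s = 0" "r \<noteq> s" for t r s
    proof
      assume t0: "t = 0"
      then have "s = - r" using t(2) by (simp add: eq_neg_iff_add_eq_0 add.commute)
      then have "{x, y, z} = {r, r + - r, r + - r + - r}" "- r \<noteq> 0" using t t0 by auto
      then show False using nap_not_ap3[OF S(1)] by blast
    qed
    show a0: "a \<noteq> 0" using nz[of a b c] abc by simp
    have b0: "b \<noteq> 0" using nz[of b a c] abc by (simp add: insert_commute add.commute add.left_commute)
    have c0: "c \<noteq> 0" using nz[of c a b] abc by (simp add: insert_commute add.commute add.left_commute)
    have "b + c = - a" using abc(5) by (simp add: eq_neg_iff_add_eq_0 add.commute add.left_commute)
    moreover have "b + c \<in> {x, y, z} + {x, y, z}" unfolding abc(1) by (intro set_plus_intro) auto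
    ultimately have "- (- a) \<in> {x, y, z} + {x, y, z}" using sym by metis
    then have "a \<in> {a, b, c} + {a, b, c}" unfolding abc(1) by simp
    then obtain r s where rs: "a = r + s" "r \<in> {a, b, c}" "s \<in> {a, b, c}" by (rule set_plus_elim) blast
    have n2: "a \<noteq> b + c"
    proof
      assume "a = b + c"
      then have "a = - a" using \<open>b + c = - a\<close> by (rule trans)
      then have "a + a = 0" by (metis add.right_inverse)
      then have "of_nat 2 * a = 0" by (simp only: of_nat_numeral mult_2)
      then show False using pn[OF a0, of 2] by simp
    qed
    then have n3: "a \<noteq> c + b" by (metis add.commute)
    show "a = b + b \<or> a = c + c" 
    proof -
      have "s \<noteq> 0" "r \<noteq> 0" using rs(2,3) a0 b0 c0 by blast+
      then have "r \<noteq> a" "s \<noteq> a" using rs(1) by auto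
      then have "r = b \<or> r = c" "s = b \<or> s = c" using rs(2,3) by blast+
      then show ?thesis using rs(1) n2 n3 by metis
    qed
  qed
  have X: "(x = y + y \<or> x = z + z) \<and> x \<noteq> 0" using ne S(3) by (intro aux) auto
  have Y: "(y = x + x \<or> y = z + z) \<and> y \<noteq> 0" using ne S(3) by (intro aux) (auto simp: add.commute add.left_commute)
  have Z: "(z = x + x \<or> z = y + y) \<and> z \<noteq> 0" using ne S(3) by (intro aux) (auto simp: add.commute add.left_commute)
  have two: False if "a = b + b" "b = a + a" "a \<noteq> 0" for a b :: "'p mod_ring"
  proof -
    have e: "(a + a) + (a + a) = a" using that(1,2) by metis
    have "3 * a = ((a + a) + (a + a)) - a" by (simp add: algebra_simps)
    then have "3 * a = 0" by (simp only: e diff_self)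
    then have "of_nat 3 * a = 0" by (simp only: of_nat_numeral)
    then show False using pn[OF that(3), of 3] by simp
  qed
  have three: False if "a = b + b" "b = c + c" "c = a + a" "a \<noteq> 0" for a b c :: "'p mod_ring"
  proof -
    have e: "((a + a) + (a + a)) + ((a + a) + (a + a)) = a" using that(1-3) by metis
    have "7 * a = (((a + a) + (a + a)) + ((a + a) + (a + a))) - a" by (simp add: algebra_simps)
    then have "7 * a = 0" by (simp only: e diff_self)
    then have "of_nat 7 * a = 0" by (simp only: of_nat_numeral)
    then show False using pn[OF that(4), of 7] by simp
  qed
  show False using X Y Z two three ne by metis
qed

lemma sum_scale: "(\<Sum>x\<in>(*) c ` X. x) = c * \<Sum>X" if "c \<noteq> 0" for c :: "'a::field"
  using that by (simp add: sum.reindex inj_on_def sum_distrib_left)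

lemma sum_translate: "\<Sum>((+) t ` X) = of_nat (card X) * t + \<Sum>X" for t :: "'a::comm_ring_1"
  by (simp add: sum.reindex inj_on_def sum.distrib)

text \<open>Let \<open>u = a / b\<close> and let \<open>A0\<close> be \<open>A\<close> translated to
  sum 0. By \<open>nap3_translate\<close>, \<open>B\<close> is a translate both of
  \<open>u A0\<close> and of \<open>A0 / u\<close>, so \<open>u * u\<close> permutes
  \<open>A0\<close> cyclically and the cube of \<open>u\<close> is \<open>1\<close> or
  \<open>- 1\<close>. Equality of the two sums also forces equal centres. Then cube \<open>1\<close>
  gives \<open>A = B\<close>, and cube \<open>- 1\<close> makes \<open>A0 + A0\<close>
  symmetric.\<close>

lemma pair_sum_three_contra:
  fixes A B :: "'p::prime_card mod_ring set"
  assumes dis: "A \<inter> B = {}" and A: "nap A" "card A = 3" and B: "nap B" "card B = 3"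
    and ab: "a \<noteq> 0" "b \<noteq> 0" "a \<noteq> b" "a \<noteq> - b"
    and eq: "(*) a ` A + (*) b ` B = (*) b ` A + (*) a ` B" and six: "card ((*) a ` A + (*) b ` B) \<le> 6"
    and p: "11 \<le> CARD('p)"
  shows False
proof -
  have pn: "(of_nat n :: 'p mod_ring) \<noteq> 0" if "0 < n" "n < 11" for n
    using of_nat_mod_ring_neq_0[where n = n and 'p = 'p] that p by simp
  have n3: "(3 :: 'p mod_ring) \<noteq> 0" using pn[of 3] by simp
  have napm: "nap ((*) a ` A)" "nap ((*) b ` B)" "nap ((*) b ` A)" "nap ((*) a ` B)"
    using A B ab by (simp_all add: nap_scale)
  have c3: "card ((*) a ` A) = 3" "card ((*) b ` B) = 3" "card ((*) b ` A) = 3" "card ((*) a ` B) = 3"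
    using A B ab by simp_all
  \<comment> \<open>The centre of mass. As 3 is invertible, it turns equalities up to translation
    into equalities.\<close>
  define c where "c = \<Sum>A / 3"
  define A0 where "A0 = (+) (- c) ` A"
  have AA0: "A = (+) c ` A0" by (simp add: A0_def image_image)
  have A0: "nap A0" "card A0 = 3" using A by (simp_all only: A0_def nap_translate card_translate)
  have sum0: "\<Sum>A0 = 0" unfolding A0_def by (subst sum_translate) (simp add: A(2) c_def n3)
  define c' where "c' = \<Sum>B / 3"
  have rep: "B = (+) c' ` (*) (e / f) ` A0" if ef: "e \<noteq> 0" "f \<noteq> 0" and t: "(*) f ` B = (+) t ` (*) e ` A" for e f t
  proof -
    have "B = (*) (1 / f) ` (*) f ` B" using ef by (simp add: image_image)
    also have "\<dots> = (*) (1 / f) ` (+) t ` (*) e ` (+) c ` A0" by (simp only: t AA0)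
    also have "\<dots> = (+) ((t + e * c) / f) ` (*) (e / f) ` A0"
      using ef by (simp add: image_image field_simps)
    finally have Bt: "B = (+) ((t + e * c) / f) ` (*) (e / f) ` A0" .
    have ne: "e / f \<noteq> 0" using ef by simp
    have "\<Sum>B = of_nat (card ((*) (e / f) ` A0)) * ((t + e * c) / f) + \<Sum>((*) (e / f) ` A0)"
      by (subst Bt) (rule sum_translate)
    also have "\<dots> = 3 * ((t + e * c) / f)"
      by (simp only: card_scale[OF ne] sum_scale[OF ne] A0(2) sum0 mult_zero_right add_0_right of_nat_numeral)
    finally have sB: "\<Sum>B = 3 * ((t + e * c) / f)" .
    have "c' = 3 * ((t + e * c) / f) / 3" by (simp only: c'_def sB)
    then have "c' = (t + e * c) / f" by (simp only: nonzero_mult_div_cancel_left[OF n3])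
    then show ?thesis using Bt by simp
  qed
  have p2: "2 < CARD('p)" using p by simp
  obtain t1 where t1: "(*) b ` B = (+) t1 ` (*) a ` A"
    using nap3_translate[OF napm(1) c3(1) napm(2) c3(2) six p2] by blast
  obtain t2 where t2: "(*) a ` B = (+) t2 ` (*) b ` A"
    using nap3_translate[OF napm(3) c3(3) napm(4) c3(4) _ p2] six eq by auto
  define u where "u = a / b"
  have u: "u \<noteq> 0" "u \<noteq> 1" "u \<noteq> - 1"
  proof -
    show "u \<noteq> 0" "u \<noteq> 1" using ab by (simp_all add: u_def)
    show "u \<noteq> - 1"
    proof
      assume um: "u = - 1"
      have "a = u * b" using ab by (simp add: u_def)
      then show False using um ab by simp
    qed
  qed
  have B1: "B = (+) c' ` (*) u ` A0" using rep[OF ab(1,2) t1] by (simp add: u_def)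
  have B2: "B = (+) c' ` (*) (1 / u) ` A0" using rep[OF ab(2,1) t2] by (simp add: u_def)
  have "(+) (- c') ` (+) c' ` (*) u ` A0 = (+) (- c') ` (+) c' ` (*) (1 / u) ` A0" using B1 B2 by simp
  then have "(*) u ` A0 = (*) (1 / u) ` A0" by (simp add: image_image)
  then have "(*) u ` (*) u ` A0 = (*) u ` (*) (1 / u) ` A0" by simp
  then have uu: "(*) (u * u) ` A0 = A0" using u(1) by (simp add: image_image mult.assoc)
  obtain x where x: "x \<in> A0" "x \<noteq> 0"
  proof -
    obtain x y where "x \<in> A0" "y \<in> A0" "x \<noteq> y" using A0(2) by (auto simp: card_3_iff)
    then show thesis using that by metis
  qed
  define v where "v = u * u"
  have v1: "v \<noteq> 1" using u by (simp add: v_def square_eq_1_iff)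
  have stab: "v * y \<in> A0" if "y \<in> A0" for y using uu that by (auto simp: v_def)
  have v0: "v \<noteq> 0" using u by (simp add: v_def)
  have m: "x \<in> A0" "v * x \<in> A0" "v * (v * x) \<in> A0" "v * (v * (v * x)) \<in> A0"
    using x stab by blast+
  have vx: "v * x \<noteq> x" using v1 x by simp
  \<comment> \<open>For \<open>v = - 1\<close> the triple would be \<open>- x, 0, x\<close>.\<close>
  have vm1: "v \<noteq> - 1"
  proof
    assume vm: "v = - 1"
    have "card (A0 - {x, - x}) = 1"
      using A0(2) m(1,2) vx vm by (simp add: card_Diff_subset)
    then obtain z where z: "A0 - {x, - x} = {z}" by (auto simp: card_1_singleton_iff)
    then have A0e: "A0 = {x, - x, z}" using m(1,2) vm by auto
    have "- z \<in> A0" using stab[of z] z vm by auto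
    then have "- z = z" using A0e z by (metis Diff_iff insert_iff minus_minus singletonD)
    then have "z + z = - z + z" by (simp only:)
    then have "of_nat 2 * z = 0" by simp
    then have "z = 0" using pn[of 2] by simp
    then have "A0 = {- x, - x + x, - x + x + x}" using A0e by auto
    then show False using nap_not_ap3[OF A0(1) x(2)] by blast
  qed
  have vvx: "v * (v * x) \<noteq> x"
  proof
    assume "v * (v * x) = x"
    then have "(v * v) * x = 1 * x" by (simp add: mult.assoc)
    then have "v * v = 1" using x(2) by (simp only: mult_right_cancel[OF x(2)])
    then show False using v1 vm1 by (simp add: square_eq_1_iff)
  qed
  have vvvx: "v * (v * x) \<noteq> v * x" using vx v0 by simp
  have c3': "card {x, v * x, v * (v * x)} = 3"
    unfolding card_3_iff using vx[symmetric] vvx[symmetric] vvvx[symmetric] by blast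
  have "{x, v * x, v * (v * x)} \<subseteq> A0" using m by blast
  then have A0e: "A0 = {x, v * x, v * (v * x)}" using c3' A0(2) by (metis card_subset_eq finite)
  have "v * (v * (v * x)) = x"
  proof -
    have "v * (v * (v * x)) \<noteq> v * x" "v * (v * (v * x)) \<noteq> v * (v * x)" using vx vvx v0 by simp_all
    then show ?thesis using m(4) A0e by blast
  qed
  then have "(v * v * v) * x = 1 * x" by (simp add: mult.assoc)
  then have v3: "v * v * v = 1" by (simp only: mult_right_cancel[OF x(2)])
  have "(u * u * u) * (u * u * u) = 1" using v3 unfolding v_def by (simp only: ac_simps)
  then have u3: "u * u * u = 1 \<or> u * u * u = - 1" by (simp only: square_eq_1_iff)
  have vimg: "(*) v ` A0 = A0" using uu by (simp add: v_def)
  have vvimg: "(*) (v * v) ` A0 = A0"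
  proof -
    have "(*) (v * v) ` A0 = (*) v ` (*) v ` A0" by (simp add: image_image mult.assoc)
    then show ?thesis using vimg by simp
  qed
  have uv: "u * (u * u * u) = v * v" by (simp add: v_def mult.assoc)
  let ?S = "A0 + A0"
  have tt: "(+) s ` P + (+) t ` Q = (+) (s + t) ` (P + Q)" for s t and P Q :: "'p mod_ring set"
  proof -
    have "P + (+) t ` Q = (+) t ` (P + Q)" by (metis add.commute translate_plus)
    moreover have "(+) s ` (+) t ` (P + Q) = (+) (s + t) ` (P + Q)"
      unfolding image_image by (rule image_cong) (simp_all add: add.assoc)
    ultimately show ?thesis by (simp only: translate_plus)
  qed
  have s1: "(*) a ` A + (*) b ` B = (+) (a * c + b * c') ` (*) a ` ?S"
  proof -
    have "(*) a ` A = (+) (a * c) ` (*) a ` A0" by (simp add: AA0 image_image distrib_left)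
    moreover have "(*) b ` B = (+) (b * c') ` (*) a ` A0"
      by (subst B1) (use ab in \<open>simp add: image_image distrib_left u_def\<close>)
    ultimately show ?thesis by (simp only: tt scale_plus)
  qed
  have s2: "(*) b ` A + (*) a ` B = (+) (b * c + a * c') ` (*) b ` ?S"
  proof -
    have "(*) b ` A = (+) (b * c) ` (*) b ` A0" by (simp add: AA0 image_image distrib_left)
    moreover have "(*) a ` B = (+) (a * c') ` (*) b ` A0"
      by (subst B2) (use ab in \<open>simp add: image_image distrib_left u_def\<close>)
    ultimately show ?thesis by (simp only: tt scale_plus)
  qed
  have cS: "card ?S = 6"
  proof -
    have "card ?S = card ((*) a ` A + (*) b ` B)" unfolding s1 using ab by simp
    moreover have "6 \<le> card ((*) a ` A + (*) b ` B)"
      using nap_sum_ge[OF napm(2), of "(*) a ` A"] c3 six p by simp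
    ultimately show ?thesis using six by simp
  qed
  have sS: "\<Sum>?S = 0"
  proof -
    have sub: "(*) v ` ?S = ?S" by (simp only: scale_plus vimg)
    have "\<Sum>?S = v * \<Sum>?S" using sum_scale[OF v0, of ?S] sub by simp
    then have "(1 - v) * \<Sum>?S = 0" by (simp add: algebra_simps)
    then show ?thesis using v1 by simp
  qed
  have e12: "(+) (a * c + b * c') ` (*) a ` ?S = (+) (b * c + a * c') ` (*) b ` ?S" using s1 s2 eq by simp
  \<comment> \<open>The sum of all elements of \<open>A0 + A0\<close> is fixed by \<open>v\<close>
    and hence 0, so summing six elements isolates the translations.\<close>
  have "of_nat 6 * (a * c + b * c') = of_nat 6 * (b * c + a * c')"
  proof -
    have "\<Sum>((+) (a * c + b * c') ` (*) a ` ?S) = of_nat 6 * (a * c + b * c')"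
      by (subst sum_translate, subst sum_scale[OF ab(1)]) (use sS cS ab in simp)
    moreover have "\<Sum>((+) (b * c + a * c') ` (*) b ` ?S) = of_nat 6 * (b * c + a * c')"
      by (subst sum_translate, subst sum_scale[OF ab(2)]) (use sS cS ab in simp)
    ultimately show ?thesis using e12 by simp
  qed
  moreover have "(of_nat 6 :: 'p mod_ring) \<noteq> 0" using pn[of 6] by simp
  ultimately have tr: "a * c + b * c' = b * c + a * c'" using mult_left_cancel by blast
  have "(a - b) * (c - c') = (a * c + b * c') - (b * c + a * c')" by (simp add: algebra_simps)
  also have "\<dots> = 0" by (simp only: tr diff_self)
  finally have cc: "c = c'" using ab by simp
  have "(+) (- (b * c + a * c')) ` (+) (a * c + b * c') ` (*) a ` ?S = (+) (- (b * c + a * c')) ` (+) (b * c + a * c') ` (*) b ` ?S"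
    using e12 by simp
  then have "(*) a ` ?S = (*) b ` ?S" unfolding tr by (simp add: image_image)
  then have "(*) (1 / b) ` (*) a ` ?S = (*) (1 / b) ` (*) b ` ?S" by simp
  then have uS: "(*) u ` ?S = ?S" using ab by (simp add: image_image u_def)
  show False
    using u3
  proof
    assume "u * u * u = 1"
    then have "u = v * v" using uv by simp
    then have "B = A" using B1 vvimg cc AA0 by simp
    then show False using dis A(2) by auto
  next
    assume um: "u * u * u = - 1"
    have "- w \<in> ?S" if "w \<in> ?S" for w
    proof -
      have st: "u * y \<in> ?S" if "y \<in> ?S" for y using uS that by blast
      have "u * (u * (u * w)) \<in> ?S" using that st by blast
      moreover have "u * (u * (u * w)) = (u * u * u) * w" by (simp only: mult.assoc)
      ultimately show ?thesis using um by simp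
    qed
    moreover have "x + v * x + v * (v * x) = 0"
    proof -
      have "\<Sum>A0 = x + v * x + v * (v * x)"
      proof -
        have "x \<notin> {v * x, v * (v * x)}" "v * x \<notin> {v * (v * x)}" using vx vvx vvvx by (metis insertE singletonD)+
        then show ?thesis unfolding A0e by (simp only: sum.insert finite.intros sum.empty add_0_right add.assoc not_False_eq_True empty_iff)
      qed
      then show ?thesis using sum0 by simp
    qed
    ultimately show False
      using symmetric_triple_contra[of x "v * x" "v * (v * x)"] A0 p unfolding A0e by blast
  qed
qed

text \<open>If one of \<open>A\<close>, \<open>B\<close> and the reflected complement
  \<open>W\<close> were a progression, another of them would be near a progression in two directions
  whose quotient is \<open>a / b\<close> or its inverse, against \<open>near_direction\<close>.
  Among non-progressions boundaries at most 2 can be transferred, and going from \<open>W\<close> to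
  a class and back by the other pair multiplies the direction by \<open>a / b\<close> or its
  inverse.\<close>

lemma pair_sum_bound:
  fixes A B :: "'p::prime_card mod_ring set"
  assumes dis: "A \<inter> B = {}" and A3: "3 \<le> card A" and B3: "3 \<le> card B" and sz: "card A + card B + 4 \<le> CARD('p)"
    and ab: "a \<noteq> 0" "b \<noteq> 0" "a \<noteq> b" "a \<noteq> - b"
  shows "card A + card B + 1 \<le> card (((*) a ` A + (*) b ` B) \<union> ((*) b ` A + (*) a ` B))" (is "_ \<le> card ?U")
proof (rule ccontr)
  assume "\<not> ?thesis"
  then have Uc: "card ?U \<le> card A + card B" by simp
  have p11: "11 \<le> CARD('p)"
  proof -
    have "10 \<le> CARD('p)" using A3 B3 sz by linarith
    moreover have "\<not> prime (10::nat)" by simp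
    then have "CARD('p) \<noteq> 10" using prime_card[where 'a = 'p] by metis
    ultimately show ?thesis by simp
  qed
  have p13: "CARD('p) = 11 \<or> 13 \<le> CARD('p)"
  proof -
    have "\<not> prime (12::nat)" by simp
    then have "CARD('p) \<noteq> 12" using prime_card[where 'a = 'p] by metis
    then show ?thesis using p11 by linarith
  qed
  have "card A + card B \<le> card (UNIV :: 'p mod_ring set)" using sz by simp
  \<comment> \<open>Padding to exactly \<open>card A + card B\<close> elements, as
    \<open>crit\<close> demands.\<close>
  then obtain U where U: "?U \<subseteq> U" "card U = card A + card B"
    using exists_subset_between[OF Uc, of UNIV] by auto
  define W where "W = uminus ` (- U)"
  have Wc: "card W + card A + card B = CARD('p)" unfolding W_def using U(2) sz by (simp add: card_Compl_finite)
  have W4: "4 \<le> card W" using Wc sz by linarith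
  have cs: "card ((*) a ` A) = card A" "card ((*) b ` B) = card B" "card ((*) b ` A) = card A" "card ((*) a ` B) = card B"
    using ab by simp_all
  have zf: "x + y + w \<noteq> 0" if "x + y \<in> U" "w \<in> W" for x y w
  proof
    assume "x + y + w = 0"
    then have "w = - (x + y)" by (metis add.commute minus_unique)
    then have "- w = x + y" by simp
    moreover have "- w \<in> - U" using that(2) by (auto simp: W_def)
    ultimately show False using that(1) by simp
  qed
  have c1: "crit ((*) a ` A) ((*) b ` B) W" unfolding crit_def
  proof (intro conjI ballI)
    fix x y w assume "x \<in> (*) a ` A" "y \<in> (*) b ` B" "w \<in> W"
    moreover from this have "x + y \<in> U" using U(1) set_plus_intro[of x _ y] by blast
    ultimately show "x + y + w \<noteq> 0" using zf by blast
  qed (use cs Wc in simp)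
  have c2: "crit ((*) b ` A) ((*) a ` B) W" unfolding crit_def
  proof (intro conjI ballI)
    fix x y w assume "x \<in> (*) b ` A" "y \<in> (*) a ` B" "w \<in> W"
    moreover from this have "x + y \<in> U" using U(1) set_plus_intro[of x _ y] by blast
    ultimately show "x + y + w \<noteq> 0" using zf by blast
  qed (use cs Wc in simp)
  have abd: "d / b \<noteq> d / a" "d / b \<noteq> - (d / a)" "b * d \<noteq> a * d" "b * d \<noteq> - (a * d)" if "d \<noteq> 0" for d
  proof -
    show "d / b \<noteq> d / a" "b * d \<noteq> a * d" using ab that by simp_all
    show n: "b * d \<noteq> - (a * d)"
    proof
      assume "b * d = - (a * d)"
      then have "b * d = (- a) * d" by simp
      then have "b = - a" by (simp only: mult_right_cancel[OF that])
      then show False using ab by simp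
    qed
    show "d / b \<noteq> - (d / a)"
    proof
      assume e: "d / b = - (d / a)"
      have "d * a = (d / b) * (a * b)" using ab by simp
      also have "\<dots> = - (d * b)" unfolding e using ab by simp
      finally have "a * d = - (b * d)" by (simp only: mult.commute)
      then have "- (a * d) = b * d" by simp
      then show False using n by simp
    qed
  qed
  have ne: "A \<noteq> {}" "B \<noteq> {}" "W \<noteq> {}" using A3 B3 W4 by auto
  have napW: "nap W"
  proof (rule ccontr)
    assume "\<not> nap W"
    then obtain d where d: "d \<noteq> 0" "bd d W \<le> 1" unfolding nap_def by fastforce
    have "near d ((*) a ` A)"
      by (rule near_of_ap_sum[OF d]) (use W4 ne cs crit_sum_card[OF crit_perm(2)[OF c1]] Wc A3 B3 sz in auto)
    moreover have "near d ((*) b ` A)"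
      by (rule near_of_ap_sum[OF d]) (use W4 ne cs crit_sum_card[OF crit_perm(2)[OF c2]] Wc A3 B3 sz in auto)
    ultimately have "near (d / a) A" "near (d / b) A" using ab by (simp_all add: near_iff_scale)
    then have "d / b = d / a \<or> d / b = - (d / a)"
      by (rule near_direction) (use d ab A3 B3 sz p11 in auto)
    then show False using abd d by blast
  qed
  have nearW: False if "d \<noteq> 0" "near (a * d) W" "near (b * d) W" for d
  proof -
    have "b * d = a * d \<or> b * d = - (a * d)"
      by (rule near_direction[OF that(2,3)]) (use that ab A3 B3 W4 Wc p11 in auto)
    then show False using abd that by blast
  qed
  have napA: "nap A"
  proof (rule ccontr)
    assume "\<not> nap A"
    then obtain d where d: "d \<noteq> 0" "bd d A \<le> 1" unfolding nap_def by fastforce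
    have b: "bd (a * d) ((*) a ` A) \<le> 1" "bd (b * d) ((*) b ` A) \<le> 1" using d ab by (simp_all add: bd_scale)
    have "near (a * d) W"
      by (rule near_of_ap_sum[OF _ b(1)]) (use W4 ne cs crit_sum_card[OF crit_perm(3)[OF crit_perm(1)[OF c1]]]
          crit_sum_card[OF crit_perm(1)[OF crit_perm(2)[OF c1]]] Wc A3 B3 sz ab d in auto)
    moreover have "near (b * d) W"
      by (rule near_of_ap_sum[OF _ b(2)]) (use W4 ne cs crit_sum_card[OF crit_perm(1)[OF crit_perm(2)[OF c2]]] Wc A3 B3 sz ab d in auto)
    ultimately show False using nearW d by blast
  qed
  have napB: "nap B"
  proof (rule ccontr)
    assume "\<not> nap B"
    then obtain d where d: "d \<noteq> 0" "bd d B \<le> 1" unfolding nap_def by fastforce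
    have b: "bd (a * d) ((*) a ` B) \<le> 1" "bd (b * d) ((*) b ` B) \<le> 1" using d ab by (simp_all add: bd_scale)
    have "near (a * d) W"
      by (rule near_of_ap_sum[OF _ b(1)]) (use W4 ne cs crit_sum_card[OF crit_perm(1)[OF crit_perm(2)[OF crit_perm(1)[OF c2]]]] Wc A3 B3 sz ab d in auto)
    moreover have "near (b * d) W"
      by (rule near_of_ap_sum[OF _ b(2)]) (use W4 ne cs crit_sum_card[OF crit_perm(1)[OF crit_perm(2)[OF crit_perm(1)[OF c1]]]] Wc A3 B3 sz ab d in auto)
    ultimately show False using nearW d by blast
  qed
  have napm: "nap ((*) a ` A)" "nap ((*) b ` B)" "nap ((*) b ` A)" "nap ((*) a ` B)"
    using napA napB ab by (simp_all add: nap_scale)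
  show False
  proof (cases "card A = 3 \<and> card B = 3")
    case True
    have c6: "card U = 6" using U(2) True by simp
    have l: "6 \<le> card ((*) a ` A + (*) b ` B)" "6 \<le> card ((*) b ` A + (*) a ` B)"
    proof -
      have s: "card ((*) a ` A + (*) b ` B) \<le> 6" "card ((*) b ` A + (*) a ` B) \<le> 6"
        using U(1) c6 card_mono[of U "(*) a ` A + (*) b ` B"] card_mono[of U "(*) b ` A + (*) a ` B"] by simp_all
      show "6 \<le> card ((*) a ` A + (*) b ` B)" "6 \<le> card ((*) b ` A + (*) a ` B)"
        using nap_sum_ge[OF napm(2), of "(*) a ` A"] nap_sum_ge[OF napm(4), of "(*) b ` A"] cs True p11 s by simp_all
    qed
    have "(*) a ` A + (*) b ` B = U" "(*) b ` A + (*) a ` B = U"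
      using U(1) c6 l by (intro card_seteq; simp)+
    then show False
      using pair_sum_three_contra[OF dis napA _ napB _ ab _ _ p11] True c6 by simp
  next
    case False
    then have s7: "7 \<le> card A + card B" using A3 B3 by linarith
    obtain d where d: "d \<noteq> 0" "bd d W \<le> 2"
      using crit_two_atom[OF c1 napW] cs A3 B3 s7 by auto
    have c1': "crit ((*) b ` B) ((*) a ` A) W" "crit ((*) a ` B) ((*) b ` A) W"
      using crit_perm(1) c1 c2 by blast+
    have tA: "bd e ((*) a ` A) \<le> 2" "bd e ((*) b ` A) \<le> 2" if "bd e W \<le> 2" for e
      using crit_transfer[OF c1 napm(2) _ W4 that] crit_transfer[OF c2 napm(4) _ W4 that] cs A3 by simp_all
    have tB: "bd e ((*) b ` B) \<le> 2" "bd e ((*) a ` B) \<le> 2" if "bd e W \<le> 2" for e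
      using crit_transfer[OF c1'(1) napm(1) _ W4 that] crit_transfer[OF c1'(2) napm(3) _ W4 that] cs B3 by simp_all
    \<comment> \<open>One scaled copy of a class receives the direction from \<open>W\<close>, the
      other copy has it multiplied by \<open>u\<close> and returns it to \<open>W\<close>. The
      return requires a class of four elements.\<close>
    have "\<exists>u. (u = b / a \<or> u = a / b) \<and> (\<forall>e. bd e W \<le> 2 \<longrightarrow> bd (u * e) W \<le> 2)"
    proof (cases "4 \<le> card A")
      case True
      have "bd (b / a * e) W \<le> 2" if e: "bd e W \<le> 2" for e
      proof -
        have "bd e ((*) a ` A) \<le> 2" by (rule tA[OF e])
        then have "bd (e / a) A \<le> 2" using ab by (simp add: bd_scale')
        then have "bd (b / a * e) ((*) b ` A) \<le> 2" using ab by (simp add: bd_scale')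
        then show ?thesis
          using crit_transfer[OF crit_perm(3)[OF c2] napm(4)] W4 True cs by simp
      qed
      then show ?thesis by blast
    next
      case f: False
      then have B4: "4 \<le> card B" using s7 by linarith
      have "bd (a / b * e) W \<le> 2" if e: "bd e W \<le> 2" for e
      proof -
        have "bd e ((*) b ` B) \<le> 2" by (rule tB[OF e])
        then have "bd (e / b) B \<le> 2" using ab by (simp add: bd_scale')
        then have "bd (a / b * e) ((*) a ` B) \<le> 2" using ab by (simp add: bd_scale')
        then show ?thesis
          using crit_transfer[OF crit_perm(3)[OF c1'(2)] napm(3)] W4 B4 cs by simp
      qed
      then show ?thesis by blast
    qed
    then obtain u where u: "u = b / a \<or> u = a / b" "\<And>e. bd e W \<le> 2 \<Longrightarrow> bd (u * e) W \<le> 2" by blast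
    have u0: "u \<noteq> 0" "u \<noteq> 1" using u(1) ab by auto
    have um: "u \<noteq> - 1"
    proof
      assume um: "u = - 1"
      have "b = u * a \<or> a = u * b" using u(1) ab by auto
      then show False using um ab by auto
    qed
    have pw: "bd (u ^ k * d) W \<le> 2" for k
    proof (induction k)
      case (Suc k)
      then show ?case using u(2)[OF Suc] by (simp add: mult.assoc)
    qed (use d in simp)
    have pA: "bd (u ^ k * d) ((*) a ` A) \<le> 2" "bd (u ^ k * d) ((*) b ` B) \<le> 2" for k
      using tA tB pw by blast+
    show False
    proof (cases "CARD('p) = 11 \<or> 5 \<le> card W")
      case True
      show False
        by (rule rotation_contra[OF u0 um d(1) pw]) (use True Wc W4 A3 B3 p13 in linarith)
    next
      \<comment> \<open>For \<open>p >= 13\<close> a set \<open>W\<close> of four elements is too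
        small for \<open>rotation_contra\<close>; but then one class has at least five, and it
        inherits all the directions.\<close>
      case False
      then have W: "card W = 4" "13 \<le> CARD('p)" using W4 p13 by auto
      then have "5 \<le> card A \<or> 5 \<le> card B" using Wc by linarith
      then show False
      proof
        assume "5 \<le> card A"
        then show False using rotation_contra[OF u0 um d(1) pA(1)] W Wc cs A3 B3 by simp
      next
        assume "5 \<le> card B"
        then show False using rotation_contra[OF u0 um d(1) pA(2)] W Wc cs A3 B3 by simp
      qed
    qed
  qed
qed

section \<open>Progressions with a common difference\<close>

lemma bd_le1_unique:
  fixes X :: "'a::{ab_group_add,finite} set"
  assumes "bd d X \<le> 1" "x \<in> X" "x + d \<notin> X" "y \<in> X" "y + d \<notin> X"
  shows "x = y"
proof -
  have "card {x \<in> X. x + d \<notin> X} \<le> Suc 0" using assms(1) by (simp add: bd_def)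
  moreover have "finite {x \<in> X. x + d \<notin> X}" by simp
  ultimately show ?thesis using card_le_Suc0_iff_eq assms(2-5) by blast
qed

lemma bd_le1_I:
  fixes X :: "'a::{ab_group_add,finite} set"
  assumes "\<And>x y. x \<in> X \<Longrightarrow> x + d \<notin> X \<Longrightarrow> y \<in> X \<Longrightarrow> y + d \<notin> X \<Longrightarrow> x = y"
  shows "bd d X \<le> 1"
proof -
  have "card {x \<in> X. x + d \<notin> X} \<le> Suc 0"
    by (subst card_le_Suc0_iff_eq, simp, use assms in blast)
  then show ?thesis by (simp add: bd_def)
qed

text \<open>If the end points of both sets were distinct exits of the union, neither would lie in
  the intersection, which would then be closed under adding \<open>d\<close>.\<close>

lemma ap_union:
  fixes I J :: "'p::prime_card mod_ring set"
  assumes d: "d \<noteq> 0" and I: "bd d I \<le> 1" and J: "bd d J \<le> 1" and ne: "I \<inter> J \<noteq> {}"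
  shows "bd d (I \<union> J) \<le> 1"
proof -
  have key: False if x: "x \<in> I" "x + d \<notin> I \<union> J" and y: "y \<in> J" "y + d \<notin> I \<union> J" and "x \<noteq> y" for x y
  proof -
    have nx: "x \<notin> J" using bd_le1_unique[OF J, of x y] x y that(5) by blast
    have ny: "y \<notin> I" using bd_le1_unique[OF I, of x y] x y that(5) by blast
    have "w + d \<in> I \<inter> J" if w: "w \<in> I \<inter> J" for w
    proof
      show "w + d \<in> I" using bd_le1_unique[OF I, of x w] x w nx by blast
      show "w + d \<in> J" using bd_le1_unique[OF J, of y w] y w ny by blast
    qed
    then have "I \<inter> J = UNIV" using ne d by (intro translation_closed[of _ d]) auto
    then show False using nx by blast
  qed
  show ?thesis
  proof (rule bd_le1_I)
    fix x y assume xy: "x \<in> I \<union> J" "x + d \<notin> I \<union> J" "y \<in> I \<union> J" "y + d \<notin> I \<union> J"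
    show "x = y"
    proof (rule ccontr)
      assume n: "x \<noteq> y"
      have "\<not> (x \<in> I \<and> y \<in> I)" using bd_le1_unique[OF I, of x y] xy n by blast
      moreover have "\<not> (x \<in> J \<and> y \<in> J)" using bd_le1_unique[OF J, of x y] xy n by blast
      ultimately have "x \<in> I \<and> y \<in> J \<or> y \<in> I \<and> x \<in> J" using xy by blast
      then show False using key[of x y] key[of y x] xy n by blast
    qed
  qed
qed

lemma ap_rep:
  fixes Y :: "'p::prime_card mod_ring set"
  assumes b: "bd d Y \<le> 1" and d: "d \<noteq> 0" and Y: "Y \<noteq> {}" "Y \<noteq> UNIV"
  obtains x where "Y = (\<lambda>i. x + of_nat i * d) ` {..<card Y}"
proof -
  let ?Z = "(*) (1 / d) ` Y"
  have Yc: "card Y < CARD('p)" using Y(2) psubset_card_mono[of UNIV Y] by auto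
  have cZ: "card ?Z = card Y" using d by (intro card_scale) simp
  have "bd 1 ?Z = bd d Y" using bd_scale'[of "1 / d" 1 Y] d by simp
  then have "bd 1 ?Z \<le> 1" using b by simp
  moreover have "?Z \<noteq> {}" using Y by simp
  moreover have "?Z \<noteq> UNIV"
  proof
    assume "?Z = UNIV"
    then have "card ?Z = CARD('p)" by simp
    then show False using cZ Yc by simp
  qed
  ultimately obtain x where x: "?Z = (\<lambda>i. x + of_nat i) ` {..<card ?Z}" by (rule interval_of_bd)
  have "Y = (*) d ` ?Z" using d by (simp add: image_image)
  also have "\<dots> = (*) d ` (\<lambda>i. x + of_nat i) ` {..<card Y}" by (subst x) (simp only: cZ)
  also have "\<dots> = (\<lambda>i. x * d + of_nat i * d) ` {..<card Y}" by (simp add: image_image distrib_left mult.commute)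
  finally show ?thesis by (rule that)
qed

lemma ap_reflect:
  fixes J :: "'p::prime_card mod_ring set"
  assumes "bd d J \<le> 1" "d \<noteq> 0"
  obtains t where "uminus ` J = (+) t ` J"
proof (cases "J = {} \<or> J = UNIV")
  case True
  then show ?thesis
  proof
    assume "J = {}" then show thesis using that[of 0] by simp
  next
    assume J: "J = UNIV"
    have "uminus ` J = UNIV" using J by (metis surj_uminus)
    then show thesis using that[of 0] J by simp
  qed
next
  case False
  then obtain x where x: "J = (\<lambda>i. x + of_nat i * d) ` {..<card J}" using ap_rep[OF assms] by blast
  define t where "t = - x - x - of_nat (card J - 1) * d"
  have "uminus ` J \<subseteq> (+) t ` J"
  proof
    fix y assume "y \<in> uminus ` J"
    then have "- y \<in> J" by auto
    then obtain i where i: "i < card J" "- y = x + of_nat i * d" by (subst (asm) x) auto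
    have "y = - (x + of_nat i * d)" using i(2) by (metis minus_minus)
    moreover have "of_nat (card J - 1) = of_nat (card J - 1 - i) + (of_nat i :: 'p mod_ring)"
      using i(1) by (simp flip: of_nat_add)
    ultimately have "y = t + (x + of_nat (card J - 1 - i) * d)" by (simp add: t_def algebra_simps)
    moreover have "x + of_nat (card J - 1 - i) * d \<in> J"
      by (subst x) (rule imageI, use i(1) in simp)
    ultimately show "y \<in> (+) t ` J" by blast
  qed
  then have "uminus ` J = (+) t ` J" by (intro card_subset_eq) auto
  then show ?thesis by (rule that)
qed

text \<open>Progressions are near-progressions; for sets too large for \<open>near_direction\<close>
  the complement is used.\<close>

lemma ap_direction:
  fixes X :: "'p::prime_card mod_ring set"
  assumes "bd d X \<le> 1" "bd e X \<le> 1" "d \<noteq> 0" "e \<noteq> 0" "3 \<le> card X" "card X + 3 \<le> CARD('p)" "11 \<le> CARD('p)"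
  shows "e = d \<or> e = - d"
proof (cases "card X + 6 \<le> CARD('p)")
  case True
  have "X \<noteq> {}" using assms by auto
  then show ?thesis using near_direction[of d X e] near_ap[of d X] near_ap[of e X] assms True by blast
next
  case False
  have c: "card (- X) = CARD('p) - card X" using card_Compl_finite[of X] by simp
  have s: "3 \<le> card (- X)" "card (- X) + 6 \<le> CARD('p)" using c assms False by linarith+
  have "- X \<noteq> {}" using s by auto
  then show ?thesis using near_direction[of d "- X" e] near_ap[of d "- X"] near_ap[of e "- X"] assms s by simp
qed

text \<open>Suppose \<open>V\<close> is a progression \<open>J\<close> without a point
  \<open>t\<close>. By symmetry \<open>V\<close> is the intersection of \<open>J\<close> with
  \<open>- J\<close>, a translate of \<open>J\<close> by some \<open>s\<close>, and hence a
  translate of \<open>J\<close> eroded by \<open>s\<close>. Only one point is lost, so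
  \<open>s\<close> is \<open>d\<close> or \<open>- d\<close>, and this erosion is again a
  progression.\<close>

lemma near_symmetric:
  fixes V :: "'p::prime_card mod_ring set"
  assumes sym: "uminus ` V = V" and n: "near d V" and d: "d \<noteq> 0" and V: "0 \<in> V" "2 \<le> card V" "card V + 4 \<le> CARD('p)"
    and p: "11 \<le> CARD('p)"
  shows "bd d V \<le> 1"
proof -
  obtain t where t: "bd d (insert t V) \<le> 1" using n by (auto simp: near_def)
  show ?thesis
  proof (cases "t \<in> V")
    case True
    then show ?thesis using t by (simp add: insert_absorb)
  next
    case False
    let ?J = "insert t V"
    have cJ: "card ?J = card V + 1" using False by simp
    obtain s where s: "uminus ` ?J = (+) s ` ?J" using ap_reflect[OF t d] by blast
    have J': "uminus ` ?J = insert (- t) V" using sym by simp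
    have tt: "- t \<noteq> t"
    proof
      assume "- t = t"
      then have "t + t = 0" by (metis add.right_inverse)
      then have "of_nat 2 * t = 0" by (simp only: of_nat_numeral mult_2)
      moreover have "(of_nat 2 :: 'p mod_ring) \<noteq> 0" using p by (intro of_nat_mod_ring_neq_0) auto
      ultimately have "t = 0" by (simp only: mult_eq_0_iff simp_thms)
      then show False using False V by simp
    qed
    have "- t \<notin> V"
    proof
      assume "- t \<in> V" then have "- (- t) \<in> uminus ` V" by (rule imageI)
      then show False using sym False by simp
    qed
    then have VJ: "V = ?J \<inter> uminus ` ?J" unfolding J' using tt tt[symmetric] False by blast
    have Ve: "V = (+) s ` erode s ?J"
    proof
      show "V \<subseteq> (+) s ` erode s ?J"
      proof
        fix x assume x: "x \<in> V"
        then have "x \<in> (+) s ` ?J" using VJ s by blast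
        then obtain y where y: "y \<in> ?J" "x = s + y" by blast
        then have "y \<in> erode s ?J" using x by (simp add: erode_def add.commute)
        then show "x \<in> (+) s ` erode s ?J" using y by blast
      qed
      show "(+) s ` erode s ?J \<subseteq> V"
      proof
        fix x assume "x \<in> (+) s ` erode s ?J"
        then obtain y where y: "y \<in> ?J" "y + s \<in> ?J" "x = s + y" by (auto simp: erode_def)
        then have "x \<in> ?J" "x \<in> (+) s ` ?J" by (simp_all only: add.commute imageI)
        then show "x \<in> V" using VJ s by blast
      qed
    qed
    have ce: "card V = card (erode s ?J)" by (subst Ve) (rule card_translate)
    then have "bd s ?J \<le> 1" using card_erode[of s ?J] cJ by linarith
    moreover have "s \<noteq> 0"
    proof
      assume "s = 0"
      moreover have "erode 0 ?J = ?J" by (auto simp: erode_def)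
      ultimately show False using ce cJ by simp
    qed
    ultimately have "s = d \<or> s = - d" using ap_direction[OF t _ d] V cJ p by simp
    then have "bd d (erode s ?J) \<le> 1"
    proof
      assume "s = d" then show ?thesis using bd_erode_le[of d ?J] t by simp
    next
      assume "s = - d" then show ?thesis using bd_erode_le[of "- d" ?J] t by simp
    qed
    then show ?thesis by (subst Ve) (simp only: bd_translate)
  qed
qed

section \<open>Symmetric sets and their runs\<close>

lemma bd_ap_le: "bd d ((\<lambda>i. of_int i * d) ` {a..b}) \<le> 1" for d :: "'a::{comm_ring_1,finite}"
proof -
  have e: "x = of_int b * d" if h: "x \<in> (\<lambda>i. of_int i * d) ` {a..b}" "x + d \<notin> (\<lambda>i. of_int i * d) ` {a..b}" for x
  proof -
    obtain i where i: "i \<in> {a..b}" "x = of_int i * d" using h(1) by blast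
    have "x + d = of_int (i + 1) * d" using i(2) by (simp add: algebra_simps)
    then have "i + 1 \<notin> {a..b}" using h(2) by blast
    then have "i = b" using i(1) by simp
    then show ?thesis using i by simp
  qed
  show ?thesis by (rule bd_le1_I) (use e in metis)
qed

lemma symmetric_run:
  fixes V :: "'p::prime_card mod_ring set"
  assumes sym: "uminus ` V = V" and V: "0 \<in> V" "V \<noteq> UNIV"
  obtains r :: nat where "of_int ` {- int r..int r} \<subseteq> V" "of_nat (Suc r) \<notin> V" "- of_nat (Suc r) \<notin> V" "2 * r + 1 < CARD('p)"
proof -
  have neg: "- x \<in> V \<longleftrightarrow> x \<in> V" for x
  proof -
    have "- y \<in> V" if "y \<in> V" for y using sym that by (metis imageI)
    from this[of x] this[of "- x"] show ?thesis by auto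
  qed
  have ex: "\<exists>n. of_nat (Suc n) \<notin> V"
  proof -
    obtain y where y: "y \<notin> V" using V(2) by blast
    obtain n where n: "y = of_nat n" using ex_of_nat_translate[of y 0] by auto
    have "n \<noteq> 0"
    proof
      assume "n = 0" then show False using n y V by simp
    qed
    then obtain k where "n = Suc k" by (cases n) auto
    then show ?thesis using n y by blast
  qed
  define r where "r = (LEAST n. of_nat (Suc n) \<notin> V)"
  have r: "of_nat (Suc r) \<notin> V" using LeastI_ex[OF ex] by (simp only: r_def not_False_eq_True)
  have le: "of_nat n \<in> V" if "n \<le> r" for n
  proof (cases n)
    case (Suc k)
    then show ?thesis using not_less_Least[of k "\<lambda>n. of_nat (Suc n) \<notin> V"] that by (auto simp only: r_def Suc_le_eq)
  qed (use V in simp)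
  have sub: "of_int ` {- int r..int r} \<subseteq> V"
  proof
    fix x :: "'p mod_ring" assume "x \<in> of_int ` {- int r..int r}"
    then obtain i where i: "- int r \<le> i" "i \<le> int r" "x = of_int i" by auto
    show "x \<in> V"
    proof (cases "0 \<le> i")
      case True
      then have "x = of_nat (nat i)" using i(3) by (simp add: of_nat_nat)
      then show ?thesis using le[of "nat i"] i by simp
    next
      case False
      then have "- x = of_nat (nat (- i))" using i(3) by (simp add: of_nat_nat)
      then have "- x \<in> V" using le[of "nat (- i)"] i by simp
      then show ?thesis using neg by blast
    qed
  qed
  have "2 * r + 1 < CARD('p)"
  proof (rule ccontr)
    assume big: "\<not> ?thesis"
    have "y \<in> V" for y
    proof -
      obtain i where i: "i < CARD('p)" "y = - of_nat r + of_nat i" using ex_of_nat_translate by blast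
      have "y = of_int (int i - int r)" using i(2) by simp
      moreover have "int i - int r \<in> {- int r..int r}" using i(1) big by auto
      ultimately show ?thesis using sub by blast
    qed
    then show False using V by blast
  qed
  then show ?thesis using that sub r neg by blast
qed

lemma card_of_int_interval:
  assumes "2 * r + 1 \<le> CARD('p)"
  shows "card (of_int ` {- int r..int r} :: 'p::prime_card mod_ring set) = 2 * r + 1"
proof -
  have "inj_on (of_int :: int \<Rightarrow> 'p mod_ring) {- int r..int r}"
  proof (rule inj_onI)
    fix i j assume ij: "i \<in> {- int r..int r}" "j \<in> {- int r..int r}" "(of_int i :: 'p mod_ring) = of_int j"
    then have "(of_int (i - j) :: 'p mod_ring) = 0" by simp
    then have "int CARD('p) dvd i - j" by (simp only: of_int_mod_ring_eq_0_iff)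
    moreover have "\<bar>i - j\<bar> < int CARD('p)" using ij assms by auto
    ultimately show "i = j" using zdvd_not_zless[of "\<bar>i - j\<bar>" "int CARD('p)"] by auto
  qed
  then show ?thesis by (simp add: card_image)
qed

lemma symmetric_interval:
  fixes V :: "'p::prime_card mod_ring set"
  assumes sym: "uminus ` V = V" and V: "0 \<in> V" "V \<noteq> UNIV" and b: "bd 1 V \<le> 1"
  obtains r :: nat where "V = of_int ` {- int r..int r}" "card V = 2 * r + 1"
proof -
  obtain r :: nat where r: "of_int ` {- int r..int r} \<subseteq> V" "of_nat (Suc r) \<notin> V" "- of_nat (Suc r) \<notin> V" "2 * r + 1 < CARD('p)"
    using symmetric_run[OF sym V] .
  let ?I = "of_int ` {- int r..int r} :: 'p mod_ring set"
  have rI: "of_int (int r) \<in> ?I" by (rule imageI) simp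
  have ex: "of_int (int r) \<in> V" "of_int (int r) + 1 \<notin> V" using r(1,2) rI by (auto simp: add.commute)
  have "V - ?I = {}"
  proof (rule ccontr)
    assume ne: "V - ?I \<noteq> {}"
    have "y + 1 \<in> V - ?I" if y: "y \<in> V - ?I" for y
    proof
      have "y \<noteq> of_int (int r)" using y rI by blast
      then show "y + 1 \<in> V" using bd_le1_unique[OF b _ _ ex] y by blast
      show "y + 1 \<notin> ?I"
      proof
        assume "y + 1 \<in> ?I"
        then obtain i where i: "i \<in> {- int r..int r}" "y + 1 = of_int i" by blast
        then have yi: "y = of_int (i - 1)" by (simp add: eq_diff_eq)
        have "i - 1 \<notin> {- int r..int r}" using y yi by blast
        then have "i = - int r" using i(1) by auto
        then have "y = - of_nat (Suc r)" using yi by simp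
        then show False using r(3) y by blast
      qed
    qed
    then have "V - ?I = UNIV" using ne by (intro translation_closed[of _ 1]) auto
    then show False using V by blast
  qed
  then have "V = ?I" using r(1) by blast
  then show ?thesis using that[of r] card_of_int_interval[of r, where 'p = 'p] r(4) by simp
qed

text \<open>An interval of \<open>n\<close> points arises from a single point by adding
  \<open>{0, 1}\<close> exactly \<open>n - 1\<close> times. Each time the size grows by the current
  boundary, which never increases; so its last and first values bound the growth from both
  sides.\<close>

lemma card_plus_interval:
  fixes A :: "'p::prime_card mod_ring set"
  assumes "n \<ge> 1"
  shows "card A + (n - 1) * bd 1 (A + (\<lambda>i. x + of_nat i) ` {..<n}) \<le> card (A + (\<lambda>i. x + of_nat i) ` {..<n})
    \<and> card (A + (\<lambda>i. x + of_nat i) ` {..<n}) \<le> card A + (n - 1) * bd 1 A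
    \<and> bd 1 (A + (\<lambda>i. x + of_nat i) ` {..<n}) \<le> bd 1 A"
  using assms
proof (induction n rule: dec_induct)
  case base
  have "A + {x} = (+) x ` A" by (auto simp: set_plus_def add.commute)
  moreover have "(\<lambda>i. x + of_nat i) ` {..<1} = {x}" by auto
  ultimately show ?case by simp
next
  case (step n)
  let ?P = "\<lambda>n. (\<lambda>i. x + of_nat i :: 'p mod_ring) ` {..<n}"
  have P: "?P (Suc n) = ?P n + {0, 1}"
  proof
    show "?P n + {0, 1} \<subseteq> ?P (Suc n)"
    proof
      fix y assume "y \<in> ?P n + {0, 1}"
      then obtain i e where i: "i < n" "e \<in> {0, 1}" "y = x + of_nat i + e" by (auto elim!: set_plus_elim)
      then have "y = x + of_nat i \<or> y = x + of_nat (Suc i)" by (auto simp: add_ac)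
      then show "y \<in> ?P (Suc n)" using i(1) by (metis imageI lessThan_iff less_SucI Suc_less_eq)
    qed
    show "?P (Suc n) \<subseteq> ?P n + {0, 1}"
    proof
      fix y assume "y \<in> ?P (Suc n)"
      then obtain i where i: "i < Suc n" "y = x + of_nat i" by blast
      show "y \<in> ?P n + {0, 1}"
      proof (cases "i < n")
        case True
        then have "(x + of_nat i) + 0 \<in> ?P n + {0, 1}" by (intro set_plus_intro) auto
        then show ?thesis using i by simp
      next
        case False
        then have n1: "i = Suc (n - 1)" "n - 1 < n" using i(1) step(1) by auto
        have "x + of_nat (n - 1) \<in> ?P n" by (rule imageI) (use n1 in simp)
        then have "(x + of_nat (n - 1)) + 1 \<in> ?P n + {0, 1}" by (intro set_plus_intro) auto
        moreover have "y = (x + of_nat (n - 1)) + 1" unfolding i(2) by (subst n1(1)) (simp only: of_nat_Suc ac_simps)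
        ultimately show ?thesis by simp
      qed
    qed
  qed
  have AP: "A + ?P (Suc n) = (A + ?P n) + {0, 1}" by (simp only: P add.assoc)
  have c: "card (A + ?P (Suc n)) = card (A + ?P n) + bd 1 (A + ?P n)" by (simp only: AP card_plus_pair)
  have b: "bd 1 (A + ?P (Suc n)) \<le> bd 1 (A + ?P n)" unfolding AP by (rule bd_plus_pair_le)
  obtain m where m: "n = Suc m" using step(1) by (cases n) auto
  have mb: "m * bd 1 (A + ?P (Suc n)) \<le> m * bd 1 (A + ?P n)" using b by (rule mult_le_mono2)
  have k: "Suc n - 1 = Suc m" "n - 1 = m" using m by simp_all
  show ?case unfolding k mult_Suc using step.IH[unfolded k] c b mb by linarith
qed

lemma nap_D: "nap X \<Longrightarrow> d \<noteq> 0 \<Longrightarrow> \<not> bd d X \<le> 1"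
  unfolding nap_def by fastforce

text \<open>The long run \<open>P\<close> makes \<open>A + P\<close> a single interval. If all
  translates \<open>a + Q\<close> met it, \<open>A + V\<close> would be a progression and so would
  \<open>B\<close>. Hence some \<open>a + Q\<close> lies apart, and \<open>A + P\<close> is smaller
  than \<open>A + V\<close> by at least \<open>card Q\<close>, which suffices to make
  \<open>A\<close> near a progression.\<close>

lemma crit_near_of_long_run:
  fixes A :: "'p::prime_card mod_ring set"
  assumes crit: "crit A B V" and napV: "nap V" and napB: "nap B" and A: "3 \<le> card A" and B: "3 \<le> card B"
    and V: "V = P \<union> Q" "P \<inter> Q = {}" and P: "bd 1 P \<le> 1" and Q: "bd 1 Q \<le> 1" "Q \<noteq> {}"
    and PQ: "card Q + 3 \<le> card P"
  shows "near 1 A"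
proof -
  have ne: "A \<noteq> {}" "P \<noteq> {}" "P \<noteq> UNIV" using A PQ V(2) Q(2) by auto
  have fin: "finite (X :: 'p mod_ring set)" for X by simp
  have cV: "card V = card P + card Q" unfolding V(1) using V(2) by (intro card_Un_disjoint) auto
  have sizes: "card A + card B + card V = CARD('p)" using crit by (simp add: crit_def)
  have AV: "card (A + V) \<le> card A + card V" using crit_sum_card[OF crit_perm(2)[OF crit]] .
  obtain x where x: "P = (\<lambda>i. x + of_nat i) ` {..<card P}" using interval_of_bd[OF P ne(2,3)] .
  have lowP: "card A + (card P - 1) * bd 1 (A + P) \<le> card (A + P)"
    using card_plus_interval[of "card P" A x] x PQ by simp
  have "A + P \<subseteq> A + V" unfolding V(1) by (intro set_plus_mono2) auto
  then have AP: "card (A + P) \<le> card (A + V)" by (intro card_mono fin)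
  \<comment> \<open>Two pieces would make \<open>A + P\<close> at least
    \<open>2 * card P - 2\<close> larger than \<open>A\<close>, more than \<open>card V\<close>
    because of the margin 3.\<close>
  have bP: "bd 1 (A + P) \<le> 1"
  proof (rule ccontr)
    assume "\<not> ?thesis"
    then have "(card P - 1) * 2 \<le> (card P - 1) * bd 1 (A + P)" by (intro mult_le_mono) auto
    then show False using lowP AP AV cV PQ by linarith
  qed
  have "card (A + V) \<ge> card A + card V"
    using nap_sum_ge[OF napV, of A] A B AV sizes by linarith
  then have cAV: "card (A + V) = card A + card V" using AV by simp
  have sub: "A + V \<subseteq> - (uminus ` B)" using crit_sum_subset[OF crit_perm(2)[OF crit]] .
  have "card (- (uminus ` B)) = card A + card V"
    using sizes card_Compl_finite[of "uminus ` B"] by simp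
  then have AVB: "A + V = - (uminus ` B)" using sub cAV by (intro card_subset_eq) auto
  have "\<exists>a\<in>A. ({a} + Q) \<inter> (A + P) = {}"
  proof (rule ccontr)
    assume "\<not> ?thesis"
    then have meet: "({a} + Q) \<inter> (A + P) \<noteq> {}" if "a \<in> A" for a using that by blast
    have u: "bd 1 ((A + P) \<union> (T + Q)) \<le> 1" if "finite T" "T \<subseteq> A" for T
      using that
    proof (induction T rule: finite_induct)
      case empty
      have "{} + Q = {}" by simp
      then show ?case using bP by simp
    next
      case (insert a T)
      have e: "(A + P) \<union> (insert a T + Q) = ((A + P) \<union> (T + Q)) \<union> ({a} + Q)"
        by (auto simp: set_plus_def)
      have "{a} + Q = (+) a ` Q" by (auto simp: set_plus_def)
      then have m1: "bd 1 ({a} + Q) \<le> 1" using Q(1) by simp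
      have m2: "((A + P) \<union> (T + Q)) \<inter> ({a} + Q) \<noteq> {}" using meet[of a] insert.prems by blast
      have "bd 1 ((A + P) \<union> (T + Q)) \<le> 1" using insert by simp
      then show ?case unfolding e by (rule ap_union[OF one_neq_zero _ m1 m2])
    qed
    have "(A + P) \<union> (A + Q) = A + V" unfolding V(1) by (auto simp: set_plus_def)
    then have "bd 1 (- (uminus ` B)) \<le> 1" using u[of A] AVB by simp
    then have "bd 1 B \<le> 1" by simp
    then show False using napB nap_D by (metis zero_neq_one)
  qed
  then obtain a where a: "a \<in> A" "({a} + Q) \<inter> (A + P) = {}" by blast
  have "{a} + Q \<subseteq> A + V" unfolding V(1) using a(1) by (intro set_plus_mono2) auto
  then have "({a} + Q) \<union> (A + P) \<subseteq> A + V" using \<open>A + P \<subseteq> A + V\<close> by blast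
  then have "card (({a} + Q) \<union> (A + P)) \<le> card (A + V)" by (intro card_mono fin)
  moreover have "card (({a} + Q) \<union> (A + P)) = card ({a} + Q) + card (A + P)"
    using a(2) by (intro card_Un_disjoint fin)
  moreover have "card ({a} + Q) = card Q"
  proof -
    have "{a} + Q = (+) a ` Q" by (auto simp: set_plus_def)
    then show ?thesis by simp
  qed
  ultimately have "card (A + P) \<le> card A + card P" using cAV cV by linarith
  moreover have "card A + card P < CARD('p)" "card A + 4 \<le> CARD('p)" "3 \<le> card P" using sizes cV PQ B by linarith+
  ultimately show ?thesis using near_of_ap_sum[of 1 P A] P ne by simp
qed

text \<open>In units of \<open>1 / 2\<close> the points near 0 are even multiples and the points
  near \<open>p / 2\<close> are odd ones, so two runs of matching lengths interleave to one
  progression.\<close>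

lemma half_progression:
  fixes V :: "'p::prime_card mod_ring set"
  assumes r: "V0 = of_int ` {- int r..int r}" and V1: "V1 = - (of_int ` {- int s..int s})"
    and V: "V = V0 \<union> V1" and q: "2 * s + 1 + 2 * q = CARD('p)" and cV: "card V = 2 * m + 1"
    and m: "2 * r \<le> m" "2 * q \<le> m + 1" and p: "2 < CARD('p)"
  shows "\<not> nap V"
proof -
  define h :: "'p mod_ring" where "h = 1 / 2"
  have two: "(2 :: 'p mod_ring) \<noteq> 0" using of_nat_mod_ring_neq_0[where n = 2 and 'p = 'p] p by simp
  have h: "2 * h = 1" "h \<noteq> 0" using two by (simp_all add: h_def)
  let ?W = "(\<lambda>i. of_int i * h) ` {- int m..int m}"
  have c: "card ?W \<le> 2 * m + 1"
    using card_image_le[of "{- int m..int m}" "\<lambda>i. of_int i * h"] by simp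
  have "V \<subseteq> ?W"
  proof
    fix y assume "y \<in> V"
    then consider "y \<in> V0" | "y \<in> V1" using V by blast
    then show "y \<in> ?W"
    proof cases
      case 1
      then obtain i where i: "- int r \<le> i" "i \<le> int r" "y = of_int i" unfolding r by auto
      have "y = of_int (2 * i) * h" using h(1) i(3) by (simp add: mult.assoc mult.left_commute[of 2])
      moreover have "2 * i \<in> {- int m..int m}" using i m(1) by auto
      ultimately show ?thesis by blast
    next
      case 2
      obtain j where j: "j < CARD('p)" "y = of_nat j" using ex_of_nat_translate[of y 0] by auto
      have "\<not> j \<le> s"
      proof
        assume "j \<le> s"
        then have "int j \<in> {- int s..int s}" by simp
        then have "(of_int (int j) :: 'p mod_ring) \<in> of_int ` {- int s..int s}" by (rule imageI)
        then show False using 2 j(2) V1 by simp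
      qed
      moreover have "\<not> CARD('p) - j \<le> s"
      proof
        assume "CARD('p) - j \<le> s"
        then have "int j - int CARD('p) \<in> {- int s..int s}" using j(1) by auto
        then have "(of_int (int j - int CARD('p)) :: 'p mod_ring) \<in> of_int ` {- int s..int s}" by (rule imageI)
        then show False using 2 j(2) V1 by (simp add: of_nat_card_eq_0)
      qed
      ultimately have rng: "2 * int j - int CARD('p) \<in> {- int m..int m}" using q m(2) j(1) by auto
      have "of_int (2 * int j - int CARD('p)) * h = of_nat j * (2 * h)"
        by (simp add: of_nat_card_eq_0 mult.assoc mult.left_commute)
      then have "y = of_int (2 * int j - int CARD('p)) * h" using h(1) j(2) by simp
      then show ?thesis using rng by blast
    qed
  qed
  then have "V = ?W" using c cV by (intro card_seteq) auto
  then have "bd h V \<le> 1" using bd_ap_le[of h "- int m" "int m"] by simp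
  then show ?thesis using h(2) nap_D by blast
qed

text \<open>Symmetry leaves a run of odd length \<open>2 r + 1\<close> centred at 0 and an opposite
  run of even length \<open>2 q\<close>. For \<open>q = r\<close> and \<open>q = r + 1\<close> they
  interleave to a progression; in all other cases the lengths differ by at least three.\<close>

lemma symmetric_two_runs:
  fixes V :: "'p::prime_card mod_ring set"
  assumes sym: "uminus ` V = V" and V: "0 \<in> V" "V \<noteq> UNIV" and b: "bd 1 V \<le> 2" and napV: "nap V" and p: "2 < CARD('p)"
  obtains P Q where "V = P \<union> Q" "P \<inter> Q = {}" "bd 1 P \<le> 1" "bd 1 Q \<le> 1" "Q \<noteq> {}" "card Q + 3 \<le> card P"
proof -
  obtain r :: nat where r: "of_int ` {- int r..int r} \<subseteq> V" "of_nat (Suc r) \<notin> V" "- of_nat (Suc r) \<notin> V" "2 * r + 1 < CARD('p)"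
    using symmetric_run[OF sym V] .
  define V0 :: "'p mod_ring set" where "V0 = of_int ` {- int r..int r}"
  define V1 where "V1 = V - V0"
  have V01: "V = V0 \<union> V1" "V0 \<inter> V1 = {}" using r(1) by (auto simp: V0_def V1_def)
  have c0: "card V0 = 2 * r + 1" unfolding V0_def using r(4) by (intro card_of_int_interval) simp
  have b0: "bd 1 V0 \<le> 1" using bd_ap_le[of "1 :: 'p mod_ring" "- int r" "int r"] by (simp add: V0_def)
  have rI: "of_int (int r) \<in> V0" unfolding V0_def by (rule imageI) simp
  have b1: "bd 1 V1 \<le> 1"
  proof -
    let ?E = "{x \<in> V. x + 1 \<notin> V}"
    have rE: "of_int (int r) \<in> ?E" using r(2) rI V01(1) by (auto simp: add.commute)
    have "{x \<in> V1. x + 1 \<notin> V1} \<subseteq> ?E - {of_int (int r)}"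
    proof
      fix y assume y: "y \<in> {x \<in> V1. x + 1 \<notin> V1}"
      have "y + 1 \<notin> V0"
      proof
        assume "y + 1 \<in> V0"
        then obtain i where i: "i \<in> {- int r..int r}" "y + 1 = of_int i" unfolding V0_def by blast
        then have yi: "y = of_int (i - 1)" by (simp add: eq_diff_eq)
        have "y \<notin> V0" using y by (simp add: V1_def)
        then have "i - 1 \<notin> {- int r..int r}" using yi unfolding V0_def by blast
        then have "i = - int r" using i(1) by auto
        then have "y = - of_nat (Suc r)" using yi by simp
        then show False using r(3) y by (simp add: V1_def)
      qed
      then show "y \<in> ?E - {of_int (int r)}" using y rI V01 by blast
    qed
    then have "card {x \<in> V1. x + 1 \<notin> V1} \<le> card (?E - {of_int (int r)})" by (intro card_mono) auto
    also have "\<dots> = card ?E - 1" using rE by (intro card_Diff_singleton)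
    finally show ?thesis using b by (simp add: bd_def)
  qed
  have two: "2 \<le> bd e V" if "e \<noteq> 0" for e using napV that by (simp add: nap_def)
  have ne1: "V1 \<noteq> {}"
  proof
    assume "V1 = {}"
    then have "bd 1 V \<le> 1" using b0 V01(1) by simp
    then show False using two[of 1] by simp
  qed
  have negV: "- x \<in> V" if "x \<in> V" for x using sym that by (metis imageI)
  have neg0: "- x \<in> V0" if "x \<in> V0" for x
  proof -
    obtain i where i: "i \<in> {- int r..int r}" "x = of_int i" using \<open>x \<in> V0\<close> unfolding V0_def by blast
    have "- x = of_int (- i)" "- i \<in> {- int r..int r}" using i by auto
    then show ?thesis unfolding V0_def by blast
  qed
  let ?W = "- V1"
  have sW: "- x \<in> ?W" if "x \<in> ?W" for x
  proof
    assume "- x \<in> V1"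
    then have "- x \<in> V" "- x \<notin> V0" by (simp_all add: V1_def)
    then have "x \<in> V" "x \<notin> V0" using negV[of "- x"] neg0[of x] by auto
    then show False using that by (simp add: V1_def)
  qed
  have symW: "uminus ` ?W = ?W"
  proof
    show "uminus ` ?W \<subseteq> ?W" using sW by blast
    show "?W \<subseteq> uminus ` ?W"
    proof
      fix x assume "x \<in> ?W"
      then have "- (- x) \<in> uminus ` ?W" by (intro imageI sW)
      then show "x \<in> uminus ` ?W" by simp
    qed
  qed
  have "(of_int 0 :: 'p mod_ring) \<in> V0" unfolding V0_def by (rule imageI) simp
  then have "0 \<in> V0" by simp
  then have W0: "0 \<in> ?W" using V01(2) by blast
  have WU: "?W \<noteq> UNIV" using ne1 by blast
  have bW: "bd 1 ?W \<le> 1" using b1 by simp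
  obtain s :: nat where s: "?W = of_int ` {- int s..int s}" "card ?W = 2 * s + 1"
    using symmetric_interval[OF symW W0 WU bW] .
  have V1s: "V1 = - (of_int ` {- int s..int s})" using s(1) by blast
  have cW: "card ?W + card V1 = CARD('p)"
    using card_Compl_finite[of V1] card_le_CARD[of V1] by simp
  have "odd CARD('p)" using prime_odd_nat[OF prime_card[where 'a = 'p]] p by linarith
  then have "even (card V1)" using cW s(2) by (metis even_add odd_even_add odd_two_times_div_two_succ even_mult_iff dvd_triv_left odd_one)
  then obtain q where q: "card V1 = 2 * q" by (elim evenE)
  have sq: "2 * s + 1 + 2 * q = CARD('p)" using cW s(2) q by simp
  have cV: "card V = (2 * r + 1) + 2 * q"
    unfolding V01(1) using card_Un_disjoint[of V0 V1] V01(2) c0 q by simp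
  have "q \<noteq> r"
  proof
    assume "q = r"
    then have "card V = 2 * (2 * r) + 1" using cV by simp
    then show False using half_progression[OF V0_def V1s V01(1) sq, of "2 * r"] napV p \<open>q = r\<close> by simp
  qed
  moreover have "q \<noteq> r + 1"
  proof
    assume "q = r + 1"
    then have "card V = 2 * (2 * r + 1) + 1" using cV by simp
    then show False using half_progression[OF V0_def V1s V01(1) sq, of "2 * r + 1"] napV p \<open>q = r + 1\<close> by simp
  qed
  ultimately consider "q + 1 \<le> r" | "r + 2 \<le> q" by linarith
  then show thesis
  proof cases
    case 1
    then show thesis using that[of V0 V1] V01 b0 b1 ne1 c0 q by simp
  next
    case 2
    have "V0 \<noteq> {}" using rI by blast
    then show thesis using that[of V1 V0] V01 b0 b1 c0 q 2 by (simp add: Un_commute Int_commute)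
  qed
qed

lemma near_nap_cover:
  fixes A :: "'p::prime_card mod_ring set"
  assumes "near 1 A" "nap A" "card A + 2 \<le> CARD('p)"
  obtains x where "A \<subseteq> (\<lambda>i. x + of_nat i) ` {..<card A + 1}" "bd 1 ((\<lambda>i. x + of_nat i :: 'p mod_ring) ` {..<card A + 1}) \<le> 1"
proof -
  obtain t where t: "bd 1 (insert t A) \<le> 1" using assms(1) by (auto simp: near_def)
  have "t \<notin> A"
  proof
    assume "t \<in> A"
    then have "bd 1 A \<le> 1" using t by (simp add: insert_absorb)
    then show False using assms(2) nap_D by (metis zero_neq_one)
  qed
  then have c: "card (insert t A) = card A + 1" by simp
  then have "insert t A \<noteq> UNIV" using assms(3) by auto
  then obtain x where "insert t A = (\<lambda>i. x + of_nat i) ` {..<card (insert t A)}"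
    using interval_of_bd[OF t] by blast
  then show ?thesis using that[of x] t c by auto
qed

text \<open>\<open>A\<close> and \<open>- B\<close> lie in intervals one longer than themselves,
  whose sum \<open>J\<close> exceeds the complement of \<open>V\<close> by a single point
  \<open>w\<close>. Symmetry gives \<open>w = 0\<close>, so \<open>J\<close> is an interval centred
  at 0, wide enough to contain \<open>A - A\<close> as well. Then \<open>A - (A \<union> B)\<close>
  lies in \<open>J\<close>, against Cauchy-Davenport.\<close>

lemma diffs_nap_contra:
  fixes A B V :: "'p::prime_card mod_ring set"
  assumes dis: "A \<inter> B = {}" and napA: "nap A" and napB: "nap B" and napV: "nap V"
    and crit: "crit A (uminus ` B) V" and sym: "uminus ` V = V" and V0: "0 \<in> V"
    and b: "bd 1 V \<le> 2" and A: "3 \<le> card A" and AB: "card A \<le> card B" and V: "7 \<le> card V"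
  shows False
proof -
  have p: "2 < CARD('p)" using crit A by (simp add: crit_def)
  have sizes: "card A + card B + card V = CARD('p)" using crit by (simp add: crit_def)
  have VU: "V \<noteq> UNIV" using sizes A by auto
  have fin: "finite (X :: 'p mod_ring set)" for X by simp
  have napB': "nap (uminus ` B)" using napB by (simp add: nap_def)
  have negV: "- x \<in> V" if "x \<in> V" for x using sym that by (metis imageI)
  obtain P Q where PQ: "V = P \<union> Q" "P \<inter> Q = {}" "bd 1 P \<le> 1" "bd 1 Q \<le> 1" "Q \<noteq> {}" "card Q + 3 \<le> card P"
    using symmetric_two_runs[OF sym V0 VU b napV p] .
  have nA: "near 1 A" using crit_near_of_long_run[OF crit napV napB' A _ PQ] AB A by simp
  have nB: "near 1 (uminus ` B)" using crit_near_of_long_run[OF crit_perm(1)[OF crit] napV napA _ _ PQ] AB A by simp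
  obtain x where x: "A \<subseteq> (\<lambda>i. x + of_nat i) ` {..<card A + 1}" "bd 1 ((\<lambda>i. x + of_nat i :: 'p mod_ring) ` {..<card A + 1}) \<le> 1"
    using near_nap_cover[OF nA napA] sizes V by auto
  obtain y where y: "uminus ` B \<subseteq> (\<lambda>i. y + of_nat i) ` {..<card B + 1}" "bd 1 ((\<lambda>i. y + of_nat i :: 'p mod_ring) ` {..<card B + 1}) \<le> 1"
    using near_nap_cover[OF nB napB'] sizes V by auto
  let ?I = "(\<lambda>i. x + of_nat i :: 'p mod_ring) ` {..<card A + 1}" and ?K = "(\<lambda>i. y + of_nat i :: 'p mod_ring) ` {..<card B + 1}"
  define J where "J = ?K + ?I"
  have cK: "card ?K \<le> card B + 1" using card_image_le[of "{..<card B + 1}"] by fastforce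
  have "card J \<le> card ?K + card A * bd 1 ?K" using card_plus_interval[of "card A + 1" ?K x] by (simp add: J_def)
  moreover have "card A * bd 1 ?K \<le> card A" using y(2) mult_le_mono2[of "bd 1 ?K" 1 "card A"] by simp
  ultimately have cJ: "card J \<le> card A + card B + 1" using cK by linarith
  have "bd 1 J \<le> bd 1 ?K * bd 1 ?I" unfolding J_def by (rule bd_plus_le)
  also have "\<dots> \<le> 1 * 1" using x(2) y(2) by (intro mult_le_mono)
  finally have bJ: "bd 1 J \<le> 1" by simp
  have "A + uminus ` B \<subseteq> J" unfolding J_def using x(1) y(1) by (subst add.commute) (rule set_plus_mono2)
  moreover have sub: "A + uminus ` B \<subseteq> - V"
  proof -
    have "A + uminus ` B \<subseteq> - (uminus ` V)" by (rule crit_sum_subset[OF crit])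
    then show ?thesis by (simp only: sym)
  qed
  moreover have "A + uminus ` B = - V"
  proof -
    have c: "card (A + uminus ` B) \<le> card A + card (uminus ` B)" by (rule crit_sum_card[OF crit])
    have "card A + card (uminus ` B) \<le> card (A + uminus ` B)"
      using nap_sum_ge[OF napB', of A] c A V sizes by simp
    then show ?thesis using sub sizes by (intro card_seteq) (simp_all add: card_Compl_finite)
  qed
  ultimately have VJ: "- V \<subseteq> J" by simp
  define K where "K = - J"
  have KV: "K \<subseteq> V" using VJ by (auto simp: K_def)
  have bK: "bd 1 K \<le> 1" using bJ by (simp add: K_def)
  have KneV: "K \<noteq> V" using napV bK nap_D by (metis zero_neq_one)
  have cKK: "card V \<le> card K + 1" using cJ sizes card_le_CARD[of J] by (simp add: K_def card_Compl_finite)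
  have "card (V - K) \<le> 1" using cKK KV by (simp add: card_Diff_subset)
  moreover have "V - K \<noteq> {}" using KV KneV by blast
  ultimately obtain w where w: "V - K = {w}" by (metis card_0_eq card_1_singletonE fin le_neq_implies_less less_one)
  have VK: "V = insert w K" "w \<notin> K" using w KV by blast+
  \<comment> \<open>For any other \<open>w\<close>, \<open>V\<close> would be the union of the
    intersecting progressions \<open>K\<close> and \<open>- K\<close>.\<close>
  have w0: "w = 0"
  proof (rule ccontr)
    assume wn: "w \<noteq> 0"
    have 0: "0 \<in> K" using V0 VK wn by blast
    have "- w \<noteq> w"
    proof
      assume "- w = w"
      then have "w + w = 0" by (metis add.right_inverse)
      then have "of_nat 2 * w = 0" by (simp only: of_nat_numeral mult_2)
      moreover have "(of_nat 2 :: 'p mod_ring) \<noteq> 0" using p by (intro of_nat_mod_ring_neq_0) auto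
      ultimately show False using wn by (simp only: mult_eq_0_iff simp_thms)
    qed
    then have "- w \<in> K" using negV[of w] VK by blast
    then have wK: "w \<in> uminus ` K" by (metis imageI minus_minus)
    have "uminus ` K \<subseteq> V" using KV negV by blast
    then have "V = K \<union> uminus ` K" using VK wK by blast
    moreover have "bd 1 (K \<union> uminus ` K) \<le> 1"
    proof (rule ap_union)
      have "- 0 \<in> uminus ` K" using 0 by (rule imageI)
      then show "K \<inter> uminus ` K \<noteq> {}" using 0 by auto
    qed (use bK in simp_all)
    ultimately have "bd 1 V \<le> 1" by simp
    then show False using napV nap_D by (metis zero_neq_one)
  qed
  have Jin: "z \<in> J \<longleftrightarrow> z = 0 \<or> z \<notin> V" for z using VK w0 by (auto simp: K_def)
  have "uminus ` J = J"
  proof -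
    have n: "- z \<in> J" if "z \<in> J" for z using that negV[of "- z"] by (auto simp: Jin)
    have "z \<in> uminus ` J" if "z \<in> J" for z using n[OF that] by (metis imageI minus_minus)
    then show ?thesis using n by blast
  qed
  moreover have "0 \<in> J" by (simp add: Jin)
  moreover have JU: "J \<noteq> UNIV"
  proof
    assume "J = UNIV"
    then have "K = {}" by (simp add: K_def)
    then show False using cKK V by simp
  qed
  ultimately obtain r :: nat where r: "J = of_int ` {- int r..int r}" "card J = 2 * r + 1"
    using symmetric_interval[OF _ _ _ bJ] by blast
  have "card J = card A + card B + 1"
  proof -
    have "card K = card V - 1" using VK by simp
    then have "card K + 1 = card V" using V by simp
    moreover have "card K + card J = CARD('p)" using card_le_CARD[of J] by (simp add: K_def card_Compl_finite)
    ultimately show ?thesis using sizes by linarith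
  qed
  \<comment> \<open>Here \<open>2 * r = card A + card B\<close>, and \<open>A\<close> is not the
    larger class.\<close>
  then have Ar: "card A \<le> r" using r(2) AB by linarith
  have AA: "a - a' \<in> J" if a: "a \<in> A" "a' \<in> A" for a a'
  proof -
    obtain i where i: "i < card A + 1" "a = x + of_nat i" using a x(1) by blast
    obtain j where j: "j < card A + 1" "a' = x + of_nat j" using a x(1) by blast
    have "a - a' = of_int (int i - int j)" using i j by simp
    moreover have "int i - int j \<in> {- int r..int r}" using i(1) j(1) Ar by auto
    ultimately show ?thesis unfolding r(1) by blast
  qed
  have "A + uminus ` (A \<union> B) \<subseteq> J"
  proof
    fix z assume "z \<in> A + uminus ` (A \<union> B)"
    then obtain a m where am: "z = a + m" "a \<in> A" "m \<in> uminus ` (A \<union> B)" by (rule set_plus_elim)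
    then obtain c where "c \<in> A \<union> B" "m = - c" by blast
    then have ac: "a \<in> A" "c \<in> A \<union> B" "z = a + - c" using am by simp_all
    show "z \<in> J"
    proof (cases "c \<in> A")
      case True
      then show ?thesis using AA[of a c] ac by simp
    next
      case False
      then have "z \<in> A + uminus ` B" unfolding ac(3) using ac(1,2) by (intro set_plus_intro imageI) blast+
      then show ?thesis using \<open>A + uminus ` B \<subseteq> J\<close> by blast
    qed
  qed
  then have c1: "card (A + uminus ` (A \<union> B)) \<le> card J" by (intro card_mono fin)
  have "card J < CARD('p)" using JU psubset_card_mono[of UNIV J] by auto
  then have "card A + card (uminus ` (A \<union> B)) \<le> card (A + uminus ` (A \<union> B)) + 1"
    using c1 A by (intro cauchy_davenport_less) auto
  moreover have "card (uminus ` (A \<union> B)) = card A + card B" using dis by (simp add: card_Un_disjoint)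
  ultimately show False using c1 \<open>card J = card A + card B + 1\<close> A by linarith
qed

lemma near_reflect: "near d (uminus ` X) \<longleftrightarrow> near d X" for X :: "'a::{ab_group_add,finite} set"
proof -
  have r: "near d (uminus ` Y)" if n: "near d Y" for Y :: "'a set"
  proof -
    obtain t where "bd d (insert t Y) \<le> 1" using n by (auto simp: near_def)
    then have "bd d (uminus ` insert t Y) \<le> 1" by (simp only: bd_reflect)
    then show ?thesis by (auto simp: near_def)
  qed
  have "uminus ` uminus ` X = X" by (simp add: image_image)
  then show ?thesis using r[of X] r[of "uminus ` X"] by auto
qed

lemma crit_scale:
  fixes c :: "'a::{field,finite}"
  assumes "c \<noteq> 0" "crit X Y Z" shows "crit ((*) c ` X) ((*) c ` Y) ((*) c ` Z)"
proof -
  have "c * x + c * y + c * z \<noteq> 0" if "x \<in> X" "y \<in> Y" "z \<in> Z" for x y z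
  proof -
    have "c * x + c * y + c * z = c * (x + y + z)" by (simp add: distrib_left)
    moreover have "x + y + z \<noteq> 0" using assms(2) that by (simp add: crit_def)
    ultimately show ?thesis using assms(1) by simp
  qed
  then show ?thesis using assms by (auto simp: crit_def)
qed

lemma uminus_image_eqI:
  fixes X :: "'a::ab_group_add set"
  assumes "\<And>x. x \<in> X \<Longrightarrow> - x \<in> X" shows "uminus ` X = X"
proof
  show "uminus ` X \<subseteq> X" using assms by blast
  show "X \<subseteq> uminus ` X"
  proof
    fix x assume "x \<in> X"
    then have "- (- x) \<in> uminus ` X" by (intro imageI assms)
    then show "x \<in> uminus ` X" by simp
  qed
qed

text \<open>Scaling by \<open>1 / d\<close> makes the difference 1, and negating the triple
  exchanges the classes if \<open>A\<close> is larger.\<close>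

lemma diffs_nap_contra_scaled:
  fixes A B V :: "'p::prime_card mod_ring set"
  assumes dis: "A \<inter> B = {}" and nap: "nap A" "nap B" "nap V"
    and crit: "crit A (uminus ` B) V" and sym: "uminus ` V = V" and V0: "0 \<in> V"
    and d: "d \<noteq> 0" and b: "bd d V \<le> 2" and A: "3 \<le> card A" and B: "3 \<le> card B" and V: "7 \<le> card V"
  shows False
proof -
  let ?s = "(*) (1 / d)"
  have c: "1 / d \<noteq> 0" using d by simp
  have main: False if h: "X \<inter> Y = {}" "nap X" "nap Y" "crit X (uminus ` Y) V" "3 \<le> card X" "card X \<le> card Y" for X Y
  proof (rule diffs_nap_contra)
    have inj: "inj ?s" using c by (simp add: inj_on_def)
    show "?s ` X \<inter> ?s ` Y = {}" using image_Int[OF inj, of X Y] h(1) by simp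
    show "nap (?s ` X)" "nap (?s ` Y)" "nap (?s ` V)" using nap_scale[OF c] h nap(3) by blast+
    have e: "?s ` uminus ` Y = uminus ` ?s ` Y" by (simp add: image_image)
    show "crit (?s ` X) (uminus ` ?s ` Y) (?s ` V)" using crit_scale[OF c h(4)] by (simp only: e)
    have "uminus ` ?s ` V = ?s ` uminus ` V" by (simp add: image_image)
    then show "uminus ` ?s ` V = ?s ` V" by (simp only: sym)
    have "1 / d * 0 \<in> ?s ` V" using V0 by (rule imageI)
    then show "0 \<in> ?s ` V" by simp
    show "bd 1 (?s ` V) \<le> 2" using bd_scale'[OF c, of 1 V] b d by simp
    show "3 \<le> card (?s ` X)" "card (?s ` X) \<le> card (?s ` Y)" "7 \<le> card (?s ` V)"
      using h V by (simp_all only: card_scale[OF c])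
  qed
  show False
  proof (cases "card A \<le> card B")
    case True
    then show False using main[of A B] dis nap crit A by blast
  next
    case False
    have "crit B (uminus ` A) V" unfolding crit_def
    proof (intro conjI ballI)
      fix x y z assume h: "x \<in> B" "y \<in> uminus ` A" "z \<in> V"
      have "- z \<in> V" using sym h(3) by (metis imageI)
      moreover have "- y \<in> A" using h(2) by auto
      moreover have "- x \<in> uminus ` B" using h(1) by (rule imageI)
      ultimately have f: "- y + - x + - z \<noteq> 0" using crit unfolding crit_def by blast
      have e: "- y + - x + - z = - (x + y + z)" by simp
      show "x + y + z \<noteq> 0"
      proof
        assume "x + y + z = 0"
        then have "- y + - x + - z = 0" unfolding e by simp
        then show False using f by blast
      qed
    qed (use crit in \<open>simp add: crit_def\<close>)
    then show False using main[of B A] dis nap B False by (simp add: Int_commute)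
  qed
qed

section \<open>Difference sets of two colors\<close>

text \<open>The values of the coefficients \<open>1, - 1\<close> on two classes in both orders.
  Symmetry under negation and, for disjoint classes, the absence of 0 are the extra information that
  coefficients \<open>c, - c\<close> provide.\<close>

definition diffs :: "'a::ab_group_add set \<Rightarrow> 'a set \<Rightarrow> 'a set" where
  "diffs A B = (A + uminus ` B) \<union> (B + uminus ` A)"

lemma diffs_commute: "diffs A B = diffs B A"
  by (auto simp: diffs_def)

lemma diffs_iff: "x \<in> diffs A B \<longleftrightarrow> (\<exists>a\<in>A. \<exists>b\<in>B. x = a - b \<or> x = b - a)"
proof
  assume "x \<in> diffs A B"
  then consider "x \<in> A + uminus ` B" | "x \<in> B + uminus ` A" by (auto simp: diffs_def)
  then show "\<exists>a\<in>A. \<exists>b\<in>B. x = a - b \<or> x = b - a"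
  proof cases
    case 1
    then obtain a m where "x = a + m" "a \<in> A" "m \<in> uminus ` B" by (rule set_plus_elim)
    moreover from this obtain b where "b \<in> B" "m = - b" by blast
    ultimately have "a \<in> A" "b \<in> B" "x = a - b" by simp_all
    then show ?thesis by blast
  next
    case 2
    then obtain a m where "x = a + m" "a \<in> B" "m \<in> uminus ` A" by (rule set_plus_elim)
    moreover from this obtain b where "b \<in> A" "m = - b" by blast
    ultimately have "b \<in> A" "a \<in> B" "x = a - b" by simp_all
    then show ?thesis by blast
  qed
next
  assume "\<exists>a\<in>A. \<exists>b\<in>B. x = a - b \<or> x = b - a"
  then obtain a b where ab: "a \<in> A" "b \<in> B" "x = a + - b \<or> x = b + - a" by auto
  have "a + - b \<in> A + uminus ` B" "b + - a \<in> B + uminus ` A" using ab(1,2) by (intro set_plus_intro imageI; simp)+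
  then show "x \<in> diffs A B" using ab(3) by (auto simp: diffs_def)
qed

lemma uminus_diffs: "uminus ` diffs A B = diffs A B"
proof (rule uminus_image_eqI)
  fix x assume "x \<in> diffs A B"
  then obtain a b where "a \<in> A" "b \<in> B" "x = a - b \<or> x = b - a" by (auto simp: diffs_iff)
  then have "- x = b - a \<or> - x = a - b" by auto
  then show "- x \<in> diffs A B" using \<open>a \<in> A\<close> \<open>b \<in> B\<close> by (auto simp: diffs_iff)
qed

lemma zero_notin_diffs: "A \<inter> B = {} \<Longrightarrow> 0 \<notin> diffs A B"
  by (auto simp: diffs_iff)

lemma crit_diffs:
  fixes A :: "'a::{ab_group_add,finite} set"
  assumes "card (diffs A B) = card A + card B"
  shows "crit A (uminus ` B) (- diffs A B)"
  unfolding crit_def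
proof (intro conjI ballI)
  fix x y z assume h: "x \<in> A" "y \<in> uminus ` B" "z \<in> - diffs A B"
  show "x + y + z \<noteq> 0"
  proof
    assume "x + y + z = 0"
    then have "z = - (x + y)" by (metis add.commute minus_unique)
    moreover have "x + y \<in> diffs A B" using h by (auto simp: diffs_def intro: set_plus_intro)
    ultimately have "z \<in> diffs A B" using uminus_diffs[of A B] by (metis imageI)
    then show False using h by simp
  qed
next
  show "card A + card (uminus ` B) + card (- diffs A B) = CARD('a)"
    using assms card_le_CARD[of "diffs A B"] by (simp add: card_Compl_finite)
qed

text \<open>The complement of the difference set is near a progression by the critical triple, and
  symmetry with 0 as an element improves this to a progression.\<close>

lemma diffs_ap_case:
  fixes A B :: "'p::prime_card mod_ring set"
  assumes dis: "A \<inter> B = {}" and A: "3 \<le> card A" and B: "3 \<le> card B" and sz: "card A + card B + 7 \<le> CARD('p)"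
    and U: "card (diffs A B) = card A + card B" and d: "d \<noteq> 0" "bd d A \<le> 1"
  shows "bd d (diffs A B) \<le> 1 \<and> near d A \<and> near d B"
proof -
  let ?V = "- diffs A B"
  have crit: "crit A (uminus ` B) ?V" using crit_diffs[OF U] .
  have V: "card ?V + card A + card B = CARD('p)" using U card_le_CARD[of "diffs A B"] by (simp add: card_Compl_finite)
  have ne: "A \<noteq> {}" "?V \<noteq> {}" "uminus ` B \<noteq> {}" using A B V sz by auto
  have s: "card ?V + card A < CARD('p)" "card ?V + 4 \<le> CARD('p)" "2 \<le> card ?V" "11 \<le> CARD('p)"
    "card (uminus ` B) + card A < CARD('p)" "card (uminus ` B) + 4 \<le> CARD('p)"
    using V A B sz card_uminus[of B] by linarith+
  have "near d ?V"
    by (rule near_of_ap_sum[OF d A ne(2) _ s(1,2)])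
      (rule crit_sum_card[OF crit_perm(1)[OF crit_perm(2)[OF crit]]])
  moreover have "uminus ` ?V = ?V"
  proof (rule uminus_image_eqI)
    fix x assume "x \<in> ?V"
    moreover have "x \<in> diffs A B" if "- x \<in> diffs A B"
      using imageI[OF that, of uminus] uminus_diffs[of A B] by simp
    ultimately show "- x \<in> ?V" by blast
  qed
  moreover have "0 \<in> ?V" using zero_notin_diffs[OF dis] by simp
  ultimately have "bd d ?V \<le> 1" using near_symmetric[of ?V d] d(1) s by blast
  then have "bd d (diffs A B) \<le> 1" by simp
  moreover have "near d A" using d ne by (simp add: near_ap)
  moreover have "near d (uminus ` B)"
    by (rule near_of_ap_sum[OF d A ne(3) _ s(5,6)]) (rule crit_sum_card[OF crit_perm(1)[OF crit]])
  ultimately show ?thesis by (simp only: near_reflect)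
qed

text \<open>\<open>- B\<close> is the translate of \<open>A\<close> by some \<open>t\<close>. Moving
  \<open>A\<close> by \<open>t / 2\<close> gives \<open>A0\<close> with \<open>A0 + A0\<close> equal
  to the symmetric set \<open>diffs A B\<close>. Its six distinct elements add up to
  \<open>4 (x + y + z)\<close>, which must be its own negative; so \<open>A0\<close> has sum 0 and
  \<open>symmetric_triple_contra\<close> applies.\<close>

lemma diffs_three_contra:
  fixes A B :: "'p::prime_card mod_ring set"
  assumes A: "card A = 3" "nap A" and B: "card B = 3" "nap B" and U: "card (diffs A B) = 6" and p: "11 \<le> CARD('p)"
  shows False
proof -
  have pn: "(of_nat n :: 'p mod_ring) \<noteq> 0" if "0 < n" "n < 11" for n
    using of_nat_mod_ring_neq_0[where n = n and 'p = 'p] that p by simp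
  have n2: "(2 :: 'p mod_ring) \<noteq> 0" and n8: "(8 :: 'p mod_ring) \<noteq> 0" using pn[of 2] pn[of 8] by simp_all
  have nB: "nap (uminus ` B)" "card (uminus ` B) = 3" using B by (simp_all add: nap_def)
  have sub: "A + uminus ` B \<subseteq> diffs A B" by (simp add: diffs_def)
  then have c6: "card (A + uminus ` B) \<le> 6" using card_mono[OF finite sub] U by simp
  moreover have "6 \<le> card (A + uminus ` B)" using nap_sum_ge[OF nB(1), of A] A nB c6 p by simp
  ultimately have eq: "A + uminus ` B = diffs A B" using sub U by (intro card_seteq) auto
  obtain t where t: "uminus ` B = (+) t ` A" using nap3_translate[OF A(2,1) nB c6] p by auto
  define s where "s = t / 2"
  have ss: "s + s = t" using n2 by (simp add: s_def field_simps)
  define A0 where "A0 = (+) s ` A"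
  have A0: "nap A0" "card A0 = 3" unfolding A0_def using A by (simp_all only: nap_translate card_translate)
  have "A0 + A0 = (+) s ` (A + (+) s ` A)" by (simp only: A0_def translate_plus)
  also have "A + (+) s ` A = (+) s ` (A + A)" by (metis translate_plus add.commute)
  also have "(+) s ` (+) s ` (A + A) = (+) t ` (A + A)"
    unfolding image_image by (rule image_cong) (simp_all add: add.assoc[symmetric] ss)
  also have "\<dots> = A + uminus ` B" unfolding t by (metis translate_plus add.commute)
  finally have S: "A0 + A0 = diffs A B" using eq by simp
  obtain x y z where xyz: "A0 = {x, y, z}" using A0(2) by (auto simp: card_3_iff)
  let ?L = "[x + x, y + y, z + z, x + y, x + z, y + z]"
  have SL: "A0 + A0 = set ?L" unfolding xyz by (auto simp: set_plus_def add.commute)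
  then have "card (set ?L) = length ?L" using S U by simp
  then have dL: "distinct ?L" by (rule card_distinct)
  have sum: "\<Sum>(A0 + A0) = sum_list ?L" unfolding SL using sum_list_distinct_conv_sum_set[OF dL, of id] by simp
  have "\<Sum>(uminus ` (A0 + A0)) = - \<Sum>(A0 + A0)"
    by (simp add: sum.reindex sum_negf)
  moreover have "uminus ` (A0 + A0) = A0 + A0" unfolding S by (rule uminus_diffs)
  ultimately have "sum_list ?L = - sum_list ?L" using sum by simp
  then have "sum_list ?L + sum_list ?L = 0" by (metis add.right_inverse)
  moreover have "sum_list ?L + sum_list ?L = 8 * (x + y + z)" by (simp add: algebra_simps)
  ultimately have "8 * (x + y + z) = 0" by metis
  then have zero: "x + y + z = 0" using n8 by (metis mult_eq_0_iff)
  have "- w \<in> A0 + A0" if "w \<in> A0 + A0" for w using uminus_diffs[of A B] that unfolding S by (metis imageI)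
  then show False using symmetric_triple_contra[of x y z] A0 zero p unfolding xyz by blast
qed

text \<open>Below \<open>card A + card B\<close> the direction comes from Vosper's theorem. At
  equality \<open>A\<close>, \<open>- B\<close> and the complement form a critical triple; a
  progression among them supplies the direction, and three non-progressions are impossible.\<close>

lemma diffs_near_of_card:
  fixes A B :: "'p::prime_card mod_ring set"
  assumes dis: "A \<inter> B = {}" and A: "3 \<le> card A" and B: "3 \<le> card B" and sz: "card A + card B + 7 \<le> CARD('p)"
    and U: "card (diffs A B) \<le> card A + card B"
  shows "\<exists>d. d \<noteq> 0 \<and> bd d (diffs A B) \<le> 1 \<and> near d A \<and> near d B"
proof -
  have p: "11 \<le> CARD('p)" using A B sz by linarith
  have sub: "A + uminus ` B \<subseteq> diffs A B" by (simp add: diffs_def)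
  have cs: "card (A + uminus ` B) \<le> card (diffs A B)" by (rule card_mono[OF finite sub])
  have ne: "A \<noteq> {}" "B \<noteq> {}" using A B by auto
  have cd: "card A + card B \<le> card (A + uminus ` B) + 1"
    using cauchy_davenport_less[of A "uminus ` B"] ne cs U sz by simp
  show ?thesis
  proof (cases "card (diffs A B) < card A + card B")
    case True
    obtain d where d: "d \<noteq> 0" "bd d A \<le> 1" "bd d (uminus ` B) \<le> 1"
      using vosper[of A "uminus ` B"] A B cs True sz by auto
    have "A + uminus ` B = diffs A B" using sub cd cs True by (intro card_seteq) auto
    moreover have "bd d (A + uminus ` B) \<le> 1 * 1"
      by (rule order_trans[OF bd_plus_le]) (use d in \<open>intro mult_le_mono\<close>)
    ultimately have "bd d (diffs A B) \<le> 1" by simp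
    moreover have "near d A" using d ne by (simp add: near_ap)
    moreover have "near d B" using d ne by (simp add: near_ap)
    ultimately show ?thesis using d(1) by blast
  next
    case False
    then have U': "card (diffs A B) = card A + card B" using U by simp
    let ?V = "- diffs A B"
    have crit: "crit A (uminus ` B) ?V" using crit_diffs[OF U'] .
    have V: "card ?V + card A + card B = CARD('p)" using U' card_le_CARD[of "diffs A B"] by (simp add: card_Compl_finite)
    have symV: "uminus ` ?V = ?V"
    proof (rule uminus_image_eqI)
      fix x assume "x \<in> ?V"
      moreover have "x \<in> diffs A B" if "- x \<in> diffs A B"
        using imageI[OF that, of uminus] uminus_diffs[of A B] by simp
      ultimately show "- x \<in> ?V" by blast
    qed
    have V0: "0 \<in> ?V" using zero_notin_diffs[OF dis] by simp
    consider (A) "\<not> nap A" | (B) "\<not> nap B" | (V) "\<not> nap ?V" | (nap) "nap A" "nap B" "nap ?V" by blast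
    then show ?thesis
    proof cases
      case A
      then obtain d where "d \<noteq> 0" "bd d A \<le> 1" unfolding nap_def by fastforce
      then show ?thesis using diffs_ap_case[OF dis assms(2,3) sz U'] by blast
    next
      case B
      then obtain d where "d \<noteq> 0" "bd d B \<le> 1" unfolding nap_def by fastforce
      then show ?thesis
        using diffs_ap_case[of B A d] dis assms(2,3) sz U' by (auto simp: diffs_commute[of B A] Int_commute add.commute)
    next
      case V
      then obtain d where d: "d \<noteq> 0" "bd d ?V \<le> 1" unfolding nap_def by fastforce
      have s: "3 \<le> card ?V" "card A + card ?V < CARD('p)" "card A + 4 \<le> CARD('p)"
        "card (uminus ` B) + card ?V < CARD('p)" "card (uminus ` B) + 4 \<le> CARD('p)"
        using \<open>card ?V + card A + card B = CARD('p)\<close> assms(2,3) sz card_uminus[of B] by linarith+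
      have ne': "uminus ` B \<noteq> {}" using ne by simp
      have "near d A"
        by (rule near_of_ap_sum[OF d s(1) ne(1) _ s(2,3)]) (rule crit_sum_card[OF crit_perm(2)[OF crit]])
      moreover have "near d (uminus ` B)"
        by (rule near_of_ap_sum[OF d s(1) ne' _ s(4,5)])
          (rule crit_sum_card[OF crit_perm(2)[OF crit_perm(1)[OF crit]]])
      moreover have "bd d (diffs A B) \<le> 1" using d(2) by simp
      ultimately show ?thesis using d(1) by (auto simp only: near_reflect)
    next
      case nap
      show ?thesis
      proof (cases "card A = 3 \<and> card B = 3")
        case True
        then show ?thesis using diffs_three_contra[of A B] nap U' p by simp
      next
        case False
        have "7 \<le> card A + card B" using False assms(2,3) by (cases "card A = 3") auto
        then have s7: "7 \<le> card A + card (uminus ` B)" by simp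
        obtain d where d: "d \<noteq> 0" "bd d ?V \<le> 2"
          using crit_two_atom[OF crit nap(3) _ _ s7] assms(2,3) by auto
        have "7 \<le> card ?V" using V sz by linarith
        then show ?thesis
          using diffs_nap_contra_scaled[OF dis nap crit symV V0 d assms(2,3)] by blast
      qed
    qed
  qed
qed

text \<open>After scaling, the complements of nonempty such sets are intervals centred at 0, which
  are ordered by inclusion.\<close>

lemma symmetric_ap_nested:
  fixes U1 U2 :: "'p::prime_card mod_ring set"
  assumes d: "d \<noteq> 0" and U1: "uminus ` U1 = U1" "0 \<notin> U1" "bd d U1 \<le> 1"
    and U2: "uminus ` U2 = U2" "0 \<notin> U2" "bd d U2 \<le> 1"
  shows "U1 \<subseteq> U2 \<or> U2 \<subseteq> U1"
proof -
  let ?s = "(*) (1 / d)"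
  have c: "1 / d \<noteq> 0" using d by simp
  have rep: "\<exists>r::nat. ?s ` (- U) = of_int ` {- int r..int r}"
    if U: "uminus ` U = U" "0 \<notin> U" "bd d U \<le> 1" "U \<noteq> {}" for U
  proof -
    let ?W = "?s ` (- U)"
    have n: "- x \<in> U" if "x \<in> U" for x using U(1) that by (metis imageI)
    have "uminus ` (- U) = - U"
    proof (rule uminus_image_eqI)
      fix x assume "x \<in> - U" then show "- x \<in> - U" using n[of "- x"] by auto
    qed
    moreover have "uminus ` ?W = ?s ` uminus ` (- U)" by (simp add: image_image)
    ultimately have "uminus ` ?W = ?W" by simp
    moreover have "1 / d * 0 \<in> ?W" using U(2) by (intro imageI) simp
    then have "0 \<in> ?W" by simp
    moreover have "?W \<noteq> UNIV"
    proof
      assume "?W = UNIV"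
      then have "card ?W = CARD('p)" by simp
      then have "card (- U) = CARD('p)" by (simp only: card_scale[OF c])
      moreover have "card U \<noteq> 0" using U(4) by simp
      moreover have "card U \<le> CARD('p)" using card_le_CARD[of U] by simp
      moreover have "card (- U) = CARD('p) - card U" using card_Compl_finite[of U] by simp
      ultimately show False by linarith
    qed
    moreover have "bd 1 ?W \<le> 1" using bd_scale'[OF c, of 1 "- U"] U(3) d by simp
    ultimately show ?thesis using symmetric_interval[of ?W] by metis
  qed
  show ?thesis
  proof (cases "U1 = {} \<or> U2 = {}")
    case False
    obtain r1 :: nat where r1: "?s ` (- U1) = of_int ` {- int r1..int r1}" using rep[OF U1] False by blast
    obtain r2 :: nat where r2: "?s ` (- U2) = of_int ` {- int r2..int r2}" using rep[OF U2] False by blast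
    have sub: "X \<subseteq> Y" if "?s ` X \<subseteq> ?s ` Y" for X Y :: "'p mod_ring set"
    proof
      fix x assume "x \<in> X"
      then have "1 / d * x \<in> ?s ` Y" using that by blast
      then obtain y where "y \<in> Y" "1 / d * x = 1 / d * y" by blast
      then show "x \<in> Y" by (simp only: mult_left_cancel[OF c])
    qed
    show ?thesis
    proof (cases "r1 \<le> r2")
      case True
      then have "?s ` (- U1) \<subseteq> ?s ` (- U2)" unfolding r1 r2 by (intro image_mono) auto
      then show ?thesis using sub by blast
    next
      case False
      then have "?s ` (- U2) \<subseteq> ?s ` (- U1)" unfolding r1 r2 by (intro image_mono) auto
      then show ?thesis using sub by blast
    qed
  qed auto
qed

text \<open>The two difference sets are nested, so the larger one contains
  \<open>(A \<union> C) - B\<close>; by Cauchy-Davenport its size then involves all three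
  classes.\<close>

lemma diffs_clash:
  fixes A B C :: "'p::prime_card mod_ring set"
  assumes dis: "A \<inter> B = {}" "C \<inter> B = {}" "A \<inter> C = {}" and sz: "3 \<le> card A" "3 \<le> card B" "3 \<le> card C" and d: "d \<noteq> 0"
    and b: "bd d (diffs A B) \<le> 1" "bd d (diffs C B) \<le> 1"
    and c: "card (diffs A B) \<le> card A + card B + 1" "card (diffs C B) \<le> card C + card B + 1"
  shows False
proof -
  have key: False if U: "diffs A B \<subseteq> U" "diffs C B \<subseteq> U" "0 \<notin> U" and cU: "card U + 1 < card A + card C + card B" for U
  proof -
    have "(A \<union> C) + uminus ` B \<subseteq> U"
    proof
      fix x assume "x \<in> (A \<union> C) + uminus ` B"
      then obtain a m where "x = a + m" "a \<in> A \<union> C" "m \<in> uminus ` B" by (rule set_plus_elim)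
      then have "x \<in> (A + uminus ` B) \<union> (C + uminus ` B)" by (auto intro: set_plus_intro)
      then show "x \<in> U" using U by (auto simp: diffs_def)
    qed
    then have le: "card ((A \<union> C) + uminus ` B) \<le> card U" by (intro card_mono) auto
    have "U \<noteq> UNIV" using U(3) by blast
    then have "card U < CARD('p)" using psubset_card_mono[of UNIV U] by auto
    then have "card (A \<union> C) + card (uminus ` B) \<le> card ((A \<union> C) + uminus ` B) + 1"
      using le sz by (intro cauchy_davenport_less) auto
    moreover have "card (A \<union> C) = card A + card C" using dis(3) by (intro card_Un_disjoint) auto
    ultimately show False using le cU by simp
  qed
  have "diffs A B \<subseteq> diffs C B \<or> diffs C B \<subseteq> diffs A B"
    by (rule symmetric_ap_nested[OF d uminus_diffs zero_notin_diffs[OF dis(1)] b(1) uminus_diffs zero_notin_diffs[OF dis(2)] b(2)])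
  then show False
  proof
    assume "diffs A B \<subseteq> diffs C B"
    then show False using key[of "diffs C B"] zero_notin_diffs[OF dis(2)] c(2) sz by simp
  next
    assume "diffs C B \<subseteq> diffs A B"
    then show False using key[of "diffs A B"] zero_notin_diffs[OF dis(1)] c(1) sz by simp
  qed
qed

text \<open>Every pair of classes is of one of two kinds. Either its difference set is large, and
  Vosper's theorem makes it and \<open>T\<close> progressions (\<open>good\<close>), or it is small,
  and the classes are near progressions (\<open>bad\<close>). Two of the three pairs are of the same
  kind and share a class. Their directions agree, by \<open>T\<close> or by the shared class, and
  \<open>diffs_clash\<close> applies.\<close>

lemma triple_sum_bound:
  fixes A B C :: "'p::prime_card mod_ring set"
  assumes dis: "A \<inter> B = {}" "B \<inter> C = {}" "A \<inter> C = {}" and sz: "3 \<le> card A" "3 \<le> card B" "3 \<le> card C"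
    and p: "card A + card B + card C + 4 \<le> CARD('p)"
    and T: "diffs A B + C \<subseteq> T" "diffs B C + A \<subseteq> T" "diffs A C + B \<subseteq> T"
  shows "card A + card B + card C + 1 \<le> card T"
proof (rule ccontr)
  assume "\<not> ?thesis"
  then have cT: "card T \<le> card A + card B + card C" by simp
  have p11: "11 \<le> CARD('p)" using sz p by linarith
  define good where "good X Y d \<longleftrightarrow> d \<noteq> 0 \<and> bd d (diffs X Y) \<le> 1 \<and> card (diffs X Y) \<le> card X + card Y + 1 \<and> bd d T \<le> 1 \<and> 3 \<le> card T" for X Y :: "'p mod_ring set" and d
  define bad where "bad X Y d \<longleftrightarrow> d \<noteq> 0 \<and> bd d (diffs X Y) \<le> 1 \<and> card (diffs X Y) \<le> card X + card Y + 1 \<and> near d X \<and> near d Y" for X Y :: "'p mod_ring set" and d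
  have alt: "(\<exists>d. good X Y d) \<or> (\<exists>d. bad X Y d)"
    if h: "X \<inter> Y = {}" "3 \<le> card X" "3 \<le> card Y" "3 \<le> card Z" "card X + card Y + card Z = card A + card B + card C"
      "diffs X Y + Z \<subseteq> T" for X Y Z
  proof (cases "card (diffs X Y) \<le> card X + card Y")
    case True
    then show ?thesis using diffs_near_of_card[OF h(1-3) _ True] h p unfolding bad_def by force
  next
    case False
    have le: "card (diffs X Y + Z) \<le> card T" by (rule card_mono[OF finite h(6)])
    have lt: "card (diffs X Y + Z) < card (diffs X Y) + card Z" using le cT h(5) False by linarith
    obtain d where d: "d \<noteq> 0" "bd d (diffs X Y) \<le> 1" "bd d Z \<le> 1"
      using vosper[of "diffs X Y" Z] False h le cT p lt by auto
    have ne: "diffs X Y \<noteq> {}" "Z \<noteq> {}" using False h by auto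
    have cd: "card (diffs X Y) + card Z \<le> card (diffs X Y + Z) + 1"
      using le cT p ne by (intro cauchy_davenport_less) auto
    then have c: "card (diffs X Y) \<le> card X + card Y + 1" using le cT h(5) by linarith
    have "diffs X Y + Z = T" using h(6) cd False cT h(5) by (intro card_seteq) auto
    moreover have "bd d (diffs X Y + Z) \<le> 1 * 1"
      by (rule order_trans[OF bd_plus_le]) (use d in \<open>intro mult_le_mono\<close>)
    ultimately have "bd d T \<le> 1" by simp
    moreover have "3 \<le> card T" using le cd False h by linarith
    ultimately show ?thesis using d c unfolding good_def by blast
  qed
  have gg: False if h: "X \<inter> Y = {}" "Z \<inter> Y = {}" "X \<inter> Z = {}" "3 \<le> card X" "3 \<le> card Y" "3 \<le> card Z"
    "good X Y d" "good Z Y e" for X Y Z d e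
  proof -
    have "e = d \<or> e = - d" using ap_direction[of d T e] h(7,8) cT p p11 by (simp add: good_def)
    then have "bd d (diffs Z Y) \<le> 1" using h(8) unfolding good_def by auto
    then show False using diffs_clash[OF h(1-6)] h(7,8) unfolding good_def by blast
  qed
  have bb: False if h: "X \<inter> Y = {}" "Z \<inter> Y = {}" "X \<inter> Z = {}" "3 \<le> card X" "3 \<le> card Y" "3 \<le> card Z"
    "bad X Y d" "bad Z Y e" "card Y + 6 \<le> CARD('p)" for X Y Z d e
  proof -
    have "e = d \<or> e = - d" using near_direction[of d Y e] h p11 by (simp add: bad_def)
    then have "bd d (diffs Z Y) \<le> 1" using h(8) unfolding bad_def by auto
    then show False using diffs_clash[OF h(1-6)] h(7,8) unfolding bad_def by blast
  qed
  have comm: "good X Y d \<longleftrightarrow> good Y X d" "bad X Y d \<longleftrightarrow> bad Y X d" for X Y d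
    unfolding good_def bad_def by (auto simp: diffs_commute[of X Y] add.commute)
  have s6: "card A + 6 \<le> CARD('p)" "card B + 6 \<le> CARD('p)" "card C + 6 \<le> CARD('p)" using sz p by linarith+
  have dis': "B \<inter> A = {}" "C \<inter> B = {}" "C \<inter> A = {}" using dis by blast+
  have AB: "(\<exists>d. good A B d) \<or> (\<exists>d. bad A B d)" using alt[OF dis(1) sz(1,2,3) _ T(1)] by simp
  have BC: "(\<exists>d. good B C d) \<or> (\<exists>d. bad B C d)" using alt[OF dis(2) sz(2,3,1) _ T(2)] by simp
  have AC: "(\<exists>d. good A C d) \<or> (\<exists>d. bad A C d)" using alt[OF dis(3) sz(1,3,2) _ T(3)] by simp
  have 1: "\<not> (good A B d \<and> good B C e)" "\<not> (bad A B d \<and> bad B C e)" for d e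
    using gg[OF dis(1) dis'(2) dis(3) sz, of d e] bb[OF dis(1) dis'(2) dis(3) sz, of d e] comm s6 by blast+
  have 2: "\<not> (good A B d \<and> good A C e)" "\<not> (bad A B d \<and> bad A C e)" for d e
    using gg[OF dis'(1) dis'(3) dis(2) sz(2,1,3), of d e] bb[OF dis'(1) dis'(3) dis(2) sz(2,1,3), of d e] comm s6 by blast+
  have 3: "\<not> (good A C d \<and> good B C e)" "\<not> (bad A C d \<and> bad B C e)" for d e
    using gg[OF dis(3) dis(2) dis(1) sz(1,3,2), of d e] bb[OF dis(3) dis(2) dis(1) sz(1,3,2), of d e] comm s6 by blast+
  show False using AB BC AC 1 2 3 by blast
qed

text \<open>Compare the sums of elements; \<open>card X\<close> is invertible.\<close>

lemma translate_cancel: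
  fixes X :: "'p::prime_card mod_ring set"
  assumes "(+) s ` X = (+) t ` X" "X \<noteq> {}" "card X < CARD('p)"
  shows "s = t"
proof -
  have "card X \<noteq> 0" using assms(2) by simp
  then have n: "(of_nat (card X) :: 'p mod_ring) \<noteq> 0" using assms(3) by (intro of_nat_mod_ring_neq_0) auto
  have "of_nat (card X) * s + \<Sum>X = of_nat (card X) * t + \<Sum>X"
    using assms(1) by (simp only: sum_translate[symmetric])
  then have "of_nat (card X) * s = of_nat (card X) * t" by (simp only: add_right_cancel)
  then show ?thesis by (simp only: mult_left_cancel[OF n])
qed

section \<open>Families of intervals\<close>

text \<open>Starting point and length are explicit, because the following arguments compare
  positions inside a common interval.\<close>

definition iv :: "'p::prime_card mod_ring \<Rightarrow> nat \<Rightarrow> 'p mod_ring set" where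
  "iv x n = (\<lambda>i. x + of_nat i) ` {..<n}"

lemma mem_iv: "i < n \<Longrightarrow> x + of_nat i \<in> iv x n"
  by (simp add: iv_def)

lemma mem_ivE:
  assumes "y \<in> iv x n" obtains i where "i < n" "y = x + of_nat i"
  using assms by (auto simp: iv_def)

lemma card_iv: "n \<le> CARD('p) \<Longrightarrow> card (iv (x :: 'p::prime_card mod_ring) n) = n"
  unfolding iv_def by (subst card_image[OF inj_on_subset[OF inj_on_of_nat_translate]]) auto

lemma iv_of_ap:
  fixes Y :: "'p::prime_card mod_ring set"
  assumes "bd 1 Y \<le> 1" "Y \<noteq> {}" "card Y < CARD('p)"
  shows "\<exists>x. Y = iv x (card Y)"
proof -
  have "Y \<noteq> UNIV" using assms(3) by auto
  then show ?thesis using interval_of_bd[OF assms(1,2)] unfolding iv_def by blast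
qed

lemma iv_plus:
  assumes "1 \<le> m" "1 \<le> n"
  shows "iv x m + iv y n = iv (x + y) (m + n - 1)"
proof
  show "iv x m + iv y n \<subseteq> iv (x + y) (m + n - 1)"
  proof
    fix z assume "z \<in> iv x m + iv y n"
    then obtain a b where ab: "z = a + b" "a \<in> iv x m" "b \<in> iv y n" by (rule set_plus_elim)
    obtain i where i: "i < m" "a = x + of_nat i" using ab(2) by (rule mem_ivE)
    obtain j where j: "j < n" "b = y + of_nat j" using ab(3) by (rule mem_ivE)
    have "z = (x + y) + of_nat (i + j)" using ab i j by (simp add: ac_simps)
    moreover have "i + j < m + n - 1" using i j by linarith
    ultimately show "z \<in> iv (x + y) (m + n - 1)" by (simp only: mem_iv)
  qed
  show "iv (x + y) (m + n - 1) \<subseteq> iv x m + iv y n"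
  proof
    fix z assume "z \<in> iv (x + y) (m + n - 1)"
    then obtain k where k: "k < m + n - 1" "z = (x + y) + of_nat k" by (rule mem_ivE)
    have "\<exists>i j. i < m \<and> j < n \<and> k = i + j"
    proof (cases "k < m")
      case True
      then show ?thesis using assms by (intro exI[of _ k] exI[of _ 0]) auto
    next
      case False
      then show ?thesis using assms k by (intro exI[of _ "m - 1"] exI[of _ "k - (m - 1)"]) auto
    qed
    then obtain i j where ij: "i < m" "j < n" "k = i + j" by blast
    have "z = (x + of_nat i) + (y + of_nat j)" using k ij by (simp add: ac_simps)
    then show "z \<in> iv x m + iv y n" using ij by (simp only: mem_iv set_plus_intro)
  qed
qed

text \<open>Copies of \<open>iv y n\<close> placed at distance \<open>l\<close> leave no gap, since
  \<open>l \<le> n\<close>.\<close>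

lemma iv_step:
  assumes "1 \<le> l" "l \<le> n" "1 \<le> c"
  shows "iv (of_nat l * x + y) (n + (c - 1) * l) \<subseteq> (*) (of_nat l) ` iv x c + iv y n"
proof
  fix z assume "z \<in> iv (of_nat l * x + y) (n + (c - 1) * l)"
  then obtain k where k: "k < n + (c - 1) * l" "z = (of_nat l * x + y) + of_nat k" by (rule mem_ivE)
  have "\<exists>i j. i < c \<and> j < n \<and> k = l * i + j"
  proof (cases "k div l \<le> c - 1")
    case True
    have "k mod l < l" using assms by simp
    then have "k mod l < n" using assms(2) by linarith
    moreover have "k div l < c" using True assms(3) by linarith
    moreover have "k = l * (k div l) + k mod l" by (simp only: mult_div_mod_eq)
    ultimately show ?thesis by blast
  next
    case False
    then have "c - 1 \<le> k div l" by simp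
    then have "(c - 1) * l \<le> k" using less_eq_div_iff_mult_less_eq[of l "c - 1" k] assms by simp
    then have "k = l * (c - 1) + (k - (c - 1) * l)" by (simp add: mult.commute)
    moreover have "c - 1 < c" "k - (c - 1) * l < n" using assms k \<open>(c - 1) * l \<le> k\<close> by linarith+
    ultimately show ?thesis by blast
  qed
  then obtain i j where ij: "i < c" "j < n" "k = l * i + j" by blast
  have "z = of_nat l * (x + of_nat i) + (y + of_nat j)" using k ij by (simp add: algebra_simps)
  moreover have "of_nat l * (x + of_nat i) \<in> (*) (of_nat l) ` iv x c" using mem_iv[OF ij(1)] by (rule imageI)
  moreover have "y + of_nat j \<in> iv y n" by (rule mem_iv[OF ij(2)])
  ultimately show "z \<in> (*) (of_nat l) ` iv x c + iv y n" by (simp only: set_plus_intro)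
qed

lemma iv_uminus:
  assumes "1 \<le> n" shows "uminus ` iv x n = iv (- (x + of_nat (n - 1))) n"
proof -
  have sub: "uminus ` iv y n \<subseteq> iv (- (y + of_nat (n - 1))) n" for y :: "'p::prime_card mod_ring"
  proof
    fix z assume "z \<in> uminus ` iv y n"
    then obtain a where "a \<in> iv y n" "z = - a" by blast
    then obtain i where i: "i < n" "z = - (y + of_nat i)" by (auto elim: mem_ivE)
    have "(of_nat (n - 1) :: 'p mod_ring) = of_nat (n - 1 - i) + of_nat i"
      using i(1) by (simp flip: of_nat_add)
    then have "z = - (y + of_nat (n - 1)) + of_nat (n - 1 - i)" using i(2) by simp
    moreover have "n - 1 - i < n" using i(1) by simp
    ultimately show "z \<in> iv (- (y + of_nat (n - 1))) n" by (simp only: mem_iv)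
  qed
  have "uminus ` uminus ` iv (- (x + of_nat (n - 1))) n \<subseteq> uminus ` iv (- (- (x + of_nat (n - 1)) + of_nat (n - 1))) n"
    by (intro image_mono sub)
  then have "iv (- (x + of_nat (n - 1))) n \<subseteq> uminus ` iv x n" by (simp add: image_image)
  then show ?thesis using sub by blast
qed

text \<open>As the outer interval is not the whole field, a point that leaves it at the end does not
  re-enter at the start; so the offset is a genuine natural number.\<close>

lemma iv_subset:
  fixes x y :: "'p::prime_card mod_ring"
  assumes "iv x m \<subseteq> iv y n" "1 \<le> m" "n < CARD('p)"
  shows "\<exists>s. s + m \<le> n \<and> x = y + of_nat s"
proof -
  have "x + of_nat 0 \<in> iv y n" using mem_iv[of 0 m x] assms by auto
  then obtain s where s: "s < n" "x + of_nat 0 = y + of_nat s" by (rule mem_ivE)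
  have "s + m \<le> n"
  proof (rule ccontr)
    assume "\<not> ?thesis"
    then have "n - s < m" using s(1) by linarith
    then have "x + of_nat (n - s) \<in> iv y n" using assms(1) mem_iv by blast
    moreover have "x + of_nat (n - s) = y + of_nat n" using s by (simp add: of_nat_diff)
    ultimately obtain j where "j < n" "y + of_nat n = y + of_nat j" by (metis mem_ivE)
    then show False using of_nat_mod_ring_inj[of n j, where 'p = 'p] assms(3) by simp
  qed
  then show ?thesis using s by auto
qed

lemma iv_sum:
  fixes S :: "'b \<Rightarrow> 'p::prime_card mod_ring set"
  assumes "finite I" "\<And>i. i \<in> I \<Longrightarrow> S i = iv (u i) (c i)" "\<And>i. i \<in> I \<Longrightarrow> 1 \<le> c i"
  shows "(\<Sum>i\<in>I. S i) = iv (\<Sum>i\<in>I. u i) ((\<Sum>i\<in>I. c i - 1) + 1)"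
  using assms
proof (induction I rule: finite_induct)
  case empty
  have "iv (0 :: 'p mod_ring) 1 = {0}" by (simp add: iv_def lessThan_Suc)
  then show ?case by (simp add: set_zero)
next
  case (insert i I)
  have "(\<Sum>i\<in>insert i I. S i) = iv (u i) (c i) + iv (\<Sum>i\<in>I. u i) ((\<Sum>i\<in>I. c i - 1) + 1)"
    using insert by simp
  also have "\<dots> = iv (u i + (\<Sum>i\<in>I. u i)) (c i + ((\<Sum>i\<in>I. c i - 1) + 1) - 1)"
    using insert.prems(2)[of i] by (intro iv_plus) auto
  also have "c i + ((\<Sum>i\<in>I. c i - 1) + 1) - 1 = (\<Sum>i\<in>insert i I. c i - 1) + 1"
    using insert.hyps insert.prems(2)[of i] by simp
  also have "u i + (\<Sum>i\<in>I. u i) = (\<Sum>i\<in>insert i I. u i)" using insert.hyps by simp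
  finally show ?case .
qed

lemma pigeonhole_less:
  fixes q :: "'b \<Rightarrow> nat"
  assumes "finite I" "I \<noteq> {}" "\<And>i. i \<in> I \<Longrightarrow> q i + 2 \<le> card I"
  obtains i j where "i \<in> I" "j \<in> I" "i \<noteq> j" "q i = q j"
proof -
  have "\<not> inj_on q I"
  proof
    assume i: "inj_on q I"
    have "q ` I \<subseteq> {..<card I - 1}" using assms(3) by fastforce
    then have "card (q ` I) \<le> card I - 1" using card_mono[of "{..<card I - 1}"] by fastforce
    then have "card I \<le> card I - 1" using card_image[OF i] by simp
    moreover have "card I \<noteq> 0" using assms(1,2) by simp
    ultimately show False by linarith
  qed
  then show ?thesis using that by (auto simp: inj_on_def)
qed

text \<open>Provides, for a coefficient \<open>- l\<close>, the index \<open>t\<close> of a point in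
  an interval of \<open>c\<close> points: the lower bound keeps a shifted offset small, the upper
  one keeps it nonnegative.\<close>

lemma multiple_between:
  fixes l c :: nat
  assumes "2 \<le> l" "3 \<le> c"
  shows "\<exists>t. c \<le> (l + 1) * t \<and> (l + 1) * t \<le> l * (c - 1)"
proof (cases "c \<le> l + 1")
  case True
  have "l * 2 \<le> l * (c - 1)" using assms by (intro mult_le_mono2) simp
  moreover have "l + 1 \<le> l * 2" using assms(1) by simp
  ultimately have "l + 1 \<le> l * (c - 1)" by (rule order_trans[rotated])
  then have "c \<le> (l + 1) * 1 \<and> (l + 1) * 1 \<le> l * (c - 1)" using True by (simp only: mult_1_right conj_absorb simp_thms)
  then show ?thesis by blast
next
  case False
  define t where "t = (c + l) div (l + 1)"
  have m: "(l + 1) * t + (c + l) mod (l + 1) = c + l" unfolding t_def by (rule mult_div_mod_eq)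
  have "(c + l) mod (l + 1) < l + 1" by simp
  then have lo: "c \<le> (l + 1) * t" using m by linarith
  obtain c' where c': "c = l + 2 + c'" using le_Suc_ex[of "l + 2" c] False by auto
  obtain l' where l': "l = l' + 2" using le_Suc_ex[of 2 l] assms(1) by auto
  have "c - 1 = l' + 3 + c'" unfolding c' l' by simp
  then have "l * (c - 1) = (l' + 2) * (l' + 3 + c')" by (simp only: l')
  then have "c + l \<le> l * (c - 1)" unfolding c' l' by (simp add: algebra_simps)
  then show ?thesis using lo m by (intro exI[of _ t]) linarith
qed

text \<open>The unscaled sum would have \<open>T + 1\<close> points and \<open>W\<close> has at most
  \<open>T + k\<close>. The shortest interval therefore shows that \<open>m\<close> is, up to sign,
  an integer \<open>l\<close> small against \<open>k\<close>. Then the scaled sums are intervals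
  with fewer than \<open>k\<close> possible positions in \<open>W\<close>; two indices with the same
  position produce a common point of two disjoint intervals.\<close>

lemma scaled_interval_family_contra:
  fixes E :: "nat \<Rightarrow> 'p::prime_card mod_ring set"
  assumes I: "finite I" "4 \<le> card I" and dis: "disjoint_family_on E I" and E: "\<And>i. i \<in> I \<Longrightarrow> bd 1 (E i) \<le> 1"
    "\<And>i. i \<in> I \<Longrightarrow> 3 \<le> card (E i)" and sz: "(\<Sum>i\<in>I. card (E i)) + 4 \<le> CARD('p)"
    and W: "bd 1 W \<le> 1" "card W \<le> (\<Sum>i\<in>I. card (E i))"
    and m: "m \<noteq> 0" "m \<noteq> 1" "m \<noteq> - 1"
    and sub: "\<And>j. j \<in> I \<Longrightarrow> (*) m ` E j + (\<Sum>i\<in>I - {j}. E i) \<subseteq> W"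
  shows False
proof -
  define k where "k = card I"
  define c where "c i = card (E i)" for i
  have c3: "3 \<le> c i" if "i \<in> I" for i using E(2)[OF that] by (simp add: c_def)
  have cp: "c i \<le> (\<Sum>i\<in>I. card (E i))" if "i \<in> I" for i
    unfolding c_def using I(1) that by (intro member_le_sum) auto
  have "\<exists>x. E i = iv x (c i)" if "i \<in> I" for i
    unfolding c_def using E(1)[OF that] c3[OF that] cp[OF that] sz by (intro iv_of_ap) (auto simp: c_def)
  then obtain u where u: "E i = iv (u i) (c i)" if "i \<in> I" for i by metis
  define T where "T = (\<Sum>i\<in>I. c i - 1)"
  have Tk: "(\<Sum>i\<in>I. card (E i)) = T + k"
  proof -
    have "(\<Sum>i\<in>I. card (E i)) = (\<Sum>i\<in>I. (c i - 1) + 1)"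
      by (rule sum.cong) (use c3 in \<open>force simp: c_def\<close>)+
    then show ?thesis unfolding T_def k_def by (simp only: sum.distrib) simp
  qed
  define V where "V = (\<Sum>i\<in>I. u i)"
  define v where "v j = V - u j" for j
  define N where "N j = T - (c j - 1) + 1" for j
  have cT: "c j - 1 + 2 * (k - 1) \<le> T" if j: "j \<in> I" for j
  proof -
    have "T = (c j - 1) + (\<Sum>i\<in>I - {j}. c i - 1)" unfolding T_def by (rule sum.remove[OF I(1) j])
    moreover have "(\<Sum>i\<in>I - {j}. 2) \<le> (\<Sum>i\<in>I - {j}. c i - 1)" using c3 by (intro sum_mono) force
    ultimately show ?thesis using j I(1) by (simp add: k_def mult.commute)
  qed
  have J: "(\<Sum>i\<in>I - {j}. E i) = iv (v j) (N j)" if j: "j \<in> I" for j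
  proof -
    have e: "(\<Sum>i\<in>I - {j}. E i) = iv (\<Sum>i\<in>I - {j}. u i) ((\<Sum>i\<in>I - {j}. c i - 1) + 1)"
      using I(1) u c3 by (intro iv_sum) force+
    have "V = u j + (\<Sum>i\<in>I - {j}. u i)" unfolding V_def by (rule sum.remove[OF I(1) j])
    then have e1: "(\<Sum>i\<in>I - {j}. u i) = v j" by (simp add: v_def)
    have "T = (c j - 1) + (\<Sum>i\<in>I - {j}. c i - 1)" unfolding T_def by (rule sum.remove[OF I(1) j])
    then have e2: "(\<Sum>i\<in>I - {j}. c i - 1) + 1 = N j" by (simp add: N_def)
    show ?thesis using e by (simp only: e1 e2)
  qed
  have I0: "I \<noteq> {}" using I(2) by auto
  have W0: "W \<noteq> {}"
  proof
    assume W0: "W = {}"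
    obtain j where j: "j \<in> I" using I0 by blast
    have "E j \<noteq> {}" using E(2)[OF j] by auto
    moreover have "iv (v j) (N j) \<noteq> {}" by (auto simp: iv_def N_def)
    ultimately show False using sub[OF j] W0 J[OF j] by simp
  qed
  define L where "L = card W"
  have Lp: "L < CARD('p)" "L \<le> T + k" using W(2) sz Tk by (simp_all add: L_def)
  obtain w where w: "W = iv w L" using iv_of_ap[OF W(1) W0] Lp by (auto simp: L_def)
  have pos: "\<exists>s. s + N j \<le> L \<and> m * x + v j = w + of_nat s" if j: "j \<in> I" and x: "x \<in> E j" for j x
  proof (rule iv_subset)
    have "iv (m * x + v j) (N j) \<subseteq> (*) m ` E j + iv (v j) (N j)"
    proof
      fix z assume "z \<in> iv (m * x + v j) (N j)"
      then obtain i where "i < N j" "z = m * x + v j + of_nat i" by (rule mem_ivE)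
      then have "z = m * x + (v j + of_nat i)" "v j + of_nat i \<in> iv (v j) (N j)" by (simp_all add: mem_iv)
      then show "z \<in> (*) m ` E j + iv (v j) (N j)" using x by (auto intro: set_plus_intro)
    qed
    then show "iv (m * x + v j) (N j) \<subseteq> iv w L" using sub[OF j] J[OF j] w by simp
  qed (use Lp in \<open>simp_all add: N_def\<close>)
  obtain j0 where j0: "j0 \<in> I" "\<And>i. i \<in> I \<Longrightarrow> c j0 \<le> c i"
    using arg_min_if_finite(1)[OF I(1) I0, of c] arg_min_least[OF I(1) I0, of _ c] by blast
  define c0 where "c0 = c j0"
  have c03: "3 \<le> c0" using c3[OF j0(1)] by (simp add: c0_def)
  \<comment> \<open>Bound for \<open>L - N j0\<close>, the largest offset in \<open>W\<close> at
    which the sum of the other intervals can start. It stays below \<open>p / 2\<close>, so residues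
    determine the steps between offsets.\<close>
  define D where "D = c0 + k - 2"
  have D2: "2 * D < CARD('p)"
  proof -
    have "k * c0 \<le> (\<Sum>i\<in>I. card (E i))"
      using sum_bounded_below[of I c0 "\<lambda>i. card (E i)"] j0(2) by (simp add: k_def c0_def c_def)
    then have p1: "k * c0 + 4 \<le> CARD('p)" using sz by linarith
    obtain a b where ab: "k = 4 + a" "c0 = 3 + b" using I(2) c03 by (metis k_def le_Suc_ex)
    have "2 * D < k * c0 + 4" unfolding D_def ab by (simp add: algebra_simps)
    then show ?thesis using p1 by linarith
  qed
  have "\<exists>s. \<forall>i<c0. s i \<le> D \<and> m * (u j0 + of_nat i) + v j0 = w + of_nat (s i)"
  proof -
    have "\<exists>s\<le>D. m * (u j0 + of_nat i) + v j0 = w + of_nat s" if i: "i < c0" for i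
    proof -
      have "u j0 + of_nat i \<in> E j0" unfolding u[OF j0(1)] using i by (simp add: mem_iv c0_def)
      then obtain s where s: "s + N j0 \<le> L" "m * (u j0 + of_nat i) + v j0 = w + of_nat s" using pos[OF j0(1)] by blast
      have "s \<le> D" using s(1) Lp(2) cT[OF j0(1)] c03 unfolding N_def D_def c0_def by linarith
      then show ?thesis using s by blast
    qed
    then show ?thesis by metis
  qed
  then obtain s where s: "\<And>i. i < c0 \<Longrightarrow> s i \<le> D" "\<And>i. i < c0 \<Longrightarrow> m * (u j0 + of_nat i) + v j0 = w + of_nat (s i)" by blast
  have sd: "of_nat (s (Suc i)) = of_nat (s i) + m" if "Suc i < c0" for i
  proof -
    have "w + of_nat (s (Suc i)) = m * (u j0 + of_nat (Suc i)) + v j0" using s(2)[OF that] by simp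
    also have "\<dots> = (m * (u j0 + of_nat i) + v j0) + m" by (simp add: algebra_simps)
    also have "\<dots> = (w + of_nat (s i)) + m" using s(2)[of i] that by simp
    finally show ?thesis by (simp only: add.assoc add_left_cancel)
  qed
  \<comment> \<open>Consecutive points of \<open>E j0\<close> have offsets differing by one constant
    integer, \<open>l\<close> or \<open>- l\<close>, so \<open>c0 - 1\<close> such steps fit into
    \<open>D\<close>.\<close>
  have "\<exists>l. (m = of_nat l \<or> m = - of_nat l) \<and> (c0 - 1) * l \<le> D \<and> l \<le> D"
  proof (cases "s 0 \<le> s 1")
    case True
    define l where "l = s 1 - s 0"
    have ml: "m = of_nat l" using sd[of 0] c03 True by (simp add: l_def of_nat_diff)
    have lD: "l \<le> D" using s(1)[of 1] c03 by (simp add: l_def)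
    have "i < c0 \<longrightarrow> s i = s 0 + i * l" for i
    proof (induction i)
      case (Suc i)
      show ?case
      proof
        assume i: "Suc i < c0"
        have "(of_nat (s (Suc i)) :: 'p mod_ring) = of_nat (s i + l)" using sd[OF i] ml by simp
        moreover have "s (Suc i) < CARD('p)" "s i + l < CARD('p)" using s(1)[OF i] s(1)[of i] i lD D2 by simp_all
        ultimately have "s (Suc i) = s i + l" by (rule of_nat_mod_ring_inj)
        then show "s (Suc i) = s 0 + Suc i * l" using Suc i by simp
      qed
    qed simp
    from this[of "c0 - 1"] have "s (c0 - 1) = s 0 + (c0 - 1) * l" using c03 by simp
    then have "(c0 - 1) * l \<le> D" using s(1)[of "c0 - 1"] c03 by simp
    then show ?thesis using ml lD by blast
  next
    case False
    define l where "l = s 0 - s 1"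
    have ml: "m = - of_nat l" using sd[of 0] c03 False by (simp add: l_def of_nat_diff)
    have lD: "l \<le> D" using s(1)[of 0] c03 by (simp add: l_def)
    have "i < c0 \<longrightarrow> s 0 = s i + i * l" for i
    proof (induction i)
      case (Suc i)
      show ?case
      proof
        assume i: "Suc i < c0"
        have "(of_nat (s i) :: 'p mod_ring) = of_nat (s (Suc i) + l)" using sd[OF i] ml by simp
        moreover have "s i < CARD('p)" "s (Suc i) + l < CARD('p)" using s(1)[OF i] s(1)[of i] i lD D2 by simp_all
        ultimately have "s i = s (Suc i) + l" by (rule of_nat_mod_ring_inj)
        then show "s 0 = s (Suc i) + Suc i * l" using Suc i by simp
      qed
    qed simp
    from this[of "c0 - 1"] have "s 0 = s (c0 - 1) + (c0 - 1) * l" using c03 by simp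
    then have "(c0 - 1) * l \<le> D" using s(1)[of 0] c03 by simp
    then show ?thesis using ml lD by blast
  qed
  then obtain l where l: "m = of_nat l \<or> m = - of_nat l" "(c0 - 1) * l \<le> D" "l \<le> D" by blast
  have l2: "2 \<le> l"
  proof (rule ccontr)
    assume "\<not> 2 \<le> l"
    then have "l = 0 \<or> l = 1" by linarith
    then show False using l(1) m by auto
  qed
  then obtain l1 where l1: "l = Suc l1" "1 \<le> l1" by (cases l) auto
  have "(c0 - 1) * l1 \<le> k - 1" using l(2) c03 unfolding l1(1) D_def by simp
  moreover have "2 * l1 \<le> (c0 - 1) * l1" using c03 by (intro mult_le_mono1) simp
  ultimately have lk: "2 * l1 \<le> k - 1" by linarith
  have lN: "l \<le> N j" if "j \<in> I" for j using cT[OF that] lk l1 by (simp add: N_def)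
  have lp: "l + 1 < CARD('p)" using l(3) D2 I(2) unfolding D_def k_def using c03 by linarith
  have start: "\<exists>q. q + (c j - 1) * l1 + 1 \<le> k \<and> of_nat l * x + v j = w + of_nat q"
    if j: "j \<in> I" and x: "(*) (of_nat l) ` iv x (c j) = (*) m ` E j" for j x
  proof -
    have "iv (of_nat l * x + v j) (N j + (c j - 1) * l) \<subseteq> (*) (of_nat l) ` iv x (c j) + iv (v j) (N j)"
      using l2 lN[OF j] c3[OF j] by (intro iv_step) auto
    also have "\<dots> \<subseteq> iv w L" using sub[OF j] J[OF j] w x by simp
    finally obtain q where q: "q + (N j + (c j - 1) * l) \<le> L" "of_nat l * x + v j = w + of_nat q"
      using iv_subset[of "of_nat l * x + v j" "N j + (c j - 1) * l" w L] Lp by (auto simp: N_def)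
    have "(c j - 1) * l = (c j - 1) * l1 + (c j - 1)" unfolding l1(1) by simp
    then have "q + (c j - 1) * l1 + 1 \<le> k" using q(1) Lp(2) cT[OF j] unfolding N_def by linarith
    then show ?thesis using q(2) by blast
  qed
  show False using l(1)
  proof
    assume ml: "m = of_nat l"
    \<comment> \<open>For the coefficient \<open>l\<close>, the offset determines
      \<open>l - 1\<close> times the starting point of \<open>E j\<close>.\<close>
    have "\<exists>q. q + 2 \<le> card I \<and> of_nat l1 * u j = (w - V) + of_nat q" if j: "j \<in> I" for j
    proof -
      obtain q where q: "q + (c j - 1) * l1 + 1 \<le> k" "of_nat l * u j + v j = w + of_nat q"
        using start[OF j, of "u j"] u[OF j] ml by auto
      have "1 * 1 \<le> (c j - 1) * l1" using c3[OF j] l1 by (intro mult_le_mono) auto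
      then have "q + 2 \<le> k" using q(1) by linarith
      then have "q + 2 \<le> card I" by (simp only: k_def)
      moreover have "of_nat l1 * u j = (of_nat l * u j + v j) - V" by (simp add: v_def l1(1) algebra_simps)
      then have "of_nat l1 * u j = (w - V) + of_nat q" unfolding q(2) by simp
      ultimately show ?thesis by blast
    qed
    then obtain q where q: "q j + 2 \<le> card I" "of_nat l1 * u j = (w - V) + of_nat (q j)" if "j \<in> I" for j by metis
    obtain i j where ij: "i \<in> I" "j \<in> I" "i \<noteq> j" "q i = q j" using pigeonhole_less[OF I(1) I0, of q] q(1) by metis
    have "(of_nat l1 :: 'p mod_ring) \<noteq> 0" using l1 lp by (intro of_nat_mod_ring_neq_0) auto
    moreover have "of_nat l1 * u i = of_nat l1 * u j" using q(2)[OF ij(1)] q(2)[OF ij(2)] ij(4) by simp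
    ultimately have "u i = u j" using mult_left_cancel by blast
    moreover have "u i + of_nat 0 \<in> E i" "u j + of_nat 0 \<in> E j"
      unfolding u[OF ij(1)] u[OF ij(2)] using c3[OF ij(1)] c3[OF ij(2)] by (intro mem_iv; simp)+
    ultimately show False using dis ij unfolding disjoint_family_on_def by auto
  next
    assume ml: "m = - of_nat l"
    \<comment> \<open>For the coefficient \<open>- l\<close>, the offset depends on both start and
      length of \<open>E j\<close>. Passing from the start to the point
      \<open>u j + of_nat t\<close> absorbs the length, and the new offset determines
      \<open>l + 1\<close> times that point.\<close>
    have "\<exists>q y. q + 2 \<le> card I \<and> y \<in> E j \<and> - (of_nat (l + 1) * y) = (w - V) + of_nat q" if j: "j \<in> I" for j
    proof -
      have "(*) m ` E j = (*) (of_nat l) ` uminus ` E j" by (simp add: image_image ml)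
      also have "uminus ` E j = iv (- (u j + of_nat (c j - 1))) (c j)" unfolding u[OF j] using c3[OF j] by (intro iv_uminus) simp
      finally obtain q where q: "q + (c j - 1) * l1 + 1 \<le> k" "of_nat l * (- (u j + of_nat (c j - 1))) + v j = w + of_nat q"
        using start[OF j, of "- (u j + of_nat (c j - 1))"] by auto
      obtain t where t: "c j \<le> (l + 1) * t" "(l + 1) * t \<le> l * (c j - 1)" using multiple_between[OF l2 c3[OF j]] by blast
      have "t < c j"
      proof (rule ccontr)
        assume "\<not> t < c j"
        then have "(l + 1) * (c j) \<le> (l + 1) * t" by (intro mult_le_mono2) simp
        moreover have "l * (c j - 1) \<le> l * c j" by (intro mult_le_mono2) simp
        ultimately show False using t c3[OF j] by (simp add: algebra_simps)
      qed
      then have y: "u j + of_nat t \<in> E j" unfolding u[OF j] by (rule mem_iv)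
      define q' where "q' = q + (l * (c j - 1) - (l + 1) * t)"
      have "(c j - 1) * l1 + (c j - 1) = l * (c j - 1)" unfolding l1(1) by (simp add: mult.commute)
      then have q'k: "q' + 2 \<le> card I" using q(1) t c3[OF j] unfolding q'_def k_def by linarith
      have "(of_nat q' :: 'p mod_ring) = of_nat q + (of_nat l * of_nat (c j - 1) - of_nat (l + 1) * of_nat t)"
        using t(2) by (simp only: q'_def of_nat_add of_nat_diff of_nat_mult)
      moreover have "of_nat q = of_nat l * (- (u j + of_nat (c j - 1))) + v j - w" using q(2) by simp
      ultimately have "- (of_nat (l + 1) * (u j + of_nat t)) = (w - V) + of_nat q'"
        by (simp add: v_def algebra_simps)
      then show ?thesis using q'k y by blast
    qed
    then obtain q y where q: "q j + 2 \<le> card I" "y j \<in> E j" "- (of_nat (l + 1) * y j) = (w - V) + of_nat (q j)" if "j \<in> I" for j by metis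
    obtain i j where ij: "i \<in> I" "j \<in> I" "i \<noteq> j" "q i = q j" using pigeonhole_less[OF I(1) I0, of q] q(1) by metis
    have "(of_nat (l + 1) :: 'p mod_ring) \<noteq> 0" using lp by (intro of_nat_mod_ring_neq_0) auto
    moreover have "of_nat (l + 1) * y i = of_nat (l + 1) * y j"
      using q(3)[OF ij(1)] q(3)[OF ij(2)] ij(4) by (metis neg_equal_iff_equal)
    ultimately have "y i = y j" using mult_left_cancel by blast
    then show False using dis ij q(2)[OF ij(1)] q(2)[OF ij(2)] unfolding disjoint_family_on_def by auto
  qed
qed

text \<open>Exchanging the signs of \<open>E i\<close> and \<open>E j\<close> moves the total sum by
  \<open>z i - z j\<close>, where \<open>z i\<close> is the sum of the end points of
  \<open>E i\<close>. Both positions fit into \<open>W\<close>, so all \<open>z i\<close> lie in a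
  window of \<open>k\<close> places. Then the middle triples of the \<open>k\<close> disjoint
  intervals, doubled, would crowd into \<open>k + 5\<close> places, although they have
  \<open>3 k\<close> points.\<close>

lemma signed_interval_family_contra:
  fixes E :: "nat \<Rightarrow> 'p::prime_card mod_ring set"
  assumes I: "finite I" "4 \<le> card I" and dis: "disjoint_family_on E I" and E: "\<And>i. i \<in> I \<Longrightarrow> bd 1 (E i) \<le> 1"
    "\<And>i. i \<in> I \<Longrightarrow> 3 \<le> card (E i)" and sz: "(\<Sum>i\<in>I. card (E i)) + 4 \<le> CARD('p)"
    and W: "bd 1 W \<le> 1" "card W \<le> (\<Sum>i\<in>I. card (E i))"
    and sub: "\<And>i j. i \<in> I \<Longrightarrow> j \<in> I \<Longrightarrow> i \<noteq> j \<Longrightarrow> \<exists>g. (\<forall>l. g l = 1 \<or> g l = - 1) \<and>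
      E i + uminus ` E j + (\<Sum>l\<in>I - {i, j}. (*) (g l) ` E l) \<subseteq> W \<and>
      uminus ` E i + E j + (\<Sum>l\<in>I - {i, j}. (*) (g l) ` E l) \<subseteq> W"
  shows False
proof -
  define k where "k = card I"
  define c where "c i = card (E i)" for i
  have c3: "3 \<le> c i" if "i \<in> I" for i using E(2)[OF that] by (simp add: c_def)
  have cp: "c i \<le> (\<Sum>i\<in>I. card (E i))" if "i \<in> I" for i
    unfolding c_def using I(1) that by (intro member_le_sum) auto
  have "\<exists>x. E i = iv x (c i)" if "i \<in> I" for i
    unfolding c_def using E(1)[OF that] c3[OF that] cp[OF that] sz by (intro iv_of_ap) (auto simp: c_def)
  then obtain u where u: "E i = iv (u i) (c i)" if "i \<in> I" for i by metis
  define T where "T = (\<Sum>i\<in>I. c i - 1)"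
  have Tk: "(\<Sum>i\<in>I. card (E i)) = T + k"
  proof -
    have "(\<Sum>i\<in>I. card (E i)) = (\<Sum>i\<in>I. (c i - 1) + 1)"
      by (rule sum.cong) (use c3 in \<open>force simp: c_def\<close>)+
    then show ?thesis unfolding T_def k_def by (simp only: sum.distrib) simp
  qed
  have kp: "3 * k + 4 \<le> CARD('p)"
  proof -
    have "k * 3 \<le> (\<Sum>i\<in>I. card (E i))" using sum_bounded_below[of I 3 "\<lambda>i. card (E i)"] E(2) by (simp add: k_def)
    then show ?thesis using sz by linarith
  qed
  define L where "L = card W"
  have Lp: "L < CARD('p)" "L \<le> T + k" using W(2) sz Tk by (simp_all add: L_def)
  define z where "z i = u i + u i + of_nat (c i - 1)" for i
  have zd: "\<exists>e::int. \<bar>e\<bar> \<le> int k - 1 \<and> z i - z j = of_int e" if ij: "i \<in> I" "j \<in> I" for i j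
  proof (cases "i = j")
    case True
    then show ?thesis using I(2) by (intro exI[of _ 0]) (simp add: k_def)
  next
    case False
    obtain g where g: "\<And>l. g l = 1 \<or> g l = - 1" "E i + uminus ` E j + (\<Sum>l\<in>I - {i, j}. (*) (g l) ` E l) \<subseteq> W"
      "uminus ` E i + E j + (\<Sum>l\<in>I - {i, j}. (*) (g l) ` E l) \<subseteq> W" using sub[OF ij False] by blast
    have "\<exists>x. (*) (g l) ` E l = iv x (c l)" if "l \<in> I" for l
    proof (cases "g l = 1")
      case True
      then show ?thesis using u[OF that] by auto
    next
      case F: False
      then have "g l = - 1" using g(1) by blast
      then have "(*) (g l) ` E l = uminus ` E l" by simp
      also have "\<dots> = iv (- (u l + of_nat (c l - 1))) (c l)" unfolding u[OF that] using c3[OF that] by (intro iv_uminus) simp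
      finally show ?thesis by blast
    qed
    then obtain r where r: "(*) (g l) ` E l = iv (r l) (c l)" if "l \<in> I" for l by metis
    define \<rho> where "\<rho> = (\<Sum>l\<in>I - {i, j}. r l)"
    define N where "N = (\<Sum>l\<in>I - {i, j}. c l - 1) + 1"
    have R: "(\<Sum>l\<in>I - {i, j}. (*) (g l) ` E l) = iv \<rho> N"
      unfolding \<rho>_def N_def using I(1) r c3 by (intro iv_sum) force+
    have TN: "(c i - 1) + (c j - 1) + N = T + 1"
    proof -
      have "T = (c i - 1) + (\<Sum>l\<in>I - {i}. c l - 1)" unfolding T_def by (rule sum.remove[OF I(1) ij(1)])
      also have "(\<Sum>l\<in>I - {i}. c l - 1) = (c j - 1) + (\<Sum>l\<in>I - {i} - {j}. c l - 1)"
        by (rule sum.remove) (use I ij False in auto)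
      also have "I - {i} - {j} = I - {i, j}" by auto
      finally show ?thesis by (simp add: N_def)
    qed
    have len: "iv x (c i) + iv y (c j) + iv \<rho> N = iv (x + y + \<rho>) (T + 1)" for x y
    proof -
      have c: "3 \<le> c i" "3 \<le> c j" using c3 ij by blast+
      have "iv x (c i) + iv y (c j) + iv \<rho> N = iv (x + y) (c i + c j - 1) + iv \<rho> N"
        using c by (subst iv_plus) auto
      also have "\<dots> = iv (x + y + \<rho>) (c i + c j - 1 + N - 1)" using c by (intro iv_plus) (auto simp: N_def)
      also have "c i + c j - 1 + N - 1 = T + 1" using TN c by linarith
      finally show ?thesis .
    qed
    have neg: "uminus ` E l = iv (- (u l + of_nat (c l - 1))) (c l)" if "l \<in> I" for l
      unfolding u[OF that] using c3[OF that] by (intro iv_uminus) simp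
    have s1: "iv (u i + - (u j + of_nat (c j - 1)) + \<rho>) (T + 1) \<subseteq> W"
      using g(2) unfolding R neg[OF ij(2)] u[OF ij(1)] len .
    have s2: "iv (- (u i + of_nat (c i - 1)) + u j + \<rho>) (T + 1) \<subseteq> W"
      using g(3) unfolding R neg[OF ij(1)] u[OF ij(2)] len .
    have "u i + - (u j + of_nat (c j - 1)) + \<rho> + of_nat 0 \<in> iv (u i + - (u j + of_nat (c j - 1)) + \<rho>) (T + 1)"
      by (rule mem_iv) simp
    then have "W \<noteq> {}" using s1 by blast
    then obtain w where w: "W = iv w L" using iv_of_ap[OF W(1)] Lp by (auto simp: L_def)
    obtain a where a: "a + (T + 1) \<le> L" "u i + - (u j + of_nat (c j - 1)) + \<rho> = w + of_nat a"
      using iv_subset[OF s1[unfolded w]] Lp by auto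
    obtain b where b: "b + (T + 1) \<le> L" "- (u i + of_nat (c i - 1)) + u j + \<rho> = w + of_nat b"
      using iv_subset[OF s2[unfolded w]] Lp by auto
    have "z i - z j = (u i + - (u j + of_nat (c j - 1)) + \<rho>) - (- (u i + of_nat (c i - 1)) + u j + \<rho>)"
      by (simp add: z_def algebra_simps)
    also have "\<dots> = of_int (int a - int b)" unfolding a(2) b(2) by simp
    finally have "z i - z j = of_int (int a - int b)" .
    moreover have "\<bar>int a - int b\<bar> \<le> int k - 1" using a(1) b(1) Lp(2) by linarith
    ultimately show ?thesis by blast
  qed
  have I0: "I \<noteq> {}" using I(2) by auto
  then obtain j0 where j0: "j0 \<in> I" by blast
  obtain \<delta> where \<delta>: "\<bar>\<delta> i\<bar> \<le> int k - 1" "z i - z j0 = of_int (\<delta> i)" if "i \<in> I" for i using zd[OF _ j0] by metis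
  obtain jm where jm: "jm \<in> I" "\<And>i. i \<in> I \<Longrightarrow> \<delta> jm \<le> \<delta> i"
    using arg_min_if_finite(1)[OF I(1) I0, of \<delta>] arg_min_least[OF I(1) I0, of _ \<delta>] by blast
  \<comment> \<open>Pairwise closeness gives one common window since three numbers below
    \<open>k\<close> in absolute value cannot combine to a nonzero multiple of
    \<open>p\<close>.\<close>
  have \<eta>: "\<exists>e<k. z i = z jm + of_nat e" if i: "i \<in> I" for i
  proof -
    obtain e :: int where e: "\<bar>e\<bar> \<le> int k - 1" "z i - z jm = of_int e" using zd[OF i jm(1)] by blast
    have "(of_int (\<delta> i - \<delta> jm - e) :: 'p mod_ring) = (z i - z j0) - (z jm - z j0) - (z i - z jm)"
      using \<delta>(2)[OF i] \<delta>(2)[OF jm(1)] e(2) by simp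
    then have "(of_int (\<delta> i - \<delta> jm - e) :: 'p mod_ring) = 0" by simp
    then have dv: "int CARD('p) dvd \<delta> i - \<delta> jm - e" by (simp only: of_int_mod_ring_eq_0_iff)
    have "\<bar>\<delta> i - \<delta> jm - e\<bar> < int CARD('p)" using \<delta>(1)[OF i] \<delta>(1)[OF jm(1)] e(1) kp by linarith
    then have "\<delta> i - \<delta> jm - e = 0" using dv zdvd_not_zless[of "\<bar>\<delta> i - \<delta> jm - e\<bar>" "int CARD('p)"] by fastforce
    then have "0 \<le> e" using jm(2)[OF i] by simp
    then have "z i = z jm + of_nat (nat e)" using e(2) by (simp add: of_nat_nat diff_eq_eq add.commute)
    moreover have "nat e < k" using e(1) \<open>0 \<le> e\<close> I(2) by (simp add: k_def)
    ultimately show ?thesis by blast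
  qed
  \<comment> \<open>Three middle points: their doubles stay at bounded distance from
    \<open>z i\<close> for either parity of the length.\<close>
  define F where "F i = iv (u i + of_nat (c i div 2 - 1)) 3" for i
  have FE: "F i \<subseteq> E i" if i: "i \<in> I" for i
  proof
    fix x assume "x \<in> F i"
    then obtain t where t: "t < 3" "x = u i + of_nat (c i div 2 - 1) + of_nat t" unfolding F_def by (rule mem_ivE)
    have "x = u i + of_nat (c i div 2 - 1 + t)" using t by (simp add: add.assoc)
    moreover have "c i div 2 - 1 + t < c i" using c3[OF i] t(1) by linarith
    ultimately show "x \<in> E i" unfolding u[OF i] by (simp only: mem_iv)
  qed
  have "card (\<Union>i\<in>I. F i) = (\<Sum>i\<in>I. card (F i))"
  proof (rule card_UN_disjoint[OF I(1)])
    show "\<forall>i\<in>I. \<forall>j\<in>I. i \<noteq> j \<longrightarrow> F i \<inter> F j = {}"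
      using FE dis unfolding disjoint_family_on_def by blast
  qed auto
  also have "\<dots> = (\<Sum>i\<in>I. 3)" using kp by (intro sum.cong) (simp_all add: F_def card_iv)
  finally have c3k: "card (\<Union>i\<in>I. F i) = 3 * k" by (simp add: k_def)
  have n2: "(2 :: 'p mod_ring) \<noteq> 0" using of_nat_mod_ring_neq_0[where n = 2 and 'p = 'p] kp by simp
  \<comment> \<open>Adding 2 makes the offsets from \<open>z i\<close> range between 0 and
    5.\<close>
  have "(\<lambda>x. 2 * x + 2) ` (\<Union>i\<in>I. F i) \<subseteq> iv (z jm) (k + 5)"
  proof
    fix y assume "y \<in> (\<lambda>x. 2 * x + 2) ` (\<Union>i\<in>I. F i)"
    then obtain x i where x: "i \<in> I" "x \<in> F i" "y = 2 * x + 2" by blast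
    obtain t where t: "t < 3" "x = u i + of_nat (c i div 2 - 1) + of_nat t" using x(2) unfolding F_def by (rule mem_ivE)
    define h where "h = c i div 2 - 1 + t"
    have hc: "c i - 1 \<le> 2 * h + 2" "2 * h + 2 - (c i - 1) \<le> 5" 
    proof -
      define hh where "hh = c i div 2"
      have "c i = 2 * hh \<or> c i = 2 * hh + 1" unfolding hh_def by presburger
      moreover have "h = hh - 1 + t" by (simp add: h_def hh_def)
      ultimately show "c i - 1 \<le> 2 * h + 2" "2 * h + 2 - (c i - 1) \<le> 5" using c3[OF x(1)] t(1) by linarith+
    qed
    obtain e where e: "e < k" "z i = z jm + of_nat e" using \<eta>[OF x(1)] by blast
    have xh: "x = u i + of_nat h" using t(2) by (simp only: h_def of_nat_add add.assoc)
    have "y = u i + u i + of_nat (2 * h + 2)" unfolding x(3) xh by (simp add: algebra_simps)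
    also have "\<dots> = z i + of_nat (2 * h + 2 - (c i - 1))" using hc(1) by (simp add: z_def of_nat_diff algebra_simps)
    also have "\<dots> = z jm + of_nat (e + (2 * h + 2 - (c i - 1)))" using e(2) by (simp only: of_nat_add add.assoc)
    finally have y: "y = z jm + of_nat (e + (2 * h + 2 - (c i - 1)))" .
    show "y \<in> iv (z jm) (k + 5)" unfolding y by (rule mem_iv) (use e hc in linarith)
  qed
  then have "card ((\<lambda>x. 2 * x + 2) ` (\<Union>i\<in>I. F i)) \<le> card (iv (z jm) (k + 5))" by (intro card_mono) (simp_all add: iv_def)
  moreover have "card (iv (z jm) (k + 5)) \<le> k + 5" using card_image_le[of "{..<k + 5}"] unfolding iv_def by fastforce
  moreover have "card ((\<lambda>x. 2 * x + 2) ` (\<Union>i\<in>I. F i)) = 3 * k"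
    using n2 c3k by (subst card_image) (auto simp: inj_on_def)
  ultimately show False using I(2) by (simp add: k_def)
qed

text \<open>View the sum \<open>S\<close> as built in steps of 1 and also in steps of
  \<open>m\<close>. It is a progression with difference 1, hence not with difference
  \<open>m\<close>, so it has at least \<open>card Y + 2 * (card X - 1)\<close> elements. This
  forces three-point classes and equality in both inclusions; comparing translations then gives
  \<open>A = B\<close>.\<close>

lemma scaled_pair_contra:
  fixes A B P :: "'p::prime_card mod_ring set"
  assumes dis: "A \<inter> B = {}" and sz: "3 \<le> card A" "3 \<le> card B" "card A + card B + 7 \<le> CARD('p)"
    and b: "bd 1 A \<le> 1" "bd 1 B \<le> 1" and P: "bd 1 P \<le> 1" "card P \<le> card A + card B + 1"
    and m: "m \<noteq> 0" "m \<noteq> 1" "m \<noteq> - 1" and e: "e = 1 \<or> e = - 1"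
    and sub: "(*) m ` A + (*) e ` B \<subseteq> P" "(*) e ` A + (*) m ` B \<subseteq> P"
  shows False
proof -
  have e0: "e \<noteq> 0" using e by auto
  have me: "m \<noteq> e" using m e by auto
  have key: "card X = 3 \<and> (*) m ` X + (*) e ` Y = P"
    if h: "3 \<le> card X" "3 \<le> card Y" "card X + card Y = card A + card B" "bd 1 X \<le> 1" "bd 1 Y \<le> 1" "(*) m ` X + (*) e ` Y \<subseteq> P"
    for X Y :: "'p mod_ring set"
  proof -
    define S where "S = (*) m ` X + (*) e ` Y"
    have SP: "S \<subseteq> P" using h(6) by (simp add: S_def)
    have cS: "card S \<le> card P" by (rule card_mono[OF finite SP])
    have cY: "card ((*) e ` Y) = card Y" and cX: "card ((*) m ` X) = card X" using e0 m by simp_all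
    have bY: "bd 1 ((*) e ` Y) \<le> 1" using h(5) e by auto
    have "(*) e ` Y \<noteq> {}" "card ((*) e ` Y) < CARD('p)" using h cY sz by auto
    then obtain y where y: "(*) e ` Y = iv y (card Y)" using iv_of_ap[OF bY] cY by auto
    have l1: "card X + (card Y - 1) * bd 1 S \<le> card S"
      using card_plus_interval[of "card Y" "(*) m ` X" y] h(2) cX unfolding S_def y iv_def by simp
    have bS: "bd 1 S \<le> 1"
    proof (rule ccontr)
      assume n: "\<not> ?thesis"
      then have "(card Y - 1) * 2 \<le> (card Y - 1) * bd 1 S" by (intro mult_le_mono2) simp
      then have "card P \<le> card S" using l1 h P by linarith
      then have "S = P" using SP by (intro card_seteq) auto
      then show False using n P by simp
    qed
    have "X \<noteq> {}" "card X < CARD('p)" using h sz by auto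
    then obtain x where x: "X = iv x (card X)" using iv_of_ap[OF h(4)] by auto
    \<comment> \<open>\<open>S\<close> divided by \<open>m\<close>, so that steps of
      \<open>m\<close> become steps of 1.\<close>
    define S' where "S' = (*) (1 / m) ` (*) e ` Y + X"
    have S'S: "(*) m ` S' = S"
      unfolding S'_def S_def scale_plus using m by (simp add: image_image add.commute)
    have cS': "card S' = card S" using S'S m by (metis card_scale)
    have bS': "bd 1 S' = bd m S" using bd_scale[OF m(1), of 1 S'] S'S by simp
    have "card ((*) (1 / m) ` (*) e ` Y) + (card X - 1) * bd 1 S' \<le> card S'"
      using card_plus_interval[of "card X" "(*) (1 / m) ` (*) e ` Y" x] h(1) x[unfolded iv_def] unfolding S'_def by simp
    moreover have "card ((*) (1 / m) ` (*) e ` Y) = card Y" using m cY by (subst card_scale) auto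
    ultimately have l2: "card Y + (card X - 1) * bd m S \<le> card S" by (simp only: cS' bS')
    have "3 \<le> card S" using l1 h(1) by linarith
    moreover have "card S + 3 \<le> CARD('p)" using cS P sz by linarith
    ultimately have "2 \<le> bd m S"
      using ap_direction[OF bS, of m] m sz by fastforce
    then have "(card X - 1) * 2 \<le> (card X - 1) * bd m S" by (rule mult_le_mono2)
    then have "card X = 3" "card P \<le> card S" using l2 cS P h by linarith+
    then show ?thesis using SP card_seteq[of P S] by (simp add: S_def)
  qed
  have kA: "card A = 3" "(*) m ` A + (*) e ` B = P" using key[of A B] sz b sub by simp_all
  have kB: "card B = 3" "(*) m ` B + (*) e ` A = P" using key[of B A] sz b sub by (simp_all add: add.commute)
  obtain a where a: "A = iv a 3" using iv_of_ap[OF b(1)] kA sz by force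
  obtain b' where b': "B = iv b' 3" using iv_of_ap[OF b(2)] kB sz by force
  have BA: "B = (+) (b' - a) ` A" unfolding a b' iv_def by (simp add: image_image)
  let ?Q = "(*) m ` A + (*) e ` A"
  have sc: "(*) t ` (+) s ` X = (+) (t * s) ` (*) t ` X" for t s and X :: "'p mod_ring set"
    by (simp add: image_image distrib_left)
  have "(*) m ` A + (*) e ` B = (+) (e * (b' - a)) ` ?Q"
    unfolding BA sc by (metis translate_plus add.commute)
  moreover have "(*) m ` B + (*) e ` A = (+) (m * (b' - a)) ` ?Q"
    unfolding BA sc by (simp only: translate_plus)
  ultimately have "(+) (e * (b' - a)) ` ?Q = (+) (m * (b' - a)) ` ?Q" using kA kB by simp
  moreover have "?Q \<noteq> {}" using kA by auto
  moreover have "card ?Q < CARD('p)"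
  proof -
    have "card ((+) (e * (b' - a)) ` ?Q) = card P" using kA(2) \<open>(*) m ` A + (*) e ` B = (+) (e * (b' - a)) ` ?Q\<close> by simp
    then have "card ?Q = card P" by (simp only: card_translate)
    then show ?thesis using P sz by linarith
  qed
  ultimately have "e * (b' - a) = m * (b' - a)" by (rule translate_cancel)
  then have "(m - e) * (b' - a) = 0" by (simp add: algebra_simps)
  then have "b' = a" using me by simp
  then show False using a b' dis kA by auto
qed

lemma scale_sum: "(*) a ` (\<Sum>i\<in>I. S i) = (\<Sum>i\<in>I. (*) a ` S i)" for a :: "'a::field"
proof (induction I rule: infinite_finite_induct)
  case (infinite I)
  then show ?case by (simp add: set_zero)
next
  case empty
  show ?case by (simp add: set_zero)
next
  case (insert i I)
  then show ?case by (simp add: scale_plus)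
qed

section \<open>Sums over all arrangements of the coefficients\<close>

text \<open>Coefficients are distributed by functions with a given multiset of values, not by
  permutations, so that putting aside a class and a coefficient removes one index and one multiset
  element.\<close>

definition arrangements :: "nat set \<Rightarrow> 'a::field multiset \<Rightarrow> (nat \<Rightarrow> 'a set) \<Rightarrow> 'a set" where
  "arrangements I M C = (\<Union>f\<in>{f. image_mset f (mset_set I) = M}. \<Sum>i\<in>I. (*) (f i) ` C i)"

lemma arrangements_sup:
  "image_mset f (mset_set I) = M \<Longrightarrow> (\<Sum>i\<in>I. (*) (f i) ` C i) \<subseteq> arrangements I M C"
  by (auto simp: arrangements_def)

lemma assignment_extend:
  assumes "finite I" "l \<in> I" "c \<in># M" "image_mset g (mset_set (I - {l})) = M - {#c#}"
  shows "image_mset (g(l := c)) (mset_set I) = M"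
proof -
  have "mset_set I = add_mset l (mset_set (I - {l}))"
    using assms(1,2) by (simp add: mset_set.remove)
  moreover have "image_mset (g(l := c)) (mset_set (I - {l})) = image_mset g (mset_set (I - {l}))"
    by (rule image_mset_cong) (use assms(1) in auto)
  ultimately show ?thesis using assms(3,4) by simp
qed

lemma assignment_exists:
  assumes "finite I" "size M = card I"
  shows "\<exists>f. image_mset f (mset_set I) = M"
  using assms
proof (induction I arbitrary: M rule: finite_induct)
  case (insert i I)
  then obtain c where c: "c \<in># M" by (metis card_insert_disjoint multiset_nonemptyE nat.distinct(1) size_empty)
  have "size (M - {#c#}) = card I" using insert c by (simp add: size_Diff_singleton)
  then obtain g where "image_mset g (mset_set I) = M - {#c#}" using insert.IH by blast
  then have "image_mset (g(i := c)) (mset_set (insert i I)) = M"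
    using insert.hyps c by (intro assignment_extend) auto
  then show ?case by blast
qed simp

lemma arrangements_remove:
  assumes "finite I" "l \<in> I" "c \<in># M"
  shows "arrangements (I - {l}) (M - {#c#}) C + (*) c ` C l \<subseteq> arrangements I M C"
proof
  fix z assume "z \<in> arrangements (I - {l}) (M - {#c#}) C + (*) c ` C l"
  then obtain a b where ab: "z = a + b" "a \<in> arrangements (I - {l}) (M - {#c#}) C" "b \<in> (*) c ` C l"
    by (rule set_plus_elim)
  obtain g where g: "image_mset g (mset_set (I - {l})) = M - {#c#}" "a \<in> (\<Sum>i\<in>I - {l}. (*) (g i) ` C i)"
    using ab(2) by (auto simp: arrangements_def)
  let ?f = "g(l := c)"
  have "(\<Sum>i\<in>I. (*) (?f i) ` C i) = (*) (?f l) ` C l + (\<Sum>i\<in>I - {l}. (*) (?f i) ` C i)"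
    using assms(1,2) by (rule sum.remove)
  also have "(\<Sum>i\<in>I - {l}. (*) (?f i) ` C i) = (\<Sum>i\<in>I - {l}. (*) (g i) ` C i)" by (rule sum.cong) auto
  finally have "b + a \<in> (\<Sum>i\<in>I. (*) (?f i) ` C i)" using ab(3) g(2) by (auto intro: set_plus_intro)
  then have "z \<in> (\<Sum>i\<in>I. (*) (?f i) ` C i)" using ab(1) by (simp add: add.commute)
  then show "z \<in> arrangements I M C"
    using arrangements_sup[OF assignment_extend[OF assms g(1)]] by blast
qed

lemma size2_mset:
  assumes "size M = 2" obtains a b where "M = {#a, b#}"
proof -
  obtain a where a: "a \<in># M" using assms by fastforce
  then have "size (M - {#a#}) = 1" using assms by (simp add: size_Diff_singleton)
  then obtain b where "M - {#a#} = {#b#}" by (metis size_1_singleton_mset)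
  then have "M = {#a, b#}" using a by (metis insert_DiffM)
  then show ?thesis by (rule that)
qed

lemma size3_mset:
  assumes "size M = 3" obtains a b c where "M = {#a, b, c#}"
proof -
  obtain a where a: "a \<in># M" using assms by fastforce
  then have "size (M - {#a#}) = 2" using assms by (simp add: size_Diff_singleton)
  then obtain b c where "M - {#a#} = {#b, c#}" by (rule size2_mset)
  then have "M = {#a, b, c#}" using a by (metis insert_DiffM)
  then show ?thesis by (rule that)
qed

lemma arrangements_pair:
  assumes "i \<noteq> j"
  shows "(*) a ` C i + (*) b ` C j \<subseteq> arrangements {i, j} {#a, b#} C"
proof -
  let ?f = "(\<lambda>_. b)(i := a)"
  have v: "image_mset ?f (mset_set {i, j}) = {#a, b#}" using assms by simp
  have "(\<Sum>l\<in>{i, j}. (*) (?f l) ` C l) = (*) a ` C i + (*) b ` C j" using assms by simp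
  then show ?thesis using arrangements_sup[OF v, of C] by (simp only:)
qed

lemma arrangements_pair_card:
  fixes C :: "nat \<Rightarrow> 'p::prime_card mod_ring set"
  assumes I: "card I = 2" "size M = 2" and dis: "disjoint_family_on C I" and c3: "\<And>i. i \<in> I \<Longrightarrow> 3 \<le> card (C i)"
    and sz: "(\<Sum>i\<in>I. card (C i)) + 4 \<le> CARD('p)" and nz: "\<And>c. c \<in># M \<Longrightarrow> c \<noteq> 0"
    and ne: "\<And>c. M \<noteq> {#c, c#}" "\<And>c. M \<noteq> {#c, - c#}"
  shows "(\<Sum>i\<in>I. card (C i)) + 1 \<le> card (arrangements I M C)"
proof -
  obtain i j where ij: "I = {i, j}" "i \<noteq> j" using I(1) by (auto simp: card_2_iff)
  obtain a b where ab: "M = {#a, b#}" using I(2) by (rule size2_mset)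
  have 1: "a \<noteq> 0" "b \<noteq> 0" "a \<noteq> b" "a \<noteq> - b"
  proof -
    show "a \<noteq> 0" "b \<noteq> 0" using nz ab by auto
    show "a \<noteq> b" using ne(1) ab by auto
    show "a \<noteq> - b" using ne(2)[of b] ab by (auto simp: add_mset_commute)
  qed
  have "C i \<inter> C j = {}" using dis ij unfolding disjoint_family_on_def by auto
  then have "card (C i) + card (C j) + 1 \<le> card (((*) a ` C i + (*) b ` C j) \<union> ((*) b ` C i + (*) a ` C j))"
    using c3 ij sz 1 by (intro pair_sum_bound) auto
  also have "\<dots> \<le> card (arrangements I M C)"
  proof (rule card_mono)
    have "(*) b ` C i + (*) a ` C j \<subseteq> arrangements I M C"
      using arrangements_pair[OF ij(2), of b C a] ij ab by (simp add: add_mset_commute)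
    then show "((*) a ` C i + (*) b ` C j) \<union> ((*) b ` C i + (*) a ` C j) \<subseteq> arrangements I M C"
      using arrangements_pair[OF ij(2), of a C b] ij ab by simp
  qed simp
  finally show ?thesis using ij by simp
qed

text \<open>Giving one \<open>e\<close> to a class leaves \<open>e, - e\<close> for the other two in
  both orders, that is, a difference set; this holds for each of the three classes.\<close>

lemma arrangements_triple_card:
  fixes C :: "nat \<Rightarrow> 'p::prime_card mod_ring set"
  assumes I: "card I = 3" and M: "M = {#e, e, - e#}" "e \<noteq> 0" and dis: "disjoint_family_on C I" and c3: "\<And>i. i \<in> I \<Longrightarrow> 3 \<le> card (C i)"
    and sz: "(\<Sum>i\<in>I. card (C i)) + 4 \<le> CARD('p)"
  shows "(\<Sum>i\<in>I. card (C i)) + 1 \<le> card (arrangements I M C)"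
proof -
  obtain i j l where ijl: "I = {i, j, l}" "i \<noteq> j" "i \<noteq> l" "j \<noteq> l" using I by (auto simp: card_3_iff)
  have fin: "finite I" using ijl by simp
  define E where "E x = (*) e ` C x" for x
  have cE: "card (E x) = card (C x)" for x using M(2) by (simp add: E_def)
  have dE: "E x \<inter> E y = {}" if "x \<in> I" "y \<in> I" "x \<noteq> y" for x y
  proof -
    have "C x \<inter> C y = {}" using dis that unfolding disjoint_family_on_def by blast
    moreover have "E x \<inter> E y = (*) e ` (C x \<inter> C y)"
      unfolding E_def using M(2) by (subst image_Int) (auto simp: inj_on_def)
    ultimately show ?thesis by simp
  qed
  have sub: "diffs (E x) (E y) + E z \<subseteq> arrangements I M C" if xyz: "I = {x, y, z}" "x \<noteq> y" "x \<noteq> z" "y \<noteq> z" for x y z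
  proof -
    have Iz: "I - {z} = {x, y}" using xyz by auto
    have Mz: "M - {#e#} = {#e, - e#}" using M by simp
    have un: "(*) (- e) ` C t = uminus ` E t" for t by (simp add: E_def image_image)
    have "diffs (E x) (E y) \<subseteq> arrangements {x, y} {#e, - e#} C"
    proof -
      have "E x + uminus ` E y \<subseteq> arrangements {x, y} {#e, - e#} C"
        using arrangements_pair[OF xyz(2), of e C "- e"] unfolding un by (simp add: E_def)
      moreover have "uminus ` E x + E y \<subseteq> arrangements {x, y} {#e, - e#} C"
        using arrangements_pair[OF xyz(2), of "- e" C e] unfolding un by (simp add: E_def add_mset_commute)
      ultimately show ?thesis by (simp add: diffs_def add.commute)
    qed
    then have "diffs (E x) (E y) + E z \<subseteq> arrangements (I - {z}) (M - {#e#}) C + (*) e ` C z"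
      unfolding Iz Mz by (intro set_plus_mono2) (simp_all add: E_def)
    also have "\<dots> \<subseteq> arrangements I M C" using fin xyz M by (intro arrangements_remove) auto
    finally show ?thesis .
  qed
  have "card (E i) + card (E j) + card (E l) + 1 \<le> card (arrangements I M C)"
  proof (rule triple_sum_bound)
    show "E i \<inter> E j = {}" "E j \<inter> E l = {}" "E i \<inter> E l = {}" using dE ijl by auto
    show "3 \<le> card (E i)" "3 \<le> card (E j)" "3 \<le> card (E l)" using c3 ijl by (auto simp: cE)
    show "card (E i) + card (E j) + card (E l) + 4 \<le> CARD('p)" using sz ijl by (simp add: cE)
    show "diffs (E i) (E j) + E l \<subseteq> arrangements I M C" using sub[of i j l] ijl by blast
    show "diffs (E j) (E l) + E i \<subseteq> arrangements I M C" using sub[of j l i] ijl by blast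
    show "diffs (E i) (E l) + E j \<subseteq> arrangements I M C" using sub[of i l j] ijl by blast
  qed
  then show ?thesis using ijl by (simp add: cE)
qed

text \<open>Coefficients whose removal leaves an admissible multiset are called \<open>rem\<close>.
  For each of them the induction hypothesis makes the last sum a Vosper pair. The value set
  \<open>?U\<close> ties all these directions together, and a fixed class then shows that removable
  coefficients agree up to sign. This leaves a few shapes of \<open>M\<close>, which the results on
  intervals and on three classes exclude.\<close>

lemma arrangements_card:
  fixes C :: "nat \<Rightarrow> 'p::prime_card mod_ring set"
  assumes "finite I" "2 \<le> card I" "size M = card I" "disjoint_family_on C I" "\<And>i. i \<in> I \<Longrightarrow> 3 \<le> card (C i)"
    "(\<Sum>i\<in>I. card (C i)) + 4 \<le> CARD('p)" "\<And>c. c \<in># M \<Longrightarrow> c \<noteq> 0"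
    "\<And>c. M \<noteq> replicate_mset (card I) c" "\<And>c. M \<noteq> {#c, - c#}"
  shows "(\<Sum>i\<in>I. card (C i)) + 1 \<le> card (arrangements I M C)"
  using assms
proof (induction "card I" arbitrary: I M rule: less_induct)
  case less
  note fin = less.prems(1) and size = less.prems(3) and dis = less.prems(4) and c3 = less.prems(5) and sz = less.prems(6)
    and nz = less.prems(7) and nconst = less.prems(8)
  define k where "k = card I"
  show ?case
  proof (cases "k = 2")
    case True
    have "M \<noteq> {#c, c#}" for c using nconst[of c] True by (simp add: k_def numeral_2_eq_2)
    then show ?thesis using arrangements_pair_card[of I M C] less.prems True by (simp add: k_def)
  next
    case False
    then have k3: "3 \<le> k" using less.prems(2) by (simp add: k_def)
    show ?thesis
    proof (rule ccontr)
      let ?U = "arrangements I M C"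
      let ?s = "\<Sum>i\<in>I. card (C i)"
      assume "\<not> ?thesis"
      then have cU: "card ?U \<le> ?s" by simp
      have p11: "11 \<le> CARD('p)"
      proof -
        have "k * 3 \<le> ?s" using sum_bounded_below[of I 3 "\<lambda>i. card (C i)"] c3 by (simp add: k_def)
        then show ?thesis using sz k3 by linarith
      qed
      have rest: "?s = card (C l) + (\<Sum>i\<in>I - {l}. card (C i))" if "l \<in> I" for l
        by (rule sum.remove[OF fin that])
      have rest3: "6 \<le> (\<Sum>i\<in>I - {l}. card (C i))" if l: "l \<in> I" for l
      proof -
        have "card (I - {l}) * 3 \<le> (\<Sum>i\<in>I - {l}. card (C i))"
          using sum_bounded_below[of "I - {l}" 3 "\<lambda>i. card (C i)"] c3 by simp
        then show ?thesis using fin l k3 by (simp add: k_def)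
      qed
      define rem where "rem c \<longleftrightarrow> c \<in># M \<and> (\<forall>e. M - {#c#} \<noteq> replicate_mset (k - 1) e) \<and> (\<forall>e. M - {#c#} \<noteq> {#e, - e#})" for c
      \<comment> \<open>The values on the other classes exceed the sum of those classes by at least
        one, while \<open>?U\<close> has at most \<open>?s\<close> elements; so Vosper's theorem
        applies and the inclusion into \<open>?U\<close> is an equality.\<close>
      have tight: "\<exists>d. d \<noteq> 0 \<and> bd d (arrangements (I - {l}) (M - {#c#}) C) \<le> 1 \<and> bd d ((*) c ` C l) \<le> 1 \<and> bd d ?U \<le> 1 \<and>
          card (arrangements (I - {l}) (M - {#c#}) C) + card (C l) \<le> ?s + 1 \<and> 3 \<le> card ?U"
        if l: "l \<in> I" and c: "rem c" for l c
      proof -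
        let ?V = "arrangements (I - {l}) (M - {#c#}) C"
        have cM: "c \<in># M" using c by (simp add: rem_def)
        have cI: "card (I - {l}) = k - 1" using fin l by (simp add: k_def)
        have "(\<Sum>i\<in>I - {l}. card (C i)) + 1 \<le> card ?V"
        proof (rule less.hyps)
          show "card (I - {l}) < card I" "2 \<le> card (I - {l})" using cI k3 by (simp_all add: k_def)
          show "size (M - {#c#}) = card (I - {l})" using size cM fin l by (simp add: size_Diff_singleton)
          show "disjoint_family_on C (I - {l})" using dis by (rule disjoint_family_on_mono[rotated]) auto
          show "(\<Sum>i\<in>I - {l}. card (C i)) + 4 \<le> CARD('p)" using rest[OF l] sz by linarith
          show "M - {#c#} \<noteq> replicate_mset (card (I - {l})) e" for e using c cI by (simp add: rem_def)
          show "M - {#c#} \<noteq> {#e, - e#}" for e using c by (simp add: rem_def)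
        qed (use fin c3 nz in \<open>auto dest: in_diffD\<close>)
        then have low: "?s + 1 \<le> card ?V + card (C l)" using rest[OF l] by linarith
        have c0: "c \<noteq> 0" using nz cM by blast
        have cc: "card ((*) c ` C l) = card (C l)" using c0 by simp
        have sub: "?V + (*) c ` C l \<subseteq> ?U" using fin l cM by (rule arrangements_remove)
        have le: "card (?V + (*) c ` C l) \<le> card ?U" by (rule card_mono[OF finite sub])
        have V2: "2 \<le> card ?V" using \<open>(\<Sum>i\<in>I - {l}. card (C i)) + 1 \<le> card ?V\<close> rest3[OF l] by linarith
        have C2: "3 \<le> card ((*) c ` C l)" using c3[OF l] cc by simp
        obtain d where d: "d \<noteq> 0" "bd d ?V \<le> 1" "bd d ((*) c ` C l) \<le> 1"
          using vosper[of ?V "(*) c ` C l"] V2 C2 le cU sz low cc by auto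
        have cd: "card ?V + card (C l) \<le> card (?V + (*) c ` C l) + 1"
          using cauchy_davenport_less[of ?V "(*) c ` C l"] V2 C2 le cU sz cc by force
        then have "?V + (*) c ` C l = ?U" using sub low cU by (intro card_seteq) auto
        moreover have "bd d (?V + (*) c ` C l) \<le> 1 * 1"
          by (rule order_trans[OF bd_plus_le]) (use d in \<open>intro mult_le_mono\<close>)
        ultimately have "bd d ?U \<le> 1" by simp
        moreover have "card ?V + card (C l) \<le> ?s + 1" using cd le cU by linarith
        moreover have "3 \<le> card ?U" using le cd low rest3[OF l] rest[OF l] by linarith
        ultimately show ?thesis using d by blast
      qed
      obtain l0 where l0: "l0 \<in> I" using k3 by (metis card.empty ex_in_conv k_def not_numeral_le_zero)
      have dir: "\<exists>d. d \<noteq> 0 \<and> bd d ?U \<le> 1 \<and> (\<forall>l\<in>I. \<forall>c'. rem c' \<longrightarrow> bd d (arrangements (I - {l}) (M - {#c'#}) C) \<le> 1 \<and> bd d ((*) c' ` C l) \<le> 1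
          \<and> (c' = c \<or> c' = - c))" if c: "rem c" for c
      proof -
        obtain d where d: "d \<noteq> 0" "bd d ((*) c ` C l0) \<le> 1" "bd d ?U \<le> 1" "3 \<le> card ?U" using tight[OF l0 c] by blast
        have all: "bd d (arrangements (I - {l}) (M - {#c'#}) C) \<le> 1 \<and> bd d ((*) c' ` C l) \<le> 1" if l: "l \<in> I" "rem c'" for l c'
        proof -
          obtain e where e: "e \<noteq> 0" "bd e (arrangements (I - {l}) (M - {#c'#}) C) \<le> 1" "bd e ((*) c' ` C l) \<le> 1" "bd e ?U \<le> 1"
            using tight[OF l] by blast
          have "e = d \<or> e = - d" using ap_direction[OF d(3) e(4) d(1) e(1) d(4)] cU sz p11 by simp
          then show ?thesis using e(2,3) by auto
        qed
        \<comment> \<open>The class \<open>C l0\<close> is a progression with difference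
          \<open>d / c\<close> and also with difference \<open>d / c'\<close>.\<close>
        have "c' = c \<or> c' = - c" if c': "rem c'" for c'
        proof -
          have z: "c \<noteq> 0" "c' \<noteq> 0" using c c' nz by (auto simp: rem_def)
          have b: "bd (d / c) (C l0) \<le> 1" "bd (d / c') (C l0) \<le> 1"
            using all[OF l0 c] all[OF l0 c'] z by (simp_all add: bd_scale')
          have "d / c' = d / c \<or> d / c' = - (d / c)"
            by (rule ap_direction[OF b]) (use d z c3[OF l0] rest[OF l0] sz p11 in auto)
          then have "d * c = d * c' \<or> d * c = d * (- c')" using z by (auto simp: field_simps)
          then have "c = c' \<or> c = - c'" using d(1) by (simp only: mult_left_cancel[OF d(1)])
          then show ?thesis by auto
        qed
        then show ?thesis using all d by blast
      qed
      have resc: "disjoint_family_on (\<lambda>i. (*) t ` C i) I" "card ((*) t ` C i) = card (C i)"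
        "(\<Sum>i\<in>I. card ((*) t ` C i)) = ?s" if "t \<noteq> 0" for t i
      proof -
        show "disjoint_family_on (\<lambda>i. (*) t ` C i) I"
          using dis that unfolding disjoint_family_on_def by (auto simp: image_Int[symmetric] inj_on_def)
      qed (use that in simp_all)
      \<comment> \<open>Division by \<open>d\<close> turns progressions with difference
        \<open>d\<close> into intervals; the factor \<open>c\<close> goes to the classes so that
        only ratios to \<open>c\<close> remain as coefficients.\<close>
      have val: "(\<Sum>i\<in>I. (*) (f i / c) ` (*) (c / d) ` C i) \<subseteq> (*) (1 / d) ` ?U"
        if f: "image_mset f (mset_set I) = M" and "c \<noteq> 0" "d \<noteq> 0" for f c d
      proof -
        have "(\<Sum>i\<in>I. (*) (f i / c) ` (*) (c / d) ` C i) = (\<Sum>i\<in>I. (*) (1 / d) ` (*) (f i) ` C i)"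
          by (rule sum.cong) (use that in \<open>simp_all add: image_image\<close>)
        also have "\<dots> = (*) (1 / d) ` (\<Sum>i\<in>I. (*) (f i) ` C i)" by (simp only: scale_sum)
        also have "\<dots> \<subseteq> (*) (1 / d) ` ?U" using arrangements_sup[OF f] by (rule image_mono)
        finally show ?thesis .
      qed
      show False
      proof (cases "k = 3")
        case True
        obtain x y z where xyz: "M = {#x, y, z#}" using size True by (metis k_def size3_mset)
        have remI: "rem x" if M: "M = {#x, y, z#}" "y \<noteq> z" "y \<noteq> - z" for x y z
        proof -
          have e: "M - {#x#} = {#y, z#}" using M by simp
          have "{#y, z#} \<noteq> replicate_mset 2 e" for e using M(2) by (auto simp: numeral_2_eq_2 add_eq_conv_ex)
          moreover have "{#y, z#} \<noteq> {#e, - e#}" for e using M(3) by (auto simp: add_eq_conv_ex)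
          ultimately show ?thesis unfolding rem_def e using M True by simp
        qed
        \<comment> \<open>Two coefficients agree up to sign and \<open>m\<close> stands apart:
          removing \<open>x\<close> leaves \<open>m\<close> and \<open>y\<close> for two classes
          that are intervals after scaling.\<close>
        have residual: False if M: "M = {#m, x, y#}" "y = x \<or> y = - x" "m \<noteq> x" "m \<noteq> - x" for m x y
        proof -
          have "rem x" using remI[of x m y] M by (auto simp: add_mset_commute)
          then obtain d where d: "d \<noteq> 0" "\<And>l. l \<in> I \<Longrightarrow> bd d (arrangements (I - {l}) (M - {#x#}) C) \<le> 1"
            "\<And>l. l \<in> I \<Longrightarrow> bd d ((*) x ` C l) \<le> 1" using dir by blast
          have z: "x \<noteq> 0" "m \<noteq> 0" using nz M by auto
          obtain i j l where ijl: "I = {i, j, l}" "i \<noteq> j" "i \<noteq> l" "j \<noteq> l" using True by (auto simp: k_def card_3_iff)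
          have Il: "I - {l} = {i, j}" and lI: "l \<in> I" using ijl by auto
          have Mx: "M - {#x#} = {#m, y#}" using M by (simp add: add_mset_commute)
          let ?P = "arrangements {i, j} {#m, y#} C"
          have t: "x / d \<noteq> 0" using z d by simp
          have P1: "card ?P + card (C l) \<le> ?s + 1" using tight[OF lI \<open>rem x\<close>] unfolding Il Mx by blast
          have P2: "bd d ?P \<le> 1" using d(2)[OF lI] unfolding Il Mx .
          have b1: "bd 1 ((*) (x / d) ` C q) \<le> 1" if "q \<in> I" for q
          proof -
            have "bd (d / x) (C q) \<le> 1" using d(3)[OF that] z by (simp add: bd_scale')
            then show ?thesis using bd_scale'[OF t, of 1 "C q"] by simp
          qed
          have P': "(*) (m / x) ` (*) (x / d) ` C i + (*) (y / x) ` (*) (x / d) ` C j \<subseteq> (*) (1 / d) ` ?P"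
            "(*) (y / x) ` (*) (x / d) ` C i + (*) (m / x) ` (*) (x / d) ` C j \<subseteq> (*) (1 / d) ` ?P"
          proof -
            have e: "(*) (v / x) ` (*) (x / d) ` C q = (*) (1 / d) ` (*) v ` C q" for v q using z by (simp add: image_image)
            show "(*) (m / x) ` (*) (x / d) ` C i + (*) (y / x) ` (*) (x / d) ` C j \<subseteq> (*) (1 / d) ` ?P"
              unfolding e scale_plus[symmetric] by (intro image_mono arrangements_pair ijl(2))
            have "(*) y ` C i + (*) m ` C j \<subseteq> ?P" using arrangements_pair[OF ijl(2), of y C m] by (simp add: add_mset_commute)
            then show "(*) (y / x) ` (*) (x / d) ` C i + (*) (m / x) ` (*) (x / d) ` C j \<subseteq> (*) (1 / d) ` ?P"
              unfolding e scale_plus[symmetric] by (rule image_mono)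
          qed
          show False
          proof (rule scaled_pair_contra[OF _ _ _ _ b1 b1 _ _ _ _ _ _ P'])
            show "i \<in> I" "j \<in> I" using ijl by auto
            show "(*) (x / d) ` C i \<inter> (*) (x / d) ` C j = {}"
              using resc(1)[OF t] ijl unfolding disjoint_family_on_def by auto
            show "3 \<le> card ((*) (x / d) ` C i)" "3 \<le> card ((*) (x / d) ` C j)" using resc(2)[OF t] c3 ijl by auto
            have s: "?s = card (C i) + card (C j) + card (C l)" using ijl by simp
            show "card ((*) (x / d) ` C i) + card ((*) (x / d) ` C j) + 7 \<le> CARD('p)"
              using resc(2)[OF t] s sz c3[OF lI] by simp
            show "bd 1 ((*) (1 / d) ` ?P) \<le> 1" using P2 d(1) bd_scale'[of "1 / d" 1 ?P] by simp
            show "card ((*) (1 / d) ` ?P) \<le> card ((*) (x / d) ` C i) + card ((*) (x / d) ` C j) + 1"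
              using resc(2)[OF t] P1 s card_scale[of "1 / d" ?P] d(1) by simp
            show "m / x \<noteq> 0" "m / x \<noteq> 1" using z M by simp_all
            show "m / x \<noteq> - 1"
            proof
              assume "m / x = - 1"
              moreover have "m = (m / x) * x" using z by simp
              ultimately have "m = - 1 * x" by (simp only:)
              then show False using M by simp
            qed
            show "y / x = 1 \<or> y / x = - 1" using M(2) z by auto
          qed
        qed
        consider "y = x \<or> y = - x" | "z = x \<or> z = - x" "\<not> (y = x \<or> y = - x)" | "\<not> (y = x \<or> y = - x)" "\<not> (z = x \<or> z = - x)" by blast
        then show False
        proof cases
          case 1
          show False
          proof (cases "z = x \<or> z = - x")
            case False
            then show False using residual[of z x y] 1 xyz by (simp add: add_mset_commute)
          next
            \<comment> \<open>The coefficients agree up to sign without being all equal. From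
              \<open>e, e, - e\<close> nothing is removable, whence the separate bound for three
              classes.\<close>
            case z: True
            have nc: "\<not> (y = x \<and> z = x)" using nconst[of x] True xyz by (auto simp: k_def numeral_3_eq_3)
            have x0: "x \<noteq> 0" using nz xyz by simp
            have t3: "False" if "M = {#e, e, - e#}" "e \<noteq> 0" for e
              using arrangements_triple_card[OF _ that dis c3 sz] cU True by (simp add: k_def)
            consider "y = x" "z = - x" | "y = - x" "z = x" | "y = - x" "z = - x" using 1 z nc by blast
            then show False
            proof cases
              case 1 then show False using t3[of x] xyz x0 by simp
            next
              case 2 then show False using t3[of x] xyz x0 by (simp add: add_mset_commute)
            next
              case 3 then show False using t3[of "- x"] xyz x0 by (simp add: add_mset_commute)
            qed
          qed
        next
          case 2
          then show False using residual[of y x z] xyz by (simp add: add_mset_commute)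
        next
          case 3
          show False
          proof (cases "z = y \<or> z = - y")
            case True
            have "x \<noteq> y" "x \<noteq> - y" using 3 by auto
            then show False using residual[of x y z] True xyz by simp
          next
            case F: False
            have "y \<noteq> z" "y \<noteq> - z" "x \<noteq> z" "x \<noteq> - z" using F 3 by auto
            then have "rem x" "rem y" using remI[of x y z] remI[of y x z] xyz by (simp_all add: add_mset_commute)
            then have "y = x \<or> y = - x" using dir[of x] l0 by blast
            then show False using 3 by blast
          qed
        qed
      next
        case False
        then have k4: "4 \<le> card I" using k3 by (simp add: k_def)
        \<comment> \<open>All coefficients are \<open>c\<close> or \<open>- c\<close>, and both
          occur. For any two classes there are two arrangements that differ only by exchanging these
          two coefficients.\<close>
        have signed: False if c: "rem c" and pm: "\<And>y. y \<in># M \<Longrightarrow> y = c \<or> y = - c" for c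
        proof -
          obtain d where d: "d \<noteq> 0" "bd d ?U \<le> 1" "\<And>l. l \<in> I \<Longrightarrow> bd d ((*) c ` C l) \<le> 1" using dir[OF c] c by blast
          have cM: "c \<in># M" using c by (simp add: rem_def)
          have c0: "c \<noteq> 0" using nz cM by blast
          have "\<exists>y\<in>#M. y \<noteq> c"
          proof (rule ccontr)
            assume "\<not> ?thesis"
            then have "M = replicate_mset (size M) c" by (metis in_replicate_mset multiset_eqI set_mset_subset_singletonD subsetI singletonI)
            then show False using nconst[of c] size by simp
          qed
          then have mc: "- c \<in># M" "- c \<noteq> c" using pm by metis+
          have t: "c / d \<noteq> 0" using c0 d by simp
          let ?E = "\<lambda>i. (*) (c / d) ` C i"
          show False
          proof (rule signed_interval_family_contra[OF fin k4 resc(1)[OF t]])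
            show "bd 1 (?E i) \<le> 1" if "i \<in> I" for i
            proof -
              have "bd (d / c) (C i) \<le> 1" using d(3)[OF that] c0 by (simp add: bd_scale')
              then show ?thesis using bd_scale'[OF t, of 1 "C i"] by simp
            qed
            show "3 \<le> card (?E i)" if "i \<in> I" for i using resc(2)[OF t] c3[OF that] by simp
            show "(\<Sum>i\<in>I. card (?E i)) + 4 \<le> CARD('p)" using resc(3)[OF t] sz by simp
            show "bd 1 ((*) (1 / d) ` ?U) \<le> 1" using d bd_scale'[of "1 / d" 1 ?U] by simp
            show "card ((*) (1 / d) ` ?U) \<le> (\<Sum>i\<in>I. card (?E i))" using resc(3)[OF t] cU card_scale[of "1 / d" ?U] d by simp
            fix i j assume ij: "i \<in> I" "j \<in> I" "i \<noteq> j"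
            have Mij: "- c \<in># M - {#c#}" "c \<in># M - {#- c#}" using mc cM by (simp_all add: in_diff_count)
            have "card (I - {i} - {j}) = card I - 2" using fin ij by simp
            moreover have "size (M - {#c#} - {#- c#}) = card I - 2"
              by (simp only: size_Diff_singleton[OF Mij(1)] size_Diff_singleton[OF cM] size diff_diff_left one_add_one)
            ultimately obtain h where h: "image_mset h (mset_set (I - {i} - {j})) = M - {#c#} - {#- c#}"
              using assignment_exists[of "I - {i} - {j}" "M - {#c#} - {#- c#}"] fin by auto
            let ?h1 = "h(j := - c, i := c)" and ?h2 = "h(j := c, i := - c)"
            have v1: "image_mset ?h1 (mset_set I) = M"
            proof (rule assignment_extend[OF fin ij(1) cM])
              show "image_mset (h(j := - c)) (mset_set (I - {i})) = M - {#c#}"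
                by (rule assignment_extend[OF _ _ Mij(1) h]) (use fin ij in auto)
            qed
            have v2: "image_mset ?h2 (mset_set I) = M"
            proof (rule assignment_extend[OF fin ij(1) mc(1)])
              have "M - {#c#} - {#- c#} = M - {#- c#} - {#c#}" by (rule diff_right_commute)
              then show "image_mset (h(j := c)) (mset_set (I - {i})) = M - {#- c#}"
                using h by (intro assignment_extend[OF _ _ Mij(2)]) (use fin ij in auto)
            qed
            define g where "g l = (if l \<in> I - {i, j} then h l / c else 1)" for l
            have g: "g l = 1 \<or> g l = - 1" for l
            proof (cases "l \<in> I - {i, j}")
              case True
              have "h l \<in># image_mset h (mset_set (I - {i} - {j}))" using True fin by auto
              then have "h l \<in># M" unfolding h by (auto dest: in_diffD)
              then have "h l = c \<or> h l = - c" by (rule pm)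
              then have "h l / c = 1 \<or> h l / c = - 1" using c0 by auto
              then show ?thesis using True by (simp only: g_def if_True)
            next
              case False
              then show ?thesis by (simp only: g_def if_False simp_thms)
            qed
            have split: "(\<Sum>l\<in>I. (*) (f l / c) ` ?E l) = (*) (f i / c) ` ?E i + (*) (f j / c) ` ?E j + (\<Sum>l\<in>I - {i, j}. (*) (g l) ` ?E l)"
              if f: "\<And>l. l \<in> I - {i, j} \<Longrightarrow> f l = h l" for f
            proof -
              have "(\<Sum>l\<in>I. (*) (f l / c) ` ?E l) = (*) (f i / c) ` ?E i + (\<Sum>l\<in>I - {i}. (*) (f l / c) ` ?E l)"
                by (rule sum.remove[OF fin ij(1)])
              also have "(\<Sum>l\<in>I - {i}. (*) (f l / c) ` ?E l) = (*) (f j / c) ` ?E j + (\<Sum>l\<in>I - {i} - {j}. (*) (f l / c) ` ?E l)"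
                by (rule sum.remove) (use fin ij in auto)
              also have "(\<Sum>l\<in>I - {i} - {j}. (*) (f l / c) ` ?E l) = (\<Sum>l\<in>I - {i, j}. (*) (g l) ` ?E l)"
                by (rule sum.cong) (use f in \<open>auto simp: g_def\<close>)
              finally show ?thesis by (simp only: add.assoc)
            qed
            have e1: "(*) (?h1 i / c) ` ?E i = ?E i" "(*) (?h1 j / c) ` ?E j = uminus ` ?E j"
              "(*) (?h2 i / c) ` ?E i = uminus ` ?E i" "(*) (?h2 j / c) ` ?E j = ?E j"
              using ij c0 by (simp_all add: image_image)
            have "?E i + uminus ` ?E j + (\<Sum>l\<in>I - {i, j}. (*) (g l) ` ?E l) \<subseteq> (*) (1 / d) ` ?U"
              using val[OF v1 c0 d(1)] split[of ?h1] unfolding e1 by simp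
            moreover have "uminus ` ?E i + ?E j + (\<Sum>l\<in>I - {i, j}. (*) (g l) ` ?E l) \<subseteq> (*) (1 / d) ` ?U"
              using val[OF v2 c0 d(1)] split[of ?h2] unfolding e1 by simp
            ultimately show "\<exists>g. (\<forall>l. g l = 1 \<or> g l = - 1) \<and>
              ?E i + uminus ` ?E j + (\<Sum>l\<in>I - {i, j}. (*) (g l) ` ?E l) \<subseteq> (*) (1 / d) ` ?U \<and>
              uminus ` ?E i + ?E j + (\<Sum>l\<in>I - {i, j}. (*) (g l) ` ?E l) \<subseteq> (*) (1 / d) ` ?U"
              using g by blast
          qed
        qed
        have not_pair: "N \<noteq> {#e, - e#}" if "size N = k - 1" for N :: "'p mod_ring multiset" and e
        proof
          assume "N = {#e, - e#}"
          then have "k - 1 = 2" using that by simp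
          then show False using k4 by (simp add: k_def)
        qed
        show False
        \<comment> \<open>With four or more classes a coefficient fails to be removable only if all
          others are equal. In that shape the repeated coefficient is still removable.\<close>
        proof (cases "\<exists>m c. M = add_mset m (replicate_mset (k - 1) c)")
          case True
          then obtain m c where M: "M = add_mset m (replicate_mset (k - 1) c)" by blast
          have mc: "m \<noteq> c"
          proof
            assume "m = c"
            then have "M = replicate_mset (card I) c" using M k4 by (metis Suc_diff_1 k_def k4 order_less_le_trans replicate_mset_Suc zero_less_numeral)
            then show False using nconst by blast
          qed
          obtain k1 where "k = 4 + k1" using le_Suc_ex[of 4 k] k4 by (auto simp: k_def)
          then obtain k' where k': "k = Suc (Suc (Suc (Suc k')))" by simp
          have cM: "c \<in># M" using M k' by simp
          have r: "rem c" unfolding rem_def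
          proof (intro conjI allI cM)
            have e: "M - {#c#} = add_mset m (replicate_mset (k - 2) c)" using M k' mc by simp
            show "M - {#c#} \<noteq> replicate_mset (k - 1) e" for e
            proof
              assume "M - {#c#} = replicate_mset (k - 1) e"
              moreover have "m \<in># M - {#c#}" "c \<in># M - {#c#}" unfolding e using k' by simp_all
              ultimately have "m = e" "c = e" by (auto simp: in_replicate_mset split: if_splits)
              then show False using mc by simp
            qed
            show "M - {#c#} \<noteq> {#e, - e#}" for e
              using cM size by (intro not_pair) (simp add: size_Diff_singleton k_def)
          qed
          show False
          proof (cases "m = - c")
            case True
            show False by (rule signed[OF r]) (use M True in \<open>auto simp: in_replicate_mset split: if_splits\<close>)
          next
            case mnc: False
            obtain d where d: "d \<noteq> 0" "bd d ?U \<le> 1" "\<And>l. l \<in> I \<Longrightarrow> bd d ((*) c ` C l) \<le> 1" using dir[OF r] r by blast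
            have z: "c \<noteq> 0" "m \<noteq> 0" using nz cM M by auto
            have t: "c / d \<noteq> 0" using z d by simp
            let ?E = "\<lambda>i. (*) (c / d) ` C i"
            show False
            proof (rule scaled_interval_family_contra[OF fin k4 resc(1)[OF t]])
              show "bd 1 (?E i) \<le> 1" if "i \<in> I" for i
              proof -
                have "bd (d / c) (C i) \<le> 1" using d(3)[OF that] z by (simp add: bd_scale')
                then show ?thesis using bd_scale'[OF t, of 1 "C i"] by simp
              qed
              show "3 \<le> card (?E i)" if "i \<in> I" for i using resc(2)[OF t] c3[OF that] by simp
              show "(\<Sum>i\<in>I. card (?E i)) + 4 \<le> CARD('p)" using resc(3)[OF t] sz by simp
              show "bd 1 ((*) (1 / d) ` ?U) \<le> 1" using d bd_scale'[of "1 / d" 1 ?U] by simp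
              show "card ((*) (1 / d) ` ?U) \<le> (\<Sum>i\<in>I. card (?E i))" using resc(3)[OF t] cU card_scale[of "1 / d" ?U] d by simp
              show "m / c \<noteq> 0" "m / c \<noteq> 1" using z mc by simp_all
              show "m / c \<noteq> - 1"
              proof
                assume "m / c = - 1"
                moreover have "m = (m / c) * c" using z by simp
                ultimately have "m = - 1 * c" by (simp only:)
                then show False using mnc by simp
              qed
              fix j assume j: "j \<in> I"
              let ?f = "(\<lambda>_. c)(j := m)"
              have "image_mset (\<lambda>_. c) (mset_set (I - {j})) = M - {#m#}"
                using M fin j by (simp add: image_mset_const_eq k_def)
              then have v: "image_mset ?f (mset_set I) = M"
                using M by (intro assignment_extend[OF fin j]) auto
              have "(\<Sum>i\<in>I. (*) (?f i / c) ` ?E i) = (*) (?f j / c) ` ?E j + (\<Sum>i\<in>I - {j}. (*) (?f i / c) ` ?E i)"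
                by (rule sum.remove[OF fin j])
              also have "(\<Sum>i\<in>I - {j}. (*) (?f i / c) ` ?E i) = (\<Sum>i\<in>I - {j}. ?E i)"
                by (rule sum.cong) (use z in \<open>auto simp: image_image\<close>)
              finally show "(*) (m / c) ` ?E j + (\<Sum>i\<in>I - {j}. ?E i) \<subseteq> (*) (1 / d) ` ?U"
                using val[OF v z(1) d(1)] by simp
            qed
          qed
        next
          case form: False
          have r: "rem c" if cM: "c \<in># M" for c
          proof -
            have "M - {#c#} \<noteq> replicate_mset (k - 1) e" for e
            proof
              assume "M - {#c#} = replicate_mset (k - 1) e"
              then have "M = add_mset c (replicate_mset (k - 1) e)" using cM by (metis insert_DiffM)
              then show False using form by blast
            qed
            moreover have "M - {#c#} \<noteq> {#e, - e#}" for e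
              using cM size by (intro not_pair) (simp add: size_Diff_singleton k_def)
            ultimately show ?thesis using cM by (simp add: rem_def)
          qed
          have "M \<noteq> {#}" using size k4 by auto
          then obtain c where c: "c \<in># M" by blast
          \<comment> \<open>Every coefficient is removable, so they all agree with \<open>c\<close>
            up to sign.\<close>
          show False using signed[OF r[OF c]] dir[OF r[OF c]] r l0 by blast
        qed
      qed
    qed
  qed
qed

section \<open>Rainbow-free colorings\<close>

lemma near_bd_le:
  fixes X :: "'a::{ab_group_add,finite} set"
  assumes "near d X" shows "bd d X \<le> 2"
proof -
  obtain t where t: "bd d (insert t X) \<le> 1" using assms by (auto simp: near_def)
  have "{x \<in> X. x + d \<notin> X} \<subseteq> insert (t - d) {x \<in> insert t X. x + d \<notin> insert t X}"
    by (auto simp: eq_diff_eq)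
  then have "card {x \<in> X. x + d \<notin> X} \<le> card (insert (t - d) {x \<in> insert t X. x + d \<notin> insert t X})"
    by (intro card_mono) auto
  also have "\<dots> \<le> card {x \<in> insert t X. x + d \<notin> insert t X} + 1" by (simp add: card_insert_if)
  finally show ?thesis using t by (simp add: bd_def)
qed

text \<open>A step that leaves \<open>X\<close> or \<open>Y\<close> must enter \<open>Z\<close>, and
  the entries into \<open>Z\<close> number \<open>bd d Z\<close>.\<close>

lemma bd_nonadjacent:
  fixes X Y Z :: "'a::{ab_group_add,finite} set"
  assumes "X \<union> Y \<union> Z = UNIV" "X \<inter> Y = {}" "X \<inter> Z = {}" "Y \<inter> Z = {}"
    and "\<And>x. x \<in> X \<Longrightarrow> x + d \<notin> Y" "\<And>y. y \<in> Y \<Longrightarrow> y + d \<notin> X"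
  shows "bd d X + bd d Y \<le> bd d Z"
proof -
  let ?E = "\<lambda>X. {x \<in> X. x + d \<notin> X}"
  have "bd d X + bd d Y = card (?E X \<union> ?E Y)"
    unfolding bd_def using assms(2) by (subst card_Un_disjoint) auto
  also have "\<dots> = card ((\<lambda>x. x + d) ` (?E X \<union> ?E Y))" by (simp add: card_image)
  also have "\<dots> \<le> card {z \<in> Z. z + (- d) \<notin> Z}"
  proof (rule card_mono)
    show "(\<lambda>x. x + d) ` (?E X \<union> ?E Y) \<subseteq> {z \<in> Z. z + (- d) \<notin> Z}"
    proof
      fix z assume "z \<in> (\<lambda>x. x + d) ` (?E X \<union> ?E Y)"
      then obtain x where x: "z = x + d" "x \<in> ?E X \<union> ?E Y" by blast
      have "x + d \<notin> X" "x + d \<notin> Y" using x(2) assms(5,6) by blast+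
      then have "x + d \<in> Z" using assms(1) by blast
      moreover have "x \<notin> Z" using x(2) assms(3,4) by blast
      ultimately show "z \<in> {z \<in> Z. z + (- d) \<notin> Z}" using x(1) by simp
    qed
  qed simp
  also have "\<dots> = bd d Z" using bd_uminus[of d Z] by (simp only: bd_def)
  finally show ?thesis .
qed

text \<open>With 0 in \<open>C\<close> all classes are symmetric, so they form a critical triple and
  have a common direction \<open>d\<close> with boundaries at most 2. Now \<open>d\<close> itself
  has a color, and adding it never leads from one of the two other colors to the other. So
  boundaries fall to 1: if \<open>d\<close> is in \<open>A\<close> or \<open>B\<close>,
  \<open>C\<close> would be \<open>{0}\<close>; if \<open>d\<close> is in \<open>C\<close>,
  \<open>A\<close> and \<open>B\<close> would be nested.\<close>

lemma rainbow_schur_zero: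
  fixes A B C :: "'p::prime_card mod_ring set"
  assumes un: "A \<union> B \<union> C = UNIV" and dis: "A \<inter> B = {}" "A \<inter> C = {}" "B \<inter> C = {}"
    and sz: "3 \<le> card A" "3 \<le> card B" "3 \<le> card C" and C0: "0 \<in> C"
    and rf: "\<And>x y z. x \<in> A \<Longrightarrow> y \<in> B \<Longrightarrow> z \<in> C \<Longrightarrow> x + y \<noteq> z \<and> x + z \<noteq> y \<and> y + z \<noteq> x"
  shows False
proof -
  have p: "2 < CARD('p)" using sz card_le_CARD[of A] by simp
  have neU: "A \<noteq> UNIV" "B \<noteq> UNIV" "A \<noteq> {}" "B \<noteq> {}" "C \<noteq> {}" "C \<noteq> UNIV" using sz dis by auto
  have A0: "0 \<notin> A" "0 \<notin> B" using C0 dis by blast+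
  have negA: "- x \<in> A" if x: "x \<in> A" for x
  proof (rule ccontr)
    assume n: "- x \<notin> A"
    have nB: "- x \<notin> B"
    proof
      assume "- x \<in> B"
      then have "x + - x \<noteq> 0" using rf[OF x _ C0] by blast
      then show False by simp
    qed
    then have xC: "- x \<in> C" using n un by blast
    \<comment> \<open>If \<open>- x\<close> had the color of 0, a step by \<open>x\<close> could
      lead from \<open>B\<close> neither to \<open>C\<close> nor to \<open>A\<close>.\<close>
    have "y + x \<in> B" if y: "y \<in> B" for y
    proof -
      have "y + x \<notin> C" using rf[OF x y] by (metis add.commute)
      moreover have "y + x \<notin> A"
      proof
        assume "y + x \<in> A"
        then have "(y + x) + - x \<noteq> y" using rf[OF _ y xC] by blast
        then show False by simp
      qed
      ultimately show ?thesis using un by blast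
    qed
    then have "B = UNIV" using neU A0 x by (intro translation_closed[of B x]) auto
    then show False using neU by blast
  qed
  have negB: "- x \<in> B" if x: "x \<in> B" for x
  proof (rule ccontr)
    assume n: "- x \<notin> B"
    have nA: "- x \<notin> A"
    proof
      assume "- x \<in> A"
      then have "- x + x \<noteq> 0" using rf[OF _ x C0] by blast
      then show False by simp
    qed
    then have xC: "- x \<in> C" using n un by blast
    have "y + x \<in> A" if y: "y \<in> A" for y
    proof -
      have "y + x \<notin> C" using rf[OF y x] by blast
      moreover have "y + x \<notin> B"
      proof
        assume "y + x \<in> B"
        then have "(y + x) + - x \<noteq> y" using rf[OF y _ xC] by blast
        then show False by simp
      qed
      ultimately show ?thesis using un by blast
    qed
    then have "A = UNIV" using neU A0 x by (intro translation_closed[of A x]) auto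
    then show False using neU by blast
  qed
  have negC: "- x \<in> C" if x: "x \<in> C" for x
  proof -
    have "- x \<notin> A" using negA[of "- x"] x dis by auto
    moreover have "- x \<notin> B" using negB[of "- x"] x dis by auto
    ultimately show ?thesis using un by blast
  qed
  have symA: "uminus ` A = A" and symB: "uminus ` B = B" using negA negB by (auto intro!: uminus_image_eqI)
  have nofix: "- x \<noteq> x" if "x \<noteq> 0" for x :: "'p mod_ring"
  proof
    assume "- x = x"
    then have "x + x = 0" by (metis add.right_inverse)
    then have "of_nat 2 * x = 0" by (simp only: of_nat_numeral mult_2)
    moreover have "of_nat 2 * x \<noteq> 0" using that p by (intro mod_ring_mult_numeral_neq_0) auto
    ultimately show False by blast
  qed
  \<comment> \<open>Negation pairs off the elements of a symmetric set without 0, so it cannot have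
    exactly three.\<close>
  have four: "4 \<le> card X" if X: "3 \<le> card X" "0 \<notin> X" "\<And>x. x \<in> X \<Longrightarrow> - x \<in> X" for X :: "'p mod_ring set"
  proof (rule ccontr)
    assume "\<not> ?thesis"
    then have X3: "card X = 3" using X(1) by simp
    then obtain x where x: "x \<in> X" by fastforce
    have f: "- x \<noteq> x" using nofix[of x] x X(2) by metis
    have "card (X - {x, - x}) = 1" using X3 x X(3)[OF x] f[symmetric] by (simp add: card_Diff_subset)
    then obtain z where z: "X - {x, - x} = {z}" by (auto simp: card_1_singleton_iff)
    then have zX: "z \<in> X" "z \<noteq> x" "z \<noteq> - x" by blast+
    have "- z \<noteq> z" using nofix[of z] zX(1) X(2) by metis
    moreover have "- z \<noteq> x" using zX(3) by auto
    moreover have "- z \<noteq> - x" using zX(2) by simp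
    ultimately show False using X(3)[OF zX(1)] z by blast
  qed
  have A4: "4 \<le> card A" and B4: "4 \<le> card B" using four sz A0 negA negB by blast+
  have crit: "crit A B C" unfolding crit_def
  proof (intro conjI ballI)
    fix x y z assume h: "x \<in> A" "y \<in> B" "z \<in> C"
    show "x + y + z \<noteq> 0"
    proof
      assume "x + y + z = 0"
      then have "x + y = - z" by (simp add: eq_neg_iff_add_eq_0)
      then show False using rf[OF h(1,2) negC[OF h(3)]] by blast
    qed
  next
    have "card (A \<union> B \<union> C) = card A + card B + card C"
      using dis by (subst card_Un_disjoint, simp, simp, blast, subst card_Un_disjoint) auto
    then show "card A + card B + card C = CARD('p mod_ring)" using un by simp
  qed
  then have sizes: "card A + card B + card C = CARD('p)" by (simp add: crit_def)
  have "\<exists>d. d \<noteq> 0 \<and> bd d A \<le> 2 \<and> bd d B \<le> 2 \<and> bd d C \<le> 2"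
  proof (cases "nap A \<and> nap B \<and> nap C")
    case True
    have "crit B C A" using crit_perm crit by blast
    then obtain d where d: "d \<noteq> 0" "bd d A \<le> 2" using crit_two_atom[of B C A] True sz B4 by auto
    have "bd d B \<le> 2" using crit_transfer[of B C A d] \<open>crit B C A\<close> True sz A4 d(2) by auto
    moreover have "crit C B A" using crit_perm crit by blast
    then have "bd d C \<le> 2" using crit_transfer[of C B A d] True sz A4 d(2) by auto
    ultimately show ?thesis using d by blast
  next
    case False
    have ap: "bd d X \<le> 2" if "crit X Y Z" "d \<noteq> 0" "bd d Y \<le> 1" "3 \<le> card X" "3 \<le> card Y" "card Y + card Z \<ge> 4" "3 \<le> card Z" for X Y Z :: "'p mod_ring set" and d
    proof (rule near_bd_le, rule near_of_ap_sum[OF that(2,3)])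
      have s: "card X + card Y + card Z = CARD('p)" using that(1) by (simp add: crit_def)
      show "3 \<le> card Y" "X \<noteq> {}" "card (X + Y) \<le> card X + card Y" using that crit_sum_card[OF that(1)] by auto
      show "card X + card Y < CARD('p)" "card X + 4 \<le> CARD('p)" using s that by linarith+
    qed
    obtain d where d: "d \<noteq> 0" "bd d A \<le> 1 \<or> bd d B \<le> 1 \<or> bd d C \<le> 1" using False unfolding nap_def by fastforce
    have cr: "crit A B C" "crit A C B" "crit B A C" "crit B C A" "crit C A B" "crit C B A"
      using crit crit_perm by blast+
    from d(2) show ?thesis
    proof (elim disjE)
      assume h: "bd d A \<le> 1"
      then show ?thesis using ap[OF cr(3) d(1) h] ap[OF cr(5) d(1) h] sz d(1) by (intro exI[of _ d]) auto
    next
      assume h: "bd d B \<le> 1"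
      then show ?thesis using ap[OF cr(1) d(1) h] ap[OF cr(6) d(1) h] sz d(1) by (intro exI[of _ d]) auto
    next
      assume h: "bd d C \<le> 1"
      then show ?thesis using ap[OF cr(2) d(1) h] ap[OF cr(4) d(1) h] sz d(1) by (intro exI[of _ d]) auto
    qed
  qed
  then obtain d where d: "d \<noteq> 0" "bd d A \<le> 2" "bd d B \<le> 2" "bd d C \<le> 2" by blast
  have pos: "1 \<le> bd d A" "1 \<le> bd d B" "1 \<le> bd d C" using bd_pos[OF d(1)] neU by auto
  \<comment> \<open>0 is then the only exit of \<open>C\<close> along \<open>d\<close>, so
    \<open>C\<close> without 0 is closed under adding \<open>d\<close>.\<close>
  have Cbig: False if dC: "d \<notin> C" and b: "bd d C \<le> 1"
  proof -
    have "- d \<notin> C" using negC[of "- d"] dC by auto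
    have "C - {0} = {}"
    proof (rule ccontr)
      assume ne: "C - {0} \<noteq> {}"
      have "x + d \<in> C - {0}" if x: "x \<in> C - {0}" for x
      proof
        show "x + d \<in> C" using bd_le1_unique[OF b, of x 0] x C0 dC by auto
        show "x + d \<notin> {0}"
        proof
          assume "x + d \<in> {0}"
          then have "x = - d" by (simp add: eq_neg_iff_add_eq_0)
          then show False using x \<open>- d \<notin> C\<close> by blast
        qed
      qed
      then have "C - {0} = UNIV" using ne d(1) by (intro translation_closed[of _ d]) auto
      then show False by blast
    qed
    then have "C \<subseteq> {0}" by blast
    then have "card C \<le> 1" using card_mono[of "{0 :: 'p mod_ring}" C] by simp
    then show False using sz by simp
  qed
  consider "d \<in> A" | "d \<in> B" | "d \<in> C" using un by blast
  then show False
  proof cases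
    case 1
    have "bd d B + bd d C \<le> bd d A"
    proof (rule bd_nonadjacent)
      show "x + d \<notin> C" if "x \<in> B" for x using rf[OF 1 that, of "x + d"] add.commute[of d x] by blast
      show "x + d \<notin> B" if "x \<in> C" for x using rf[OF 1 _ that, of "x + d"] add.commute[of d x] by blast
    qed (use un dis in blast)+
    then have "bd d C \<le> 1" using d pos by linarith
    then show False using Cbig 1 dis by blast
  next
    case 2
    have "bd d A + bd d C \<le> bd d B"
    proof (rule bd_nonadjacent)
      show "x + d \<notin> C" if "x \<in> A" for x using rf[OF that 2] by blast
      show "x + d \<notin> A" if "x \<in> C" for x using rf[OF _ 2 that, of "x + d"] add.commute[of d x] by blast
    qed (use un dis in blast)+
    then have "bd d C \<le> 1" using d pos by linarith
    then show False using Cbig 2 dis by blast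
  next
    case 3
    have "bd d A + bd d B \<le> bd d C"
    proof (rule bd_nonadjacent)
      show "x + d \<notin> B" if "x \<in> A" for x using rf[OF that _ 3] by blast
      show "x + d \<notin> A" if "x \<in> B" for x using rf[OF _ that 3] by blast
    qed (use un dis in blast)+
    then have b: "bd d A \<le> 1" "bd d B \<le> 1" using d pos by linarith+
    have "A \<subseteq> B \<or> B \<subseteq> A" by (rule symmetric_ap_nested[OF d(1) symA A0(1) b(1) symB A0(2) b(2)])
    then show False using dis neU by blast
  qed
qed

lemma rainbow_schur:
  fixes A B C :: "'p::prime_card mod_ring set"
  assumes un: "A \<union> B \<union> C = UNIV" and dis: "A \<inter> B = {}" "A \<inter> C = {}" "B \<inter> C = {}"
    and sz: "3 \<le> card A" "3 \<le> card B" "3 \<le> card C"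
    and rf: "\<And>x y z. x \<in> A \<Longrightarrow> y \<in> B \<Longrightarrow> z \<in> C \<Longrightarrow> x + y \<noteq> z \<and> x + z \<noteq> y \<and> y + z \<noteq> x"
  shows False
proof -
  consider "0 \<in> A" | "0 \<in> B" | "0 \<in> C" using un by blast
  then show False
  proof cases
    case 1
    have r: "x + y \<noteq> z \<and> x + z \<noteq> y \<and> y + z \<noteq> x" if "x \<in> B" "y \<in> C" "z \<in> A" for x y z
      unfolding add.commute[of x z] add.commute[of y z] using rf[OF that(3,1,2)] by blast
    show False by (rule rainbow_schur_zero[of B C A, OF _ _ _ _ _ _ _ _ r]) (use un dis sz 1 in auto)
  next
    case 2
    have r: "x + y \<noteq> z \<and> x + z \<noteq> y \<and> y + z \<noteq> x" if "x \<in> A" "y \<in> C" "z \<in> B" for x y z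
      unfolding add.commute[of y z] using rf[OF that(1,3,2)] by blast
    show False by (rule rainbow_schur_zero[of A C B, OF _ _ _ _ _ _ _ _ r]) (use un dis sz 2 in auto)
  next
    case 3
    show False by (rule rainbow_schur_zero[of A B C]) (use un dis sz 3 rf in auto)
  qed
qed

section \<open>From value sets to rainbow solutions\<close>

lemma arrangements_not_rainbow_free:
  assumes "b \<in> arrangements {1..n} (image_mset a (mset_set {1..n})) C"
  shows "\<not> rainbow_free n a b C"
proof -
  let ?I = "{1..n}"
  obtain f where f: "image_mset f (mset_set ?I) = image_mset a (mset_set ?I)" "b \<in> (\<Sum>i\<in>?I. (*) (f i) ` C i)"
    using assms by (auto simp: arrangements_def)
  obtain s where s: "b = sum s ?I" "\<forall>i\<in>?I. s i \<in> (*) (f i) ` C i"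
    using f(2) set_sum_alt[of ?I "\<lambda>i. (*) (f i) ` C i"] by auto
  then have "\<forall>i\<in>?I. \<exists>x. x \<in> C i \<and> s i = f i * x" by blast
  then obtain v where v: "\<And>i. i \<in> ?I \<Longrightarrow> v i \<in> C i \<and> s i = f i * v i" by metis
  obtain p where p: "p permutes ?I" "\<forall>i\<in>?I. f i = a (p i)"
    using image_mset_eq_implies_permutes[of ?I f a] f(1) by auto
  have "(\<Sum>i\<in>?I. a (p i) * v i) = b" unfolding s(1) using v p(2) by (intro sum.cong) auto
  then show ?thesis using p(1) v unfolding rainbow_free_def by blast
qed

text \<open>If every class had three elements, \<open>p\<close> would be \<open>3 n\<close>.\<close>

lemma exists_large_color:
  fixes C :: "nat \<Rightarrow> 'p::prime_card mod_ring set"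
  assumes "coloring n C" "\<forall>i\<in>{1..n}. 3 \<le> card (C i)" "2 \<le> n"
  shows "(\<Sum>i\<in>{1..n}. card (C i)) = CARD('p)" "\<exists>l\<in>{1..n}. 4 \<le> card (C l)"
proof -
  have "card (\<Union>i\<in>{1..n}. C i) = (\<Sum>i\<in>{1..n}. card (C i))"
    using assms(1) by (intro card_UN_disjoint) (auto simp: coloring_def disjoint_family_on_def)
  then show s: "(\<Sum>i\<in>{1..n}. card (C i)) = CARD('p)" using assms(1) by (simp add: coloring_def)
  show "\<exists>l\<in>{1..n}. 4 \<le> card (C l)"
  proof (rule ccontr)
    assume "\<not> ?thesis"
    then have "card (C i) = 3" if "i \<in> {1..n}" for i using assms(2) that by force
    then have "CARD('p) = 3 * n" using s by simp
    moreover have "prime CARD('p)" by (rule prime_card)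
    ultimately have "prime (3 * n)" by simp
    then show False using assms(3) prime_product[of 3 n] by simp
  qed
qed

text \<open>A class of four elements leaves the room that \<open>arrangements_card\<close> demands.
  The extra element obtained there makes the sizes of the two summands add up to at least
  \<open>p + 1\<close>.\<close>

lemma large_arrangements_contra:
  fixes C :: "nat \<Rightarrow> 'p::prime_card mod_ring set"
  assumes col: "coloring n C" and c3: "\<forall>i\<in>{1..n}. 3 \<le> card (C i)" and n: "3 \<le> n"
    and nz: "\<forall>i\<in>{1..n}. a i \<noteq> 0" and rf: "rainbow_free n a b C"
    and M: "M = image_mset a (mset_set {1..n})" and c: "c \<in># M"
    and nc: "\<And>e. M - {#c#} \<noteq> replicate_mset (n - 1) e" "\<And>e. M - {#c#} \<noteq> {#e, - e#}"
  shows False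
proof -
  let ?I = "{1..n}"
  have s: "(\<Sum>i\<in>?I. card (C i)) = CARD('p)" using exists_large_color[OF col c3] n by simp
  obtain l where l: "l \<in> ?I" "4 \<le> card (C l)" using exists_large_color[OF col c3] n by auto
  have r: "(\<Sum>i\<in>?I. card (C i)) = card (C l) + (\<Sum>i\<in>?I - {l}. card (C i))" by (rule sum.remove) (use l in auto)
  have nzM: "x \<noteq> 0" if "x \<in># M" for x using that nz M by auto
  have cI: "card (?I - {l}) = n - 1" using l by simp
  have sM: "size M = n" by (simp add: M)
  have "(\<Sum>i\<in>?I - {l}. card (C i)) + 1 \<le> card (arrangements (?I - {l}) (M - {#c#}) C)"
  proof (rule arrangements_card)
    show "2 \<le> card (?I - {l})" using cI n by simp
    show "size (M - {#c#}) = card (?I - {l})" using cI sM c by (simp add: size_Diff_singleton)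
    show "disjoint_family_on C (?I - {l})" using col unfolding coloring_def disjoint_family_on_def by blast
    show "(\<Sum>i\<in>?I - {l}. card (C i)) + 4 \<le> CARD('p)" using s r l by linarith
    show "M - {#c#} \<noteq> replicate_mset (card (?I - {l})) e" for e unfolding cI by (rule nc(1))
    show "M - {#c#} \<noteq> {#e, - e#}" for e by (rule nc(2))
    show "x \<noteq> 0" if "x \<in># M - {#c#}" for x using nzM in_diffD[OF that] by blast
  qed (use c3 in auto)
  moreover have "card ((*) c ` C l) = card (C l)" using nzM[OF c] by simp
  ultimately have "CARD('p mod_ring) < card (arrangements (?I - {l}) (M - {#c#}) C) + card ((*) c ` C l)"
    using s r by simp
  then have "arrangements (?I - {l}) (M - {#c#}) C + (*) c ` C l = UNIV" by (intro plus_eq_UNIV)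
  moreover have "arrangements (?I - {l}) (M - {#c#}) C + (*) c ` C l \<subseteq> arrangements ?I M C"
    using l c by (intro arrangements_remove) auto
  ultimately have "b \<in> arrangements ?I M C" by blast
  then show False using arrangements_not_rainbow_free rf unfolding M by blast
qed

text \<open>The coefficients sum to \<open>e\<close>, so translating every class by
  \<open>- b / e\<close> turns \<open>e x + e y - e z = b\<close> into
  \<open>x + y = z\<close>.\<close>

lemma signed_triple_not_rainbow_free:
  fixes C :: "nat \<Rightarrow> 'p::prime_card mod_ring set"
  assumes col: "coloring 3 C" and c3: "\<forall>i\<in>{1..3}. 3 \<le> card (C i)"
    and M: "image_mset a (mset_set {1..3}) = {#e, e, - e#}" and e: "e \<noteq> 0"
  shows "\<not> rainbow_free 3 a b C"
proof
  assume rf: "rainbow_free 3 a b C"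
  have I: "{1..3} = {1, 2, 3 :: nat}" by auto
  define t where "t = b / e"
  define D where "D i = (+) (- t) ` C i" for i
  have mem: "x + t \<in> C i" if "x \<in> D i" for x i using that by (auto simp: D_def)
  have rb: False if ijl: "{i, j, l} = {1, 2, 3 :: nat}" "i \<noteq> j" "i \<noteq> l" "j \<noteq> l" "x \<in> D i" "y \<in> D j" "z \<in> D l" "x + y = z" for i j l x y z
  proof -
    let ?f = "(\<lambda>_. e)(l := - e)"
    have "mset_set {i, j, l} = {#i, j, l#}" using ijl(2-4) by simp
    then have v: "image_mset ?f (mset_set {1..3}) = {#e, e, - e#}"
      unfolding I ijl(1)[symmetric] using ijl(2-4) by simp
    have "(\<Sum>q\<in>{1..3}. (*) (?f q) ` C q) = (*) e ` C i + ((*) e ` C j + (*) (- e) ` C l)"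
      unfolding I ijl(1)[symmetric] using ijl(2-4) by simp
    moreover have "e * (x + t) + (e * (y + t) + - e * (z + t)) \<in> (*) e ` C i + ((*) e ` C j + (*) (- e) ` C l)"
      using mem ijl(5-7) by (intro set_plus_intro imageI) auto
    moreover have "e * (x + t) + (e * (y + t) + - e * (z + t)) = e * t"
      unfolding ijl(8)[symmetric] by (simp add: algebra_simps)
    moreover have "e * t = b" using e by (simp add: t_def)
    ultimately have "b \<in> arrangements {1..3} {#e, e, - e#} C"
      using arrangements_sup[OF v, of C] by (simp only:) blast
    then show False using arrangements_not_rainbow_free[of b 3 a C] rf M by simp
  qed
  have disC: "C i \<inter> C j = {}" if "i \<in> {1, 2, 3}" "j \<in> {1, 2, 3}" "i \<noteq> j" for i j
    using col that unfolding coloring_def disjoint_family_on_def I by blast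
  have dis: "D i \<inter> D j = {}" if "i \<in> {1, 2, 3}" "j \<in> {1, 2, 3}" "i \<noteq> j" for i j
    using disC[OF that] mem by blast
  show False
  proof (rule rainbow_schur[of "D 1" "D 2" "D 3"])
    have "x \<in> D i" if "x + t \<in> C i" for x i
    proof -
      have "- t + (x + t) \<in> D i" unfolding D_def using that by (rule imageI)
      then show ?thesis by simp
    qed
    moreover have "x + t \<in> C 1 \<union> C 2 \<union> C 3" for x
    proof -
      have "x + t \<in> (\<Union>i\<in>{1..3}. C i)" using col by (simp add: coloring_def)
      then show ?thesis unfolding I by blast
    qed
    ultimately show "D 1 \<union> D 2 \<union> D 3 = UNIV" by blast
    show "D 1 \<inter> D 2 = {}" "D 1 \<inter> D 3 = {}" "D 2 \<inter> D 3 = {}" by (rule dis; simp)+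
    show "3 \<le> card (D 1)" "3 \<le> card (D 2)" "3 \<le> card (D 3)" using c3 by (simp_all only: D_def card_translate) auto
    fix x y z assume h: "x \<in> D 1" "y \<in> D 2" "z \<in> D 3"
    show "x + y \<noteq> z \<and> x + z \<noteq> y \<and> y + z \<noteq> x"
    proof (intro conjI notI)
      assume "x + y = z" then show False using rb[of 1 2 3 x y z] h by simp
    next
      assume "x + z = y" then show False using rb[of 1 3 2 x z y] h by (simp add: insert_commute)
    next
      assume "y + z = x" then show False using rb[of 2 3 1 y z x] h by (simp add: insert_commute)
    qed
  qed
qed

text \<open>For three classes a coefficient can be put aside unless the other two agree up to sign;
  if none can, the multiset is \<open>e, e, - e\<close>. For more classes it suffices to avoid
  leaving equal coefficients, and a repeated or arbitrary coefficient does so.\<close>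

lemma rainbow_free_imp_two:
  fixes C :: "nat \<Rightarrow> 'p::prime_card mod_ring set"
  assumes n2: "2 \<le> n" and col: "coloring n C" and c3: "\<forall>i\<in>{1..n}. 3 \<le> card (C i)"
    and nz: "\<forall>i\<in>{1..n}. a i \<noteq> 0" and ne: "\<exists>i\<in>{1..n}. \<exists>j\<in>{1..n}. a i \<noteq> a j" and rf: "rainbow_free n a b C"
  shows "n = 2"
proof (rule ccontr)
  assume "n \<noteq> 2"
  then have n: "3 \<le> n" using n2 by simp
  define M where "M = image_mset a (mset_set {1..n})"
  have sM: "size M = n" by (simp add: M_def)
  have nconst: "M \<noteq> replicate_mset n c" for c
  proof
    assume "M = replicate_mset n c"
    then have "set_mset M \<subseteq> {c}" by (auto simp: in_replicate_mset split: if_splits)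
    then have "\<forall>i\<in>{1..n}. a i = c" by (simp add: M_def image_subset_iff)
    then show False using ne by simp
  qed
  have contra: False if "c \<in># M" "\<And>e. M - {#c#} \<noteq> replicate_mset (n - 1) e" "\<And>e. M - {#c#} \<noteq> {#e, - e#}" for c
    using large_arrangements_contra[OF col c3 n nz rf M_def that] .
  show False
  proof (cases "n = 3")
    case True
    obtain x y z where xyz: "M = {#x, y, z#}" using sM True by (metis size3_mset)
    have step: "y = z \<or> y = - z" if M: "M = {#x, y, z#}" for x y z
    proof (rule ccontr)
      assume h: "\<not> ?thesis"
      have e: "M - {#x#} = {#y, z#}" using M by simp
      have "{#y, z#} \<noteq> replicate_mset 2 e" for e using h by (auto simp: numeral_2_eq_2 add_eq_conv_ex)
      moreover have "{#y, z#} \<noteq> {#e, - e#}" for e using h by (auto simp: add_eq_conv_ex)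
      ultimately show False using contra[of x] M True unfolding e by simp
    qed
    have s1: "y = x \<or> y = - x" using step[of z y x] xyz by (simp add: add_mset_commute)
    have s2: "z = x \<or> z = - x" using step[of y z x] xyz by (simp add: add_mset_commute)
    have nc: "\<not> (y = x \<and> z = x)" using nconst[of x] True xyz by (auto simp: numeral_3_eq_3)
    have "x \<in># M" using xyz by simp
    then have x0: "x \<noteq> 0" using nz by (auto simp: M_def)
    have t3: False if "M = {#e, e, - e#}" "e \<noteq> 0" for e
      using signed_triple_not_rainbow_free[of C a e b] that col c3 rf True by (simp add: M_def)
    consider "y = x" "z = - x" | "y = - x" "z = x" | "y = - x" "z = - x" using s1 s2 nc by blast
    then show False
    proof cases
      case 1 then show False using t3[of x] xyz x0 by simp
    next
      case 2 then show False using t3[of x] xyz x0 by (simp add: add_mset_commute)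
    next
      case 3 then show False using t3[of "- x"] xyz x0 by (simp add: add_mset_commute)
    qed
  next
    case False
    then obtain k where k: "n = Suc (Suc (Suc (Suc k)))" using n by (metis Suc_le_D numeral_3_eq_3 le_antisym not_less_eq_eq)
    have np: "M - {#c#} \<noteq> {#e, - e#}" if "c \<in># M" for c e
    proof
      assume "M - {#c#} = {#e, - e#}"
      then have "size (M - {#c#}) = 2" by simp
      then show False using that sM k by (simp add: size_Diff_singleton)
    qed
    show False
    proof (cases "\<exists>m c. M = add_mset m (replicate_mset (n - 1) c)")
      case True
      then obtain m c where M: "M = add_mset m (replicate_mset (n - 1) c)" by blast
      have mc: "m \<noteq> c"
      proof
        assume "m = c"
        then have "M = replicate_mset n c" using M k by simp
        then show False using nconst by blast
      qed
      have cM: "c \<in># M" using M k by simp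
      have e: "M - {#c#} = add_mset m (replicate_mset (n - 2) c)" using M k mc by simp
      have "M - {#c#} \<noteq> replicate_mset (n - 1) e" for e
      proof
        assume "M - {#c#} = replicate_mset (n - 1) e"
        moreover have "m \<in># M - {#c#}" "c \<in># M - {#c#}" unfolding e using k by simp_all
        ultimately have "m = e" "c = e" by (auto simp: in_replicate_mset split: if_splits)
        then show False using mc by simp
      qed
      then show False using contra[OF cM] np[OF cM] by blast
    next
      case form: False
      have "M \<noteq> {#}" using sM n by auto
      then obtain c where c: "c \<in># M" by blast
      have "M - {#c#} \<noteq> replicate_mset (n - 1) e" for e
      proof
        assume "M - {#c#} = replicate_mset (n - 1) e"
        then have "M = add_mset c (replicate_mset (n - 1) e)" using c by (metis insert_DiffM)
        then show False using form by blast
      qed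
      then show False using contra[OF c] np[OF c] by blast
    qed
  qed
qed

section \<open>Two classes and affine orbits\<close>

lemma affine_orbit_self: "x \<in> affine_orbit l m x"
  unfolding affine_orbit_def by (rule CollectI, rule exI[of _ 0]) simp

lemma affine_orbit_step:
  assumes "y \<in> affine_orbit l m x" shows "l * y + m \<in> affine_orbit l m x"
proof -
  obtain k where k: "y = l ^ k * x + (\<Sum>i<k. l ^ i) * m" using assms by (auto simp: affine_orbit_def)
  have "(\<Sum>i<Suc k. l ^ i) = 1 + l * (\<Sum>i<k. l ^ i)"
    by (subst sum.lessThan_Suc_shift) (simp add: sum_distrib_left)
  then have "l * y + m = l ^ Suc k * x + (\<Sum>i<Suc k. l ^ i) * m" unfolding k by (simp add: algebra_simps)
  then show ?thesis unfolding affine_orbit_def by blast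
qed

lemma affine_orbit_subset:
  assumes "\<And>y. y \<in> X \<Longrightarrow> l * y + m \<in> X" "x \<in> X"
  shows "affine_orbit l m x \<subseteq> X"
proof -
  have "l ^ k * x + (\<Sum>i<k. l ^ i) * m \<in> X" for k
  proof (induction k)
    case (Suc k)
    have "(\<Sum>i<Suc k. l ^ i) = 1 + l * (\<Sum>i<k. l ^ i)"
      by (subst sum.lessThan_Suc_shift) (simp add: sum_distrib_left)
    then have "l ^ Suc k * x + (\<Sum>i<Suc k. l ^ i) * m = l * (l ^ k * x + (\<Sum>i<k. l ^ i) * m) + m"
      by (simp add: algebra_simps)
    then show ?case using assms(1)[OF Suc] by simp
  qed (use assms(2) in simp)
  then show ?thesis by (auto simp: affine_orbit_def)
qed

text \<open>Orbits are closed under the map, and a closed set is the union of the orbits of its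
  points, which finiteness allows to number by \<open>{1..m}\<close>; the empty set has
  \<open>m = 0\<close>.\<close>

lemma union_affine_orbits_iff:
  fixes X :: "'a::{field,finite} set"
  shows "(\<exists>(m::nat) z. X = (\<Union>i\<in>{1..m}. affine_orbit l u (z i))) \<longleftrightarrow> (\<forall>y\<in>X. l * y + u \<in> X)"
proof
  assume "\<exists>(m::nat) z. X = (\<Union>i\<in>{1..m}. affine_orbit l u (z i))"
  then show "\<forall>y\<in>X. l * y + u \<in> X" using affine_orbit_step by blast
next
  assume cl: "\<forall>y\<in>X. l * y + u \<in> X"
  obtain z where z: "bij_betw z {1..card X} X" using ex_bij_betw_nat_finite_1[of X] by auto
  have "affine_orbit l u x \<subseteq> X" if "x \<in> X" for x
    by (rule affine_orbit_subset) (use cl that in auto)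
  then have "(\<Union>x\<in>X. affine_orbit l u x) \<subseteq> X" by (rule UN_least)
  moreover have "x \<in> (\<Union>x\<in>X. affine_orbit l u x)" if "x \<in> X" for x
    using that affine_orbit_self by (rule UN_I)
  then have "X \<subseteq> (\<Union>x\<in>X. affine_orbit l u x)" by (rule subsetI)
  ultimately have "X = (\<Union>x\<in>X. affine_orbit l u x)" by (rule subset_antisym[rotated])
  also have "\<dots> = (\<Union>x\<in>z ` {1..card X}. affine_orbit l u x)" by (simp only: bij_betw_imp_surj_on[OF z])
  also have "\<dots> = (\<Union>i\<in>{1..card X}. affine_orbit l u (z i))" by (simp only: image_image)
  finally show "\<exists>(m::nat) z. X = (\<Union>i\<in>{1..m}. affine_orbit l u (z i))" by blast
qed

text \<open>Solving for the first variable gives \<open>x = l * y + u\<close>. As there are only two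
  classes, having no solution with different colors in either order means that this map preserves
  colors.\<close>

lemma rainbow_free_two_iff:
  fixes C :: "nat \<Rightarrow> 'a::field set" and b :: 'a
  assumes col: "coloring 2 C" and a: "a 1 \<noteq> 0" "a 2 \<noteq> 0"
  defines "l \<equiv> - a 2 * inverse (a 1)" and "u \<equiv> b * inverse (a 1)"
  shows "rainbow_free 2 a b C \<longleftrightarrow> (\<forall>y\<in>C 1. l * y + u \<in> C 1) \<and> (\<forall>y\<in>C 2. l * y + u \<in> C 2)"
proof -
  have I: "{1..2} = {1, 2 :: nat}" by auto
  have S: "(\<Sum>i=1..2. g i) = g 1 + g 2" for g :: "nat \<Rightarrow> 'a" unfolding I by simp
  have part: "x \<in> C 1 \<longleftrightarrow> x \<notin> C 2" for x
  proof -
    have "C 1 \<inter> C 2 = {}" using col unfolding coloring_def disjoint_family_on_def I by auto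
    moreover have "C 1 \<union> C 2 = UNIV" using col unfolding coloring_def I by auto
    ultimately show ?thesis by blast
  qed
  have eq: "a 1 * x + a 2 * y = b \<longleftrightarrow> x = l * y + u" for x y
  proof -
    have "a 1 * (l * y + u) = - a 2 * y + b" using a by (simp add: l_def u_def field_simps)
    moreover have "a 1 * x + a 2 * y = b \<longleftrightarrow> a 1 * x = - a 2 * y + b" by (auto simp: algebra_simps)
    ultimately have "a 1 * x + a 2 * y = b \<longleftrightarrow> a 1 * x = a 1 * (l * y + u)" by simp
    then show ?thesis using a by simp
  qed
  have "rainbow_free 2 a b C \<longleftrightarrow> (\<forall>x\<in>C 1. \<forall>y\<in>C 2. a 1 * x + a 2 * y \<noteq> b \<and> a 1 * y + a 2 * x \<noteq> b)"
  proof
    assume rf: "rainbow_free 2 a b C"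
    show "\<forall>x\<in>C 1. \<forall>y\<in>C 2. a 1 * x + a 2 * y \<noteq> b \<and> a 1 * y + a 2 * x \<noteq> b"
    proof (intro ballI)
      fix x y assume xy: "x \<in> C 1" "y \<in> C 2"
      let ?v = "(\<lambda>_. y)(1 := x)"
      have v: "\<forall>i\<in>{1..2}. ?v i \<in> C i" unfolding I using xy by simp
      have r: "(\<Sum>i=1..2. a (s i) * ?v i) \<noteq> b" if "s permutes {1..2}" for s
        using rf that v unfolding rainbow_free_def by blast
      have "(\<Sum>i=1..2. a (id i) * ?v i) \<noteq> b" by (rule r) (rule permutes_id)
      moreover have "(\<Sum>i=1..2. a (transpose 1 2 i) * ?v i) \<noteq> b" by (rule r) (rule permutes_swap_id; simp)
      ultimately show "a 1 * x + a 2 * y \<noteq> b \<and> a 1 * y + a 2 * x \<noteq> b" unfolding S by (simp add: add.commute)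
    qed
  next
    assume h: "\<forall>x\<in>C 1. \<forall>y\<in>C 2. a 1 * x + a 2 * y \<noteq> b \<and> a 1 * y + a 2 * x \<noteq> b"
    show "rainbow_free 2 a b C" unfolding rainbow_free_def
    proof (intro allI impI)
      fix s v assume s: "s permutes {1..2::nat}" and v: "\<forall>i\<in>{1..2}. v i \<in> C i"
      have v12: "v 1 \<in> C 1" "v 2 \<in> C 2" using v unfolding I by simp_all
      have "s 1 \<in> {1, 2}" "s 2 \<in> {1, 2}" using permutes_in_image[OF s] I by (metis insertI1 insertI2)+
      moreover have "s 1 \<noteq> s 2" using permutes_inj[OF s] by (simp add: inj_eq)
      ultimately have "s 1 = 1 \<and> s 2 = 2 \<or> s 1 = 2 \<and> s 2 = 1" by auto
      then show "(\<Sum>i=1..2. a (s i) * v i) \<noteq> b"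
        unfolding S using h v12 by (elim disjE conjE) (simp_all add: add.commute)
    qed
  qed
  also have "\<dots> \<longleftrightarrow> (\<forall>y\<in>C 1. l * y + u \<in> C 1) \<and> (\<forall>y\<in>C 2. l * y + u \<in> C 2)"
    unfolding eq using part by blast
  finally show ?thesis .
qed

theorem theorem1p2:
  fixes n :: nat
    and C :: "nat \<Rightarrow> 'p::prime_card mod_ring set"
    and a :: "nat \<Rightarrow> 'p mod_ring"
    and b :: "'p mod_ring"
  assumes "n \<ge> 2"
    and "coloring n C"
    and "\<forall>i\<in>{1..n}. card (C i) \<ge> 3"
    and "\<forall>i\<in>{1..n}. a i \<noteq> 0"
    and "\<exists>i\<in>{1..n}. \<exists>j\<in>{1..n}. a i \<noteq> a j"
  shows "rainbow_free n a b C \<longleftrightarrow>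
    n = 2 \<and>
    (\<exists>(m::nat) (q::nat) (z :: nat \<Rightarrow> 'p mod_ring) (y :: nat \<Rightarrow> 'p mod_ring).
      C 1 = (\<Union>i\<in>{1..m}. affine_orbit (- a 2 * inverse (a 1)) (b * inverse (a 1)) (z i)) \<and>
      C 2 = (\<Union>i\<in>{1..q}. affine_orbit (- a 2 * inverse (a 1)) (b * inverse (a 1)) (y i)))"
proof (cases "n = 2")
  case True
  have a12: "a 1 \<noteq> 0" "a 2 \<noteq> 0" using assms(4) True by auto
  have col: "coloring 2 C" using assms(2) True by simp
  let ?O = "affine_orbit (- a 2 * inverse (a 1)) (b * inverse (a 1))"
  have "(\<exists>(m::nat) (q::nat) z y. C 1 = (\<Union>i\<in>{1..m}. ?O (z i)) \<and> C 2 = (\<Union>i\<in>{1..q}. ?O (y i))) \<longleftrightarrow>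
      (\<exists>(m::nat) z. C 1 = (\<Union>i\<in>{1..m}. ?O (z i))) \<and> (\<exists>(m::nat) z. C 2 = (\<Union>i\<in>{1..m}. ?O (z i)))"
    by blast
  then show ?thesis
    unfolding True using rainbow_free_two_iff[OF col a12, of b] by (simp only: union_affine_orbits_iff simp_thms)
next
  case False
  then show ?thesis using rainbow_free_imp_two[OF assms] by blast
qed

end
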